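(* Let $d\ge 2$ and let $(\mathbf X_i)_{i\in\mathbb Z}$ be a strictly stationary, alpha-mixing sequence of $\mathbb R^d$-valued random vectors whose mixing coefficients satisfy $\alpha^{[\mathbf X]}(k)=O(a^k)$ as $k\to\infty$, for some $a\in(0,1)$. Suppose that the marginal c.d.f.s of the stationary distribution are continuous and that the corresponding copula $C$ satisfies the following: for every $j\in\{1,\dots,d\}$ the partial derivative $\dot C_j(\mathbf u)=\partial C(\mathbf u)/\partial u_j$ exists and is continuous on $V_j=\{\mathbf u\in[0,1]^d: u_j\in(0,1)\}$; for every $j_1,j_2\in\{1,\dots,d\}$ the second order partial derivative $\ddot C_{j_1j_2}(\mathbf u)=\partial^2 C(\mathbf u)/\partial u_{j_1}\partial u_{j_2}$ exists and is continuous on $V_{j_1}\cap V_{j_2}$; and there is a constant $K>0$ such that $$|\ddot C_{j_1j_2}(\mathbf u)|\le K\min\Big\{\frac1{u_{j_1}(1-u_{j_1})},\frac1{u_{j_2}(1-u_{j_2})}\Big\}\qquad\text{for all }\mathbf u\in V_{j_1}\cap V_{j_2}.$$ Then, for any $c\in(0,1)$ and any $\omega\in(0,1/2)$, as $n\to\infty$, $$\sup_{\mathbf u\in[\frac cn,1-\frac cn]^d}\left|\frac{\hat{\mathbb C}_n(\mathbf u)}{g_\omega(\mathbf u)}-\frac{\bar{\mathbb C}_n(\mathbf u)}{g_\omega(\mathbf u)}\right|=o_P(1).$$ Moreover, $\bar{\mathbb C}_n/\tilde g_\omega\rightsquigarrow \mathbb C_C/\tilde g_\omega$ in $(\ell^\infty([0,1]^d),\|\cdot\|_\infty)$,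 where $$\mathbb C_C(\mathbf u)=\alpha_C(\mathbf u)-\sum_{j=1}^d\dot C_j(\mathbf u)\,\alpha_C(\mathbf u^{(j)})$$ and $\alpha_C$ is a tight, centered Gaussian process with covariance $$\mathrm{Cov}\{\alpha_C(\mathbf u),\alpha_C(\mathbf v)\}=\sum_{i\in\mathbb Z}\mathrm{Cov}\{\mathbf 1(\mathbf U_0\le\mathbf u),\mathbf 1(\mathbf U_i\le\mathbf v)\}.$$
   Context: Write $\mathbf X_i=(X_{i1},\dots,X_{id})$, let $F_1,\dots,F_d$ be the marginal c.d.f.s, $U_{ij}=F_j(X_{ij})$, $\mathbf U_i=(U_{i1},\dots,U_{id})$. The copula $C$ is the joint c.d.f. of $\mathbf U_i$ on $[0,1]^d$. Inequalities between vectors are componentwise. Mixing: for $-\infty\le a<b\le\infty$ let $\mathcal F_a^b$ be the sigma-field generated by those $\mathbf X_i$ with $i\in\{a,a+1,\dots,b\}$; then $\alpha^{[\mathbf X]}(k)=\sup\{|\mathbb P(A\cap B)-\mathbb P(A)\mathbb P(B)|: A\in\mathcal F_{-\infty}^i, B\in\mathcal F_{i+k}^\infty, i\in\mathbb Z\}$ for $k\ge1$, and the sequence is alpha-mixing if $\alpha^{[\mathbf X]}(k)\to0$. Empirical copula: $F_{nj}(x)=n^{-1}\sum_{i=1}^n\mathbf 1(X_{ij}\le x)$, $\hat U_{ij}=\frac{n}{n+1}F_{nj}(X_{ij})$, $\hat{\mathbf U}_i=(\hat U_{i1},\dots,\hat U_{id})$, $\hat C_n(\mathbf u)=n^{-1}\sum_{i=1}^n\mathbf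 1(\hat{\mathbf U}_i\le\mathbf u)$, and $\hat{\mathbb C}_n(\mathbf u)=\sqrt n\{\hat C_n(\mathbf u)-C(\mathbf u)\}$. Further, $G_n(\mathbf u)=n^{-1}\sum_{i=1}^n\mathbf 1(\mathbf U_i\le\mathbf u)$, $\alpha_n(\mathbf u)=\sqrt n\{G_n(\mathbf u)-C(\mathbf u)\}$, $\mathbf u^{(j)}=(1,\dots,1,u_j,1,\dots,1)$ ($u_j$ in position $j$), and $\bar{\mathbb C}_n(\mathbf u)=\alpha_n(\mathbf u)-\sum_{j=1}^d\dot C_j(\mathbf u)\alpha_n(\mathbf u^{(j)})$ for $\mathbf u\in[0,1]^d$. Wherever $\dot C_j(\mathbf u)$ does not exist it is defined as $\limsup_{h\to0}\{C(\mathbf u+h\mathbf e_j)-C(\mathbf u)\}/h$, where $\mathbf e_j$ is the $j$th unit vector. Weights: for $\omega\ge0$, $g_\omega(\mathbf u)=\min\{\min_{1\le j\le d}u_j,\ \min_{1\le j\le d}[1-\min_{k\ne j}u_k]\}^\omega$, and $\tilde g_\omega(\mathbf u)=g_\omega(\mathbf u)+\mathbf 1\{g_\omega(\mathbf u)=0\}$. $\ell^\infty(T)$ is the space of bounded real functions on $T$ and $\rightsquigarrow$ denotes weak convergence in the sense of Hoffmann-Jørgensen. *)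

theory Defs
  imports "HOL-Probability.Probability"
begin

text \<open>
  Weak convergence in the sense of Hoffmann-Jorgensen: the approximating maps are arbitrary
  (not necessarily measurable), so expectations and probabilities are replaced by outer ones.
\<close>

definition outer_prob :: "'a measure \<Rightarrow> 'a set \<Rightarrow> real" where
  "outer_prob M A = (INF B\<in>{B \<in> sets M. A \<inter> space M \<subseteq> B}. measure M B)"

text \<open>Only meant for bounded \<open>T\<close> on a probability space; there it suffices to consider
  real-valued integrable majorants.\<close>

definition outer_expectation :: "'a measure \<Rightarrow> ('a \<Rightarrow> real) \<Rightarrow> real" where
  "outer_expectation M T =
     (INF U\<in>{U. integrable M U \<and> (\<forall>s\<in>space M. T s \<le> U s)}. integral\<^sup>L M U)"

text \<open>\<open>Z n = o\<^sub>P(1)\<close> for possibly infinite, possibly non-measurable nonnegative \<open>Z n\<close>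
  (a supremum over an empty set is \<open>-\<infinity>\<close> and causes no harm).\<close>

definition small_o_P_1 :: "'a measure \<Rightarrow> (nat \<Rightarrow> 'a \<Rightarrow> ereal) \<Rightarrow> bool" where
  "small_o_P_1 M Z \<longleftrightarrow>
     (\<forall>\<epsilon>>0. (\<lambda>n. outer_prob M {s \<in> space M. Z n s > ereal \<epsilon>}) \<longlonglongrightarrow> 0)"

definition metric_borel :: "'e metric \<Rightarrow> 'e measure" where
  "metric_borel E = sigma (mspace E) {G. openin (mtopology_of E) G}"

text \<open>
  The maps \<open>Xn n\<close> need to take values in \<open>E\<close> only almost surely. The test functions
  are bounded on the whole ambient type (every bounded continuous function on \<open>mspace E\<close> has
  such an extension), so the exceptional null sets do not affect the outer expectations.
\<close>

definition weakly_converges_HJ ::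
  "'e metric \<Rightarrow> 'a measure \<Rightarrow> (nat \<Rightarrow> 'a \<Rightarrow> 'e) \<Rightarrow> 'b measure \<Rightarrow> ('b \<Rightarrow> 'e) \<Rightarrow> bool" where
  "weakly_converges_HJ E M Xn N Y \<longleftrightarrow>
     (\<forall>n. AE s in M. Xn n s \<in> mspace E) \<and>
     Y \<in> N \<rightarrow>\<^sub>M metric_borel E \<and>
     (\<forall>f. continuous_map (mtopology_of E) euclideanreal f \<and> bounded (range f) \<longrightarrow>
        (\<lambda>n. outer_expectation M (\<lambda>s. f (Xn n s))) \<longlonglongrightarrow> integral\<^sup>L N (\<lambda>s. f (Y s)))"

text \<open>Bounded real functions on \<open>T\<close> with the supremum distance; elements are extensional, i.e.
  \<open>undefined\<close> outside \<open>T\<close>.\<close>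

definition linf :: "'t set \<Rightarrow> ('t \<Rightarrow> real) metric" where
  "linf T = funspace T euclidean_metric"

definition covariance :: "'a measure \<Rightarrow> ('a \<Rightarrow> real) \<Rightarrow> ('a \<Rightarrow> real) \<Rightarrow> real" where
  "covariance M Y Z =
     integral\<^sup>L M (\<lambda>s. (Y s - integral\<^sup>L M Y) * (Z s - integral\<^sup>L M Z))"

text \<open>Normal random variables, including the degenerate (constant) ones.\<close>

definition normal_rv :: "'a measure \<Rightarrow> ('a \<Rightarrow> real) \<Rightarrow> bool" where
  "normal_rv M Y \<longleftrightarrow> Y \<in> borel_measurable M \<and>
     (\<exists>\<mu> \<sigma>. (\<sigma> = 0 \<and> (AE s in M. Y s = \<mu>)) \<or>
             (\<sigma> > 0 \<and> distributed M lborel Y (normal_density \<mu> \<sigma>)))"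

definition centered_gaussian_process :: "'a measure \<Rightarrow> 't set \<Rightarrow> ('a \<Rightarrow> 't \<Rightarrow> real) \<Rightarrow> bool" where
  "centered_gaussian_process M T A \<longleftrightarrow>
     (\<forall>I b. finite I \<and> I \<subseteq> T \<longrightarrow> normal_rv M (\<lambda>s. \<Sum>t\<in>I. b t * A s t)) \<and>
     (\<forall>t\<in>T. integral\<^sup>L M (\<lambda>s. A s t) = 0)"

text \<open>A tight Borel random element of the metric space \<open>E\<close>.\<close>

definition tight_random_element :: "'a measure \<Rightarrow> 'e metric \<Rightarrow> ('a \<Rightarrow> 'e) \<Rightarrow> bool" where
  "tight_random_element M E Y \<longleftrightarrow> Y \<in> M \<rightarrow>\<^sub>M metric_borel E \<and>
     (\<forall>\<epsilon>>0. \<exists>K. compactin (mtopology_of E) K \<and> measure M {s \<in> space M. Y s \<in> K} \<ge> 1 - \<epsilon>)"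


definition strictly_stationary :: "'a measure \<Rightarrow> (int \<Rightarrow> 'a \<Rightarrow> 'e::topological_space) \<Rightarrow> bool" where
  "strictly_stationary M X \<longleftrightarrow>
     (\<forall>I h. finite I \<longrightarrow>
        distr M (Pi\<^sub>M I (\<lambda>_. borel)) (\<lambda>s. \<lambda>i\<in>I. X (i + h) s) =
        distr M (Pi\<^sub>M I (\<lambda>_. borel)) (\<lambda>s. \<lambda>i\<in>I. X i s))"

definition sigma_field ::
  "'a measure \<Rightarrow> (int \<Rightarrow> 'a \<Rightarrow> 'e::topological_space) \<Rightarrow> int set \<Rightarrow> 'a set set" where
  "sigma_field M X I =
     sigma_sets (space M) (\<Union>i\<in>I. {X i -` B \<inter> space M | B. B \<in> sets borel})"

definition alpha_coeff ::
  "'a measure \<Rightarrow> (int \<Rightarrow> 'a \<Rightarrow> 'e::topological_space) \<Rightarrow> nat \<Rightarrow> real" where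
  "alpha_coeff M X k =
     Sup {\<bar>measure M (A \<inter> B) - measure M A * measure M B\<bar> | A B i.
            A \<in> sigma_field M X {..i} \<and> B \<in> sigma_field M X {i + int k..}}"

definition alpha_mixing :: "'a measure \<Rightarrow> (int \<Rightarrow> 'a \<Rightarrow> 'e::topological_space) \<Rightarrow> bool" where
  "alpha_mixing M X \<longleftrightarrow> alpha_coeff M X \<longlonglongrightarrow> 0"


text \<open>\<open>[0,1]\<^sup>d\<close>; the order on vectors is the componentwise one.\<close>

abbreviation unit_cube :: "(real ^ 'd) set" where
  "unit_cube \<equiv> {0..1}"

definition V :: "'d \<Rightarrow> (real ^ 'd) set" where
  "V j = {u \<in> unit_cube. 0 < u $ j \<and> u $ j < 1}"

text \<open>Partial derivatives of functions on the unit cube: the increments \<open>h\<close> are restricted to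
  those which do not leave the cube (one-sided derivatives on the faces \<open>u\<^sub>j \<in> {0,1}\<close>; no
  restriction locally on \<open>V j\<close>).\<close>

definition increments :: "'d \<Rightarrow> real ^ 'd \<Rightarrow> real set" where
  "increments j u = {h. u + h *\<^sub>R axis j 1 \<in> unit_cube}"

definition has_partial :: "(real ^ 'd \<Rightarrow> real) \<Rightarrow> 'd \<Rightarrow> real \<Rightarrow> real ^ 'd \<Rightarrow> bool" where
  "has_partial f j D u \<longleftrightarrow>
     ((\<lambda>h. f (u + h *\<^sub>R axis j 1)) has_real_derivative D) (at 0 within increments j u)"

definition partial_exists :: "(real ^ 'd \<Rightarrow> real) \<Rightarrow> 'd \<Rightarrow> real ^ 'd \<Rightarrow> bool" where
  "partial_exists f j u \<longleftrightarrow> (\<exists>D. has_partial f j D u)"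

definition partial_deriv :: "(real ^ 'd \<Rightarrow> real) \<Rightarrow> 'd \<Rightarrow> real ^ 'd \<Rightarrow> real" where
  "partial_deriv f j u = (THE D. has_partial f j D u)"

definition C_dot :: "(real ^ 'd \<Rightarrow> real) \<Rightarrow> 'd \<Rightarrow> real ^ 'd \<Rightarrow> real" where
  "C_dot C j u =
     (if partial_exists C j u then partial_deriv C j u
      else real_of_ereal (Limsup (at 0 within increments j u)
             (\<lambda>h. ereal ((C (u + h *\<^sub>R axis j 1) - C u) / h))))"

definition C_ddot :: "(real ^ 'd \<Rightarrow> real) \<Rightarrow> 'd \<Rightarrow> 'd \<Rightarrow> real ^ 'd \<Rightarrow> real" where
  "C_ddot C j\<^sub>1 j\<^sub>2 u = partial_deriv (C_dot C j\<^sub>2) j\<^sub>1 u"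

text \<open>\<open>u\<^sup>(\<^sup>j\<^sup>)\<close>: all coordinates except the \<open>j\<close>th are replaced by 1.\<close>

definition only_coord :: "'d \<Rightarrow> real ^ 'd \<Rightarrow> real ^ 'd" where
  "only_coord j u = (\<chi> k. if k = j then u $ k else 1)"

text \<open>The inner minimum over \<open>k \<noteq> j\<close> requires at least two coordinates. Since
  \<open>0 powr 0 = 0\<close>, \<open>g\<close> is the usual weight only for \<open>\<omega> > 0\<close> (or where the base is positive).\<close>

definition g :: "real \<Rightarrow> real ^ 'd \<Rightarrow> real" where
  "g \<omega> u = min (MIN j. u $ j) (MIN j. 1 - (MIN k\<in>UNIV - {j}. u $ k)) powr \<omega>"

definition g_tilde :: "real \<Rightarrow> real ^ 'd \<Rightarrow> real" where
  "g_tilde \<omega> u = g \<omega> u + of_bool (g \<omega> u = 0)"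


definition marginal_cdf :: "'a measure \<Rightarrow> (int \<Rightarrow> 'a \<Rightarrow> real ^ 'd) \<Rightarrow> 'd \<Rightarrow> real \<Rightarrow> real" where
  "marginal_cdf M X j = cdf (distr M borel (\<lambda>s. X 0 s $ j))"

definition U :: "'a measure \<Rightarrow> (int \<Rightarrow> 'a \<Rightarrow> real ^ 'd) \<Rightarrow> int \<Rightarrow> 'a \<Rightarrow> real ^ 'd" where
  "U M X i s = (\<chi> j. marginal_cdf M X j (X i s $ j))"

definition copula :: "'a measure \<Rightarrow> (int \<Rightarrow> 'a \<Rightarrow> real ^ 'd) \<Rightarrow> real ^ 'd \<Rightarrow> real" where
  "copula M X u = measure M {s \<in> space M. U M X 0 s \<le> u}"

text \<open>Statistics of the sample \<open>X 1, \<dots>, X n\<close>, evaluated at the sample point \<open>s\<close>.\<close>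

definition emp_cdf :: "(int \<Rightarrow> 'a \<Rightarrow> real ^ 'd) \<Rightarrow> nat \<Rightarrow> 'a \<Rightarrow> 'd \<Rightarrow> real \<Rightarrow> real" where
  "emp_cdf X n s j x = (\<Sum>i\<in>{1..int n}. of_bool (X i s $ j \<le> x)) / real n"

definition U_hat :: "(int \<Rightarrow> 'a \<Rightarrow> real ^ 'd) \<Rightarrow> nat \<Rightarrow> int \<Rightarrow> 'a \<Rightarrow> real ^ 'd" where
  "U_hat X n i s = (\<chi> j. real n / (real n + 1) * emp_cdf X n s j (X i s $ j))"

definition C_hat :: "(int \<Rightarrow> 'a \<Rightarrow> real ^ 'd) \<Rightarrow> nat \<Rightarrow> 'a \<Rightarrow> real ^ 'd \<Rightarrow> real" where
  "C_hat X n s u = (\<Sum>i\<in>{1..int n}. of_bool (U_hat X n i s \<le> u)) / real n"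

definition emp_copula_process ::
  "'a measure \<Rightarrow> (int \<Rightarrow> 'a \<Rightarrow> real ^ 'd) \<Rightarrow> nat \<Rightarrow> 'a \<Rightarrow> real ^ 'd \<Rightarrow> real" where
  "emp_copula_process M X n s u = sqrt (real n) * (C_hat X n s u - copula M X u)"

definition G ::
  "'a measure \<Rightarrow> (int \<Rightarrow> 'a \<Rightarrow> real ^ 'd) \<Rightarrow> nat \<Rightarrow> 'a \<Rightarrow> real ^ 'd \<Rightarrow> real" where
  "G M X n s u = (\<Sum>i\<in>{1..int n}. of_bool (U M X i s \<le> u)) / real n"

definition alpha_n ::
  "'a measure \<Rightarrow> (int \<Rightarrow> 'a \<Rightarrow> real ^ 'd) \<Rightarrow> nat \<Rightarrow> 'a \<Rightarrow> real ^ 'd \<Rightarrow> real" where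
  "alpha_n M X n s u = sqrt (real n) * (G M X n s u - copula M X u)"

text \<open>The linear map \<open>a \<mapsto> a(u) - \<Sum>\<^sub>j \<partial>\<^sub>jC(u) a(u\<^sup>(\<^sup>j\<^sup>))\<close>, common to the
  processes \<open>C_bar\<close> (applied to \<open>alpha_n\<close>) and its limit (applied to the Gaussian process).\<close>

definition copula_transform ::
  "(real ^ 'd \<Rightarrow> real) \<Rightarrow> (real ^ 'd \<Rightarrow> real) \<Rightarrow> real ^ 'd \<Rightarrow> real" where
  "copula_transform C a u = a u - (\<Sum>j\<in>UNIV. C_dot C j u * a (only_coord j u))"

definition C_bar ::
  "'a measure \<Rightarrow> (int \<Rightarrow> 'a \<Rightarrow> real ^ 'd) \<Rightarrow> nat \<Rightarrow> 'a \<Rightarrow> real ^ 'd \<Rightarrow> real" where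
  "C_bar M X n s = copula_transform (copula M X) (alpha_n M X n s)"

end

theory Submission
 imports Defs "HOL-Complex_Analysis.Great_Picard" "HOL-Real_Asymp.Real_Asymp"
begin

text \<open>
 Fix \<open>\<omega> < \<theta> < 1/2\<close>. Moment bounds for sums over geometrically mixing sequences and chaining give, with
 probability close to one, a Hoelder modulus of order \<open>\<theta>\<close> for the process \<open>\<alpha>\<^sub>n\<close> down to the scale \<open>1/n\<close>, and hence
 bounds of order \<open>x\<^sup>\<theta>\<close> at distance \<open>x\<close> from the part of the boundary where \<open>g\<^sub>\<omega>\<close> vanishes. The empirical copula
 at \<open>u\<close> is \<open>G\<^sub>n\<close> at a random point \<open>v\<close> whose empirical margins are \<open>u\<close> up to a small error, so the difference of
 the two processes is the error of a linearisation of \<open>C\<close> between \<open>u\<close> and \<open>v\<close>. Away from the boundary it is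
 controlled by the second derivatives; near it, the growth condition gives a bound of order \<open>x\<^sup>\<theta>\<close>, which
 beats the weight \<open>x\<^sup>\<omega>\<close>.

 For weak convergence, the finite-dimensional limits come from Stein's method for mixing sequences. The limit is a
 Gaussian process on dyadic points, extended by the modulus that it inherits from \<open>\<alpha>\<^sub>n\<close>. Uniformly in \<open>n\<close>,
 the weighted processes are close to Lipschitz functions of their values on a finite grid.
\<close>

text \<open>The obstacle is the weight: on the cube from c/n to 1 - c/n it drops to the order of
  n^-\<omega>, while \<alpha>_n is controlled only down to the scale 1/n and the random point v is
  known only through its empirical margins. Near the boundary a second scale \<nu> = n^-\<gamma> is
  therefore used. For large n the condition \<gamma> (1 - \<theta>) < 1/2 keeps each |v_k - u_k| at
  most half the maximum of \<nu> and the distance of u_k from {0, 1}; the condition \<omega> <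
  \<gamma> \<theta> makes an error of order \<nu>^\<theta> negligible against the weight. Both can
  be met if and only if 2 \<omega> (1 - \<theta>) < \<theta>, which holds for \<theta> close to 1/2
  because \<omega> < 1/2. The growth condition makes the j-th partial derivative Lipschitz with
  constant K / (u_j (1 - u_j)). On \<open>V j\<close> it vanishes if another coordinate is 0 and
  equals 1 if all other coordinates are 1, so it is known near the zero set of the weight. On the
  faces where u_j is 0 or 1 it may fail to exist, but there the process that it multiplies
  vanishes.\<close>

section \<open>Covariances of bounded variables under mixing\<close>

text \<open>The extremal \<open>f\<close> is the sign of the conditional expectation of \<open>k\<close> given \<open>A\<close>.\<close>

lemma (in prob_space) ex_extremal_set:
 fixes f k :: "'a => real"
 assumes f: "f \<in> borel_measurable A" "\<And>x. x \<in> space M ==> \<bar>f x\<bar> \<le> 1"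
  and A: "sets A \<subseteq> sets M" "space A = space M" and k: "integrable M k" "expectation k = 0"
 shows "\<exists>S\<in>sets A. \<bar>expectation (\<lambda>x. f x * k x)\<bar> \<le> 2 * expectation (\<lambda>x. indicat_real S x * k x)"
proof -
 have sub: "subalgebra M A" using A by (simp add: subalgebra_def)
 define \<eta> where "\<eta> = real_cond_exp M A k"
 have \<eta>A [measurable]: "\<eta> \<in> borel_measurable A" unfolding \<eta>_def by simp
 define S where "S = {x \<in> space A. \<eta> x > 0}"
 have S: "S \<in> sets A" unfolding S_def by measurable
 have fM: "f \<in> borel_measurable M" and SM: "S \<in> sets M" using measurable_from_subalg[OF sub f(1)] S A by auto
 interpret finite_measure_subalgebra M A by unfold_locales (rule sub)
 have ik: "integrable M (\<lambda>x. h x * k x)" if "h \<in> borel_measurable M" "\<And>x. x \<in> space M ==> \<bar>h x\<bar> \<le> 1" for h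
  using that borel_measurable_integrable[OF k(1)] by (intro Bochner_Integration.integrable_bound[OF k(1)] AE_I2) (auto simp: abs_mult mult_left_le_one_le)
 have E: "integrable M (\<lambda>x. h x * \<eta> x)" "expectation (\<lambda>x. h x * \<eta> x) = expectation (\<lambda>x. h x * k x)"
  if "h \<in> borel_measurable A" "\<And>x. x \<in> space M ==> \<bar>h x\<bar> \<le> 1" for h
  unfolding \<eta>_def by (rule real_cond_exp_intg[OF ik[OF measurable_from_subalg[OF sub that(1)] that(2)] that(1) borel_measurable_integrable[OF k(1)]]; assumption)+
 have "expectation (\<lambda>x. h x * k x) \<le> 2 * expectation (\<lambda>x. indicat_real S x * k x)"
  if h: "h \<in> borel_measurable A" "\<And>x. x \<in> space M ==> \<bar>h x\<bar> \<le> 1" for h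
 proof -
  let ?s = "\<lambda>x. 2 * indicat_real S x - 1"
  have s: "?s \<in> borel_measurable A" "\<bar>?s x\<bar> \<le> 1" for x using S by (simp, simp add: indicator_def)
  have "h x * \<eta> x \<le> ?s x * \<eta> x" if "x \<in> space M" for x
   using mult_right_mono[OF h(2)[OF that] abs_ge_zero[of "\<eta> x"]] abs_ge_self[of "h x * \<eta> x"] that A by (auto simp: S_def indicator_def abs_mult)
  hence "expectation (\<lambda>x. h x * \<eta> x) \<le> expectation (\<lambda>x. ?s x * \<eta> x)" by (intro integral_mono E h s)
  hence "expectation (\<lambda>x. h x * k x) \<le> expectation (\<lambda>x. ?s x * k x)" by (simp only: E[OF h] E[OF s])
  \<comment> \<open>The sign is 2 times an indicator minus 1; since k has mean 0, the constant
    contributes nothing.\<close>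
  also have "(\<lambda>x. ?s x * k x) = (\<lambda>x. 2 * (indicat_real S x * k x) - k x)" by (simp add: fun_eq_iff left_diff_distrib)
  also have "expectation ... = 2 * expectation (\<lambda>x. indicat_real S x * k x)"
   using ik[of "indicat_real S"] SM k by (simp add: indicator_def)
  finally show ?thesis .
 qed
 from this[of f] this[of "\<lambda>x. - f x"] show ?thesis using f S by (intro bexI[of _ S]) (auto simp: abs_le_iff)
qed

text \<open>Passing to extremal sets twice, first for f against the centred h and then for h against
  the centred indicator of the first set, reduces the covariance to one of events; each passage
  costs a factor 2.\<close>

lemma (in prob_space) cov_le_bounded:
 fixes f h :: "'a => real"
 assumes fA: "f \<in> borel_measurable A" and hB: "h \<in> borel_measurable B"
  and sA: "sets A \<subseteq> sets M" "space A = space M" and sB: "sets B \<subseteq> sets M" "space B = space M"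
  and mix: "\<And>S T. S \<in> sets A ==> T \<in> sets B ==> \<bar>prob (S \<inter> T) - prob S * prob T\<bar> \<le> \<alpha>"
  and f1: "\<And>x. x \<in> space M ==> \<bar>f x\<bar> \<le> 1"
  and h1: "\<And>x. x \<in> space M ==> \<bar>h x\<bar> \<le> 1"
 shows "\<bar>expectation (\<lambda>x. f x * h x) - expectation f * expectation h\<bar> \<le> 4 * \<alpha>"
proof -
 have [measurable]: "f \<in> borel_measurable M" "h \<in> borel_measurable M"
  using measurable_mono[of borel borel A M] measurable_mono[of borel borel B M] fA hB sA sB by auto
 have int: "integrable M f" "integrable M h" "integrable M (\<lambda>x. f x * h x)"
  using f1 h1 by (auto intro!: integrable_const_bound[where B=1] simp: abs_mult mult_le_one)
 have iS: "integrable M (indicat_real S)" "integrable M (\<lambda>x. indicat_real S x * h x)" "expectation (indicat_real S) = prob S" if "S \<in> sets M" for S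
  using that h1 by (auto intro!: integrable_const_bound[where B=1] simp: abs_mult indicator_def)
 obtain S where S: "S \<in> sets A" and 1: "\<bar>expectation (\<lambda>x. f x * (h x - expectation h))\<bar> \<le> 2 * expectation (\<lambda>x. indicat_real S x * (h x - expectation h))"
  using ex_extremal_set[OF fA f1 sA, of "\<lambda>x. h x - expectation h"] int by (auto simp: prob_space)
 have SM: "S \<in> sets M" using S sA by blast
 obtain T where T: "T \<in> sets B" and 2: "\<bar>expectation (\<lambda>x. h x * (indicat_real S x - prob S))\<bar> \<le> 2 * expectation (\<lambda>x. indicat_real T x * (indicat_real S x - prob S))"
  using ex_extremal_set[OF hB h1 sB, of "\<lambda>x. indicat_real S x - prob S"] iS[OF SM] by (auto simp: prob_space)
 have TM: "T \<in> sets M" using T sB by blast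
 have "expectation (\<lambda>x. f x * (h x - expectation h)) = expectation (\<lambda>x. f x * h x) - expectation f * expectation h"
  using int by (simp add: right_diff_distrib)
 moreover have "expectation (\<lambda>x. indicat_real S x * (h x - expectation h)) = expectation (\<lambda>x. h x * (indicat_real S x - prob S))"
  using int iS[OF SM] by (simp add: right_diff_distrib mult.commute)
 moreover have "expectation (\<lambda>x. indicat_real T x * (indicat_real S x - prob S)) = prob (S \<inter> T) - prob S * prob T"
  using iS[OF SM] iS[OF TM] iS(1,3)[of "S \<inter> T"] SM TM by (simp add: right_diff_distrib indicator_inter_arith[symmetric] Int_commute)
 ultimately show ?thesis using 1 2 mix[OF S T] by linarith
qed

text \<open>Real and imaginary parts of both factors give four real covariances, each at most 4
  \<alpha>.\<close>

lemma (in prob_space) cov_le_complex: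
 fixes f h :: "'a => complex"
 assumes fA: "f \<in> borel_measurable A" and hB: "h \<in> borel_measurable B"
  and sA: "sets A \<subseteq> sets M" "space A = space M" and sB: "sets B \<subseteq> sets M" "space B = space M"
  and mix: "\<And>S T. S \<in> sets A ==> T \<in> sets B ==> \<bar>prob (S \<inter> T) - prob S * prob T\<bar> \<le> \<alpha>"
  and f1: "\<And>x. x \<in> space M ==> norm (f x) \<le> 1"
  and h1: "\<And>x. x \<in> space M ==> norm (h x) \<le> 1"
 shows "norm (expectation (\<lambda>x. f x * h x) - expectation f * expectation h) \<le> 16 * \<alpha>"
proof -
 have [measurable]: "f \<in> borel_measurable M" "h \<in> borel_measurable M"
  using measurable_mono[of borel borel A M] measurable_mono[of borel borel B M] fA hB sA sB by auto
 have int: "integrable M f" "integrable M h" "integrable M (\<lambda>x. f x * h x)"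
  using f1 h1 by (auto intro!: integrable_const_bound[where B=1] simp: norm_mult mult_le_one)
 define p where "p u w = expectation (\<lambda>x. u (f x) * w (h x)) - expectation (\<lambda>x. u (f x)) * expectation (\<lambda>x. w (h x))" for u w :: "complex => real"
 have P: "\<bar>p u w\<bar> \<le> 4 * \<alpha>" if "u \<in> {Re, Im}" "w \<in> {Re, Im}" for u w
  unfolding p_def
 proof (rule cov_le_bounded[OF _ _ sA sB mix])
  show "(\<lambda>x. u (f x)) \<in> borel_measurable A" "(\<lambda>x. w (h x)) \<in> borel_measurable B"
   using that fA hB by auto
  show "\<bar>u (f x)\<bar> \<le> 1" "\<bar>w (h x)\<bar> \<le> 1" if "x \<in> space M" for x
   using \<open>u \<in> _\<close> \<open>w \<in> _\<close> f1[OF that] h1[OF that] abs_Re_le_cmod[of "f x"] abs_Im_le_cmod[of "f x"]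
    abs_Re_le_cmod[of "h x"] abs_Im_le_cmod[of "h x"] by auto
 qed
 have intp: "integrable M (\<lambda>x. u (f x) * w (h x))" if "u \<in> {Re, Im}" "w \<in> {Re, Im}" for u w
 proof -
  have m: "u \<in> borel_measurable borel" "w \<in> borel_measurable borel" using that by auto
  have b: "\<bar>u z\<bar> \<le> norm z" "\<bar>w z\<bar> \<le> norm z" for z using that abs_Re_le_cmod abs_Im_le_cmod by auto
  have "norm (u (f x) * w (h x)) \<le> 1" if "x \<in> space M" for x
   using b(1)[of "f x"] b(2)[of "h x"] f1[OF that] h1[OF that] by (auto simp: abs_mult intro!: mult_le_one)
  thus ?thesis using m by (intro integrable_const_bound[where B=1]) (auto intro: AE_I2)
 qed
 have "Re (expectation (\<lambda>x. f x * h x)) = expectation (\<lambda>x. Re (f x) * Re (h x) - Im (f x) * Im (h x))"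
  using integral_Re[OF int(3)] by simp
 hence "Re (expectation (\<lambda>x. f x * h x) - expectation f * expectation h) = p Re Re - p Im Im"
  using int(1,2) intp[of Re Re] intp[of Im Im] by (simp add: p_def)
 moreover have "Im (expectation (\<lambda>x. f x * h x)) = expectation (\<lambda>x. Re (f x) * Im (h x) + Im (f x) * Re (h x))"
  using integral_Im[OF int(3)] by simp
 hence "Im (expectation (\<lambda>x. f x * h x) - expectation f * expectation h) = p Re Im + p Im Re"
  using int(1,2) intp[of Re Im] intp[of Im Re] by (simp add: p_def)
 moreover have "\<bar>p Re Re\<bar> \<le> 4 * \<alpha>" "\<bar>p Im Im\<bar> \<le> 4 * \<alpha>" "\<bar>p Re Im\<bar> \<le> 4 * \<alpha>" "\<bar>p Im Re\<bar> \<le> 4 * \<alpha>"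
  by (intro P; simp)+
 ultimately show ?thesis
  using cmod_le[of "expectation (\<lambda>x. f x * h x) - expectation f * expectation h"] by linarith
qed

section \<open>Moments of sums under geometric decay of dependence\<close>

text \<open>Sorted lists represent the index multisets in the expansion of the q-th power of a sum.
  Sorting separates an initial from a final block, which is the form in which mixing
  applies.\<close>

definition slists :: "nat => nat => int list set" where
 "slists n q = {xs. sorted xs \<and> length xs = q \<and> set xs \<subseteq> {1..int n}}"

lemma finite_slists [simp]: "finite (slists n q)"
 by (rule finite_subset[OF _ finite_lists_length_eq[of "{1..int n}" q]]) (auto simp: slists_def)

lemma slists_0: "slists n 0 = {[]}"
 by (auto simp: slists_def)

lemma slists_1: "slists n (Suc 0) = (\<lambda>x. [x]) ` {1..int n}"
 by (auto simp: slists_def length_Suc_conv)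

lemma slists_Suc:
 "slists n (Suc (Suc q)) = (\<lambda>(xs, x). x # xs) ` Sigma (slists n (Suc q)) (\<lambda>xs. {1..hd xs})" (is "?L = ?R")
proof (intro set_eqI iffI)
 fix ys assume "ys \<in> ?L"
 then obtain x z zs where ys: "ys = x # z # zs" and "sorted ys" "length ys = Suc (Suc q)" "set ys \<subseteq> {1..int n}"
  by (auto simp: slists_def length_Suc_conv)
 thus "ys \<in> ?R" by (auto simp: slists_def subset_iff intro!: rev_image_eqI[of "(z # zs, x)"])
next
 fix ys assume "ys \<in> ?R"
 then obtain xs x where "ys = x # xs" "sorted xs" "length xs = Suc q" "set xs \<subseteq> {1..int n}" "1 \<le> x" "x \<le> hd xs"
  by (auto simp: slists_def)
 moreover then obtain z zs where "xs = z # zs" by (cases xs) auto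
 ultimately show "ys \<in> ?L" by (auto simp: slists_def)
qed

lemma sum_power_dist_le:
 fixes c :: real and h :: int
 assumes "0 < c" "c < 1"
 shows "(\<Sum>x\<in>{1..h}. c ^ nat (h - x)) \<le> 1 / (1 - c)"
proof -
 have "(\<Sum>x\<in>{1..h}. c ^ nat (h - x)) = (\<Sum>k<nat h. c ^ k)"
  by (rule sum.reindex_bij_witness[of _ "\<lambda>k. h - int k" "\<lambda>x. nat (h - x)"]) auto
 also have "... = (1 - c ^ nat h) / (1 - c)"
  using assms by (simp add: sum_gp_strict)
 also have "... \<le> 1 / (1 - c)"
  using assms by (intro divide_right_mono) auto
 finally show ?thesis .
qed

text \<open>Prepending entries below the current head, each new head x contributes a geometric
  factor in its distance from the old one. Only the last entry is free, which gives the single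
  factor n.\<close>

lemma sum_slists_weight:
 fixes c :: real
 assumes c: "0 < c" "c < 1"
 shows "(\<Sum>xs\<in>slists n (Suc q). c ^ nat (last xs - hd xs)) \<le> real n * (1 / (1 - c)) ^ q"
proof (induction q)
 case 0
 have "(\<Sum>xs\<in>slists n (Suc 0). c ^ nat (last xs - hd xs)) = (\<Sum>x\<in>{1..int n}. 1)"
  unfolding slists_1 by (subst sum.reindex) (auto simp: inj_on_def)
 thus ?case by simp
next
 case (Suc q)
 have "(\<Sum>xs\<in>slists n (Suc (Suc q)). c ^ nat (last xs - hd xs)) =
  (\<Sum>(xs, x)\<in>Sigma (slists n (Suc q)) (\<lambda>xs. {1..hd xs}). c ^ nat (last (x # xs) - x))"
  unfolding slists_Suc by (subst sum.reindex) (auto simp: inj_on_def case_prod_beta intro!: sum.cong)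
 also have "... = (\<Sum>xs\<in>slists n (Suc q). \<Sum>x\<in>{1..hd xs}. c ^ nat (last (x # xs) - x))"
  by (subst sum.Sigma) auto
 also have "... = (\<Sum>xs\<in>slists n (Suc q). c ^ nat (last xs - hd xs) * (\<Sum>x\<in>{1..hd xs}. c ^ nat (hd xs - x)))"
 proof (intro sum.cong refl)
  fix xs assume xs: "xs \<in> slists n (Suc q)"
  have ne: "xs \<noteq> []" using xs by (auto simp: slists_def)
  have le: "hd xs \<le> last xs" using xs ne
   by (cases xs) (auto simp: slists_def)
  have "c ^ nat (last (x # xs) - x) = c ^ nat (last xs - hd xs) * c ^ nat (hd xs - x)" if "x \<in> {1..hd xs}" for x
   using that le ne by (simp add: power_add[symmetric] nat_add_distrib[symmetric])
  thus "(\<Sum>x\<in>{1..hd xs}. c ^ nat (last (x # xs) - x)) = c ^ nat (last xs - hd xs) * (\<Sum>x\<in>{1..hd xs}. c ^ nat (hd xs - x))"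
   unfolding sum_distrib_left by (intro sum.cong) auto
 qed
 also have "... \<le> (\<Sum>xs\<in>slists n (Suc q). c ^ nat (last xs - hd xs) * (1 / (1 - c)))"
  using c by (intro sum_mono mult_left_mono sum_power_dist_le) auto
 also have "... = (\<Sum>xs\<in>slists n (Suc q). c ^ nat (last xs - hd xs)) * (1 / (1 - c))"
  by (rule sum_distrib_right[symmetric])
 also have "... \<le> real n * (1 / (1 - c)) ^ q * (1 / (1 - c))"
  using c by (intro mult_right_mono Suc.IH) auto
 finally show ?case by (simp add: field_simps)
qed

text \<open>By the pigeonhole principle some gap is at least the average gap.\<close>

lemma large_gap:
 fixes xs :: "int list"
 assumes q: "length xs = q" "2 \<le> q" and s: "sorted xs"
 shows "\<exists>k\<in>{1..<q}. last xs - hd xs \<le> int q * (xs ! k - xs ! (k - 1))"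
proof (rule ccontr)
 assume "\<not> ?thesis"
 hence neg: "int q * (xs ! k - xs ! (k - 1)) < last xs - hd xs" if "k \<in> {1..<q}" for k
  using that by force
 have tel: "(\<Sum>k\<in>{1..<m}. xs ! k - xs ! (k - 1)) = xs ! (m - 1) - xs ! 0" if "m \<ge> 1" for m
  using that by (induction m rule: dec_induct) auto
 have ne: "xs \<noteq> []" using q by auto
 have L: "last xs - hd xs = (\<Sum>k\<in>{1..<q}. xs ! k - xs ! (k - 1))"
  using tel[of q] q ne by (simp add: last_conv_nth hd_conv_nth)
 have L0: "0 \<le> last xs - hd xs" using s ne by (cases xs) auto
 have "int q * (last xs - hd xs) = (\<Sum>k\<in>{1..<q}. int q * (xs ! k - xs ! (k - 1)))"
  unfolding L by (simp add: sum_distrib_left)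
 also have "... < (\<Sum>k\<in>{1..<q}. last xs - hd xs)"
  using q neg by (intro sum_strict_mono) auto
 also have "... = int (q - 1) * (last xs - hd xs)" by simp
 also have "... \<le> int q * (last xs - hd xs)" using L0 by (intro mult_right_mono) auto
 finally show False by simp
qed

text \<open>Abstracts the mixed moments of a centred mixing sequence. D stays explicit because it
  will carry the smallness of an increment of the empirical process.\<close>

definition geometric_moments :: "(int list => real) => real => real => bool" where
 "geometric_moments m D c \<longleftrightarrow> D \<ge> 0 \<and> m [] = 1 \<and> (\<forall>x. m [x] = 0) \<and>
  (\<forall>ys zs. ys \<noteq> [] --> zs \<noteq> [] --> sorted (ys @ zs) -->
    \<bar>m (ys @ zs) - m ys * m zs\<bar> \<le> D * c ^ nat (hd zs - last ys))"

text \<open>Induction on q. Cutting a list at a large gap factorises its moment up to an error that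
  decays in the gap. The products contribute powers k div 2 and (q - k) div 2, which add up to at
  most q div 2; because singletons vanish, this is about one factor n D for each pair of indices.
  The errors sum to a multiple of n D.\<close>

lemma moment_sum_bound:
 fixes c :: real
 assumes c: "0 < c" "c < 1"
 shows "\<exists>K\<ge>0. \<forall>m D n. geometric_moments m D c -->
     (\<Sum>xs\<in>slists n q. \<bar>m xs\<bar>) \<le> K * max 1 (real n * D) ^ (q div 2)"
proof (induction q rule: less_induct)
 case (less q)
 show ?case
 proof (cases "q < 2")
  case True
  show ?thesis
  proof (cases "q = 0")
   case True
   thus ?thesis by (intro exI[of _ 1]) (auto simp: slists_0 geometric_moments_def)
  next
   case False
   with True have "q = Suc 0" by simp
   moreover have "(\<Sum>xs\<in>slists n (Suc 0). \<bar>m xs\<bar>) = 0" if "geometric_moments m D c" for m D n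
    using that by (auto simp: slists_1 geometric_moments_def intro!: sum.neutral)
   ultimately show ?thesis by (intro exI[of _ 1]) auto
  qed
 next
  case False
  hence q2: "q \<ge> 2" by simp
  obtain Kf where Kf: "\<And>k. k < q ==> Kf k \<ge> 0"
   "\<And>k m D n. k < q ==> geometric_moments m D c ==>
     (\<Sum>xs\<in>slists n k. \<bar>m xs\<bar>) \<le> Kf k * max 1 (real n * D) ^ (k div 2)"
   using less.IH by metis
  \<comment> \<open>The gap used for cutting is at least a q-th part of the whole span, so decay at
    rate c in the gap is decay at rate d in the span.\<close>
  define d where "d = root q c"
  have d: "0 < d" "d < 1" and dq: "d ^ q = c"
   using c q2 by (auto simp: d_def)
  define K where "K = (\<Sum>k\<in>{1..<q}. Kf k * Kf (q - k)) + (1 / (1 - d)) ^ (q - 1)"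
  have K0: "K \<ge> 0" unfolding K_def
   using Kf(1) d by (intro add_nonneg_nonneg sum_nonneg mult_nonneg_nonneg) auto
  have "(\<Sum>xs\<in>slists n q. \<bar>m xs\<bar>) \<le> K * max 1 (real n * D) ^ (q div 2)"
   if gm: "geometric_moments m D c" for m D n
  proof -
   define Y where "Y = max 1 (real n * D)"
   have Y1: "Y \<ge> 1" by (simp add: Y_def)
   have D0: "D \<ge> 0" using gm by (simp add: geometric_moments_def)
   have single: "\<bar>m xs\<bar> \<le> (\<Sum>k\<in>{1..<q}. \<bar>m (take k xs)\<bar> * \<bar>m (drop k xs)\<bar>) + D * d ^ nat (last xs - hd xs)"
    if xs: "xs \<in> slists n q" for xs
   proof -
    have len: "length xs = q" and srt: "sorted xs" using xs by (auto simp: slists_def)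
    obtain k where k: "k \<in> {1..<q}" and gap: "last xs - hd xs \<le> int q * (xs ! k - xs ! (k - 1))"
     using large_gap[OF len q2 srt] by blast
    have "\<bar>m (take k xs @ drop k xs) - m (take k xs) * m (drop k xs)\<bar>
      \<le> D * c ^ nat (hd (drop k xs) - last (take k xs))"
    proof -
     have "take k xs \<noteq> []" "drop k xs \<noteq> []" "sorted (take k xs @ drop k xs)" using k len srt by auto
     thus ?thesis using gm unfolding geometric_moments_def by blast
    qed
    also have "hd (drop k xs) - last (take k xs) = xs ! k - xs ! (k - 1)"
    proof -
     have "take k xs \<noteq> []" "length (take k xs) = k" using k len by auto
     hence "last (take k xs) = xs ! (k - 1)" using k by (subst last_conv_nth) auto
     thus ?thesis using k len by (simp add: hd_drop_conv_nth)
    qed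
    also have "c ^ nat (xs ! k - xs ! (k - 1)) \<le> d ^ nat (last xs - hd xs)"
    proof -
     have "nat (last xs - hd xs) \<le> q * nat (xs ! k - xs ! (k - 1))"
     proof -
      have "xs ! (k - 1) \<le> xs ! k" using srt k len by (intro sorted_nth_mono) auto
      hence "int (q * nat (xs ! k - xs ! (k - 1))) = int q * (xs ! k - xs ! (k - 1))" by simp
      thus ?thesis using gap by linarith
     qed
     hence "d ^ (q * nat (xs ! k - xs ! (k - 1))) \<le> d ^ nat (last xs - hd xs)"
      using d by (intro power_decreasing) auto
     thus ?thesis by (simp add: power_mult dq)
    qed
    finally have "\<bar>m xs - m (take k xs) * m (drop k xs)\<bar> \<le> D * d ^ nat (last xs - hd xs)"
     using D0 by (simp add: mult_left_mono)
    \<comment> \<open>The cut k depends on the list; summing over all k removes this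
      dependence.\<close>
    moreover have "\<bar>m (take k xs) * m (drop k xs)\<bar> \<le> (\<Sum>k\<in>{1..<q}. \<bar>m (take k xs)\<bar> * \<bar>m (drop k xs)\<bar>)"
     unfolding abs_mult by (rule member_le_sum[OF k]) auto
    ultimately show ?thesis by linarith
   qed
   have split: "(\<Sum>xs\<in>slists n q. \<bar>m (take k xs)\<bar> * \<bar>m (drop k xs)\<bar>)
     \<le> (\<Sum>ys\<in>slists n k. \<bar>m ys\<bar>) * (\<Sum>zs\<in>slists n (q - k). \<bar>m zs\<bar>)" if k: "k \<in> {1..<q}" for k
   proof -
    have "(\<Sum>xs\<in>slists n q. \<bar>m (take k xs)\<bar> * \<bar>m (drop k xs)\<bar>)
     = (\<Sum>(ys, zs)\<in>(\<lambda>xs. (take k xs, drop k xs)) ` slists n q. \<bar>m ys\<bar> * \<bar>m zs\<bar>)"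
    proof (subst sum.reindex)
     show "inj_on (\<lambda>xs. (take k xs, drop k xs)) (slists n q)"
      by (rule inj_onI) (metis append_take_drop_id prod.inject)
    qed simp
    also have "... \<le> (\<Sum>(ys, zs)\<in>slists n k \<times> slists n (q - k). \<bar>m ys\<bar> * \<bar>m zs\<bar>)"
    proof (intro sum_mono2 finite_cartesian_product finite_slists)
     show "(\<lambda>xs. (take k xs, drop k xs)) ` slists n q \<subseteq> slists n k \<times> slists n (q - k)"
      using k by (auto simp: slists_def dest: in_set_takeD in_set_dropD)
    qed auto
    also have "... = (\<Sum>ys\<in>slists n k. \<bar>m ys\<bar>) * (\<Sum>zs\<in>slists n (q - k). \<bar>m zs\<bar>)"
     by (simp add: sum_product sum.cartesian_product)
    finally show ?thesis .
   qed
   have prodb: "(\<Sum>ys\<in>slists n k. \<bar>m ys\<bar>) * (\<Sum>zs\<in>slists n (q - k). \<bar>m zs\<bar>) \<le> Kf k * Kf (q - k) * Y ^ (q div 2)"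
    if k: "k \<in> {1..<q}" for k
   proof -
    have "(\<Sum>ys\<in>slists n k. \<bar>m ys\<bar>) * (\<Sum>zs\<in>slists n (q - k). \<bar>m zs\<bar>)
     \<le> (Kf k * Y ^ (k div 2)) * (Kf (q - k) * Y ^ ((q - k) div 2))"
     using k Kf(1) Y1 gm unfolding Y_def by (intro mult_mono Kf(2)) (auto intro!: sum_nonneg)
    also have "... = Kf k * Kf (q - k) * Y ^ (k div 2 + (q - k) div 2)"
     by (simp add: power_add)
    also have "... \<le> Kf k * Kf (q - k) * Y ^ (q div 2)"
    proof (intro mult_left_mono power_increasing)
     have "q = k + (q - k)" using k by simp
     thus "k div 2 + (q - k) div 2 \<le> q div 2" by linarith
    qed (use Y1 Kf(1) k in auto)
    finally show ?thesis .
   qed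
   have "(\<Sum>xs\<in>slists n q. \<bar>m xs\<bar>)
     \<le> (\<Sum>xs\<in>slists n q. (\<Sum>k\<in>{1..<q}. \<bar>m (take k xs)\<bar> * \<bar>m (drop k xs)\<bar>) + D * d ^ nat (last xs - hd xs))"
    by (intro sum_mono single)
   also have "... = (\<Sum>k\<in>{1..<q}. \<Sum>xs\<in>slists n q. \<bar>m (take k xs)\<bar> * \<bar>m (drop k xs)\<bar>)
     + D * (\<Sum>xs\<in>slists n q. d ^ nat (last xs - hd xs))"
    by (simp add: sum.distrib sum_distrib_left sum.swap[of _ "slists n q"])
   also have "... \<le> (\<Sum>k\<in>{1..<q}. Kf k * Kf (q - k) * Y ^ (q div 2)) + (1 / (1 - d)) ^ (q - 1) * Y ^ (q div 2)"
   proof (intro add_mono sum_mono)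
    show "(\<Sum>xs\<in>slists n q. \<bar>m (take k xs)\<bar> * \<bar>m (drop k xs)\<bar>) \<le> Kf k * Kf (q - k) * Y ^ (q div 2)"
     if "k \<in> {1..<q}" for k using split[OF that] prodb[OF that] by linarith
    have "D * (\<Sum>xs\<in>slists n q. d ^ nat (last xs - hd xs)) \<le> D * (real n * (1 / (1 - d)) ^ (q - 1))"
     using sum_slists_weight[OF d, of n "q - 1"] q2 D0 by (intro mult_left_mono) auto
    also have "... = (1 / (1 - d)) ^ (q - 1) * (real n * D)" by simp
    also have "... \<le> (1 / (1 - d)) ^ (q - 1) * Y ^ (q div 2)"
    proof (intro mult_left_mono)
     have "real n * D \<le> Y ^ 1" by (simp add: Y_def)
     also have "... \<le> Y ^ (q div 2)" using Y1 q2 by (intro power_increasing) auto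
     finally show "real n * D \<le> Y ^ (q div 2)" .
    qed (use d in auto)
    finally show "D * (\<Sum>xs\<in>slists n q. d ^ nat (last xs - hd xs)) \<le> (1 / (1 - d)) ^ (q - 1) * Y ^ (q div 2)" .
   qed
   also have "... = K * Y ^ (q div 2)"
    by (simp add: K_def sum_distrib_right distrib_right)
   finally show ?thesis unfolding Y_def .
  qed
  with K0 show ?thesis by blast
 qed
qed

lemma sum_power_lists:
 fixes f :: "'i => real"
 assumes "finite A"
 shows "(\<Sum>i\<in>A. f i) ^ q = (\<Sum>xs\<in>{xs. set xs \<subseteq> A \<and> length xs = q}. prod_list (map f xs))"
proof (induction q)
 case 0
 have "{xs. set xs \<subseteq> A \<and> length xs = 0} = {[]}" by auto
 thus ?case by simp
next
 case (Suc q)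
 let ?L = "\<lambda>q. {xs. set xs \<subseteq> A \<and> length xs = q}"
 have L: "?L (Suc q) = (\<lambda>(x, xs). x # xs) ` (A \<times> ?L q)"
  by (auto simp: length_Suc_conv image_iff)
 have "(\<Sum>xs\<in>?L (Suc q). prod_list (map f xs)) = (\<Sum>(x, xs)\<in>A \<times> ?L q. f x * prod_list (map f xs))"
  unfolding L by (subst sum.reindex) (auto simp: inj_on_def intro!: sum.cong)
 also have "... = (\<Sum>x\<in>A. f x) * (\<Sum>xs\<in>?L q. prod_list (map f xs))"
  by (simp add: sum_product sum.cartesian_product)
 finally show ?case using Suc by simp
qed

lemma card_sort_fiber: "card {xs :: int list. sort xs = ys} \<le> fact (length ys)"
proof -
 have "{xs. sort xs = ys} \<subseteq> permutations_of_multiset (mset ys)"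
  by (auto simp: permutations_of_multiset_def)
 hence "card {xs. sort xs = ys} \<le> card (permutations_of_multiset (mset ys))"
  by (intro card_mono) auto
 also have "... \<le> fact (length ys)"
  by (simp add: card_permutations_of_multiset(1))
 finally show ?thesis .
qed

lemma sum_lists_le_slists:
 fixes h :: "int list => real"
 assumes h0: "\<And>xs. h xs \<ge> 0"
 shows "(\<Sum>xs\<in>{xs. set xs \<subseteq> {1..int n} \<and> length xs = q}. h (sort xs)) \<le> fact q * (\<Sum>ys\<in>slists n q. h ys)"
proof -
 let ?L = "{xs. set xs \<subseteq> {1..int n} \<and> length xs = q}"
 have fin: "finite ?L" by (rule finite_lists_length_eq) simp
 have "(\<Sum>xs\<in>?L. h (sort xs)) = (\<Sum>ys\<in>slists n q. \<Sum>xs\<in>{xs\<in>?L. sort xs = ys}. h (sort xs))"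
  by (rule sum.group[symmetric, OF fin finite_slists]) (auto simp: slists_def)
 also have "... \<le> (\<Sum>ys\<in>slists n q. fact q * h ys)"
 proof (rule sum_mono)
  fix ys assume ys: "ys \<in> slists n q"
  have "(\<Sum>xs\<in>{xs\<in>?L. sort xs = ys}. h (sort xs)) = real (card {xs\<in>?L. sort xs = ys}) * h ys"
   by simp
  also have "... \<le> fact q * h ys"
  proof (intro mult_right_mono h0)
   have "{xs\<in>?L. sort xs = ys} = {xs. sort xs = ys}"
    using ys by (auto simp: slists_def)
   hence "card {xs\<in>?L. sort xs = ys} \<le> fact q"
    using card_sort_fiber[of ys] ys by (simp add: slists_def)
   from of_nat_mono[OF this, where 'a=real] show "real (card {xs\<in>?L. sort xs = ys}) \<le> fact q"
    by simp
  qed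
  finally show "(\<Sum>xs\<in>{xs\<in>?L. sort xs = ys}. h (sort xs)) \<le> fact q * h ys" .
 qed
 finally show ?thesis by (simp add: sum_distrib_left)
qed

text \<open>Expanding the power produces all index lists. The factors commute, so every list may be
  sorted, and at most q! lists have the same sorting.\<close>

lemma moment_inequality:
 fixes c :: real and N :: "'a measure"
 assumes c: "0 < c" "c < 1"
 shows "\<exists>K\<ge>0. \<forall>(\<zeta> :: int => 'a => real) D n.
  (\<forall>i. \<zeta> i \<in> borel_measurable N) --> (\<forall>i. \<forall>x\<in>space N. \<bar>\<zeta> i x\<bar> \<le> 1) --> prob_space N -->
  geometric_moments (\<lambda>xs. integral\<^sup>L N (\<lambda>x. prod_list (map (\<lambda>i. \<zeta> i x) xs))) D c -->
  integral\<^sup>L N (\<lambda>x. (\<Sum>i\<in>{1..int n}. \<zeta> i x) ^ q) \<le> K * max 1 (real n * D) ^ (q div 2)"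
proof -
 obtain K where K: "K \<ge> 0" "\<And>m D n. geometric_moments m D c ==>
     (\<Sum>xs\<in>slists n q. \<bar>m xs\<bar>) \<le> K * max 1 (real n * D) ^ (q div 2)"
  using moment_sum_bound[OF c, of q] by blast
 show ?thesis
 proof (intro exI[of _ "fact q * K"] conjI allI impI)
  show "0 \<le> fact q * K" using K by simp
  fix \<zeta> :: "int => 'a => real" and D n
  assume m: "\<forall>i. \<zeta> i \<in> borel_measurable N" and b: "\<forall>i. \<forall>x\<in>space N. \<bar>\<zeta> i x\<bar> \<le> 1" and "prob_space N"
   and gm: "geometric_moments (\<lambda>xs. integral\<^sup>L N (\<lambda>x. prod_list (map (\<lambda>i. \<zeta> i x) xs))) D c"
  interpret prob_space N by fact
  define mm where "mm xs = integral\<^sup>L N (\<lambda>x. prod_list (map (\<lambda>i. \<zeta> i x) xs))" for xs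
  have meas: "(\<lambda>x. prod_list (map (\<lambda>i. \<zeta> i x) xs)) \<in> borel_measurable N" for xs
  proof (induction xs)
   case (Cons i xs)
   have "\<zeta> i \<in> borel_measurable N" using m by blast
   from borel_measurable_times[OF this Cons] show ?case by simp
  qed simp
  have bd: "\<bar>prod_list (map (\<lambda>i. \<zeta> i x) xs)\<bar> \<le> 1" if "x \<in> space N" for xs x
   by (induction xs) (use b that in \<open>auto simp: abs_mult intro!: mult_le_one\<close>)
  have int: "integrable N (\<lambda>x. prod_list (map (\<lambda>i. \<zeta> i x) xs))" for xs
   using bd meas by (intro integrable_const_bound[where B=1]) (auto intro!: AE_I2)
  have srt: "mm (sort xs) = mm xs" for xs
  proof -
   have "prod_list (map f (sort xs)) = prod_list (map f xs)" for f :: "int => real"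
    by (metis mset_map mset_sort prod_mset_prod_list)
   thus ?thesis by (simp add: mm_def)
  qed
  let ?L = "{xs. set xs \<subseteq> {1..int n} \<and> length xs = q}"
  have "integral\<^sup>L N (\<lambda>x. (\<Sum>i\<in>{1..int n}. \<zeta> i x) ^ q) = (\<Sum>xs\<in>?L. mm xs)"
   unfolding mm_def sum_power_lists[OF finite_atLeastAtMost_int] using int by (simp add: Bochner_Integration.integral_sum)
  also have "... \<le> (\<Sum>xs\<in>?L. \<bar>mm (sort xs)\<bar>)"
   unfolding srt by (intro sum_mono) auto
  also have "... \<le> fact q * (\<Sum>ys\<in>slists n q. \<bar>mm ys\<bar>)"
   by (rule sum_lists_le_slists) auto
  also have "... \<le> fact q * (K * max 1 (real n * D) ^ (q div 2))"
   using K(2)[OF gm, of n] unfolding mm_def by (intro mult_left_mono) auto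
  finally show "integral\<^sup>L N (\<lambda>x. (\<Sum>i\<in>{1..int n}. \<zeta> i x) ^ q) \<le> fact q * K * max 1 (real n * D) ^ (q div 2)"
   by simp
 qed
qed

section \<open>Stationary geometrically mixing sequences\<close>

locale geometric_mixing = prob_space M for M :: "'a measure" +
 fixes X :: "int => 'a => real ^ 'd" and a :: real
 assumes X_meas [measurable]: "\<And>i. X i \<in> borel_measurable M"
  and stat: "strictly_stationary M X"
  and a01: "0 < a" "a < 1"
  and alpha_O: "alpha_coeff M X \<in> O(\<lambda>k. a ^ k)"
  and marg_cont: "\<And>j. continuous_on UNIV (marginal_cdf M X j)"
begin

text \<open>The sets of \<open>sigma_field M X I\<close> as a measurable space, so that
  measurability of functions with respect to it can be stated.\<close>

definition Fld :: "int set => 'a measure" where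
 "Fld I = sigma (space M) (\<Union>i\<in>I. {X i -` B \<inter> space M | B. B \<in> sets borel})"

lemma space_Fld [simp]: "space (Fld I) = space M"
 by (auto simp: Fld_def space_measure_of_conv)

lemma sets_Fld: "sets (Fld I) = sigma_field M X I"
 unfolding Fld_def sigma_field_def by (rule sets_measure_of) auto

lemma Fld_subset: "sets (Fld I) \<subseteq> sets M"
 unfolding sets_Fld sigma_field_def by (intro sets.sigma_sets_subset) auto

lemma X_Fld: "i \<in> I ==> X i \<in> borel_measurable (Fld I)"
 by (intro measurableI) (auto simp: sets_Fld sigma_field_def intro!: sigma_sets.Basic)

lemma Fld_mono_measurable: "f \<in> borel_measurable (Fld I) ==> f \<in> borel_measurable M"
 using measurable_mono[of borel borel "Fld I" M] Fld_subset by auto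

lemma cov_prob_le_1: "\<bar>prob S - prob S' * prob T'\<bar> \<le> 1"
proof -
 have "0 \<le> prob S' * prob T'" "prob S' * prob T' \<le> 1" by (auto intro: mult_le_one)
 thus ?thesis using prob_le_1[of S] measure_nonneg[of M S] by linarith
qed

text \<open>The real-valued \<open>Sup\<close> in \<open>alpha_coeff\<close> dominates its elements
  only on account of this bound.\<close>

lemma alpha_coeff_bdd:
 "bdd_above {\<bar>measure M (A \<inter> B) - measure M A * measure M B\<bar> | A B i.
      A \<in> sigma_field M X {..i} \<and> B \<in> sigma_field M X {i + int k..}}"
 by (rule bdd_aboveI[of _ 1]) (auto intro: cov_prob_le_1)

lemma alpha_upper:
 assumes "S \<in> sets (Fld {..i})" "T \<in> sets (Fld {i + int k..})"
 shows "\<bar>prob (S \<inter> T) - prob S * prob T\<bar> \<le> alpha_coeff M X k"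
 unfolding alpha_coeff_def
 by (rule cSup_upper[OF _ alpha_coeff_bdd]) (use assms in \<open>auto simp: sets_Fld\<close>)

text \<open>The O-bound holds from some k0 on; the finitely many earlier coefficients are absorbed
  into the constant through the sum \<open>?s\<close>.\<close>

lemma ex_alpha_const: "\<exists>A\<ge>1. \<forall>k. alpha_coeff M X k \<le> A * a ^ k"
proof -
 obtain c where c: "c > 0" "eventually (\<lambda>k. norm (alpha_coeff M X k) \<le> c * norm (a ^ k)) sequentially"
  using landau_o.bigE[OF alpha_O] by blast
 then obtain k0 where k0: "\<And>k. k \<ge> k0 ==> alpha_coeff M X k \<le> c * a ^ k"
  using a01 by (force simp: eventually_sequentially)
 let ?s = "\<Sum>j<k0. \<bar>alpha_coeff M X j\<bar> / a ^ j"
 have s0: "0 \<le> ?s" using a01 by (intro sum_nonneg) auto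
 have "alpha_coeff M X k \<le> (1 + c + ?s) * a ^ k" for k
 proof (cases "k \<ge> k0")
  case True
  thus ?thesis using k0[OF True] a01 s0 by (intro order.trans[OF _ mult_right_mono[of c "1 + c + ?s"]]) auto
 next
  case False
  have "alpha_coeff M X k \<le> \<bar>alpha_coeff M X k\<bar> / a ^ k * a ^ k" using a01 by simp
  also have "... \<le> (1 + c + ?s) * a ^ k"
   using False a01 c(1) member_le_sum[of k "{..<k0}" "\<lambda>j. \<bar>alpha_coeff M X j\<bar> / a ^ j"] by (intro mult_right_mono) auto
  finally show ?thesis .
 qed
 thus ?thesis using c(1) s0 by (intro exI[of _ "1 + c + ?s"]) auto
qed

definition A0 :: real where "A0 = (SOME A. A \<ge> 1 \<and> (\<forall>k. alpha_coeff M X k \<le> A * a ^ k))"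

lemma A0: "A0 \<ge> 1" "alpha_coeff M X k \<le> A0 * a ^ k"
 using someI_ex[of "\<lambda>A. A \<ge> 1 \<and> (\<forall>k. alpha_coeff M X k \<le> A * a ^ k)"] ex_alpha_const
 unfolding A0_def by auto

lemma mix:
 assumes "S \<in> sets (Fld {..i})" "T \<in> sets (Fld {j..})" "i \<le> j"
 shows "\<bar>prob (S \<inter> T) - prob S * prob T\<bar> \<le> A0 * a ^ nat (j - i)"
 using alpha_upper[of S i T "nat (j - i)"] assms A0(2)[of "nat (j - i)"] by simp

lemma mix_cov:
 fixes f h :: "'a => real"
 assumes "f \<in> borel_measurable (Fld {..i})" "h \<in> borel_measurable (Fld {j..})" "i \<le> j"
  and "\<And>x. x \<in> space M ==> \<bar>f x\<bar> \<le> 1" "\<And>x. x \<in> space M ==> \<bar>h x\<bar> \<le> 1"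
 shows "\<bar>expectation (\<lambda>x. f x * h x) - expectation f * expectation h\<bar> \<le> 4 * (A0 * a ^ nat (j - i))"
 by (rule cov_le_bounded[OF assms(1,2) Fld_subset space_Fld Fld_subset space_Fld])
  (use mix assms in auto)

lemma mix_cov_complex:
 fixes f h :: "'a => complex"
 assumes "f \<in> borel_measurable (Fld {..i})" "h \<in> borel_measurable (Fld {j..})" "i \<le> j"
  and "\<And>x. x \<in> space M ==> norm (f x) \<le> 1" "\<And>x. x \<in> space M ==> norm (h x) \<le> 1"
 shows "norm (expectation (\<lambda>x. f x * h x) - expectation f * expectation h) \<le> 16 * (A0 * a ^ nat (j - i))"
 by (rule cov_le_complex[OF assms(1,2) Fld_subset space_Fld Fld_subset space_Fld])
  (use mix assms in auto)

lemma stationary_integral: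
 fixes F :: "(int => real ^ 'd) => 'c::{banach, second_countable_topology}"
 assumes I: "finite I" and F: "F \<in> borel_measurable (Pi\<^sub>M I (\<lambda>_. borel))"
 shows "expectation (\<lambda>s. F (\<lambda>i\<in>I. X (i + h) s)) = expectation (\<lambda>s. F (\<lambda>i\<in>I. X i s))"
proof -
 have m: "(\<lambda>s. \<lambda>i\<in>I. X (i + k) s) \<in> M \<rightarrow>\<^sub>M Pi\<^sub>M I (\<lambda>_. borel)" for k by measurable
 have "expectation (\<lambda>s. F (\<lambda>i\<in>I. X (i + h) s)) = integral\<^sup>L (distr M (Pi\<^sub>M I (\<lambda>_. borel)) (\<lambda>s. \<lambda>i\<in>I. X (i + h) s)) F"
  by (rule integral_distr[symmetric, OF m F])
 also have "... = integral\<^sup>L (distr M (Pi\<^sub>M I (\<lambda>_. borel)) (\<lambda>s. \<lambda>i\<in>I. X i s)) F"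
  using stat I unfolding strictly_stationary_def by metis
 also have "... = expectation (\<lambda>s. F (\<lambda>i\<in>I. X i s))"
  using integral_distr[OF m[of 0] F] by simp
 finally show ?thesis .
qed

lemma stationary_1:
 fixes f :: "real ^ 'd => 'c::{banach, second_countable_topology}"
 assumes [measurable]: "f \<in> borel_measurable borel"
 shows "expectation (\<lambda>s. f (X i s)) = expectation (\<lambda>s. f (X 0 s))"
 using stationary_integral[of "{0}" "\<lambda>x. f (x 0)" i] by simp

lemma stationary_2:
 fixes f h :: "real ^ 'd => real"
 assumes [measurable]: "f \<in> borel_measurable borel" "h \<in> borel_measurable borel"
 shows "expectation (\<lambda>s. f (X i s) * h (X k s)) = expectation (\<lambda>s. f (X 0 s) * h (X (k - i) s))"
 using stationary_integral[of "{0, k - i}" "\<lambda>x. f (x 0) * h (x (k - i))" i] by simp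

lemma prod_list_Fld:
 fixes \<phi> :: "real ^ 'd => real"
 assumes [measurable]: "\<phi> \<in> borel_measurable borel" and "set xs \<subseteq> I"
 shows "(\<lambda>s. prod_list (map (\<lambda>i. \<phi> (X i s)) xs)) \<in> borel_measurable (Fld I)"
 using assms(2)
proof (induction xs)
 case (Cons i xs)
 have [measurable]: "X i \<in> borel_measurable (Fld I)" using Cons by (intro X_Fld) auto
 have "(\<lambda>s. \<phi> (X i s)) \<in> borel_measurable (Fld I)" by measurable
 from borel_measurable_times[OF this Cons.IH] show ?case using Cons.prems by simp
qed simp

lemma int_bounded:
 fixes f :: "'a => 'c::{banach, second_countable_topology}"
 assumes "f \<in> borel_measurable M" "\<And>x. x \<in> space M ==> norm (f x) \<le> B"
 shows "integrable M f"
 using assms by (intro integrable_const_bound[where B=B]) (auto intro!: AE_I2)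

lemma expectation_mono_bound:
 fixes f h :: "'a => real"
 assumes "f \<in> borel_measurable M" "integrable M h" "\<And>x. x \<in> space M ==> \<bar>f x\<bar> \<le> h x"
 shows "\<bar>expectation f\<bar> \<le> expectation h"
proof -
 have "integrable M f"
  by (rule Bochner_Integration.integrable_bound[OF assms(2,1)]) (use assms(3) in \<open>auto intro!: AE_I2 intro: order.trans[OF _ abs_ge_self]\<close>)
 hence "\<bar>expectation f\<bar> \<le> expectation (\<lambda>x. \<bar>f x\<bar>)" by simp
 also have "... \<le> expectation h" using \<open>integrable M f\<close> assms by (intro integral_mono) auto
 finally show ?thesis .
qed

text \<open>The factorisation error has two bounds: 4 A0 a^r from mixing and 2 \<rho> from the size
  of a single variable. Interpolating them with exponents \<epsilon> and 1 - \<epsilon> keeps a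
  geometric decay while D retains almost the full power of \<rho>.\<close>

lemma geometric_moments_X:
 fixes \<phi> :: "real ^ 'd => real"
 assumes [measurable]: "\<phi> \<in> borel_measurable borel" and b: "\<And>x. \<bar>\<phi> x\<bar> \<le> 1"
  and E0: "expectation (\<lambda>s. \<phi> (X 0 s)) = 0"
  and \<rho>: "expectation (\<lambda>s. \<bar>\<phi> (X 0 s)\<bar>) \<le> \<rho>"
  and \<epsilon>: "0 < \<epsilon>" "\<epsilon> < 1"
 shows "geometric_moments (\<lambda>xs. expectation (\<lambda>s. prod_list (map (\<lambda>i. \<phi> (X i s)) xs)))
     ((4 * A0) powr \<epsilon> * 2 powr (1 - \<epsilon>) * \<rho> powr (1 - \<epsilon>)) (a powr \<epsilon>)"
 unfolding geometric_moments_def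
proof (intro conjI allI impI)
 let ?m = "\<lambda>xs. expectation (\<lambda>s. prod_list (map (\<lambda>i. \<phi> (X i s)) xs))"
 show "?m [] = 1" by (simp add: prob_space)
 show "?m [x] = 0" for x using stationary_1[of \<phi> x] E0 by simp
 show "0 \<le> (4 * A0) powr \<epsilon> * 2 powr (1 - \<epsilon>) * \<rho> powr (1 - \<epsilon>)" by simp
 have bd: "\<bar>prod_list (map (\<lambda>i. \<phi> (X i s)) xs)\<bar> \<le> 1" for xs s
  by (induction xs) (use b in \<open>auto simp: abs_mult intro!: mult_le_one\<close>)
 have meas: "(\<lambda>s. prod_list (map (\<lambda>i. \<phi> (X i s)) xs)) \<in> borel_measurable M" for xs
  using prod_list_Fld[of \<phi> xs UNIV] Fld_mono_measurable by auto
 have "0 \<le> expectation (\<lambda>s. \<bar>\<phi> (X 0 s)\<bar>)" by simp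
 hence \<rho>0: "\<rho> \<ge> 0" using \<rho> by linarith
 have mle: "\<bar>?m xs\<bar> \<le> \<rho>" if ne: "xs \<noteq> []" for xs
 proof -
  obtain i zs where xs: "xs = i # zs" using ne by (cases xs) auto
  have "\<bar>?m xs\<bar> \<le> expectation (\<lambda>s. \<bar>\<phi> (X i s)\<bar>)"
  proof (rule expectation_mono_bound[OF meas])
   show "integrable M (\<lambda>s. \<bar>\<phi> (X i s)\<bar>)" using b by (intro int_bounded[where B=1]) auto
   show "\<bar>prod_list (map (\<lambda>i. \<phi> (X i s)) xs)\<bar> \<le> \<bar>\<phi> (X i s)\<bar>" for s
    using bd[of s zs] by (simp add: xs abs_mult mult_left_le)
  qed
  also have "... \<le> \<rho>" using stationary_1[of "\<lambda>x. \<bar>\<phi> x\<bar>" i] \<rho> by simp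
  finally show ?thesis .
 qed
 have mle1: "\<bar>?m xs\<bar> \<le> 1" for xs
  using expectation_mono_bound[OF meas, of "\<lambda>_. 1"] bd by (simp add: prob_space)
 fix ys zs :: "int list" assume ne: "ys \<noteq> []" "zs \<noteq> []" and s: "sorted (ys @ zs)"
 let ?r = "nat (hd zs - last ys)"
 have le: "last ys \<le> hd zs" using s ne by (auto simp: sorted_append)
 have "set ys \<subseteq> {..last ys}"
  using s ne by (induction ys rule: rev_induct) (auto simp: sorted_append)
 moreover have "set zs \<subseteq> {hd zs..}" using s ne by (cases zs) (auto simp: sorted_append)
 ultimately have 1: "\<bar>?m (ys @ zs) - ?m ys * ?m zs\<bar> \<le> 4 * (A0 * a ^ ?r)"
  using mix_cov[OF prod_list_Fld prod_list_Fld le, of \<phi> ys \<phi> zs] bd by simp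
 have 2: "\<bar>?m (ys @ zs) - ?m ys * ?m zs\<bar> \<le> 2 * \<rho>"
 proof -
  have "\<bar>?m ys * ?m zs\<bar> \<le> \<rho> * 1"
   unfolding abs_mult using mle[OF ne(1)] mle1[of zs] \<rho>0 by (intro mult_mono) auto
  thus ?thesis using mle[of "ys @ zs"] ne by simp
 qed
 let ?x = "\<bar>?m (ys @ zs) - ?m ys * ?m zs\<bar>"
 have "?x = ?x powr \<epsilon> * ?x powr (1 - \<epsilon>)"
  by (simp add: powr_add[symmetric])
 also have "... \<le> (4 * (A0 * a ^ ?r)) powr \<epsilon> * (2 * \<rho>) powr (1 - \<epsilon>)"
  using 1 2 \<epsilon> by (intro mult_mono powr_mono2) auto
 also have "(4 * (A0 * a ^ ?r)) powr \<epsilon> = (4 * A0) powr \<epsilon> * (a ^ ?r) powr \<epsilon>"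
  using A0(1) a01 by (simp add: powr_mult[symmetric] mult.assoc)
 also have "(a ^ ?r) powr \<epsilon> = (a powr \<epsilon>) ^ ?r"
  using a01 by (simp add: powr_realpow[symmetric] powr_powr mult.commute)
 also have "(2 * \<rho>) powr (1 - \<epsilon>) = 2 powr (1 - \<epsilon>) * \<rho> powr (1 - \<epsilon>)"
  using \<rho>0 by (simp add: powr_mult)
 finally show "?x \<le> (4 * A0) powr \<epsilon> * 2 powr (1 - \<epsilon>) * \<rho> powr (1 - \<epsilon>) * (a powr \<epsilon>) ^ ?r"
  by (simp add: mult_ac)
qed

text \<open>The point is uniformity: K depends on neither \<phi>, \<rho> nor n, so one constant
  serves all increments at all dyadic levels.\<close>

lemma moment_X:
 fixes q :: nat
 assumes \<epsilon>: "0 < \<epsilon>" "\<epsilon> < 1"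
 shows "\<exists>K\<ge>0. \<forall>(\<phi> :: real ^ 'd => real) \<rho> n. \<phi> \<in> borel_measurable borel --> (\<forall>x. \<bar>\<phi> x\<bar> \<le> 1) -->
  expectation (\<lambda>s. \<phi> (X 0 s)) = 0 --> expectation (\<lambda>s. \<bar>\<phi> (X 0 s)\<bar>) \<le> \<rho> -->
  expectation (\<lambda>s. (\<Sum>i\<in>{1..int n}. \<phi> (X i s)) ^ q) \<le> K * max 1 (real n * \<rho> powr (1 - \<epsilon>)) ^ (q div 2)"
proof -
 have c: "0 < a powr \<epsilon>" "a powr \<epsilon> < 1"
  using a01 \<epsilon> powr_less_mono2[of \<epsilon> a 1] by auto
 obtain K where K: "K \<ge> 0" "\<And>(\<zeta> :: int => 'a => real) D n.
  (\<forall>i. \<zeta> i \<in> borel_measurable M) ==> (\<forall>i. \<forall>x\<in>space M. \<bar>\<zeta> i x\<bar> \<le> 1) ==> prob_space M ==>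
  geometric_moments (\<lambda>xs. expectation (\<lambda>x. prod_list (map (\<lambda>i. \<zeta> i x) xs))) D (a powr \<epsilon>) ==>
  expectation (\<lambda>x. (\<Sum>i\<in>{1..int n}. \<zeta> i x) ^ q) \<le> K * max 1 (real n * D) ^ (q div 2)"
  using moment_inequality[OF c, of M q] by blast
 define B where "B = max 1 ((4 * A0) powr \<epsilon> * 2 powr (1 - \<epsilon>))"
 show ?thesis
 proof (intro exI[of _ "K * B ^ (q div 2)"] conjI allI impI)
  show "0 \<le> K * B ^ (q div 2)" using K(1) by (simp add: B_def)
  fix \<phi> :: "real ^ 'd => real" and \<rho> n
  assume m [measurable]: "\<phi> \<in> borel_measurable borel" and b: "\<forall>x. \<bar>\<phi> x\<bar> \<le> 1"
   and E0: "expectation (\<lambda>s. \<phi> (X 0 s)) = 0" and \<rho>: "expectation (\<lambda>s. \<bar>\<phi> (X 0 s)\<bar>) \<le> \<rho>"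
  let ?D = "(4 * A0) powr \<epsilon> * 2 powr (1 - \<epsilon>) * \<rho> powr (1 - \<epsilon>)"
  have "expectation (\<lambda>s. (\<Sum>i\<in>{1..int n}. \<phi> (X i s)) ^ q) \<le> K * max 1 (real n * ?D) ^ (q div 2)"
   by (rule K(2)[OF _ _ prob_space_axioms geometric_moments_X[OF m _ E0 \<rho> \<epsilon>]]) (use b in auto)
  also have "... \<le> K * (B * max 1 (real n * \<rho> powr (1 - \<epsilon>))) ^ (q div 2)"
  proof (intro mult_left_mono power_mono max.boundedI)
   have "1 * 1 \<le> B * max 1 (real n * \<rho> powr (1 - \<epsilon>))" by (intro mult_mono) (auto simp: B_def)
   thus "1 \<le> B * max 1 (real n * \<rho> powr (1 - \<epsilon>))" by simp
   have "real n * ?D = (4 * A0) powr \<epsilon> * 2 powr (1 - \<epsilon>) * (real n * \<rho> powr (1 - \<epsilon>))" by simp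
   also have "... \<le> B * max 1 (real n * \<rho> powr (1 - \<epsilon>))" by (intro mult_mono) (auto simp: B_def)
   finally show "real n * ?D \<le> B * max 1 (real n * \<rho> powr (1 - \<epsilon>))" .
  qed (use K(1) in auto)
  finally show "expectation (\<lambda>s. (\<Sum>i\<in>{1..int n}. \<phi> (X i s)) ^ q)
    \<le> K * B ^ (q div 2) * max 1 (real n * \<rho> powr (1 - \<epsilon>)) ^ (q div 2)"
   by (simp add: power_mult_distrib)
 qed
qed

end

section \<open>Chaining over dyadic grids\<close>

definition fl :: "nat => real ^ 'd => real ^ 'd" where
 "fl k u = (\<chi> j. of_int \<lfloor>2 ^ k * u $ j\<rfloor> / 2 ^ k)"

definition cl :: "nat => real ^ 'd => real ^ 'd" where
 "cl k u = (\<chi> j. of_int \<lceil>2 ^ k * u $ j\<rceil> / 2 ^ k)"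

definition grid :: "nat => (real ^ 'd) set" where
 "grid k = (\<lambda>f. \<chi> j. real (f j) / 2 ^ k) ` (UNIV \<rightarrow>\<^sub>E {..2 ^ k})"

text \<open>One relation for the three links of chaining: floors of two close points, floors of one
  point at consecutive levels, and floor and ceiling of one point.\<close>

definition adj :: "nat => ((real ^ 'd) \<times> (real ^ 'd)) set" where
 "adj k = {(s, t) \<in> grid k \<times> grid k. \<forall>j. \<bar>s $ j - t $ j\<bar> \<le> 1 / 2 ^ k}"

lemma cube_iff: "u \<in> unit_cube \<longleftrightarrow> (\<forall>j. 0 \<le> u $ j \<and> u $ j \<le> 1)"
 by (auto simp: less_eq_vec_def)

lemma cube_ge0: "u \<in> unit_cube ==> 0 \<le> u $ j"
 and cube_le1: "u \<in> unit_cube ==> u $ j \<le> 1"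
 unfolding cube_iff by auto

lemma cubeI: "(\<And>j. 0 \<le> u $ j) ==> (\<And>j. u $ j \<le> 1) ==> u \<in> unit_cube"
 unfolding cube_iff by auto

lemma finite_grid [simp]: "finite (grid k)"
 unfolding grid_def by (intro finite_imageI finite_PiE) auto

lemma card_grid: "card (grid k :: (real ^ 'd) set) \<le> (2 ^ k + 1) ^ CARD('d)"
proof -
 have "card (grid k :: (real ^ 'd) set) \<le> card ((UNIV :: 'd set) \<rightarrow>\<^sub>E {..(2::nat) ^ k})"
  unfolding grid_def by (intro card_image_le finite_PiE) auto
 thus ?thesis by (simp add: card_PiE)
qed

lemma grid_iff: "t \<in> grid k \<longleftrightarrow> t \<in> unit_cube \<and> (\<forall>j. \<exists>i::int. t $ j = of_int i / 2 ^ k)"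
proof
 assume "t \<in> grid k"
 then obtain f where f: "f \<in> UNIV \<rightarrow>\<^sub>E {..2 ^ k}" "t = (\<chi> j. real (f j) / 2 ^ k)"
  by (auto simp: grid_def)
 have "real (f j) \<le> 2 ^ k" for j
  using f(1) by (metis PiE_mem UNIV_I atMost_iff of_nat_le_iff of_nat_numeral of_nat_power)
 hence "t \<in> unit_cube" by (intro cubeI) (auto simp: f(2))
 moreover have "t $ j = of_int (int (f j)) / 2 ^ k" for j by (simp add: f(2))
 ultimately show "t \<in> unit_cube \<and> (\<forall>j. \<exists>i::int. t $ j = of_int i / 2 ^ k)" by blast
next
 assume *: "t \<in> unit_cube \<and> (\<forall>j. \<exists>i::int. t $ j = of_int i / 2 ^ k)"
 hence "\<forall>j. \<exists>i::int. t $ j = of_int i / 2 ^ k" by blast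
 from choice[OF this] obtain i :: "'a => int" where i: "\<And>j. t $ j = of_int (i j) / 2 ^ k" by blast
 have b: "0 \<le> i j" "i j \<le> 2 ^ k" for j
 proof -
  have "real_of_int (i j) = t $ j * 2 ^ k" using i[of j] by simp
  moreover have "0 \<le> t $ j * 2 ^ k" "t $ j * 2 ^ k \<le> 1 * 2 ^ k"
   using * cube_ge0[of t j] cube_le1[of t j] by (auto intro: mult_right_mono)
  ultimately have "0 \<le> real_of_int (i j)" and 1: "real_of_int (i j) \<le> real_of_int (2 ^ k)" by auto
  thus "0 \<le> i j" by simp
  show "i j \<le> 2 ^ k" using 1 by (rule of_int_le_iff[THEN iffD1])
 qed
 have "(\<lambda>j. nat (i j)) \<in> UNIV \<rightarrow>\<^sub>E {..2 ^ k}"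
 proof (intro PiE_I)
  fix j show "nat (i j) \<in> {..2 ^ k}"
   using b[of j] by (auto simp: nat_le_iff)
 qed auto
 moreover have "t = (\<chi> j. real (nat (i j)) / 2 ^ k)"
  using i b by (auto simp: vec_eq_iff)
 ultimately show "t \<in> grid k" unfolding grid_def by (intro image_eqI[where x="\<lambda>j. nat (i j)"])
qed

lemma grid_Suc: "grid k \<subseteq> grid (Suc k)"
proof
 fix t :: "real ^ 'd" assume t: "t \<in> grid k"
 have "\<exists>i::int. t $ j = of_int i / 2 ^ Suc k" for j
 proof -
  obtain i :: int where "t $ j = of_int i / 2 ^ k" using t by (auto simp: grid_iff)
  thus ?thesis by (intro exI[of _ "2 * i"]) simp
 qed
 thus "t \<in> grid (Suc k)" using t by (simp add: grid_iff)
qed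

lemma grid_subset_cube: "grid k \<subseteq> unit_cube"
 by (auto simp: grid_iff)

lemma fl_grid: "u \<in> unit_cube ==> fl k u \<in> grid k"
 unfolding grid_iff
proof (intro conjI allI)
 assume u: "u \<in> unit_cube"
 have "\<lfloor>2 ^ k * u $ j\<rfloor> \<ge> 0" "\<lfloor>2 ^ k * u $ j\<rfloor> \<le> 2 ^ k" for j
 proof -
  have "2 ^ k * u $ j \<le> 2 ^ k * 1" using cube_le1[OF u] by (intro mult_left_mono) auto
  thus "\<lfloor>2 ^ k * u $ j\<rfloor> \<le> 2 ^ k" unfolding floor_le_iff of_int_power of_int_numeral by linarith
  show "\<lfloor>2 ^ k * u $ j\<rfloor> \<ge> 0" using cube_ge0[OF u] by simp
 qed
 hence "0 \<le> real_of_int \<lfloor>2 ^ k * u $ j\<rfloor>" "real_of_int \<lfloor>2 ^ k * u $ j\<rfloor> \<le> real_of_int (2 ^ k)" for j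
  by (auto simp only: of_int_le_iff of_int_0_le_iff)
 thus "fl k u \<in> unit_cube" by (intro cubeI) (simp_all add: fl_def)
 show "\<exists>i::int. fl k u $ j = of_int i / 2 ^ k" for j by (auto simp: fl_def)
qed

lemma cl_grid: "u \<in> unit_cube ==> cl k u \<in> grid k"
 unfolding grid_iff
proof (intro conjI allI)
 assume u: "u \<in> unit_cube"
 have "\<lceil>2 ^ k * u $ j\<rceil> \<ge> 0" "\<lceil>2 ^ k * u $ j\<rceil> \<le> 2 ^ k" for j
 proof -
  have "2 ^ k * u $ j \<le> 2 ^ k * 1" using cube_le1[OF u] by (intro mult_left_mono) auto
  thus "\<lceil>2 ^ k * u $ j\<rceil> \<le> 2 ^ k" unfolding ceiling_le_iff of_int_power of_int_numeral by linarith
  have "0 \<le> 2 ^ k * u $ j" using cube_ge0[OF u] by simp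
  thus "\<lceil>2 ^ k * u $ j\<rceil> \<ge> 0" by linarith
 qed
 hence "0 \<le> real_of_int \<lceil>2 ^ k * u $ j\<rceil>" "real_of_int \<lceil>2 ^ k * u $ j\<rceil> \<le> real_of_int (2 ^ k)" for j
  by (auto simp only: of_int_le_iff of_int_0_le_iff)
 thus "cl k u \<in> unit_cube" by (intro cubeI) (simp_all add: cl_def)
 show "\<exists>i::int. cl k u $ j = of_int i / 2 ^ k" for j by (auto simp: cl_def)
qed

lemma fl_le: "fl k u \<le> u" and cl_ge: "u \<le> cl k u"
 by (auto simp: less_eq_vec_def fl_def cl_def divide_le_eq le_divide_eq mult.commute)

lemma fl_dist: "\<bar>u $ j - fl k u $ j\<bar> \<le> 1 / 2 ^ k"
proof -
 have "u $ j - fl k u $ j = (2 ^ k * u $ j - of_int \<lfloor>2 ^ k * u $ j\<rfloor>) / 2 ^ k"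
  by (simp add: fl_def field_simps)
 moreover have "\<bar>2 ^ k * u $ j - of_int \<lfloor>2 ^ k * u $ j\<rfloor>\<bar> \<le> 1" by linarith
 ultimately show ?thesis by (simp add: divide_right_mono)
qed

lemma fl_cl_adj: "u \<in> unit_cube ==> (fl k u, cl k u) \<in> adj k"
proof -
 have "\<bar>real_of_int \<lfloor>x\<rfloor> - of_int \<lceil>x\<rceil>\<bar> \<le> 1" for x :: real
  using ceiling_diff_floor_le_1[of x] floor_le_ceiling[of x] by linarith
 thus "u \<in> unit_cube ==> (fl k u, cl k u) \<in> adj k"
  by (auto simp: adj_def fl_grid cl_grid) (simp add: fl_def cl_def diff_divide_distrib[symmetric] divide_right_mono)
qed

lemma fl_adj:
 assumes "u \<in> unit_cube" "v \<in> unit_cube" "\<And>j. \<bar>u $ j - v $ j\<bar> \<le> 1 / 2 ^ k"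
 shows "(fl k u, fl k v) \<in> adj k"
proof -
 have "\<bar>fl k u $ j - fl k v $ j\<bar> \<le> 1 / 2 ^ k" for j
 proof -
  have "\<bar>2 ^ k * u $ j - 2 ^ k * v $ j\<bar> = 2 ^ k * \<bar>u $ j - v $ j\<bar>"
   by (simp add: right_diff_distrib[symmetric] abs_mult)
  also have "... \<le> 2 ^ k * (1 / 2 ^ k)" by (intro mult_left_mono assms(3)) auto
  finally have "\<bar>2 ^ k * u $ j - 2 ^ k * v $ j\<bar> \<le> 1" by simp
  hence "\<bar>\<lfloor>2 ^ k * u $ j\<rfloor> - \<lfloor>2 ^ k * v $ j\<rfloor>\<bar> \<le> 1" by linarith
  hence "\<bar>real_of_int \<lfloor>2 ^ k * u $ j\<rfloor> - of_int \<lfloor>2 ^ k * v $ j\<rfloor>\<bar> \<le> 1" by linarith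
  thus ?thesis by (simp add: fl_def diff_divide_distrib[symmetric] divide_right_mono)
 qed
 thus ?thesis using assms by (auto simp: adj_def fl_grid)
qed

lemma fl_Suc_adj:
 assumes "u \<in> unit_cube"
 shows "(fl k u, fl (Suc k) u) \<in> adj (Suc k)"
proof -
 have "\<bar>fl k u $ j - fl (Suc k) u $ j\<bar> \<le> 1 / 2 ^ Suc k" for j
 proof -
  let ?x = "2 ^ k * u $ j"
  have "\<bar>2 * \<lfloor>?x\<rfloor> - \<lfloor>2 * ?x\<rfloor>\<bar> \<le> 1" by linarith
  hence "\<bar>real_of_int (2 * \<lfloor>?x\<rfloor>) - of_int \<lfloor>2 * ?x\<rfloor>\<bar> \<le> 1" by linarith
  moreover have "fl k u $ j - fl (Suc k) u $ j = (real_of_int (2 * \<lfloor>?x\<rfloor>) - of_int \<lfloor>2 * ?x\<rfloor>) / 2 ^ Suc k"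
   by (simp add: fl_def field_simps)
  ultimately show ?thesis by (simp add: divide_right_mono del: of_int_mult power_Suc)
 qed
 thus ?thesis using assms by (auto simp: adj_def fl_grid subsetD[OF grid_Suc])
qed

lemma finite_adj [simp]: "finite (adj k)"
 by (rule finite_subset[of _ "grid k \<times> grid k"]) (auto simp: adj_def)

text \<open>A count of all pairs of grid points is good enough, because the order of the moments can
  be raised to beat any fixed exponential in k.\<close>

lemma card_adj: "real (card (adj k :: ((real ^ 'd) \<times> (real ^ 'd)) set)) \<le> 4 ^ CARD('d) * (4 ^ CARD('d)) ^ k"
proof -
 have "card (adj k :: ((real ^ 'd) \<times> (real ^ 'd)) set) \<le> card (grid k \<times> grid k :: ((real ^ 'd) \<times> (real ^ 'd)) set)"
  by (rule card_mono) (auto simp: adj_def)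
 also have "... \<le> (2 ^ k + 1) ^ CARD('d) * (2 ^ k + 1) ^ CARD('d)"
  unfolding card_cartesian_product by (intro mult_mono card_grid) auto
 also have "... \<le> (2 * 2 ^ k) ^ CARD('d) * (2 * 2 ^ k) ^ CARD('d)"
  by (intro mult_mono power_mono) auto
 also have "... = 4 ^ CARD('d) * (4 ^ CARD('d)) ^ k"
 proof -
  have "(2 * 2 ^ k) * (2 * 2 ^ k) = (4 * (2 * 2) ^ k :: nat)" unfolding power_mult_distrib by simp
  hence "(2 * 2 ^ k) ^ CARD('d) * (2 * 2 ^ k) ^ CARD('d) = (4 * 4 ^ k :: nat) ^ CARD('d)"
   unfolding power_mult_distrib[symmetric] by simp
  also have "... = 4 ^ CARD('d) * (4 ^ k) ^ CARD('d)" by (rule power_mult_distrib)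
  also have "((4::nat) ^ k) ^ CARD('d) = (4 ^ CARD('d)) ^ k"
   unfolding power_mult[symmetric] by (simp only: mult.commute)
  finally show ?thesis .
 qed
 finally have "real (card (adj k :: ((real ^ 'd) \<times> (real ^ 'd)) set)) \<le> real (4 ^ CARD('d) * (4 ^ CARD('d)) ^ k)"
  by (rule of_nat_mono)
 thus ?thesis by (simp only: of_nat_mult of_nat_power of_nat_numeral)
qed

lemma chain_levels:
 fixes f :: "real ^ 'd => real"
 assumes H: "\<And>k (s :: real ^ 'd) t. k \<le> K ==> (s, t) \<in> adj k ==> \<bar>f s - f t\<bar> \<le> L * r ^ k"
  and r: "0 < r" "r < 1" and L: "L \<ge> 0" and u: "u \<in> unit_cube" and kl: "k \<le> l" "l \<le> K"
 shows "\<bar>f (fl k u) - f (fl l u)\<bar> \<le> L * r ^ k / (1 - r)"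
proof -
 \<comment> \<open>The sharper bound with r^k - r^l in place of r^k lets the induction on l
   close.\<close>
 have "\<bar>f (fl k u) - f (fl l u)\<bar> \<le> L * (r ^ k - r ^ l) / (1 - r)"
  using kl
 proof (induction l rule: dec_induct)
  case (step l)
  have "\<bar>f (fl l u) - f (fl (Suc l) u)\<bar> \<le> L * r ^ Suc l"
   using step.prems by (intro H fl_Suc_adj u) auto
  also have "... \<le> L * r ^ l" using r L by (intro mult_left_mono power_decreasing) auto
  also have "... = L * (r ^ l - r ^ Suc l) / (1 - r)" using r by (simp add: field_simps)
  finally have "\<bar>f (fl k u) - f (fl (Suc l) u)\<bar> \<le> L * (r ^ k - r ^ l) / (1 - r) + L * (r ^ l - r ^ Suc l) / (1 - r)"
   using step by linarith
  thus ?case by (simp add: add_divide_distrib[symmetric] right_diff_distrib)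
 qed simp
 also have "... \<le> L * r ^ k / (1 - r)" using r L by (intro divide_right_mono mult_left_mono) auto
 finally show ?thesis .
qed

lemma chain_close:
 fixes f :: "real ^ 'd => real"
 assumes H: "\<And>k (s :: real ^ 'd) t. k \<le> K ==> (s, t) \<in> adj k ==> \<bar>f s - f t\<bar> \<le> L * r ^ k"
  and r: "0 < r" "r < 1" and L: "L \<ge> 0" and u: "u \<in> unit_cube" "v \<in> unit_cube"
  and k: "k \<le> K" and uv: "\<And>j. \<bar>u $ j - v $ j\<bar> \<le> 1 / 2 ^ k"
 shows "\<bar>f (fl K u) - f (fl K v)\<bar> \<le> L * r ^ k * (1 + 2 / (1 - r))"
proof -
 have "\<bar>f (fl k u) - f (fl K u)\<bar> \<le> L * r ^ k / (1 - r)"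
  by (rule chain_levels[OF H]) (use assms in auto)
 moreover have "\<bar>f (fl k v) - f (fl K v)\<bar> \<le> L * r ^ k / (1 - r)"
  by (rule chain_levels[OF H]) (use assms in auto)
 moreover have "\<bar>f (fl k u) - f (fl k v)\<bar> \<le> L * r ^ k"
  by (intro H k fl_adj u uv)
 ultimately have "\<bar>f (fl K u) - f (fl K v)\<bar> \<le> L * r ^ k + L * r ^ k / (1 - r) + L * r ^ k / (1 - r)"
  by linarith
 also have "... = L * r ^ k * (1 + 2 / (1 - r))" by (simp add: distrib_left mult_ac)
 finally show ?thesis .
qed

lemma ex_dyadic_scale:
 fixes \<delta> :: real
 assumes "0 < \<delta>" "\<delta> \<le> 1"
 shows "\<exists>k. \<delta> \<le> 1 / 2 ^ k \<and> 1 / 2 ^ k < 2 * \<delta>"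
proof -
 have ex: "\<exists>k. 1 / 2 ^ k < 2 * \<delta>"
  using real_arch_pow_inv[of "2 * \<delta>" "1/2"] assms by (auto simp: power_divide)
 define k where "k = (LEAST k. 1 / 2 ^ k < 2 * \<delta>)"
 have 1: "1 / 2 ^ k < 2 * \<delta>" unfolding k_def using ex by (rule LeastI_ex)
 have 2: "\<delta> \<le> 1 / 2 ^ k"
 proof (cases k)
  case (Suc l)
  hence "\<not> (1 / 2 ^ l < 2 * \<delta>)" using not_less_Least[of l "\<lambda>k. 1 / 2 ^ k < 2 * \<delta>"] by (simp add: k_def)
  thus ?thesis using Suc by (simp add: field_simps)
 qed (use assms in simp)
 show ?thesis using 1 2 by blast
qed

text \<open>Markov's inequality is applied once, to the sum of all normalised 2p-th powers over all
  levels and adjacent pairs. The expectation of this sum is bounded by a geometric series with ratio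
  4^d w / r^(2p) < 1, so L depends neither on the process nor on the number of levels.\<close>

lemma (in prob_space) ex_chaining_event:
 assumes p: "p \<ge> 1" and r: "0 < r" and w: "0 \<le> w" "4 ^ CARD('d) * w < r ^ (2 * p)" and \<eta>: "\<eta> > 0" and c: "c \<ge> 0"
 shows "\<exists>L\<ge>0. \<forall>(Z :: real ^ 'd => 'a => real) K. (\<forall>t. Z t \<in> borel_measurable M) -->
  (\<forall>s t. integrable M (\<lambda>x. (Z s x - Z t x) ^ (2 * p))) -->
  (\<forall>k\<le>K. \<forall>(s, t)\<in>adj k. expectation (\<lambda>x. (Z s x - Z t x) ^ (2 * p)) \<le> c * w ^ k) -->
  (\<exists>E\<in>sets M. prob E \<ge> 1 - \<eta> \<and> (\<forall>x\<in>E. \<forall>k\<le>K. \<forall>(s, t)\<in>adj k. \<bar>Z s x - Z t x\<bar> \<le> L * r ^ k))"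
proof -
 define b where "b = 4 ^ CARD('d) * w / r ^ (2 * p)"
 have b: "0 \<le> b" "b < 1" using w r by (auto simp: b_def divide_less_eq)
 define T where "T = c * 4 ^ CARD('d) / (1 - b)"
 \<comment> \<open>Chosen such that the Markov bound T / L^(2p) is at most \<eta>; the summand 1
   keeps L positive when T = 0.\<close>
 define L where "L = root (2 * p) ((T + 1) / \<eta>)"
 have T0: "T \<ge> 0" using b c by (simp add: T_def)
 have L0: "L \<ge> 0" unfolding L_def using T0 \<eta> p by (intro real_root_ge_zero) auto
 have Lp: "L ^ (2 * p) = (T + 1) / \<eta>" unfolding L_def using T0 \<eta> p by (intro real_root_pow_pos2) auto
 have Lp0: "L ^ (2 * p) > 0" using T0 \<eta> by (simp add: Lp)
 show ?thesis
 proof (intro exI[of _ L] conjI L0 allI impI)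
  fix Z :: "real ^ 'd => 'a => real" and K
  assume Z [rule_format, measurable]: "\<forall>t. Z t \<in> borel_measurable M" and int: "\<forall>s t. integrable M (\<lambda>x. (Z s x - Z t x) ^ (2 * p))"
   and mom: "\<forall>k\<le>K. \<forall>(s, t)\<in>adj k. expectation (\<lambda>x. (Z s x - Z t x) ^ (2 * p)) \<le> c * w ^ k"
  define I where "I = Sigma {..K} (\<lambda>k. adj k :: ((real ^ 'd) \<times> (real ^ 'd)) set)"
  have fI: "finite I" by (simp add: I_def)
  define q where "q i x = ((Z (fst (snd i)) x - Z (snd (snd i)) x) / r ^ fst i) ^ (2 * p)" for i x
  have q0: "0 \<le> q i x" for i x unfolding q_def by (rule zero_le_even_power) simp
  have iq: "integrable M (q i)" for i unfolding q_def[abs_def] power_divide using int by auto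
  define S where "S x = (\<Sum>i\<in>I. q i x)" for x
  have Sm [measurable]: "S \<in> borel_measurable M" unfolding S_def[abs_def] q_def by measurable
  have "expectation S = (\<Sum>i\<in>I. expectation (q i))" unfolding S_def[abs_def] by (rule Bochner_Integration.integral_sum[OF iq])
  also have "... \<le> (\<Sum>(k, st)\<in>I. c * w ^ k / (r ^ k) ^ (2 * p))"
   using r mom by (intro sum_mono) (auto simp: I_def q_def[abs_def] power_divide intro!: divide_right_mono dest!: spec bspec)
  also have "... = (\<Sum>k\<le>K. card (adj k :: ((real ^ 'd) \<times> (real ^ 'd)) set) * (c * w ^ k / (r ^ k) ^ (2 * p)))"
   unfolding I_def by (subst sum.Sigma[symmetric]) simp_all
  also have "... \<le> (\<Sum>k\<le>K. (4 ^ CARD('d) * (4 ^ CARD('d)) ^ k) * (c * w ^ k / (r ^ k) ^ (2 * p)))"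
   using r c w by (intro sum_mono mult_right_mono card_adj) auto
  also have "... = (\<Sum>k\<le>K. c * 4 ^ CARD('d) * b ^ k)"
   by (intro sum.cong refl) (simp add: b_def power_divide power_mult_distrib power_mult[symmetric] mult_ac)
  also have "... = c * 4 ^ CARD('d) * ((1 - b ^ Suc K) / (1 - b))" using b by (simp add: sum_distrib_left[symmetric] sum_gp0)
  also have "... \<le> c * 4 ^ CARD('d) * (1 / (1 - b))" using b c by (intro mult_left_mono divide_right_mono) auto
  finally have ES: "expectation S \<le> T" by (simp add: T_def)
  have "prob {x \<in> space M. S x \<ge> L ^ (2 * p)} \<le> expectation S / L ^ (2 * p)"
   unfolding S_def[abs_def] using Lp0 q0 by (intro integral_Markov_inequality_measure[where A="space M"] Bochner_Integration.integrable_sum iq) (auto intro!: sum_nonneg)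
  also have "... \<le> \<eta>" using ES T0 \<eta> Lp0 by (simp add: divide_le_eq) (simp add: Lp)
  finally have 1: "prob {x \<in> space M. S x \<ge> L ^ (2 * p)} \<le> \<eta>" .
  show "\<exists>E\<in>sets M. prob E \<ge> 1 - \<eta> \<and> (\<forall>x\<in>E. \<forall>k\<le>K. \<forall>(s, t)\<in>adj k. \<bar>Z s x - Z t x\<bar> \<le> L * r ^ k)"
  proof (intro bexI[of _ "space M - {x \<in> space M. S x \<ge> L ^ (2 * p)}"] conjI ballI allI impI)
   show "1 - \<eta> \<le> prob (space M - {x \<in> space M. S x \<ge> L ^ (2 * p)})" using 1 by (subst prob_compl) auto
   fix x k and st :: "(real ^ 'd) \<times> (real ^ 'd)" assume x: "x \<in> space M - {x \<in> space M. S x \<ge> L ^ (2 * p)}" and k: "k \<le> K" and st: "st \<in> adj k"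
   obtain s t where [simp]: "st = (s, t)" by (cases st)
   have "q (k, st) x \<le> S x" unfolding S_def using fI q0 k st by (intro member_le_sum) (auto simp: I_def)
   hence "\<bar>(Z s x - Z t x) / r ^ k\<bar> ^ (2 * p) \<le> L ^ (2 * p)" using x by (subst power_even_abs) (auto simp: q_def)
   hence "\<bar>(Z s x - Z t x) / r ^ k\<bar> \<le> L" using L0 p by (subst (asm) power_mono_iff) auto
   thus "case st of (s, t) => \<bar>Z s x - Z t x\<bar> \<le> L * r ^ k" using r by (simp add: abs_divide divide_le_eq)
  qed measurable
 qed
qed

section \<open>The copula and the modulus of continuity of the empirical process\<close>

text \<open>The sublevel set of the c.d.f. is everything, empty, or by monotonicity and continuity
  the half-line up to its supremum, where the c.d.f. takes the value u by the intermediate value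
  theorem. Flat stretches are thus covered.\<close>

lemma (in real_distribution) uniform_transform:
 assumes cont: "continuous_on UNIV (cdf M)" and u: "0 \<le> u" "u \<le> 1"
 shows "prob {x. cdf M x \<le> u} = u"
proof -
 define S where "S = {x. cdf M x \<le> u}"
 have "prob S = u"
 proof (cases "u = 1")
  case True
  hence "S = space M" using cdf_bounded_prob by (auto simp: S_def)
  thus ?thesis using True prob_space by simp
 next
  case False
  hence "eventually (\<lambda>x. cdf M x > u) at_top" using order_tendstoD[OF cdf_lim_at_top_prob] u by auto
  then obtain x1 where x1: "\<And>x. x \<ge> x1 ==> cdf M x > u" by (auto simp: eventually_at_top_linorder)
  show ?thesis
  proof (cases "S = {}")
   case True
   hence "u < cdf M x" for x by (auto simp: S_def not_le)
   hence "u \<le> 0" by (intro tendsto_lowerbound[OF cdf_lim_at_bot] always_eventually allI less_imp_le) auto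
   thus ?thesis using True u by simp
  next
   case False
   have bdd: "bdd_above S" using x1 by (auto simp: S_def intro!: bdd_aboveI[of _ x1]) (meson linorder_not_le order_less_imp_le)
   have "closed S" unfolding S_def using cont by (intro closed_Collect_le) auto
   hence sup: "cdf M (Sup S) \<le> u" using closed_contains_Sup[OF False bdd] by (simp add: S_def)
   have "z \<in> S \<longleftrightarrow> z \<le> Sup S" for z
    using cSup_upper[OF _ bdd, of z] order.trans[OF cdf_nondecreasing[of z "Sup S"] sup] by (auto simp: S_def)
   hence "S = {..Sup S}" by auto
   hence "prob S = cdf M (Sup S)" by (simp add: cdf_def)
   moreover have "u \<le> cdf M (max x1 (Sup S))" using x1[of "max x1 (Sup S)"] by simp
   then obtain z where "Sup S \<le> z" "cdf M z = u"
    using IVT[of "cdf M" "Sup S" u "max x1 (Sup S)"] sup cont by (auto simp: continuous_on_eq_continuous_at)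
   hence "cdf M (Sup S) = u" using cSup_upper[OF _ bdd, of z] by (simp add: S_def)
   ultimately show ?thesis by simp
  qed
 qed
 thus ?thesis by (simp add: S_def)
qed

lemma borel_measurable_vec_nth' [measurable (raw)]:
 fixes f :: "'a => real ^ 'd"
 assumes "f \<in> borel_measurable N"
 shows "(\<lambda>x. f x $ j) \<in> borel_measurable N"
proof -
 have "(\<lambda>x :: real ^ 'd. x $ j) \<in> borel_measurable borel"
  by (intro borel_measurable_continuous_onI continuous_intros)
 from measurable_compose[OF assms this] show ?thesis .
qed

lemma powr_dyadic: "((c * (1 / 2 ^ l)) powr x) ^ p = (c powr x) ^ p * (((1/2) powr x) ^ p) ^ l" if "c \<ge> 0" for c :: real
proof -
 have "((1/2)^l) powr x = ((1/2) powr x) ^ l"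
  by (simp add: powr_realpow[symmetric] powr_powr mult.commute)
 hence "(1 / 2 ^ l) powr x = ((1/2) powr x) ^ l" by (simp add: power_divide)
 thus ?thesis using that unfolding powr_mult power_mult_distrib by (simp add: power_mult[symmetric] mult.commute)
qed

text \<open>For this \<epsilon> one has 1 - \<epsilon> = 2 \<theta> + \<epsilon>. The quotient of
  the two p-th powers is therefore (1/2)^(\<epsilon> p), which falls below 1 / 4^d for large
  p.\<close>

lemma chaining_parameters:
 fixes \<theta> :: real and d :: nat
 assumes \<theta>: "0 < \<theta>" "\<theta> < 1/2"
 shows "\<exists>\<epsilon> p. 0 < \<epsilon> \<and> \<epsilon> < 1 \<and> p \<ge> 1 \<and> 4 ^ d * ((1/2) powr (1 - \<epsilon>)) ^ p < ((1/2) powr \<theta>) ^ (2 * p)"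
proof -
 define \<epsilon> where "\<epsilon> = (1 - 2 * \<theta>) / 2"
 have \<epsilon>: "0 < \<epsilon>" "\<epsilon> < 1" using \<theta> by (auto simp: \<epsilon>_def)
 let ?x = "(1/2) powr \<epsilon> :: real" and ?y = "(1/2) powr \<theta> :: real"
 have x: "0 < ?x" "?x < 1" using \<epsilon> powr_less_mono2[of \<epsilon> "1/2" 1] by auto
 obtain p where p: "?x ^ p < 1 / 4 ^ d" using real_arch_pow_inv[of "1 / 4 ^ d" ?x] x by auto
 have "?x ^ Suc p \<le> ?x ^ p" using x by (intro power_decreasing) auto
 hence "?x ^ Suc p < 1 / 4 ^ d" using p by (rule order.strict_trans1)
 hence "4 ^ d * ?x ^ Suc p < 1" by (simp add: less_divide_eq mult.commute)
 hence "4 ^ d * ?x ^ Suc p * ?y ^ (2 * Suc p) < 1 * ?y ^ (2 * Suc p)" by (rule mult_strict_right_mono) simp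
 moreover have "(1/2) powr (1 - \<epsilon>) = ?x * ?y ^ 2" by (simp add: power2_eq_square powr_add[symmetric] \<epsilon>_def field_simps)
 hence "((1/2) powr (1 - \<epsilon>)) ^ Suc p = ?x ^ Suc p * ?y ^ (2 * Suc p)" by (simp only: power_mult_distrib power_mult)
 ultimately show ?thesis using \<epsilon> by (intro exI[of _ \<epsilon>] exI[of _ "Suc p"]) (simp only: mult.assoc, simp)
qed

context geometric_mixing
begin

text \<open>The transform as a Borel function of one observation, so that stationarity and the
  sigma-fields generated by the observations apply to it.\<close>

definition Uf :: "real ^ 'd => real ^ 'd" where
 "Uf x = (\<chi> j. marginal_cdf M X j (x $ j))"

abbreviation "Cop \<equiv> copula M X"

lemma U_eq: "U M X i s = Uf (X i s)"
 by (simp add: U_def Uf_def)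

lemma marg_meas [measurable]: "marginal_cdf M X j \<in> borel_measurable borel"
 by (rule borel_measurable_continuous_onI[OF marg_cont])

lemma Uf_comp_meas [measurable]: "(\<lambda>x. Uf x $ j) \<in> borel_measurable borel"
 unfolding Uf_def by simp

lemma Uf_le_meas [measurable]: "Measurable.pred borel (\<lambda>x. Uf x \<le> t)"
 unfolding less_eq_vec_def by measurable

lemma real_dist: "real_distribution (distr M borel (\<lambda>s. X 0 s $ j))"
 by (intro real_distribution_distr) measurable

lemma Uf_cube: "Uf x \<in> unit_cube"
proof (rule cubeI)
 fix j
 interpret D: real_distribution "distr M borel (\<lambda>s. X 0 s $ j)" by (rule real_dist)
 show "0 \<le> Uf x $ j" "Uf x $ j \<le> 1"
  using D.cdf_nonneg D.cdf_bounded_prob by (auto simp: Uf_def marginal_cdf_def)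
qed

lemma prob_U_le:
 assumes "0 \<le> u" "u \<le> 1"
 shows "prob {s \<in> space M. Uf (X i s) $ j \<le> u} = u"
proof -
 let ?D = "distr M borel (\<lambda>s. X 0 s $ j)"
 have e: "prob {s \<in> space M. Uf (X k s) $ j \<le> u} = expectation (\<lambda>s. indicator {x. Uf x $ j \<le> u} (X k s))" for k
 proof -
  have "expectation (\<lambda>s. indicator {x. Uf x $ j \<le> u} (X k s)) = expectation (indicat_real {s \<in> space M. Uf (X k s) $ j \<le> u})"
   by (intro Bochner_Integration.integral_cong refl) (auto simp: indicator_def)
  thus ?thesis by (simp add: Int_absorb2 subset_eq)
 qed
 have "prob {s \<in> space M. Uf (X i s) $ j \<le> u} = prob {s \<in> space M. Uf (X 0 s) $ j \<le> u}"
  unfolding e by (rule stationary_1) measurable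
 also have "... = measure ?D {x. cdf ?D x \<le> u}"
 proof -
  have "{x. cdf ?D x \<le> u} \<in> sets borel" using marg_meas[of j] unfolding marginal_cdf_def by measurable
  thus ?thesis by (subst measure_distr) (auto simp: Uf_def marginal_cdf_def vimage_def Int_def conj_commute)
 qed
 also have "... = u"
  by (rule real_distribution.uniform_transform[OF real_dist]) (use marg_cont[of j] assms in \<open>auto simp: marginal_cdf_def[abs_def]\<close>)
 finally show ?thesis .
qed

lemma Cop_def: "Cop u = prob {s \<in> space M. Uf (X 0 s) \<le> u}"
 by (simp add: copula_def U_eq)

lemma expectation_ind: "expectation (\<lambda>s. of_bool (Uf (X i s) \<le> u)) = Cop u"
proof -
 have "expectation (\<lambda>s. of_bool (Uf (X 0 s) \<le> u)) = expectation (indicat_real {s \<in> space M. Uf (X 0 s) \<le> u})"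
  by (intro Bochner_Integration.integral_cong refl) (auto simp: indicator_def)
 also have "... = Cop u" unfolding Cop_def by (simp add: Int_absorb2 subset_eq)
 finally show ?thesis using stationary_1[of "\<lambda>x. of_bool (Uf x \<le> u) :: real" i] by simp
qed

text \<open>The two events differ only if some coordinate falls between u_j and v_j, and every
  margin is uniform.\<close>

lemma expectation_ind_diff:
 assumes u: "u \<in> unit_cube" "v \<in> unit_cube"
 shows "expectation (\<lambda>s. \<bar>of_bool (Uf (X i s) \<le> u) - of_bool (Uf (X i s) \<le> v)\<bar>) \<le> (\<Sum>j\<in>UNIV. \<bar>u $ j - v $ j\<bar>)"
proof -
 let ?h = "\<lambda>j s. \<bar>of_bool (Uf (X i s) $ j \<le> u $ j) - of_bool (Uf (X i s) $ j \<le> v $ j)\<bar> :: real"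
 have "\<bar>of_bool (Uf (X i s) \<le> u) - of_bool (Uf (X i s) \<le> v)\<bar> \<le> (\<Sum>j\<in>UNIV. ?h j s)" for s
 proof (cases "of_bool (Uf (X i s) \<le> u) = (of_bool (Uf (X i s) \<le> v) :: real)")
  case False
  have "(Uf (X i s) \<le> u) \<noteq> (Uf (X i s) \<le> v)"
  proof
   assume "(Uf (X i s) \<le> u) = (Uf (X i s) \<le> v)"
   thus False using False by simp
  qed
  then obtain j where "(Uf (X i s) $ j \<le> u $ j) \<noteq> (Uf (X i s) $ j \<le> v $ j)"
   unfolding less_eq_vec_def by blast
  hence "1 \<le> ?h j s" by auto
  also have "... \<le> (\<Sum>j\<in>UNIV. ?h j s)" by (rule member_le_sum) auto
  finally show ?thesis by (auto simp: of_bool_def)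
 qed (auto intro!: sum_nonneg)
 hence "expectation (\<lambda>s. \<bar>of_bool (Uf (X i s) \<le> u) - of_bool (Uf (X i s) \<le> v)\<bar>) \<le> expectation (\<lambda>s. \<Sum>j\<in>UNIV. ?h j s)"
  by (intro integral_mono int_bounded[where B=1] Bochner_Integration.integrable_sum) auto
 also have "... = (\<Sum>j\<in>UNIV. expectation (?h j))"
  by (intro Bochner_Integration.integral_sum int_bounded[where B=1]) auto
 also have "... = (\<Sum>j\<in>UNIV. \<bar>u $ j - v $ j\<bar>)"
 proof (intro sum.cong refl)
  fix j
  have *: "expectation (\<lambda>s. of_bool (Uf (X i s) $ j \<le> x)) = x" if "0 \<le> x" "x \<le> 1" for x
  proof -
   have "expectation (\<lambda>s. of_bool (Uf (X i s) $ j \<le> x)) = expectation (indicat_real {s \<in> space M. Uf (X i s) $ j \<le> x})"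
    by (intro Bochner_Integration.integral_cong refl) (auto simp: indicator_def)
   thus ?thesis using prob_U_le[OF that] by (simp add: Int_absorb2 subset_eq)
  qed
  have i: "integrable M (\<lambda>s. of_bool (Uf (X i s) $ j \<le> x) :: real)" for x by (intro int_bounded[where B=1]) auto
  have **: "expectation (\<lambda>s. \<bar>of_bool (Uf (X i s) $ j \<le> x) - of_bool (Uf (X i s) $ j \<le> y)\<bar>) = y - x"
   if "0 \<le> x" "x \<le> y" "y \<le> 1" for x y
  proof -
   have "expectation (\<lambda>s. \<bar>of_bool (Uf (X i s) $ j \<le> x) - of_bool (Uf (X i s) $ j \<le> y)\<bar>)
    = expectation (\<lambda>s. of_bool (Uf (X i s) $ j \<le> y) - of_bool (Uf (X i s) $ j \<le> x) :: real)"
    by (intro Bochner_Integration.integral_cong refl) (use that in auto)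
   also have "... = y - x" using i *[of x] *[of y] that by simp
   finally show ?thesis .
  qed
  show "expectation (?h j) = \<bar>u $ j - v $ j\<bar>"
  proof (cases "u $ j \<le> v $ j")
   case True
   thus ?thesis using **[of "u $ j" "v $ j"] cube_ge0[OF u(1)] cube_le1[OF u(2)] by simp
  next
   case False
   thus ?thesis using **[of "v $ j" "u $ j"] cube_ge0[OF u(2)] cube_le1[OF u(1)] by (simp add: abs_minus_commute)
  qed
 qed
 finally show ?thesis .
qed

lemma Cop_mono: "u \<le> v ==> Cop u \<le> Cop v"
 unfolding Cop_def by (intro finite_measure_mono) auto

lemma Cop_bounds: "0 \<le> Cop u" "Cop u \<le> 1"
 unfolding Cop_def by auto

lemma Cop_lipschitz:
 assumes "u \<in> unit_cube" "v \<in> unit_cube"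
 shows "\<bar>Cop u - Cop v\<bar> \<le> (\<Sum>j\<in>UNIV. \<bar>u $ j - v $ j\<bar>)"
proof -
 have i: "integrable M (\<lambda>s. of_bool (Uf (X 0 s) \<le> x) :: real)" for x by (intro int_bounded[where B=1]) auto
 have "Cop u - Cop v = expectation (\<lambda>s. of_bool (Uf (X 0 s) \<le> u) - of_bool (Uf (X 0 s) \<le> v))"
  using i by (simp add: expectation_ind)
 also have "\<bar>...\<bar> \<le> expectation (\<lambda>s. \<bar>of_bool (Uf (X 0 s) \<le> u) - of_bool (Uf (X 0 s) \<le> v)\<bar>)"
  by (rule integral_abs_bound)
 also have "... \<le> (\<Sum>j\<in>UNIV. \<bar>u $ j - v $ j\<bar>)" by (rule expectation_ind_diff[OF assms])
 finally show ?thesis .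
qed

lemma Cop_only_coord: assumes "u \<in> unit_cube" shows "Cop (only_coord j u) = u $ j"
proof -
 have "{s \<in> space M. Uf (X 0 s) \<le> only_coord j u} = {s \<in> space M. Uf (X 0 s) $ j \<le> u $ j}"
  using cube_le1[OF Uf_cube] by (auto simp: less_eq_vec_def only_coord_def)
 thus ?thesis using prob_U_le[of "u $ j" 0 j] cube_ge0[OF assms] cube_le1[OF assms] by (simp add: Cop_def)
qed

lemma Cop_le: assumes "u \<in> unit_cube" shows "Cop u \<le> u $ j"
proof -
 have "u \<le> only_coord j u" using cube_le1[OF assms] by (auto simp: less_eq_vec_def only_coord_def)
 from Cop_mono[OF this] show ?thesis using Cop_only_coord[OF assms] by simp
qed

lemma Cop_1: "Cop 1 = 1"
proof -
 have "only_coord j 1 = (1 :: real ^ 'd)" for j by (simp add: only_coord_def vec_eq_iff)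
 thus ?thesis using Cop_only_coord[of 1 undefined] by (auto simp: less_eq_vec_def)
qed

lemma Cop_0: "u \<in> unit_cube ==> u $ j = 0 ==> Cop u = 0"
 using Cop_le[of u j] Cop_bounds(1)[of u] by simp

section \<open>Increments of the empirical process\<close>

abbreviation "\<alpha>n \<equiv> alpha_n M X"

definition phi :: "real ^ 'd => real ^ 'd => real" where
 "phi t x = of_bool (Uf x \<le> t) - Cop t"

lemma phi_meas [measurable]: "phi t \<in> borel_measurable borel"
 unfolding phi_def by measurable

lemma phi_bound: "\<bar>phi t x\<bar> \<le> 1"
 using Cop_bounds[of t] by (auto simp: phi_def of_bool_def)

lemma phi_mean: "expectation (\<lambda>s. phi t (X i s)) = 0"
proof -
 have i: "integrable M (\<lambda>s. of_bool (Uf (X i s) \<le> x) :: real)" for x by (intro int_bounded[where B=1]) auto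
 thus ?thesis unfolding phi_def by (simp add: expectation_ind prob_space)
qed

lemma alpha_eq: "n \<ge> 1 ==> \<alpha>n n s t = (\<Sum>i\<in>{1..int n}. phi t (X i s)) / sqrt n"
proof -
 assume n: "n \<ge> 1"
 have "(\<Sum>i\<in>{1..int n}. phi t (X i s)) = (\<Sum>i\<in>{1..int n}. of_bool (Uf (X i s) \<le> t)) - real n * Cop t"
  by (simp add: phi_def sum_subtractf)
 also have "... = real n * (G M X n s t - Cop t)" using n by (simp add: G_def U_eq right_diff_distrib)
 finally have "(\<Sum>i\<in>{1..int n}. phi t (X i s)) = sqrt n * (sqrt n * (G M X n s t - Cop t))"
  by simp
 thus ?thesis using n by (simp add: alpha_n_def)
qed

lemma G_mono: "u \<le> v ==> G M X n s u \<le> G M X n s v"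
proof -
 assume "u \<le> v"
 hence "of_bool (U M X i s \<le> u) \<le> (of_bool (U M X i s \<le> v) :: real)" for i by (auto dest: order.trans)
 thus ?thesis unfolding G_def by (intro divide_right_mono sum_mono) auto
qed

lemma alpha_meas [measurable]: "(\<lambda>s. \<alpha>n n s t) \<in> borel_measurable M"
proof (cases "n = 0")
 case False
 thus ?thesis by (simp add: alpha_eq)
qed (simp add: alpha_n_def)

lemma alpha_bound: "\<bar>\<alpha>n n s t\<bar> \<le> sqrt n"
proof (cases "n = 0")
 case False
 have "\<bar>\<Sum>i\<in>{1..int n}. phi t (X i s)\<bar> \<le> (\<Sum>i\<in>{1..int n}. 1)"
  by (intro order.trans[OF sum_abs] sum_mono phi_bound)
 hence "\<bar>\<Sum>i\<in>{1..int n}. phi t (X i s)\<bar> \<le> sqrt n * sqrt n" by simp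
 thus ?thesis using False by (simp add: alpha_eq abs_divide divide_le_eq)
qed (simp add: alpha_n_def)

text \<open>The condition on n \<rho> absorbs the 1 in the maximum of \<open>moment_X\<close>. It
  restricts the estimate to distances of at least the order 1/n, which is why the modulus below
  stops at that scale.\<close>

lemma alpha_moment:
 assumes \<epsilon>: "0 < \<epsilon>" "\<epsilon> < 1"
 shows "\<exists>K\<ge>0. \<forall>n\<ge>1. \<forall>u\<in>unit_cube. \<forall>v\<in>unit_cube. \<forall>\<rho>. (\<Sum>j\<in>UNIV. \<bar>u $ j - v $ j\<bar>) \<le> \<rho> --> 1 / 2 \<le> real n * \<rho> -->
  expectation (\<lambda>s. (\<alpha>n n s u - \<alpha>n n s v) ^ (2 * p)) \<le> K * (\<rho> powr (1 - \<epsilon>)) ^ p"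
proof -
 obtain K where K: "K \<ge> 0" "\<And>(\<phi> :: real ^ 'd => real) \<rho> n. \<phi> \<in> borel_measurable borel ==> (\<forall>x. \<bar>\<phi> x\<bar> \<le> 1) ==>
  expectation (\<lambda>s. \<phi> (X 0 s)) = 0 ==> expectation (\<lambda>s. \<bar>\<phi> (X 0 s)\<bar>) \<le> \<rho> ==>
  expectation (\<lambda>s. (\<Sum>i\<in>{1..int n}. \<phi> (X i s)) ^ (2 * p)) \<le> K * max 1 (real n * \<rho> powr (1 - \<epsilon>)) ^ (2 * p div 2)"
  using moment_X[OF \<epsilon>, of "2 * p"] by blast
 show ?thesis
 proof (intro exI[of _ "8 ^ p * K"] conjI allI impI ballI)
  show "0 \<le> 8 ^ p * K" using K(1) by simp
  fix n :: nat and u v :: "real ^ 'd" and \<rho> :: real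
  assume n: "1 \<le> n" and u: "u \<in> unit_cube" "v \<in> unit_cube" and \<rho>: "(\<Sum>j\<in>UNIV. \<bar>u $ j - v $ j\<bar>) \<le> \<rho>" "1 / 2 \<le> real n * \<rho>"
  \<comment> \<open>Halving keeps the difference of two functions bounded by 1 within [-1, 1], as
    \<open>moment_X\<close> requires; the factor 4^p below restores it.\<close>
  define \<phi> where "\<phi> x = (phi u x - phi v x) / 2" for x
  have [measurable]: "\<phi> \<in> borel_measurable borel" unfolding \<phi>_def by measurable
  have b: "\<bar>\<phi> x\<bar> \<le> 1" for x using phi_bound[of u x] phi_bound[of v x] by (simp add: \<phi>_def)
  have ip: "integrable M (\<lambda>s. phi t (X i s))" for t i using phi_bound by (intro int_bounded[where B=1]) auto
  have E0: "expectation (\<lambda>s. \<phi> (X 0 s)) = 0" unfolding \<phi>_def using ip by (simp add: phi_mean)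
  have E1: "expectation (\<lambda>s. \<bar>\<phi> (X 0 s)\<bar>) \<le> \<rho>"
  proof -
   have i: "integrable M (\<lambda>s. \<bar>of_bool (Uf (X 0 s) \<le> u) - of_bool (Uf (X 0 s) \<le> v)\<bar> :: real)"
    by (intro int_bounded[where B=1]) auto
   have "expectation (\<lambda>s. \<bar>\<phi> (X 0 s)\<bar>) \<le> expectation (\<lambda>s. (\<bar>of_bool (Uf (X 0 s) \<le> u) - of_bool (Uf (X 0 s) \<le> v)\<bar> + \<rho>) / 2)"
   proof (intro integral_mono)
    show "integrable M (\<lambda>s. \<bar>\<phi> (X 0 s)\<bar>)" using b by (intro int_bounded[where B=1]) auto
    show "integrable M (\<lambda>s. (\<bar>of_bool (Uf (X 0 s) \<le> u) - of_bool (Uf (X 0 s) \<le> v)\<bar> + \<rho>) / 2)" using i by auto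
    show "\<bar>\<phi> (X 0 s)\<bar> \<le> (\<bar>of_bool (Uf (X 0 s) \<le> u) - of_bool (Uf (X 0 s) \<le> v)\<bar> + \<rho>) / 2" for s
    proof -
     have "\<bar>(a - c - (b - d)) / 2\<bar> \<le> (\<bar>a - b\<bar> + \<rho>) / 2" if "\<bar>c - d\<bar> \<le> \<rho>" for a b c d :: real
     proof -
      have e: "a - c - (b - d) = (a - b) - (c - d)" by simp
      show ?thesis unfolding e using abs_triangle_ineq4[of "a - b" "c - d"] that by simp
     qed
     thus ?thesis using Cop_lipschitz[OF u] \<rho>(1) unfolding \<phi>_def phi_def by auto
    qed
   qed
   also have "... = (expectation (\<lambda>s. \<bar>of_bool (Uf (X 0 s) \<le> u) - of_bool (Uf (X 0 s) \<le> v)\<bar>) + \<rho>) / 2"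
    using i by (simp add: prob_space)
   also have "... \<le> \<rho>" using expectation_ind_diff[OF u, of 0] \<rho>(1) by simp
   finally show ?thesis .
  qed
  have "\<rho> > 0" using \<rho>(2) n by (metis mult_nonneg_nonpos not_less of_nat_0_le_iff linorder_not_le order_less_le_trans half_gt_zero_iff zero_less_one)
  have big: "1 / 2 \<le> real n * \<rho> powr (1 - \<epsilon>)"
  proof (cases "\<rho> \<le> 1")
   case True
   have "\<rho> powr 1 \<le> \<rho> powr (1 - \<epsilon>)" using True \<open>\<rho> > 0\<close> \<epsilon> by (intro powr_mono') auto
   hence "real n * \<rho> \<le> real n * \<rho> powr (1 - \<epsilon>)" using \<open>\<rho> > 0\<close> by (intro mult_left_mono) auto
   thus ?thesis using \<rho>(2) by simp
  next
   case False
   have "1 * 1 \<le> real n * \<rho> powr (1 - \<epsilon>)" using False n \<epsilon> by (intro mult_mono ge_one_powr_ge_zero) auto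
   thus ?thesis by simp
  qed
  have sq: "sqrt n ^ (2 * p) = real n ^ p" by (simp add: power_mult)
  have "expectation (\<lambda>s. (\<alpha>n n s u - \<alpha>n n s v) ^ (2 * p)) = expectation (\<lambda>s. 4 ^ p / real n ^ p * (\<Sum>i\<in>{1..int n}. \<phi> (X i s)) ^ (2 * p))"
  proof (intro Bochner_Integration.integral_cong refl)
   fix s
   have "\<alpha>n n s u - \<alpha>n n s v = 2 * (\<Sum>i\<in>{1..int n}. \<phi> (X i s)) / sqrt n"
    using n by (simp add: alpha_eq \<phi>_def diff_divide_distrib[symmetric] sum_subtractf[symmetric] sum_divide_distrib[symmetric])
   thus "(\<alpha>n n s u - \<alpha>n n s v) ^ (2 * p) = 4 ^ p / real n ^ p * (\<Sum>i\<in>{1..int n}. \<phi> (X i s)) ^ (2 * p)"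
    by (simp add: power_divide power_mult_distrib sq power_mult[of 2])
  qed
  also have "... = 4 ^ p / real n ^ p * expectation (\<lambda>s. (\<Sum>i\<in>{1..int n}. \<phi> (X i s)) ^ (2 * p))" by simp
  also have "... \<le> 4 ^ p / real n ^ p * (K * max 1 (real n * \<rho> powr (1 - \<epsilon>)) ^ p)"
   using K(2)[of \<phi> \<rho> n] b E0 E1 by (intro mult_left_mono) auto
  also have "... \<le> 4 ^ p / real n ^ p * (K * (2 * (real n * \<rho> powr (1 - \<epsilon>))) ^ p)"
   using big K(1) by (intro mult_left_mono power_mono max.boundedI) auto
  also have "... = 4 ^ p * 2 ^ p * K * (\<rho> powr (1 - \<epsilon>)) ^ p" using n by (simp add: power_mult_distrib field_simps)
  also have "4 ^ p * 2 ^ p = (8 ^ p :: real)" by (simp add: power_mult_distrib[symmetric])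
  finally show "expectation (\<lambda>s. (\<alpha>n n s u - \<alpha>n n s v) ^ (2 * p)) \<le> 8 ^ p * K * (\<rho> powr (1 - \<epsilon>)) ^ p" by simp
 qed
qed

lemma ex_level:
 assumes "n \<ge> 1"
 shows "\<exists>K. n \<le> 2 ^ K \<and> (2::nat) ^ K \<le> 2 * n"
proof -
 obtain k where "2 ^ k \<le> n" "n < 2 ^ (k + 1)" using ex_power_ivl1[of 2 n] assms by auto
 thus ?thesis by (intro exI[of _ "k + 1"]) auto
qed

text \<open>The moments of order \<open>2p\<close> decay like \<open>2\<^sup>-\<^sup>k\<^sup>p\<^sup>(\<^sup>1\<^sup>-\<^sup>\<epsilon>\<^sup>)\<close> at dyadic level \<open>k\<close>, so for large \<open>p\<close> chaining
 loses arbitrarily little from the exponent \<open>1/2\<close>.\<close>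

lemma alpha_modulus:
 assumes \<theta>: "0 < \<theta>" "\<theta> < 1/2" and \<eta>: "\<eta> > 0"
 shows "\<exists>L\<ge>1. \<forall>n\<ge>1. \<exists>E\<in>sets M. prob E \<ge> 1 - \<eta> \<and>
  (\<forall>s\<in>E. \<forall>u\<in>unit_cube. \<forall>v\<in>unit_cube. \<bar>\<alpha>n n s u - \<alpha>n n s v\<bar> \<le> L * max (norm (u - v)) (1 / real n) powr \<theta>)"
proof -
 let ?d = "CARD('d)"
 obtain \<epsilon> and p :: nat where \<epsilon>: "0 < \<epsilon>" "\<epsilon> < 1" and "p \<ge> 1"
  and w2: "4 ^ ?d * ((1/2) powr (1 - \<epsilon>)) ^ p < ((1/2) powr \<theta>) ^ (2 * p)"
  using chaining_parameters[OF \<theta>] by blast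
 obtain K where K: "K \<ge> 0" "\<And>n u v \<rho>. n \<ge> 1 ==> u \<in> unit_cube ==> v \<in> unit_cube ==> (\<Sum>j\<in>UNIV. \<bar>u $ j - v $ j\<bar>) \<le> \<rho> ==> 1 / 2 \<le> real n * \<rho> ==>
  expectation (\<lambda>s. (\<alpha>n n s u - \<alpha>n n s v) ^ (2 * p)) \<le> K * (\<rho> powr (1 - \<epsilon>)) ^ p"
  using alpha_moment[OF \<epsilon>, of p] by blast
 define r :: real where "r = (1/2) powr \<theta>"
 have r: "0 < r" "r < 1" using \<theta> powr_less_mono2[of \<theta> "1/2" 1] by (auto simp: r_def)
 have rk: "r ^ k = (1 / 2 ^ k) powr \<theta>" for k
  by (simp add: r_def powr_realpow[symmetric] powr_powr mult.commute powr_divide)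
 define w :: real where "w = ((1/2) powr (1 - \<epsilon>)) ^ p"
 define c where "c = K * (real ?d powr (1 - \<epsilon>)) ^ p"
 have w: "0 \<le> w" "4 ^ ?d * w < r ^ (2 * p)"
  using w2 by (simp_all add: w_def r_def)
 have c0: "c \<ge> 0" using K(1) by (simp add: c_def)
 obtain L where L0: "L \<ge> 0" and ch: "\<forall>(Z :: real ^ 'd => 'a => real) k. (\<forall>t. Z t \<in> borel_measurable M) -->
  (\<forall>s t. integrable M (\<lambda>x. (Z s x - Z t x) ^ (2 * p))) -->
  (\<forall>l\<le>k. \<forall>(s, t)\<in>adj l. expectation (\<lambda>x. (Z s x - Z t x) ^ (2 * p)) \<le> c * w ^ l) -->
  (\<exists>E\<in>sets M. prob E \<ge> 1 - \<eta> \<and> (\<forall>x\<in>E. \<forall>l\<le>k. \<forall>(s, t)\<in>adj l. \<bar>Z s x - Z t x\<bar> \<le> L * r ^ l))"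
  using ex_chaining_event[OF \<open>p \<ge> 1\<close> r(1) w \<eta> c0] by blast
 \<comment> \<open>The second summand comes from chaining between grid points, with a 2 for rounding
   the distance to a dyadic scale; the third from moving u and v to the grid; the 1 ensures B \<ge>
   1.\<close>
 define B where "B = 1 + 2 * (L * (1 + 2 / (1 - r))) + 2 * (L + real ?d)"
 show ?thesis
 proof (intro exI[of _ B] conjI allI impI)
  have ev: "\<exists>E\<in>sets M. prob E \<ge> 1 - \<eta> \<and> (\<forall>x\<in>E. \<forall>l\<le>k. \<forall>(s, t)\<in>adj l. \<bar>\<alpha>n n x s - \<alpha>n n x t\<bar> \<le> L * r ^ l)"
   if n: "n \<ge> 1" and k: "2 ^ k \<le> 2 * n" for n k
  proof (rule ch[rule_format])
   show "integrable M (\<lambda>x. (\<alpha>n n x s - \<alpha>n n x t) ^ (2 * p))" for s t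
   proof (rule int_bounded[where B="(2 * sqrt n) ^ (2 * p)"])
    show "norm ((\<alpha>n n x s - \<alpha>n n x t) ^ (2 * p)) \<le> (2 * sqrt n) ^ (2 * p)" for x
     using alpha_bound[of n x s] alpha_bound[of n x t] unfolding norm_power
     by (intro power_mono) (auto simp: abs_le_iff)
   qed measurable
   have "expectation (\<lambda>x. (\<alpha>n n x s - \<alpha>n n x t) ^ (2 * p)) \<le> c * w ^ l" if l: "l \<le> k" and st: "(s, t) \<in> adj l" for l s t
   proof -
    let ?\<rho> = "real ?d * (1 / 2 ^ l)"
    have "expectation (\<lambda>x. (\<alpha>n n x s - \<alpha>n n x t) ^ (2 * p)) \<le> K * (?\<rho> powr (1 - \<epsilon>)) ^ p"
    proof (rule K(2)[OF n])
     show "s \<in> unit_cube" "t \<in> unit_cube" using st grid_subset_cube[of l] unfolding adj_def by blast+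
     have "(\<Sum>j\<in>UNIV. \<bar>s $ j - t $ j\<bar>) \<le> (\<Sum>j\<in>(UNIV :: 'd set). 1 / 2 ^ l)"
      using st by (intro sum_mono) (auto simp: adj_def)
     thus "(\<Sum>j\<in>UNIV. \<bar>s $ j - t $ j\<bar>) \<le> ?\<rho>" by simp
     have "(2::nat) ^ l \<le> 2 ^ k" using l by (intro power_increasing) auto
     hence "2 ^ l \<le> 2 * n" using k by linarith
     from of_nat_mono[OF this, where 'a=real] have "2 ^ l \<le> 2 * real n" by simp
     hence "1 / 2 \<le> real n * (1 / 2 ^ l) * 1" by (simp add: field_simps)
     also have "... \<le> real n * (1 / 2 ^ l) * real ?d" by (intro mult_left_mono) (auto simp: Suc_leI)
     finally show "1 / 2 \<le> real n * ?\<rho>" by (simp add: mult_ac)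
    qed
    also have "(?\<rho> powr (1 - \<epsilon>)) ^ p = (real ?d powr (1 - \<epsilon>)) ^ p * w ^ l"
     unfolding w_def by (rule powr_dyadic) simp
    finally show ?thesis by (simp add: c_def)
   qed
   thus "case st of (s, t) => expectation (\<lambda>x. (\<alpha>n n x s - \<alpha>n n x t) ^ (2 * p)) \<le> c * w ^ l" if "l \<le> k" "st \<in> adj l" for l st
    using that by (cases st) auto
  qed (rule alpha_meas)
  have B1: "0 \<le> L * (1 + 2 / (1 - r))" using L0 r by (intro mult_nonneg_nonneg) auto
  show "1 \<le> B" using L0 B1 by (simp add: B_def)
  fix n :: nat assume n: "1 \<le> n"
  obtain k where k: "n \<le> 2 ^ k" "(2::nat) ^ k \<le> 2 * n" using ex_level[OF n] by blast
  have kn: "1 / 2 ^ k \<le> 1 / real n"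
  proof -
   from of_nat_mono[OF k(1), where 'a=real] have "real n \<le> 2 ^ k" by simp
   thus ?thesis using n by (intro divide_left_mono) auto
  qed
  obtain E where E: "E \<in> sets M" "prob E \<ge> 1 - \<eta>" and H0: "\<forall>x\<in>E. \<forall>l\<le>k. \<forall>(s, t)\<in>adj l. \<bar>\<alpha>n n x s - \<alpha>n n x t\<bar> \<le> L * r ^ l"
   using ev[OF n k(2)] by blast
  show "\<exists>E\<in>sets M. prob E \<ge> 1 - \<eta> \<and>
   (\<forall>s\<in>E. \<forall>u\<in>unit_cube. \<forall>v\<in>unit_cube. \<bar>\<alpha>n n s u - \<alpha>n n s v\<bar> \<le> B * max (norm (u - v)) (1 / real n) powr \<theta>)"
  proof (intro bexI[OF _ E(1)] conjI ballI E(2))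
   fix s and u v :: "real ^ 'd" assume s: "s \<in> E" and u: "u \<in> unit_cube" and v: "v \<in> unit_cube"
   have H: "\<bar>\<alpha>n n s x - \<alpha>n n s y\<bar> \<le> L * r ^ l" if "l \<le> k" "(x, y) \<in> adj l" for l x y
    using H0[rule_format, OF s that] by simp
   define \<delta> where "\<delta> = max (norm (u - v)) (1 / real n)"
   define \<delta>' where "\<delta>' = min \<delta> 1"
   have \<delta>': "0 < \<delta>'" "\<delta>' \<le> 1" "1 / real n \<le> \<delta>'" "\<delta>' \<le> \<delta>" using n by (auto simp: \<delta>'_def \<delta>_def less_max_iff_disj)
   obtain l where l: "\<delta>' \<le> 1 / 2 ^ l" "1 / 2 ^ l < 2 * \<delta>'" using ex_dyadic_scale[OF \<delta>'(1,2)] by blast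
   \<comment> \<open>If the dyadic scale of \<delta>' is finer than the last level k, then k itself
     serves, since 1/2^k \<le> 1/n \<le> \<delta>'.\<close>
   have lk: "\<exists>l'\<le>k. \<delta>' \<le> 1 / 2 ^ l' \<and> 1 / 2 ^ l' \<le> 2 * \<delta>'"
   proof (cases "l \<le> k")
    case False
    hence "(1::real) / 2 ^ l \<le> 1 / 2 ^ k" by (intro divide_left_mono power_increasing) auto
    thus ?thesis using l(1) kn \<delta>' by (intro exI[of _ k]) auto
   qed (use l in auto)
   then obtain l' where l': "l' \<le> k" "\<delta>' \<le> 1 / 2 ^ l'" "1 / 2 ^ l' \<le> 2 * \<delta>'" by blast
   have uvj: "\<bar>u $ j - v $ j\<bar> \<le> 1 / 2 ^ l'" for j
   proof -
    have "\<bar>u $ j - v $ j\<bar> \<le> norm (u - v)" using component_le_norm_cart[of "u - v" j] by simp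
    moreover have "\<bar>u $ j - v $ j\<bar> \<le> 1" using cube_ge0[OF u, of j] cube_le1[OF u, of j] cube_ge0[OF v, of j] cube_le1[OF v, of j] by linarith
    ultimately have "\<bar>u $ j - v $ j\<bar> \<le> \<delta>'" by (simp add: \<delta>'_def \<delta>_def)
    thus ?thesis using l'(2) by simp
   qed
   have p1: "r ^ l' \<le> 2 * \<delta> powr \<theta>"
   proof -
    have "r ^ l' \<le> (2 * \<delta>) powr \<theta>" unfolding rk using l'(3) \<delta>' \<theta> by (intro powr_mono2) auto
    also have "... = 2 powr \<theta> * \<delta> powr \<theta>" using \<delta>' by (simp add: powr_mult)
    also have "... \<le> 2 powr 1 * \<delta> powr \<theta>" using \<theta> by (intro mult_right_mono powr_mono) auto
    finally show ?thesis by simp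
   qed
   have n1: "(1 / real n) powr \<theta> \<le> \<delta> powr \<theta>" using \<theta> n by (intro powr_mono2) (auto simp: \<delta>_def)
   have n2: "1 / sqrt n \<le> (1 / real n) powr \<theta>"
   proof -
    have "1 / sqrt n = (1 / real n) powr (1/2)" using n by (simp add: powr_half_sqrt real_sqrt_divide)
    also have "... \<le> (1 / real n) powr \<theta>" using \<theta> n by (intro powr_mono') auto
    finally show ?thesis .
   qed
   \<comment> \<open>Beyond the last level moments give nothing. Monotonicity of \<open>G\<close>
     and of the copula sandwiches the value at x between floor and ceiling, at the cost of sqrt n
     times an increment of C, hence of at most d / sqrt n.\<close>
   have endpt: "\<bar>\<alpha>n n s x - \<alpha>n n s (fl k x)\<bar> \<le> (L + real ?d) * \<delta> powr \<theta>" if x: "x \<in> unit_cube" for x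
   proof -
    let ?t = "fl k x" and ?t' = "cl k x"
    have cube: "?t \<in> unit_cube" "?t' \<in> unit_cube" using fl_grid[OF x] cl_grid[OF x] grid_subset_cube by blast+
    have ad: "(?t, ?t') \<in> adj k" by (rule fl_cl_adj[OF x])
    have Gm: "G M X n s ?t \<le> G M X n s x" "G M X n s x \<le> G M X n s ?t'"
     by (intro G_mono fl_le cl_ge)+
    have Cm: "Cop ?t \<le> Cop x" "Cop x \<le> Cop ?t'" using fl_le[of k x] cl_ge[of x k] by (auto intro: Cop_mono)
    have "Cop ?t' - Cop ?t \<le> (\<Sum>j\<in>UNIV. \<bar>?t' $ j - ?t $ j\<bar>)" using Cop_lipschitz[OF cube(2,1)] by linarith
    also have "... \<le> (\<Sum>j\<in>(UNIV::'d set). 1 / 2 ^ k)"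
     using ad by (intro sum_mono) (auto simp: adj_def abs_minus_commute)
    also have "... \<le> real ?d * (1 / real n)" using mult_left_mono[OF kn, of "real ?d"] by simp
    finally have Cd: "Cop ?t' - Cop ?t \<le> real ?d * (1 / real n)" .
    have sd: "sqrt n * (Cop ?t' - Cop ?t) \<le> real ?d * (1 / sqrt n)"
    proof -
     have "sqrt n * (Cop ?t' - Cop ?t) \<le> sqrt n * (real ?d * (1 / real n))"
      using Cd by (intro mult_left_mono) auto
     also have "... = real ?d * (1 / sqrt n)" using n by (simp add: field_simps)
     finally show ?thesis .
    qed
    have "\<alpha>n n s x \<le> \<alpha>n n s ?t' + sqrt n * (Cop ?t' - Cop ?t)"
    proof -
     have "sqrt n * (G M X n s x - Cop x) \<le> sqrt n * (G M X n s ?t' - Cop ?t)"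
      using Gm Cm by (intro mult_left_mono) auto
     thus ?thesis by (simp add: alpha_n_def algebra_simps)
    qed
    moreover have "\<alpha>n n s x \<ge> \<alpha>n n s ?t - sqrt n * (Cop ?t' - Cop ?t)"
    proof -
     have "sqrt n * (G M X n s x - Cop x) \<ge> sqrt n * (G M X n s ?t - Cop ?t')"
      using Gm Cm by (intro mult_left_mono) auto
     thus ?thesis by (simp add: alpha_n_def algebra_simps)
    qed
    moreover have "\<bar>\<alpha>n n s ?t - \<alpha>n n s ?t'\<bar> \<le> L * r ^ k" by (rule H[OF _ ad]) simp
    moreover have "L * r ^ k \<le> L * \<delta> powr \<theta>"
    proof -
     have "r ^ k \<le> (1 / real n) powr \<theta>" unfolding rk using kn \<theta> by (intro powr_mono2) auto
     thus ?thesis using n1 L0 by (intro mult_left_mono) auto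
    qed
    moreover have "real ?d * (1 / sqrt n) \<le> real ?d * \<delta> powr \<theta>"
     using n1 n2 by (intro mult_left_mono) auto
    ultimately have "\<bar>\<alpha>n n s x - \<alpha>n n s ?t\<bar> \<le> L * \<delta> powr \<theta> + real ?d * \<delta> powr \<theta>" using sd by linarith
    thus ?thesis by (simp add: distrib_right)
   qed
   have mid: "\<bar>\<alpha>n n s (fl k u) - \<alpha>n n s (fl k v)\<bar> \<le> 2 * (L * (1 + 2 / (1 - r))) * \<delta> powr \<theta>"
   proof -
    have "\<bar>\<alpha>n n s (fl k u) - \<alpha>n n s (fl k v)\<bar> \<le> L * r ^ l' * (1 + 2 / (1 - r))"
     by (rule chain_close[OF H r L0 u v l'(1) uvj])
    also have "... = L * (1 + 2 / (1 - r)) * r ^ l'" by (simp only: mult_ac)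
    also have "... \<le> L * (1 + 2 / (1 - r)) * (2 * \<delta> powr \<theta>)" by (rule mult_left_mono[OF p1 B1])
    finally show ?thesis by (simp only: mult_ac)
   qed
   have "\<bar>\<alpha>n n s u - \<alpha>n n s v\<bar> \<le> 2 * (L * (1 + 2 / (1 - r))) * \<delta> powr \<theta> + (L + real ?d) * \<delta> powr \<theta> + (L + real ?d) * \<delta> powr \<theta>"
    using endpt[OF u] endpt[OF v] mid by linarith
   also have "... = (B - 1) * \<delta> powr \<theta>" by (simp add: B_def algebra_simps)
   also have "... \<le> B * \<delta> powr \<theta>" by (intro mult_right_mono) auto
   finally show "\<bar>\<alpha>n n s u - \<alpha>n n s v\<bar> \<le> B * max (norm (u - v)) (1 / real n) powr \<theta>" by (simp add: \<delta>_def)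
  qed
 qed
qed

end

section \<open>Covariances and the central limit theorem\<close>

text \<open>Row i is the sum of r over the window from 1 - i to n - i, which is close to S unless i
  is within m of an end of {1..n}. These at most 2 m rows differ from S by at most |S| + T
  each.\<close>

lemma cesaro_covariance:
 fixes r :: "int => real"
 assumes S: "(r has_sum S) UNIV" and T: "\<And>F. finite F ==> \<bar>sum r F\<bar> \<le> T"
 shows "(\<lambda>n. (\<Sum>i\<in>{1..int n}. \<Sum>k\<in>{1..int n}. r (k - i)) / real n) \<longlonglongrightarrow> S"
proof (rule LIMSEQ_I)
 fix e :: real assume e: "e > 0"
 obtain F where F: "finite F" "\<And>F'. finite F' ==> F \<subseteq> F' ==> dist (sum r F') S < e / 2"
  using S e unfolding has_sum_def tendsto_iff eventually_finite_subsets_at_top by (metis half_gt_zero subset_UNIV)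
 define m where "m = Max (insert 0 (abs ` F))"
 have m0: "0 \<le> m" and mF: "\<And>h. h \<in> F ==> \<bar>h\<bar> \<le> m" using F(1) by (auto simp: m_def)
 define c where "c = \<bar>S\<bar> + T"
 have c0: "c \<ge> 0" using T[of "{}"] by (simp add: c_def)
 define N where "N = nat \<lceil>4 * (real_of_int m + 1) * c / e\<rceil> + 1"
 show "\<exists>N. \<forall>n\<ge>N. norm ((\<Sum>i\<in>{1..int n}. \<Sum>k\<in>{1..int n}. r (k - i)) / real n - S) < e"
 proof (intro exI[of _ N] allI impI)
  fix n assume n: "n \<ge> N"
  hence n1: "n \<ge> 1" by (simp add: N_def)
  have nc: "4 * (real_of_int m + 1) * c / e < real n" using n unfolding N_def by linarith
  let ?I = "{1..int n}"
  define f where "f i = (\<Sum>k\<in>?I. r (k - i))" for i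
  have fs: "f i = sum r {1 - i..int n - i}" for i
   unfolding f_def by (rule sum.reindex_bij_witness[of _ "\<lambda>h. h + i" "\<lambda>k. k - i"]) auto
  have mid: "\<bar>f i - S\<bar> \<le> e / 2 + (if i \<in> {m+1..int n - m} then 0 else c)" if "i \<in> ?I" for i
  proof (cases "i \<in> {m+1..int n - m}")
   case True
   have "F \<subseteq> {1 - i..int n - i}" using mF True by force
   hence "dist (f i) S < e / 2" unfolding fs by (intro F(2)) auto
   thus ?thesis using True by (simp add: dist_real_def)
  next
   case False
   have "\<bar>f i\<bar> \<le> T" unfolding fs by (rule T) auto
   hence "\<bar>f i - S\<bar> \<le> c" unfolding c_def by linarith
   thus ?thesis using e by (simp only: False if_False)
  qed
  have "\<bar>(\<Sum>i\<in>?I. f i) - real n * S\<bar> = \<bar>\<Sum>i\<in>?I. f i - S\<bar>" by (simp add: sum_subtractf)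
  also have "... \<le> (\<Sum>i\<in>?I. e / 2 + (if i \<in> {m+1..int n - m} then 0 else c))"
   by (intro order.trans[OF sum_abs] sum_mono mid)
  also have "... = real n * (e / 2) + (\<Sum>i\<in>?I. if i \<in> {m+1..int n - m} then 0 else c)" by (simp add: sum.distrib)
  also have "(\<Sum>i\<in>?I. if i \<in> {m+1..int n - m} then 0 else c) \<le> (\<Sum>i\<in>{1..m} \<union> {int n - m + 1..int n}. c)"
  proof -
   have "(\<Sum>i\<in>?I. if i \<in> {m+1..int n - m} then 0 else c) = (\<Sum>i\<in>?I - {m+1..int n - m}. c)"
    by (rule sum.mono_neutral_cong_right) auto
   also have "... \<le> (\<Sum>i\<in>{1..m} \<union> {int n - m + 1..int n}. c)"
    using c0 m0 by (intro sum_mono2) auto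
   finally show ?thesis .
  qed
  also have "(\<Sum>i\<in>{1..m} \<union> {int n - m + 1..int n}. c) \<le> 2 * real_of_int m * c"
  proof -
   have "card ({1..m} \<union> {int n - m + 1..int n}) \<le> nat m + nat m"
    by (rule order.trans[OF card_Un_le]) simp
   hence "real (card ({1..m} \<union> {int n - m + 1..int n})) \<le> 2 * real_of_int m" using m0 by linarith
   thus ?thesis using c0 by (simp add: mult_right_mono)
  qed
  also have "2 * real_of_int m * c < real n * (e / 2)"
  proof -
   have "2 * real_of_int m * c \<le> 2 * (real_of_int m + 1) * c" using c0 by (intro mult_right_mono) auto
   also have "... < real n * (e / 2)" using nc e by (simp add: field_simps)
   finally show ?thesis .
  qed
  finally have "\<bar>(\<Sum>i\<in>?I. f i) - real n * S\<bar> < real n * e" by (simp add: mult.commute)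
  moreover have "(\<Sum>i\<in>?I. f i) / real n - S = ((\<Sum>i\<in>?I. f i) - real n * S) / real n" using n1 by (simp add: field_simps)
  ultimately show "norm ((\<Sum>i\<in>{1..int n}. \<Sum>k\<in>{1..int n}. r (k - i)) / real n - S) < e"
   using n1 by (simp add: f_def abs_divide divide_less_eq mult.commute)
 qed
qed

lemma summable_geometric_int:
 fixes a :: real
 assumes "0 < a" "a < 1"
 shows "(\<lambda>h::int. a ^ nat \<bar>h\<bar>) summable_on UNIV"
proof -
 have s: "(\<lambda>n. a ^ n) summable_on UNIV"
  using assms by (subst summable_on_UNIV_nonneg_real_iff) (auto intro: summable_geometric)
 have 1: "(\<lambda>h::int. a ^ nat \<bar>h\<bar>) summable_on (range int)"
  using s by (subst summable_on_reindex) (auto simp: o_def)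
 have 2: "(\<lambda>h::int. a ^ nat \<bar>h\<bar>) summable_on (range (\<lambda>n. - int n))"
  using s by (subst summable_on_reindex) (auto simp: o_def inj_on_def)
 have "UNIV = range int \<union> range (\<lambda>n. - int n)"
  by (auto simp: image_iff) (metis int_cases2)
 thus ?thesis using summable_on_union[OF 1 2] by simp
qed

text \<open>The integrating factor exp (x^2 v / 2) turns the approximate equation f' = - x v f into
  a bound on a derivative. The mean value inequality between 0 and t gives the claim after division
  by the factor at t, which is the largest one.\<close>

lemma gaussian_ode:
 fixes f :: "real => complex"
 assumes D: "\<And>x. (f has_vector_derivative f' x) (at x)"
  and e: "\<And>x. \<bar>x\<bar> \<le> \<bar>t\<bar> ==> norm (f' x + of_real (x * v) * f x) \<le> e" and f0: "f 0 = 1" and v: "v \<ge> 0"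
 shows "norm (f t - of_real (exp (- (t\<^sup>2 * v / 2)))) \<le> \<bar>t\<bar> * e"
proof -
 let ?g = "\<lambda>x. of_real (exp (x\<^sup>2 * v / 2)) * f x"
 have g: "(?g has_vector_derivative of_real (exp (x\<^sup>2 * v / 2)) * (f' x + of_real (x * v) * f x)) (at x)" for x
  by (rule derivative_eq_intros D refl | simp add: algebra_simps)+
 have "norm (?g t - ?g 0) \<le> (exp (t\<^sup>2 * v / 2) * e) * norm (t - 0)"
 proof (rule differentiable_bound[of "closed_segment 0 t" ?g "\<lambda>x h. h *\<^sub>R (of_real (exp (x\<^sup>2 * v / 2)) * (f' x + of_real (x * v) * f x))"])
  show "(?g has_derivative (\<lambda>h. h *\<^sub>R (of_real (exp (x\<^sup>2 * v / 2)) * (f' x + of_real (x * v) * f x)))) (at x within closed_segment 0 t)" for x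
   using g[of x] unfolding has_vector_derivative_def by (rule has_derivative_at_withinI)
  fix x assume "x \<in> closed_segment 0 t"
  hence x: "\<bar>x\<bar> \<le> \<bar>t\<bar>" by (auto simp: closed_segment_eq_real_ivl split: if_splits)
  have "norm (of_real (exp (x\<^sup>2 * v / 2)) * (f' x + of_real (x * v) * f x)) \<le> exp (t\<^sup>2 * v / 2) * e"
   unfolding norm_mult using x v by (intro mult_mono e) (auto simp: abs_le_square_iff intro!: mult_right_mono)
  thus "onorm (\<lambda>h. h *\<^sub>R (of_real (exp (x\<^sup>2 * v / 2)) * (f' x + of_real (x * v) * f x))) \<le> exp (t\<^sup>2 * v / 2) * e"
   by (subst onorm_scaleR_left) (auto simp: onorm_id)
 qed auto
 moreover have "norm (?g t - ?g 0) = exp (t\<^sup>2 * v / 2) * norm (f t - of_real (exp (- (t\<^sup>2 * v / 2))))"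
 proof -
  have "?g t - ?g 0 = of_real (exp (t\<^sup>2 * v / 2)) * (f t - of_real (exp (- (t\<^sup>2 * v / 2))))"
   by (simp add: f0 right_diff_distrib flip: of_real_mult exp_add)
  thus ?thesis by (simp add: norm_mult)
 qed
 ultimately show ?thesis by (simp add: mult.commute)
qed

text \<open>For bounded Y the first-order remainder of the exponential is at most (y - x)^2 B^2 at
  every sample point, so it can be integrated directly.\<close>

lemma (in prob_space) char_has_derivative:
 fixes Y :: "'a => real"
 assumes Y [measurable]: "Y \<in> borel_measurable M" and B: "\<And>s. \<bar>Y s\<bar> \<le> B"
 shows "((\<lambda>t. expectation (\<lambda>s. iexp (t * Y s))) has_vector_derivative expectation (\<lambda>s. \<i> * of_real (Y s) * iexp (x * Y s))) (at x)"
 unfolding has_vector_derivative_def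
proof (rule has_derivativeI_sandwich[of 1])
 show "((\<lambda>y. \<bar>y - x\<bar> * B\<^sup>2) \<longlongrightarrow> 0) (at x)" by (auto intro!: tendsto_eq_intros)
 fix y assume yx: "y \<noteq> x"
 have i: "integrable M (\<lambda>s. iexp (t * Y s))" "integrable M (\<lambda>s. \<i> * of_real (Y s) * iexp (x * Y s))" for t
  by (rule integrable_const_bound[where B=1], simp, simp) (rule integrable_const_bound[where B=B], use B in \<open>simp_all add: norm_mult\<close>)
 let ?r = "\<lambda>s. iexp (y * Y s) - iexp (x * Y s) - (y - x) *\<^sub>R (\<i> * of_real (Y s) * iexp (x * Y s))"
 have "norm (expectation ?r) \<le> expectation (\<lambda>s. norm (?r s))" by (rule integral_norm_bound)
 also have "... \<le> expectation (\<lambda>_. \<bar>y - x\<bar>\<^sup>2 * B\<^sup>2)"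
 proof (rule integral_mono)
  fix s
  have "?r s = iexp (x * Y s) * (iexp ((y - x) * Y s) - (1 + \<i> * of_real ((y - x) * Y s)))"
   by (simp add: algebra_simps scaleR_conv_of_real flip: exp_add)
  hence "norm (?r s) = norm (iexp ((y - x) * Y s) - (1 + \<i> * of_real ((y - x) * Y s)))" by (simp only: norm_mult norm_exp_i_times mult_1_left)
  also have "... \<le> ((y - x) * Y s)\<^sup>2 / 2" using iexp_approx1[of "(y - x) * Y s" 1] by (auto simp: fact_numeral power2_eq_square)
  also have "... \<le> \<bar>y - x\<bar>\<^sup>2 * B\<^sup>2"
  proof -
   have "(Y s)\<^sup>2 \<le> B\<^sup>2" using power_mono[OF B[of s] abs_ge_zero, of 2] by simp
   hence "(y - x)\<^sup>2 * (Y s)\<^sup>2 \<le> (y - x)\<^sup>2 * B\<^sup>2" by (rule mult_left_mono) simp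
   moreover have "0 \<le> (y - x)\<^sup>2 * (Y s)\<^sup>2" by simp
   ultimately show ?thesis unfolding power_mult_distrib power2_abs by linarith
  qed
  finally show "norm (?r s) \<le> \<bar>y - x\<bar>\<^sup>2 * B\<^sup>2" .
 qed (use i in auto)
 finally have "norm (expectation ?r) / norm (y - x) \<le> \<bar>y - x\<bar> * B\<^sup>2" using yx by (simp add: divide_le_eq power2_eq_square prob_space mult_ac)
 thus "norm (expectation (\<lambda>s. iexp (y * Y s)) - expectation (\<lambda>s. iexp (x * Y s)) - (y - x) *\<^sub>R expectation (\<lambda>s. \<i> * of_real (Y s) * iexp (x * Y s))) / norm (y - x) \<le> \<bar>y - x\<bar> * B\<^sup>2"
  using i by simp
qed (auto intro: bounded_linear_scaleR_left)

section \<open>Autocovariances and long-run covariances\<close>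

context geometric_mixing
begin

definition centered :: "(real ^ 'd => real) => bool" where
 "centered \<phi> \<longleftrightarrow> \<phi> \<in> borel_measurable borel \<and> (\<forall>x. \<bar>\<phi> x\<bar> \<le> 1) \<and> expectation (\<lambda>s. \<phi> (X 0 s)) = 0"

definition acov :: "(real ^ 'd => real) => (real ^ 'd => real) => int => real" where
 "acov \<phi> \<psi> h = expectation (\<lambda>s. \<phi> (X 0 s) * \<psi> (X h s))"

lemma centered_phi: "centered (phi t)"
 using phi_bound phi_mean by (auto simp: centered_def)

lemma centered_mean: "centered \<phi> ==> expectation (\<lambda>s. \<phi> (X i s)) = 0"
 using stationary_1[of \<phi> i] by (auto simp: centered_def)

lemma acov_bound:
 assumes "centered \<phi>" "centered \<psi>"
 shows "\<bar>acov \<phi> \<psi> h\<bar> \<le> 4 * A0 * a ^ nat \<bar>h\<bar>"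
proof -
 have [measurable]: "\<phi> \<in> borel_measurable borel" "\<psi> \<in> borel_measurable borel"
  and b: "\<And>x. \<bar>\<phi> x\<bar> \<le> 1" "\<And>x. \<bar>\<psi> x\<bar> \<le> 1" using assms by (auto simp: centered_def)
 have m: "(\<lambda>s. \<phi> (X i s)) \<in> borel_measurable (Fld I)" "(\<lambda>s. \<psi> (X i s)) \<in> borel_measurable (Fld I)" if "i \<in> I" for i I
  using X_Fld[OF that] by measurable
 show ?thesis
 proof (cases "h \<ge> 0")
  case True
  have "\<bar>expectation (\<lambda>s. \<phi> (X 0 s) * \<psi> (X h s)) - expectation (\<lambda>s. \<phi> (X 0 s)) * expectation (\<lambda>s. \<psi> (X h s))\<bar> \<le> 4 * (A0 * a ^ nat (h - 0))"
   by (rule mix_cov) (use True b in \<open>auto intro: m\<close>)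
  thus ?thesis using True centered_mean[OF assms(1)] by (simp add: acov_def)
 next
  case False
  have "\<bar>expectation (\<lambda>s. \<psi> (X h s) * \<phi> (X 0 s)) - expectation (\<lambda>s. \<psi> (X h s)) * expectation (\<lambda>s. \<phi> (X 0 s))\<bar> \<le> 4 * (A0 * a ^ nat (0 - h))"
   by (rule mix_cov) (use False b in \<open>auto intro: m\<close>)
  thus ?thesis using False centered_mean[OF assms(1)] by (simp add: acov_def mult_ac)
 qed
qed

text \<open>One bound for the absolute sums of autocovariances of all pairs of
  \<open>centered\<close> functions, hence for all second moments of \<alpha>_n.\<close>

definition T0 :: real where "T0 = infsum (\<lambda>h::int. 4 * A0 * a ^ nat \<bar>h\<bar>) UNIV"

lemma T0_summable: "(\<lambda>h::int. 4 * A0 * a ^ nat \<bar>h\<bar>) summable_on UNIV"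
 by (rule summable_on_cmult_right[OF summable_geometric_int[OF a01]])

lemma T0_nonneg: "T0 \<ge> 0"
 unfolding T0_def using A0(1) a01 by (intro infsum_nonneg) auto

lemma acov_abs_sum:
 assumes "centered \<phi>" "centered \<psi>" "finite F"
 shows "(\<Sum>h\<in>F. \<bar>acov \<phi> \<psi> h\<bar>) \<le> T0"
proof -
 have "(\<Sum>h\<in>F. \<bar>acov \<phi> \<psi> h\<bar>) \<le> (\<Sum>h\<in>F. 4 * A0 * a ^ nat \<bar>h\<bar>)"
  by (intro sum_mono acov_bound assms)
 also have "... \<le> T0" unfolding T0_def
  using A0(1) a01 by (intro finite_sum_le_infsum T0_summable assms) auto
 finally show ?thesis .
qed

lemma acov_sum:
 assumes "centered \<phi>" "centered \<psi>" "finite F"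
 shows "\<bar>sum (acov \<phi> \<psi>) F\<bar> \<le> T0"
 using acov_abs_sum[OF assms] sum_abs[of "acov \<phi> \<psi>" F] by linarith

lemma acov_summable:
 assumes "centered \<phi>" "centered \<psi>"
 shows "acov \<phi> \<psi> summable_on UNIV"
proof -
 have "(\<lambda>h. norm (acov \<phi> \<psi> h)) summable_on UNIV"
  by (rule summable_on_comparison_test[OF T0_summable]) (use acov_bound[OF assms] in auto)
 thus ?thesis by (rule abs_summable_summable)
qed

text \<open>The long-run covariance, identified in \<open>variance_limit\<close> as the limit of the
  normalised covariances of partial sums.\<close>

definition Gam :: "(real ^ 'd => real) => (real ^ 'd => real) => real" where
 "Gam \<phi> \<psi> = infsum (acov \<phi> \<psi>) UNIV"

lemma acov_has_sum:
 assumes "centered \<phi>" "centered \<psi>"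
 shows "(acov \<phi> \<psi> has_sum Gam \<phi> \<psi>) UNIV"
 unfolding Gam_def by (rule has_sum_infsum[OF acov_summable[OF assms]])

lemma expectation_prod:
 assumes "centered \<phi>" "centered \<psi>"
 shows "expectation (\<lambda>s. \<phi> (X i s) * \<psi> (X k s)) = acov \<phi> \<psi> (k - i)"
 using assms unfolding acov_def centered_def by (intro stationary_2) auto

lemma centered_int:
 assumes "centered \<phi>" "centered \<psi>"
 shows "integrable M (\<lambda>s. \<phi> (X i s) * \<psi> (X k s))"
proof -
 have [measurable]: "\<phi> \<in> borel_measurable borel" "\<psi> \<in> borel_measurable borel"
  and b: "\<And>x. \<bar>\<phi> x\<bar> \<le> 1" "\<And>x. \<bar>\<psi> x\<bar> \<le> 1" using assms by (auto simp: centered_def)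
 show ?thesis using b by (intro int_bounded[where B=1]) (auto simp: abs_mult intro!: mult_le_one)
qed

lemma expectation_sum_prod:
 assumes "centered \<phi>" "centered \<psi>" "finite I" "finite J"
 shows "expectation (\<lambda>s. (\<Sum>i\<in>I. \<phi> (X i s)) * (\<Sum>k\<in>J. \<psi> (X k s))) = (\<Sum>i\<in>I. \<Sum>k\<in>J. acov \<phi> \<psi> (k - i))"
proof -
 have "expectation (\<lambda>s. (\<Sum>i\<in>I. \<phi> (X i s)) * (\<Sum>k\<in>J. \<psi> (X k s))) = (\<Sum>i\<in>I. \<Sum>k\<in>J. expectation (\<lambda>s. \<phi> (X i s) * \<psi> (X k s)))"
  unfolding sum_product using centered_int[OF assms(1,2)]
  by (simp add: Bochner_Integration.integral_sum Bochner_Integration.integrable_sum)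
 thus ?thesis by (simp add: expectation_prod[OF assms(1,2)])
qed

lemma variance_limit:
 assumes "centered \<phi>" "centered \<psi>"
 shows "(\<lambda>n. expectation (\<lambda>s. (\<Sum>i\<in>{1..int n}. \<phi> (X i s)) * (\<Sum>k\<in>{1..int n}. \<psi> (X k s))) / real n) \<longlonglongrightarrow> Gam \<phi> \<psi>"
 unfolding expectation_sum_prod[OF assms finite_atLeastAtMost_int finite_atLeastAtMost_int]
 by (rule cesaro_covariance[OF acov_has_sum[OF assms] acov_sum[OF assms]])

lemma second_moment_le:
 assumes "centered \<phi>" "finite I"
 shows "expectation (\<lambda>s. (\<Sum>i\<in>I. \<phi> (X i s))\<^sup>2) \<le> T0 * real (card I)"
proof -
 have "expectation (\<lambda>s. (\<Sum>i\<in>I. \<phi> (X i s))\<^sup>2) = (\<Sum>i\<in>I. \<Sum>k\<in>I. acov \<phi> \<phi> (k - i))"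
  using expectation_sum_prod[OF assms(1,1,2,2)] by (simp add: power2_eq_square)
 also have "... \<le> (\<Sum>i\<in>I. T0)"
 proof (rule sum_mono)
  fix i
  have "(\<Sum>k\<in>I. acov \<phi> \<phi> (k - i)) = sum (acov \<phi> \<phi>) ((\<lambda>k. k - i) ` I)"
   by (subst sum.reindex) (auto simp: inj_on_def)
  thus "(\<Sum>k\<in>I. acov \<phi> \<phi> (k - i)) \<le> T0"
   using acov_sum[OF assms(1,1), of "(\<lambda>k. k - i) ` I"] assms(2) by simp
 qed
 finally show ?thesis by (simp add: mult.commute)
qed

lemma sum_Fld:
 assumes "centered \<phi>" "I \<subseteq> J"
 shows "(\<lambda>s. \<Sum>i\<in>I. \<phi> (X i s)) \<in> borel_measurable (Fld J)"
proof -
 have [measurable]: "\<phi> \<in> borel_measurable borel" using assms by (auto simp: centered_def)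
 show ?thesis
 proof (intro borel_measurable_sum)
  fix i assume "i \<in> I"
  hence [measurable]: "X i \<in> borel_measurable (Fld J)" using assms by (intro X_Fld) auto
  show "(\<lambda>s. \<phi> (X i s)) \<in> borel_measurable (Fld J)" by measurable
 qed
qed

lemma Fld_mono:
 assumes "f \<in> borel_measurable (Fld I)" "I \<subseteq> J"
 shows "f \<in> borel_measurable (Fld J)"
proof -
 have "sets (Fld I) \<subseteq> sets (Fld J)" unfolding sets_Fld sigma_field_def using assms(2) by (intro sigma_sets_mono') auto
 thus ?thesis using assms(1) measurable_mono[of borel borel "Fld I" "Fld J"] by auto
qed

section \<open>Characteristic functions of partial sums and Stein's method\<close>

lemma norm_expectation_le:
 fixes f :: "'a => complex"
 assumes "f \<in> borel_measurable M" "\<And>s. norm (f s) \<le> B"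
 shows "norm (expectation f) \<le> B"
proof -
 have i: "integrable M f" by (rule int_bounded[OF assms])
 have "norm (expectation f) \<le> expectation (\<lambda>s. norm (f s))" by (rule integral_norm_bound)
 also have "... \<le> expectation (\<lambda>_. B)" by (rule integral_mono) (use assms(2) i in auto)
 finally show ?thesis by (simp add: prob_space)
qed

text \<open>Indexed by the set of summation indices, so that removing a window becomes splitting off
  a factor.\<close>

definition esum :: "(real ^ 'd => real) => real => int set => 'a => complex" where
 "esum \<phi> \<tau> I s = iexp (\<tau> * (\<Sum>i\<in>I. \<phi> (X i s)))"

lemma norm_esum [simp]: "norm (esum \<phi> \<tau> I s) = 1"
 by (simp add: esum_def)

lemma esum_Fld: "centered \<phi> ==> I \<subseteq> J ==> esum \<phi> \<tau> I \<in> borel_measurable (Fld J)"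
 unfolding esum_def[abs_def] using sum_Fld[of \<phi> I J] by measurable

lemma esum_meas: "centered \<phi> ==> esum \<phi> \<tau> I \<in> borel_measurable M"
 by (rule Fld_mono_measurable[OF esum_Fld]) auto

lemma esum_split: "finite I ==> J \<subseteq> I ==> esum \<phi> \<tau> I s = esum \<phi> \<tau> (I - J) s * esum \<phi> \<tau> J s"
 by (simp add: esum_def sum.subset_diff[of J I] distrib_left exp_add)

text \<open>Mixing compares a past with a future, but I lies on both sides of the window from p to
  q. The exponential is split into a left and a right factor, and three covariances are estimated:
  right factor against the rest, left factor against Y, and left against right to reassemble the
  exponential.\<close>

lemma decouple:
 fixes Y :: "'a => complex"
 assumes c: "centered \<phi>" and Y: "Y \<in> borel_measurable (Fld {p..q})" "\<And>s. norm (Y s) \<le> 1" and pq: "p \<le> q"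
  and I: "finite I" "I \<subseteq> {..p - int m} \<union> {q + int m..}"
 shows "norm (expectation (\<lambda>s. Y s * esum \<phi> \<tau> I s) - expectation Y * expectation (esum \<phi> \<tau> I)) \<le> 48 * (A0 * a ^ m)"
proof -
 define e1 e2 where "e1 = esum \<phi> \<tau> (I \<inter> {..p - int m})" and "e2 = esum \<phi> \<tau> (I - {..p - int m})"
 have e: "esum \<phi> \<tau> I s = e1 s * e2 s" for s
  using esum_split[OF I(1), of "I \<inter> {..p - int m}" \<phi> \<tau> s] by (simp add: e1_def e2_def Diff_Int_distrib2 mult.commute Diff_Int)
 have n: "norm (e1 s) = 1" "norm (e2 s) = 1" for s by (simp_all add: e1_def e2_def)
 have m1: "e1 \<in> borel_measurable (Fld {..p - int m})" and m2: "e2 \<in> borel_measurable (Fld {q + int m..})"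
  unfolding e1_def e2_def using I(2) by (intro esum_Fld c; auto)+
 have m1': "e1 \<in> borel_measurable (Fld {..q})" by (rule Fld_mono[OF m1]) (use pq in auto)
 have Y': "Y \<in> borel_measurable (Fld {..q})" "Y \<in> borel_measurable (Fld {p..})" by (rule Fld_mono[OF Y(1)]; auto)+
 have M: "Y \<in> borel_measurable M" "e2 \<in> borel_measurable M"
  unfolding e2_def by (rule Fld_mono_measurable[OF Y(1)], rule esum_meas[OF c])
 let ?E = expectation
 have 1: "norm (?E (\<lambda>s. (e1 s * Y s) * e2 s) - ?E (\<lambda>s. e1 s * Y s) * ?E e2) \<le> 16 * (A0 * a ^ nat ((q + int m) - q))"
  by (rule mix_cov_complex[OF borel_measurable_times[OF m1' Y'(1)] m2]) (use n Y(2) in \<open>auto simp: norm_mult\<close>)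
 have 2: "norm (?E (\<lambda>s. e1 s * Y s) - ?E e1 * ?E Y) \<le> 16 * (A0 * a ^ nat (p - (p - int m)))"
  by (rule mix_cov_complex[OF m1 Y'(2)]) (use n Y(2) in auto)
 have 3: "norm (?E (\<lambda>s. e1 s * e2 s) - ?E e1 * ?E e2) \<le> 16 * (A0 * a ^ nat ((q + int m) - q))"
  by (rule mix_cov_complex[OF m1' m2]) (use n in auto)
 have le: "norm (?E e2) \<le> 1" "norm (?E Y) \<le> 1" by (rule norm_expectation_le; use M n Y(2) in simp)+
 have "norm (?E e2 * (?E (\<lambda>s. e1 s * Y s) - ?E e1 * ?E Y)) \<le> 16 * (A0 * a ^ m)"
  using 2 mult_mono[OF le(1) 2] by (simp add: norm_mult)
 moreover have "norm (?E Y * (?E (\<lambda>s. e1 s * e2 s) - ?E e1 * ?E e2)) \<le> 16 * (A0 * a ^ m)"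
  using 3 mult_mono[OF le(2) 3] by (simp add: norm_mult)
 moreover have "?E (\<lambda>s. Y s * esum \<phi> \<tau> I s) - ?E Y * ?E (esum \<phi> \<tau> I)
  = (?E (\<lambda>s. (e1 s * Y s) * e2 s) - ?E (\<lambda>s. e1 s * Y s) * ?E e2) + ?E e2 * (?E (\<lambda>s. e1 s * Y s) - ?E e1 * ?E Y)
   - ?E Y * (?E (\<lambda>s. e1 s * e2 s) - ?E e1 * ?E e2)"
  unfolding e by (simp add: algebra_simps)
 moreover have "norm (x + y - z) \<le> norm x + norm y + norm z" for x y z :: complex
  using norm_triangle_ineq4[of "x + y" z] norm_triangle_ineq[of x y] by linarith
 ultimately show ?thesis using 1 by (smt (verit) nat_int add_diff_cancel_left')
qed

lemma esum_remove:
 fixes Z :: "'a => complex"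
 assumes c: "centered \<phi>" and Z: "Z \<in> borel_measurable M" "\<And>s. norm (Z s) \<le> 1" and I: "finite I" "J \<subseteq> I"
 shows "norm (expectation (\<lambda>s. Z s * esum \<phi> \<tau> I s) - expectation (\<lambda>s. Z s * esum \<phi> \<tau> (I - J) s)) \<le> \<bar>\<tau>\<bar> * real (card J)"
proof -
 have m: "(\<lambda>s. Z s * esum \<phi> \<tau> K s) \<in> borel_measurable M" for K using Z(1) esum_meas[OF c] by measurable
 have i: "integrable M (\<lambda>s. Z s * esum \<phi> \<tau> K s)" for K using m Z(2) by (intro int_bounded[where B=1]) (auto simp: norm_mult)
 have "norm (Z s * esum \<phi> \<tau> I s - Z s * esum \<phi> \<tau> (I - J) s) \<le> \<bar>\<tau>\<bar> * real (card J)" for s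
 proof -
  have "Z s * esum \<phi> \<tau> I s - Z s * esum \<phi> \<tau> (I - J) s = Z s * esum \<phi> \<tau> (I - J) s * (esum \<phi> \<tau> J s - 1)"
   unfolding esum_split[OF I] by (simp add: algebra_simps)
  hence "norm (Z s * esum \<phi> \<tau> I s - Z s * esum \<phi> \<tau> (I - J) s) = norm (Z s) * norm (esum \<phi> \<tau> J s - 1)" by (simp add: norm_mult)
  also have "... \<le> 1 * \<bar>\<tau> * (\<Sum>i\<in>J. \<phi> (X i s))\<bar>"
   using iexp_approx1[of "\<tau> * (\<Sum>i\<in>J. \<phi> (X i s))" 0] by (intro mult_mono Z(2)) (auto simp: esum_def)
  also have "\<bar>\<Sum>i\<in>J. \<phi> (X i s)\<bar> \<le> (\<Sum>i\<in>J. 1)"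
   using c by (intro order.trans[OF sum_abs] sum_mono) (auto simp: centered_def)
  hence "1 * \<bar>\<tau> * (\<Sum>i\<in>J. \<phi> (X i s))\<bar> \<le> \<bar>\<tau>\<bar> * real (card J)" unfolding abs_mult by (simp add: mult_left_mono)
  finally show ?thesis .
 qed
 thus ?thesis unfolding Bochner_Integration.integral_diff[OF i i, symmetric] by (intro norm_expectation_le borel_measurable_diff m)
qed

text \<open>Stein's method after Bolthausen: removing a window of width \<open>m\<close> around \<open>i\<close> decouples the \<open>i\<close>-th summand from
 the rest, so the characteristic function \<open>f\<close> of the normalised sum almost solves \<open>f' t = - t v f t\<close>.\<close>

lemma stein_term:
 fixes n m :: nat and i :: int and \<tau> :: real
 assumes c: "centered \<phi>" and i: "i \<in> {1..int n}"
 defines "f \<equiv> expectation (esum \<phi> \<tau> {1..int n})"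
 shows "norm (expectation (\<lambda>s. of_real (\<phi> (X i s)) * esum \<phi> \<tau> {1..int n} s) - \<i> * of_real (\<tau> * (\<Sum>j\<in>{1..int n}. acov \<phi> \<phi> (j - i))) * f)
  \<le> 48 * (A0 * a ^ m) + 18 * \<tau>\<^sup>2 * (real m)\<^sup>2 + \<bar>\<tau>\<bar> * (96 * real m + 4 * real n) * (A0 * a ^ m)"
proof -
 let ?E = expectation and ?y = "\<lambda>i s. complex_of_real (\<phi> (X i s))"
 define T where "T = {1..int n}"
 define J where "J w = T \<inter> {i - int w<..<i + int w}" for w
 have fT: "finite T" "J w \<subseteq> T" "finite (J w)" for w by (auto simp: T_def J_def)
 have [measurable]: "\<phi> \<in> borel_measurable borel" and b: "\<And>x. \<bar>\<phi> x\<bar> \<le> 1" using c by (auto simp: centered_def)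
 note [measurable] = esum_meas[OF c]
 have cJ: "real (card (J w)) \<le> 2 * real w" for w
 proof -
  have "card (J w) \<le> card {i - int w<..<i + int w}" unfolding J_def by (rule card_mono) auto
  thus ?thesis by simp
 qed
 have ny: "norm (?y j s) \<le> 1" "norm (?y j s * ?y k s) \<le> 1" for j k s using b by (auto simp: norm_mult intro!: mult_le_one)
 have I: "integrable M (\<lambda>s. ?y j s * esum \<phi> \<tau> K s)" "integrable M (\<lambda>s. ?y j s * ?y k s * esum \<phi> \<tau> K s)" for j k K
  using ny by (intro int_bounded[where B=1]; auto simp: norm_mult)+
 let ?A = "\<lambda>s. \<Sum>j\<in>J m. \<phi> (X j s)" and ?R = "T - J m"
 let ?f = "\<lambda>s. ?y i s * esum \<phi> \<tau> T s" and ?g = "\<lambda>s. ?y i s * esum \<phi> \<tau> ?R s" and ?h = "\<lambda>s. ?y i s * of_real (?A s) * esum \<phi> \<tau> ?R s"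
 let ?w = "\<lambda>j s. ?y i s * ?y j s * esum \<phi> \<tau> ?R s" and ?r = "\<i> * complex_of_real \<tau>"
 let ?l = "\<lambda>s. ?f s - ?g s - ?r * ?h s"
 have bA: "\<bar>?A s\<bar> \<le> 2 * real m" for s
 proof -
  have "\<bar>?A s\<bar> \<le> (\<Sum>j\<in>J m. 1)" using b by (intro order.trans[OF sum_abs] sum_mono)
  thus ?thesis using cJ[of m] by simp
 qed
 have sumA: "?h s = (\<Sum>j\<in>J m. ?y i s * ?y j s * esum \<phi> \<tau> ?R s)" for s
  by (simp add: sum_distrib_left sum_distrib_right)
 have iA: "integrable M ?h" unfolding sumA by (rule Bochner_Integration.integrable_sum) (rule I(2))
 \<comment> \<open>Second-order expansion of the exponential over the window of width m around i,
   whose exponent is at most 2 m |\<tau>|.\<close>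
 have 1: "norm (?E ?f - ?E ?g - ?r * ?E ?h) \<le> 2 * \<tau>\<^sup>2 * (real m)\<^sup>2" (is "norm ?L \<le> _")
 proof -
  have "?L = ?E (\<lambda>s. ?l s)"
   using I iA by (simp del: of_real_sum)
  also have "norm ... \<le> 2 * \<tau>\<^sup>2 * (real m)\<^sup>2"
  proof (rule norm_expectation_le)
   fix s
   have "?l s
    = (?y i s * esum \<phi> \<tau> ?R s) * (esum \<phi> \<tau> (J m) s - (1 + \<i> * of_real (\<tau> * ?A s)))"
    unfolding esum_split[OF fT(1) fT(2)[of m], of \<phi> \<tau> s] by (simp add: algebra_simps)
   hence "norm (?l s)
    = norm (?y i s) * norm (esum \<phi> \<tau> (J m) s - (1 + \<i> * of_real (\<tau> * ?A s)))"
    by (simp only: norm_mult norm_esum mult_1_right)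
   also have "... \<le> 1 * ((\<tau> * ?A s)\<^sup>2 / 2)"
    using iexp_approx1[of "\<tau> * ?A s" 1] by (intro mult_mono ny) (auto simp: fact_numeral esum_def power2_eq_square)
   also have "... \<le> (\<tau>\<^sup>2 * (2 * real m)\<^sup>2) / 2"
    using mult_left_mono[OF power_mono[OF bA[of s] abs_ge_zero, of 2], of "\<tau>\<^sup>2"] by (simp add: power_mult_distrib)
   finally show "norm (?l s) \<le> 2 * \<tau>\<^sup>2 * (real m)\<^sup>2"
    by (simp add: power_mult_distrib)
  qed measurable
  finally show ?thesis .
 qed
 have yF: "?y j \<in> borel_measurable (Fld {p..q})" if "j \<in> {p..q}" for j p q
 proof -
  have [measurable]: "X j \<in> borel_measurable (Fld {p..q})" by (rule X_Fld[OF that])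
  show ?thesis by measurable
 qed
 \<comment> \<open>The zeroth-order term is nearly a product with the factor E \<phi>(X_i) =
   0.\<close>
 have "?R \<subseteq> {..i - int m} \<union> {i + int m..}" by (auto simp: J_def)
 from decouple[OF c yF[of i i i] ny(1) order_refl _ this, of \<tau>] have 2: "norm (?E ?g) \<le> 48 * (A0 * a ^ m)"
  using fT(1) centered_mean[OF c, of i] by simp
 \<comment> \<open>In the first-order term the pair X_i, X_j fills the window of width m, so it is
   widened to 2 m before decoupling. Taking out the further indices, and restoring the whole
   exponential afterwards, costs at most 4 m |\<tau>| each.\<close>
 have 3: "norm (?E (?w j) - of_real (acov \<phi> \<phi> (j - i)) * f) \<le> 8 * \<bar>\<tau>\<bar> * real m + 48 * (A0 * a ^ m)" (is "_ \<le> ?b")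
  if j: "j \<in> J m" for j
 proof -
  let ?R' = "T - J (2 * m)"
  have "J m \<subseteq> J (2 * m)" by (auto simp: J_def)
  hence R': "?R - (J (2 * m) - J m) = ?R'" and sub: "J (2 * m) - J m \<subseteq> ?R" using fT(2) by blast+
  have cd: "real (card (J (2 * m) - J m)) \<le> 4 * real m"
   using card_mono[of "J (2 * m)" "J (2 * m) - J m"] fT cJ[of "2 * m"] by auto
  have p1: "norm (?E (?w j) - ?E (\<lambda>s. ?y i s * ?y j s * esum \<phi> \<tau> ?R' s)) \<le> \<bar>\<tau>\<bar> * (4 * real m)"
   unfolding R'[symmetric] by (rule order.trans[OF esum_remove[OF c _ ny(2) _ sub] mult_left_mono[OF cd]]) (use fT in auto)
  have p3: "norm (f - ?E (esum \<phi> \<tau> ?R')) \<le> \<bar>\<tau>\<bar> * (4 * real m)"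
   using order.trans[OF esum_remove[OF c, of "\<lambda>_. 1" T "J (2 * m)" \<tau>] mult_left_mono[OF cJ]] fT by (simp add: f_def T_def)
  have E2: "?E (\<lambda>s. ?y i s * ?y j s) = of_real (acov \<phi> \<phi> (j - i))"
   using expectation_prod[OF c c, of i j] by (simp only: of_real_mult[symmetric] integral_complex_of_real)
  have p2: "norm (?E (\<lambda>s. ?y i s * ?y j s * esum \<phi> \<tau> ?R' s) - of_real (acov \<phi> \<phi> (j - i)) * ?E (esum \<phi> \<tau> ?R')) \<le> 48 * (A0 * a ^ m)"
   unfolding E2[symmetric] by (rule decouple[where p="i - int m" and q="i + int m", OF c borel_measurable_times[OF yF yF] ny(2)])
    (use j fT in \<open>auto simp: J_def\<close>)
  have "norm (?E (\<lambda>s. ?y i s * ?y j s)) \<le> 1" by (rule norm_expectation_le[OF _ ny(2)]) measurable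
  hence "\<bar>acov \<phi> \<phi> (j - i)\<bar> \<le> 1" unfolding E2 by simp
  hence "norm (of_real (acov \<phi> \<phi> (j - i)) * (f - ?E (esum \<phi> \<tau> ?R'))) \<le> 1 * (\<bar>\<tau>\<bar> * (4 * real m))"
   unfolding norm_mult by (intro mult_mono p3) auto
  moreover have "norm (x - c * z) \<le> b1 + b2 + b3" if "norm (x - y) \<le> b1" "norm (y - c * w) \<le> b2" "norm (c * (z - w)) \<le> b3" for x y z w c :: complex and b1 b2 b3
   using that norm_triangle_ineq4[of "(x - y) + (y - c * w)" "c * (z - w)"] norm_triangle_ineq[of "x - y" "y - c * w"] by (simp add: right_diff_distrib)
  from this[OF p1 p2 calculation] show ?thesis by (simp add: algebra_simps)
 qed

 let ?c = "\<lambda>j. acov \<phi> \<phi> (j - i)"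
 have 4: "norm (?E ?h - of_real (\<Sum>j\<in>J m. ?c j) * f) \<le> 2 * real m * ?b"
 proof -
  have "?E ?h - of_real (\<Sum>j\<in>J m. ?c j) * f = (\<Sum>j\<in>J m. ?E (?w j) - of_real (?c j) * f)"
   unfolding sumA using I by (simp add: Bochner_Integration.integral_sum sum_subtractf sum_distrib_right)
  also have "norm ... \<le> real (card (J m)) * ?b" by (rule sum_norm_bound[OF 3])
  also have "... \<le> 2 * real m * ?b" using cJ[of m] A0(1) a01 by (intro mult_right_mono) auto
  finally show ?thesis .
 qed
 \<comment> \<open>Extends the covariance sum from the window to all indices, so that the sum over i
   becomes the exact variance.\<close>
 have 5: "norm (of_real (\<Sum>j\<in>T - J m. ?c j) * f) \<le> real n * (4 * (A0 * a ^ m))"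
 proof -
  have "\<bar>?c j\<bar> \<le> 4 * (A0 * a ^ m)" if "j \<in> T - J m" for j
  proof -
   have "a ^ nat \<bar>j - i\<bar> \<le> a ^ m" using that a01 by (intro power_decreasing) (auto simp: J_def)
   from mult_left_mono[OF this, of "4 * A0"] show ?thesis using acov_bound[OF c c, of "j - i"] A0(1) by linarith
  qed
  hence "\<bar>\<Sum>j\<in>T - J m. ?c j\<bar> \<le> (\<Sum>j\<in>T - J m. 4 * (A0 * a ^ m))" by (intro order.trans[OF sum_abs] sum_mono)
  also have "... \<le> real n * (4 * (A0 * a ^ m))"
   using A0(1) a01 card_mono[of T "T - J m"] fT(1) by (auto simp: T_def intro!: mult_right_mono)
  finally show ?thesis
   using mult_mono[of "\<bar>\<Sum>j\<in>T - J m. ?c j\<bar>" "real n * (4 * (A0 * a ^ m))" "norm f" 1] norm_expectation_le[OF esum_meas[OF c], of \<tau> T 1] A0(1) a01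
   by (simp add: norm_mult f_def T_def del: of_real_sum)
 qed
 have tri: "norm (x + y + z - w) \<le> b1 + b2 + b3 + b4" if "norm x \<le> b1" "norm y \<le> b2" "norm z \<le> b3" "norm w \<le> b4" for x y z w :: complex and b1 b2 b3 b4
  using that norm_triangle_ineq4[of "x + y + z" w] norm_triangle_ineq[of "x + y" z] norm_triangle_ineq[of x y] by linarith
 have eq: "?E ?f - \<i> * of_real (\<tau> * (\<Sum>j\<in>T. ?c j)) * f = ?L + ?E ?g
  + ?r * (?E ?h - of_real (\<Sum>j\<in>J m. ?c j) * f) - ?r * (of_real (\<Sum>j\<in>T - J m. ?c j) * f)"
  unfolding sum.subset_diff[OF fT(2)[of m] fT(1), of ?c] by (simp add: algebra_simps del: of_real_sum)
 have "norm (?r * z) \<le> \<bar>\<tau>\<bar> * b" if "norm z \<le> b" for z b using that by (simp add: norm_mult mult_left_mono)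
 from tri[OF 1 2 this[OF 4] this[OF 5]] show ?thesis unfolding T_def[symmetric] eq by (simp add: algebra_simps power2_eq_square)
qed

text \<open>Summed over i, the estimates of \<open>stein_term\<close> say that the characteristic
  function almost solves the Gaussian equation with the variance v of stage n, and
  \<open>gaussian_ode\<close> integrates it. The width m stays free.\<close>

lemma stein_bound:
 fixes n m :: nat
 assumes c: "centered \<phi>" and n: "1 \<le> n" "m \<le> n"
 defines "v \<equiv> expectation (\<lambda>s. (\<Sum>i\<in>{1..int n}. \<phi> (X i s)) * (\<Sum>i\<in>{1..int n}. \<phi> (X i s))) / real n"
 shows "norm (expectation (\<lambda>s. iexp (t / sqrt n * (\<Sum>i\<in>{1..int n}. \<phi> (X i s)))) - of_real (exp (- (t\<^sup>2 * v / 2))))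
  \<le> \<bar>t\<bar> * ((48 + 100 * \<bar>t\<bar>) * A0 * (real n * a ^ m) + 18 * t\<^sup>2 * (real m)\<^sup>2 / sqrt n)" (is "_ \<le> \<bar>t\<bar> * ?b t")
proof -
 let ?S = "\<lambda>s. (\<Sum>i\<in>{1..int n}. \<phi> (X i s)) / sqrt n"
 have [measurable]: "\<phi> \<in> borel_measurable borel" and b: "\<And>x. \<bar>\<phi> x\<bar> \<le> 1" using c by (auto simp: centered_def)
 have Sm: "?S \<in> borel_measurable M" by measurable
 have Sb: "\<bar>?S s\<bar> \<le> real n" for s
 proof -
  have "\<bar>\<Sum>i\<in>{1..int n}. \<phi> (X i s)\<bar> \<le> (\<Sum>i\<in>{1..int n}. 1)" by (intro order.trans[OF sum_abs] sum_mono b)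
  also have "... \<le> real n * sqrt n" using n by simp
  finally show ?thesis using n by (simp add: divide_le_eq)
 qed
 let ?f = "\<lambda>t. expectation (\<lambda>s. iexp (t * ?S s))" and ?f' = "\<lambda>t. expectation (\<lambda>s. \<i> * of_real (?S s) * iexp (t * ?S s))"
 have D: "(?f has_vector_derivative ?f' x) (at x)" for x by (rule char_has_derivative[OF Sm Sb])
 have bound: "norm (?f' x + of_real (x * v) * ?f x) \<le> ?b t" if x: "\<bar>x\<bar> \<le> \<bar>t\<bar>" for x
 proof -
  let ?\<tau> = "x / sqrt n" and ?T = "{1..int n}"
  have e: "iexp (x * ?S s) = esum \<phi> ?\<tau> ?T s" for s by (simp add: esum_def)
  have iy: "integrable M (\<lambda>s. of_real (\<phi> (X i s)) * esum \<phi> ?\<tau> ?T s)" for i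
   using b esum_meas[OF c, of ?\<tau> ?T] by (intro int_bounded[where B=1]) (auto simp: norm_mult)
  have f': "?f' x = \<i> / of_real (sqrt n) * (\<Sum>i\<in>?T. expectation (\<lambda>s. of_real (\<phi> (X i s)) * esum \<phi> ?\<tau> ?T s))"
  proof -
   have q: "\<i> * of_real (?S s) * esum \<phi> ?\<tau> ?T s = \<i> / of_real (sqrt n) * (\<Sum>i\<in>?T. of_real (\<phi> (X i s)) * esum \<phi> ?\<tau> ?T s)" for s
    by (simp add: sum_distrib_right)
   show ?thesis unfolding e q using iy by (simp add: Bochner_Integration.integral_sum)
  qed
  have gen: "\<i> / of_real r * (\<Sum>i\<in>I. E i) + of_real ((\<Sum>i\<in>I. c i) / r) * F = \<i> / of_real r * (\<Sum>i\<in>I. E i - \<i> * of_real (c i) * F)" for r F E c and I :: "int set"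
  proof -
   have eq: "(\<Sum>i\<in>I. E i - \<i> * of_real (c i) * F) = (\<Sum>i\<in>I. E i) - \<i> * of_real (\<Sum>i\<in>I. c i) * F"
    by (simp add: sum_subtractf sum_distrib_left sum_distrib_right)
   show ?thesis unfolding eq by (simp add: right_diff_distrib diff_divide_distrib mult.assoc[symmetric] del: of_real_sum)
  qed
  have v: "x * v = (\<Sum>i\<in>?T. ?\<tau> * (\<Sum>j\<in>?T. acov \<phi> \<phi> (j - i))) / sqrt n"
   unfolding v_def expectation_sum_prod[OF c c finite_atLeastAtMost_int finite_atLeastAtMost_int] sum_distrib_left[symmetric] using n by simp
  define d where "d i = expectation (\<lambda>s. of_real (\<phi> (X i s)) * esum \<phi> ?\<tau> ?T s) - \<i> * of_real (?\<tau> * (\<Sum>j\<in>?T. acov \<phi> \<phi> (j - i))) * ?f x" for i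
  define K where "K = 48 * (A0 * a ^ m) + 18 * ?\<tau>\<^sup>2 * (real m)\<^sup>2 + \<bar>?\<tau>\<bar> * (96 * real m + 4 * real n) * (A0 * a ^ m)"
  have dK: "norm (d i) \<le> K" if "i \<in> ?T" for i unfolding d_def K_def e by (rule stein_term[OF c that])
  have "?f' x + of_real (x * v) * ?f x = \<i> / of_real (sqrt n) * (\<Sum>i\<in>?T. d i)"
   unfolding f' v d_def by (rule gen)
  also have "norm ... = norm (\<Sum>i\<in>?T. d i) / sqrt n" by (simp add: norm_mult norm_divide)
  also have "... \<le> real n * K / sqrt n"
   using sum_norm_bound[of ?T d K] dK by (intro divide_right_mono) auto
  also have "... \<le> ?b x"
  proof -
   have r: "1 \<le> sqrt n" "sqrt n \<le> real n" using n by (simp, intro real_le_lsqrt self_le_power) auto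
   have d: "real n * c / sqrt n = sqrt n * c" for c using real_div_sqrt[of "real n"] by (metis times_divide_eq_left of_nat_0_le_iff)
   have A: "0 \<le> A0 * a ^ m" using A0(1) a01 by simp
   have "real n * (48 * (A0 * a ^ m)) / sqrt n = 48 * (sqrt n * (A0 * a ^ m))" unfolding d by simp
   also have "... \<le> 48 * (real n * (A0 * a ^ m))" using r A by (intro mult_left_mono mult_right_mono) auto
   finally have 1: "real n * (48 * (A0 * a ^ m)) / sqrt n \<le> 48 * (real n * (A0 * a ^ m))" .
   have 2: "real n * (18 * ?\<tau>\<^sup>2 * (real m)\<^sup>2) / sqrt n = 18 * x\<^sup>2 * (real m)\<^sup>2 / sqrt n" using n by (simp add: power_divide)
   have "real n * (\<bar>?\<tau>\<bar> * (96 * real m + 4 * real n) * (A0 * a ^ m)) / sqrt n = \<bar>x\<bar> * ((96 * real m + 4 * real n) * (A0 * a ^ m))"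
    unfolding d using r(1) by simp
   also have "... \<le> \<bar>x\<bar> * ((100 * real n) * (A0 * a ^ m))" using n A by (intro mult_left_mono mult_right_mono) auto
   finally have 3: "real n * (\<bar>?\<tau>\<bar> * (96 * real m + 4 * real n) * (A0 * a ^ m)) / sqrt n \<le> \<bar>x\<bar> * ((100 * real n) * (A0 * a ^ m))" .
   have "48 * (real n * (A0 * a ^ m)) + \<bar>x\<bar> * ((100 * real n) * (A0 * a ^ m)) = (48 + 100 * \<bar>x\<bar>) * A0 * (real n * a ^ m)" by (simp add: algebra_simps)
   thus ?thesis unfolding K_def distrib_left[of "real n"] add_divide_distrib using 1 2 3 by linarith
  qed
  also have "... \<le> ?b t" using x abs_le_square_iff[of x t] A0(1) a01 by (intro add_mono mult_right_mono divide_right_mono mult_left_mono) simp_all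
  finally show ?thesis .
 qed
 have "norm (?f t - of_real (exp (- (t\<^sup>2 * v / 2)))) \<le> \<bar>t\<bar> * ?b t"
  by (rule gaussian_ode[OF D bound]) (auto simp: prob_space v_def)
 thus ?thesis by simp
qed

lemma clt:
 assumes c: "centered \<phi>"
 shows "(\<lambda>n. expectation (\<lambda>s. iexp (t / sqrt n * (\<Sum>i\<in>{1..int n}. \<phi> (X i s))))) \<longlonglongrightarrow> of_real (exp (- (t\<^sup>2 * Gam \<phi> \<phi> / 2)))"
proof -
 \<comment> \<open>The width has to make n a^m small while m^2 / sqrt n tends to 0; any positive
   power of n below 1/4 achieves both.\<close>
 define m where "m n = nat \<lfloor>real n powr (1/8)\<rfloor>" for n
 let ?V = "\<lambda>n. expectation (\<lambda>s. (\<Sum>i\<in>{1..int n}. \<phi> (X i s)) * (\<Sum>i\<in>{1..int n}. \<phi> (X i s))) / real n"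
 let ?err = "\<lambda>n. \<bar>t\<bar> * ((48 + 100 * \<bar>t\<bar>) * A0 * (real n * a ^ m n) + 18 * t\<^sup>2 * (real (m n))\<^sup>2 / sqrt n)"
 have mn: "real (m n) \<le> real n powr (1/8)" "real n powr (1/8) - 1 \<le> real (m n)" for n unfolding m_def by (simp, linarith)
 have "(\<lambda>n. real n * a ^ m n) \<longlonglongrightarrow> 0"
 proof (rule tendsto_sandwich[OF _ _ tendsto_const])
  show "\<forall>\<^sub>F n in sequentially. real n * a ^ m n \<le> real n * a powr (real n powr (1/8) - 1)"
   unfolding powr_realpow[OF a01(1), symmetric] using mn(2) a01 by (intro always_eventually allI mult_left_mono powr_mono') auto
  show "(\<lambda>n. real n * a powr (real n powr (1/8) - 1)) \<longlonglongrightarrow> 0" using a01 by real_asymp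
 qed (use a01 in \<open>auto intro!: always_eventually\<close>)
 moreover have "(\<lambda>n. (real (m n))\<^sup>2 / sqrt n) \<longlonglongrightarrow> 0"
 proof (rule tendsto_sandwich[OF _ _ tendsto_const])
  show "\<forall>\<^sub>F n in sequentially. (real (m n))\<^sup>2 / sqrt n \<le> (real n powr (1/8))\<^sup>2 / sqrt n"
   using mn(1) by (intro always_eventually allI divide_right_mono power_mono) auto
  show "(\<lambda>n. (real n powr (1/8))\<^sup>2 / sqrt n) \<longlonglongrightarrow> 0" by real_asymp
 qed auto
 ultimately have "(\<lambda>n. \<bar>t\<bar> * ((48 + 100 * \<bar>t\<bar>) * A0 * (real n * a ^ m n) + 18 * t\<^sup>2 * ((real (m n))\<^sup>2 / sqrt n))) \<longlonglongrightarrow> \<bar>t\<bar> * ((48 + 100 * \<bar>t\<bar>) * A0 * 0 + 18 * t\<^sup>2 * 0)"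
  by (intro tendsto_add tendsto_mult tendsto_const)
 hence err: "?err \<longlonglongrightarrow> 0" by simp
 have "(\<lambda>n. expectation (\<lambda>s. iexp (t / sqrt n * (\<Sum>i\<in>{1..int n}. \<phi> (X i s)))) - of_real (exp (- (t\<^sup>2 * ?V n / 2)))) \<longlonglongrightarrow> 0"
 proof (rule Lim_null_comparison[OF _ err])
  have "m n \<le> n" if "n \<ge> 1" for n
  proof -
   have "real n powr (1/8) \<le> real n powr 1" using that by (intro powr_mono) auto
   thus ?thesis using mn(1)[of n] by simp
  qed
  thus "\<forall>\<^sub>F n in sequentially. norm (expectation (\<lambda>s. iexp (t / sqrt n * (\<Sum>i\<in>{1..int n}. \<phi> (X i s)))) - of_real (exp (- (t\<^sup>2 * ?V n / 2)))) \<le> ?err n"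
   unfolding eventually_sequentially by (intro exI[of _ 1] allI impI stein_bound[OF c]) auto
 qed
 moreover have "(\<lambda>n. complex_of_real (exp (- (t\<^sup>2 * ?V n / 2)))) \<longlonglongrightarrow> of_real (exp (- (t\<^sup>2 * Gam \<phi> \<phi> / 2)))"
  by (intro tendsto_of_real tendsto_exp tendsto_minus tendsto_divide tendsto_mult tendsto_const variance_limit c) simp
 ultimately have "(\<lambda>n. (expectation (\<lambda>s. iexp (t / sqrt n * (\<Sum>i\<in>{1..int n}. \<phi> (X i s)))) - of_real (exp (- (t\<^sup>2 * ?V n / 2)))) + of_real (exp (- (t\<^sup>2 * ?V n / 2))))
  \<longlonglongrightarrow> 0 + complex_of_real (exp (- (t\<^sup>2 * Gam \<phi> \<phi> / 2)))" by (rule tendsto_add)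
 thus ?thesis by (simp only: diff_add_cancel add_0)
qed

end

section \<open>From characteristic functions to finite-dimensional convergence\<close>

lemma (in prob_space) integrable_bdd:
 fixes f :: "'a => 'c::{banach, second_countable_topology}"
 assumes "f \<in> borel_measurable M" "\<And>x. x \<in> space M ==> norm (f x) \<le> B"
 shows "integrable M f"
 using assms by (intro integrable_const_bound[where B=B]) (auto intro!: AE_I2)

text \<open>Trigonometric polynomials in the coordinates from T: their expectations are determined
  by characteristic functions, and they form an algebra, as Stone-Weierstrass requires.\<close>

inductive_set trig :: "'t set => (('t => real) => complex) set" for T where
 exp: "(\<lambda>x. iexp (\<Sum>t\<in>T. b t * x t)) \<in> trig T"
| add: "f \<in> trig T ==> h \<in> trig T ==> (\<lambda>x. f x + h x) \<in> trig T"
| scale: "f \<in> trig T ==> (\<lambda>x. c * f x) \<in> trig T"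

lemma trig_mult: "f \<in> trig T ==> h \<in> trig T ==> (\<lambda>x. f x * h x) \<in> trig T"
proof (induction f rule: trig.induct)
 case (exp b)
 from exp show ?case
 proof (induction h rule: trig.induct)
  case (exp c)
  have "iexp (\<Sum>t\<in>T. b t * x t) * iexp (\<Sum>t\<in>T. c t * x t) = iexp (\<Sum>t\<in>T. (b t + c t) * x t)" for x
   by (simp add: mult_exp_exp distrib_left distrib_right sum.distrib)
  thus ?case using trig.exp[of "\<lambda>t. b t + c t" T] by simp
 next
  case (scale h c)
  thus ?case using trig.scale[of _ T c] by (simp add: mult.left_commute)
 qed (simp add: distrib_left trig.add)
next
 case (scale f c)
 thus ?case using trig.scale[of "\<lambda>x. f x * h x" T c] by (simp add: mult.assoc)
qed (simp add: distrib_right trig.add)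

lemma trig_const: "(\<lambda>x. c) \<in> trig T"
 using trig.scale[OF trig.exp[of "\<lambda>_. 0" T], of c] by simp

lemma trig_sin:
 assumes "finite T" "t \<in> T"
 shows "(\<lambda>x. of_real (sin (c * x t))) \<in> trig T"
proof -
 have e: "(\<lambda>x. iexp (a * x t)) \<in> trig T" for a
 proof -
  have "(\<Sum>t'\<in>T. (if t' = t then a else 0) * x t') = a * x t" for x
   using assms by (simp add: if_distrib[of "\<lambda>a. a * _"] cong: if_cong)
  thus ?thesis using trig.exp[of "\<lambda>t'. if t' = t then a else 0" T] by simp
 qed
 have "complex_of_real (sin (c * x t)) = 1 / (2 * \<i>) * iexp (c * x t) + - 1 / (2 * \<i>) * iexp (- c * x t)" for x
  by (simp add: sin_of_real[symmetric] sin_exp_eq del: sin_of_real) (simp add: algebra_simps diff_divide_distrib)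
 thus ?thesis using trig.add[OF trig.scale[OF e[of c]] trig.scale[OF e[of "- c"]], of "1 / (2 * \<i>)" "- 1 / (2 * \<i>)"]
  by simp
qed

lemma trig_convergence:
 assumes M: "prob_space M" and N: "prob_space N"
  and [measurable]: "\<And>n t. (\<lambda>s. X n s t) \<in> borel_measurable M" "\<And>t. (\<lambda>s. Y s t) \<in> borel_measurable N"
  and conv: "\<And>b. (\<lambda>n. integral\<^sup>L M (\<lambda>s. iexp (\<Sum>t\<in>T. b t * X n s t))) \<longlonglongrightarrow> integral\<^sup>L N (\<lambda>s. iexp (\<Sum>t\<in>T. b t * Y s t))"
  and "f \<in> trig T"
 shows "(\<forall>n. integrable M (\<lambda>s. f (X n s))) \<and> integrable N (\<lambda>s. f (Y s)) \<and>
  (\<lambda>n. integral\<^sup>L M (\<lambda>s. f (X n s))) \<longlonglongrightarrow> integral\<^sup>L N (\<lambda>s. f (Y s))"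
 using \<open>f \<in> trig T\<close>
proof (induction f rule: trig.induct)
 case (exp b)
 show ?case
  by (intro conjI allI conv prob_space.integrable_bdd[OF M, where B=1] prob_space.integrable_bdd[OF N, where B=1]; (measurable | simp))
qed (auto intro!: tendsto_add tendsto_mult)

text \<open>On the box of radius \<open>R\<close>, \<open>F\<close> is a continuous function of the sines of \<open>\<pi> x\<^sub>t / (2 R)\<close>; Stone--Weierstrass
 yields a polynomial in these sines, which by periodicity stays bounded outside the box.\<close>

lemma trig_approx:
 fixes F :: "('t => real) => real"
 assumes T: "finite T" and B: "\<And>x. \<bar>F x\<bar> \<le> B"
  and L: "\<And>x y \<delta>. (\<And>t. t \<in> T ==> \<bar>x t - y t\<bar> \<le> \<delta>) ==> 0 \<le> \<delta> ==> \<bar>F x - F y\<bar> \<le> L * \<delta>"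
  and R: "R > 0" and e: "e > 0"
 shows "\<exists>q. (\<lambda>x. of_real (q x)) \<in> trig T \<and> (\<forall>x. \<bar>F x - q x\<bar> \<le> e + 2 * B * ((\<Sum>t\<in>T. (x t)\<^sup>2) / R\<^sup>2))"
proof -
 let ?i = "to_nat_on T" and ?t = "from_nat_into T"
 have ti: "?t (?i t) = t" if "t \<in> T" for t by (rule from_nat_into_to_nat_on[OF countable_finite[OF T] that])
 \<comment> \<open>A copy of the cube of sines, with T encoded in the naturals. The remaining
   coordinates are pinned to 0, so that coordinates coming from T separate the points.\<close>
 define S where "S = PiE (UNIV :: nat set) (\<lambda>k. if k \<in> ?i ` T then {-1..1::real} else {0})"
 define W where "W x k = (if k \<in> ?i ` T then sin (pi / (2 * R) * x (?t k)) else 0)" for x :: "'t => real" and k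
 define rs where "rs = {r. continuous_on S r \<and> (\<lambda>x. complex_of_real (r (W x))) \<in> trig T}"
 \<comment> \<open>On [-R, R] the arcsine undoes the sine in W, so H (W x) = F x for x in the
   box.\<close>
 define H where "H s = F (\<lambda>t. 2 * R / pi * arcsin (s (?i t)))" for s
 have St: "- 1 \<le> s k" "s k \<le> 1" "k \<notin> ?i ` T ==> s k = 0" if "s \<in> S" for s k
  using PiE_mem[OF that[unfolded S_def], of k] by (auto split: if_splits)
 have coord: "continuous_on S (\<lambda>s. s k)" for k by (rule continuous_on_subset[OF continuous_on_product_coordinates subset_UNIV])
 interpret function_ring_on rs S
 proof
  have "compactin (product_topology (\<lambda>_. euclidean) UNIV) S" unfolding S_def compactin_PiE by auto
  thus "compact S" by (simp add: euclidean_product_topology)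
  fix f h assume f: "f \<in> rs"
  thus "continuous_on S f" unfolding rs_def by blast
  assume h: "h \<in> rs"
  show "(\<lambda>x. f x + h x) \<in> rs" using f h unfolding rs_def mem_Collect_eq of_real_add by (intro conjI continuous_on_add trig.add) blast+
  show "(\<lambda>x. f x * h x) \<in> rs" using f h unfolding rs_def mem_Collect_eq of_real_mult by (intro conjI continuous_on_mult trig_mult) blast+
 next
  show "(\<lambda>_. c) \<in> rs" for c by (simp add: rs_def trig_const)
  show "\<exists>f\<in>rs. f x \<noteq> f y" if "x \<in> S" "y \<in> S" "x \<noteq> y" for x y
  proof -
   obtain k where k: "x k \<noteq> y k" using \<open>x \<noteq> y\<close> by blast
   hence k': "k \<in> ?i ` T" using St(3)[OF that(1), of k] St(3)[OF that(2), of k] by (cases "k \<in> ?i ` T") simp_all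
   then obtain t where "t \<in> T" "k = ?i t" by blast
   hence "(\<lambda>x. complex_of_real (W x k)) \<in> trig T" using trig_sin[OF T, of t "pi / (2 * R)"] k' by (simp add: W_def ti)
   hence "(\<lambda>s. s k) \<in> rs" using coord unfolding rs_def by blast
   from bexI[where P="\<lambda>f. f x \<noteq> f y", OF k this] show ?thesis .
  qed
 qed
 have FL: "\<bar>F x - F y\<bar> \<le> L * (\<Sum>t\<in>T. \<bar>x t - y t\<bar>)" for x y
 proof (rule L)
  show "\<bar>x t - y t\<bar> \<le> (\<Sum>t\<in>T. \<bar>x t - y t\<bar>)" if "t \<in> T" for t
   using T that by (intro member_le_sum[of t T "\<lambda>t. \<bar>x t - y t\<bar>"]) auto
 qed (simp add: sum_nonneg)
 have "continuous_on S H"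
  unfolding continuous_on_def
 proof
  fix s assume s: "s \<in> S"
  let ?d = "\<lambda>y. \<Sum>t\<in>T. \<bar>2 * R / pi * arcsin (y (?i t)) - 2 * R / pi * arcsin (s (?i t))\<bar>"
  have "continuous_on S (\<lambda>s. arcsin (s k))" for k by (rule continuous_on_arcsin[OF coord]) (use St in blast)
  hence "continuous_on S ?d"
   by (intro continuous_on_sum continuous_on_rabs continuous_on_diff continuous_on_mult_left continuous_on_const)
  hence "(?d \<longlongrightarrow> ?d s) (at s within S)" using s unfolding continuous_on_def by blast
  hence "((\<lambda>y. L * ?d y) \<longlongrightarrow> 0) (at s within S)" by (intro tendsto_mult_right_zero) simp
  moreover have "norm (H y - H s) \<le> L * ?d y" for y
   unfolding H_def real_norm_def by (rule FL)
  ultimately have "((\<lambda>y. H y - H s) \<longlongrightarrow> 0) (at s within S)" by (rule Lim_null_comparison[OF always_eventually, OF allI, rotated])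
  thus "(H \<longlongrightarrow> H s) (at s within S)" by (rule LIM_zero_cancel)
 qed
 then obtain r where r: "r \<in> rs" and approx: "\<And>s. s \<in> S ==> \<bar>H s - r s\<bar> < e" using Stone_Weierstrass_basic[OF _ e] by blast
 have "\<bar>F x - r (W x)\<bar> \<le> e + 2 * B * ((\<Sum>t\<in>T. (x t)\<^sup>2) / R\<^sup>2)" for x
 proof -
  have "W x \<in> S" unfolding S_def W_def by (rule PiE_I) simp_all
  note a = approx[OF this]
  have B0: "0 \<le> B" using B[of x] by simp
  have "\<bar>F x - H (W x)\<bar> \<le> 2 * B * ((\<Sum>t\<in>T. (x t)\<^sup>2) / R\<^sup>2)"
  proof (cases "\<forall>t\<in>T. \<bar>x t\<bar> \<le> R")
   case True
   have "x t = 2 * R / pi * arcsin (W x (?i t))" if "t \<in> T" for t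
   proof -
    define y where "y = pi / (2 * R) * x t"
    have "\<bar>y\<bar> \<le> pi / (2 * R) * R" unfolding y_def abs_mult using True that R by (intro mult_mono) auto
    hence "\<bar>y\<bar> \<le> pi / 2" using R by simp
    hence "arcsin (sin y) = y" by (intro arcsin_sin) linarith+
    hence "arcsin (W x (?i t)) = pi / (2 * R) * x t" using that by (simp add: W_def ti y_def)
    thus ?thesis using R by simp
   qed
   hence "\<bar>F x - H (W x)\<bar> \<le> L * 0" unfolding H_def by (intro L) simp_all
   moreover have "0 \<le> 2 * B * ((\<Sum>t\<in>T. (x t)\<^sup>2) / R\<^sup>2)" using B0 by (intro mult_nonneg_nonneg divide_nonneg_nonneg sum_nonneg) auto
   ultimately show ?thesis by simp
  next
   case False
   \<comment> \<open>Outside the box some |x t| exceeds R, so the second term of the claim already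
     reaches the trivial bound 2 B.\<close>
   then obtain t where t: "t \<in> T" "R \<le> \<bar>x t\<bar>" by force
   have "R\<^sup>2 \<le> (x t)\<^sup>2" using power_mono[OF t(2), of 2] R by simp
   also have "... \<le> (\<Sum>t\<in>T. (x t)\<^sup>2)" using t(1) T by (intro member_le_sum) auto
   finally have "2 * B * 1 \<le> 2 * B * ((\<Sum>t\<in>T. (x t)\<^sup>2) / R\<^sup>2)" using R B0 by (intro mult_left_mono) auto
   moreover have "\<bar>F x - H (W x)\<bar> \<le> 2 * B" using B[of x] B[of "\<lambda>t. 2 * R / pi * arcsin (W x (?i t))"] unfolding H_def by linarith
   ultimately show ?thesis by linarith
  qed
  thus ?thesis using a by linarith
 qed
 thus ?thesis using r by (intro exI[of _ "\<lambda>x. r (W x)"]) (simp add: rs_def)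
qed

lemma trig_measurable:
 assumes "f \<in> trig T" and [measurable]: "\<And>t. (\<lambda>s. \<xi> s t) \<in> borel_measurable M"
 shows "(\<lambda>s. f (\<xi> s)) \<in> borel_measurable M"
 using assms(1)
proof induction
 case (exp b)
 show ?case by measurable
qed (auto intro: borel_measurable_add borel_measurable_times)

text \<open>With accuracy 1/k on boxes of radius k, trigonometric polynomials converge to F
  pointwise, and they are measurable by construction.\<close>

lemma lipschitz_coordinates_measurable:
 fixes \<xi> :: "'a => 't => real"
 assumes T: "finite T" and meas: "\<And>t. (\<lambda>s. \<xi> s t) \<in> borel_measurable M" and B: "\<And>x. \<bar>F x\<bar> \<le> B"
  and L: "\<And>x y \<delta>. (\<And>t. t \<in> T ==> \<bar>x t - y t\<bar> \<le> \<delta>) ==> 0 \<le> \<delta> ==> \<bar>F x - F y\<bar> \<le> L * \<delta>"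
 shows "(\<lambda>s. F (\<xi> s)) \<in> borel_measurable M"
proof -
 have "\<exists>q. (\<lambda>x. of_real (q x)) \<in> trig T \<and> (\<forall>x. \<bar>F x - q x\<bar> \<le> 1 / real (Suc k) + 2 * B * ((\<Sum>t\<in>T. (x t)\<^sup>2) / (real (Suc k))\<^sup>2))" for k
  by (rule trig_approx[OF T B L]) auto
 then obtain q where q: "\<And>k. (\<lambda>x. complex_of_real (q k x)) \<in> trig T"
  and qa: "\<And>k x. \<bar>F x - q k x\<bar> \<le> 1 / real (Suc k) + 2 * B * ((\<Sum>t\<in>T. (x t)\<^sup>2) / (real (Suc k))\<^sup>2)" by metis
 show ?thesis
 proof (rule borel_measurable_LIMSEQ_real)
  show "(\<lambda>s. q k (\<xi> s)) \<in> borel_measurable M" for k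
   using measurable_compose[OF trig_measurable[where \<xi>=\<xi>, OF q meas] borel_measurable_Re] by simp
  fix s
  have z: "(\<lambda>k. 1 / real (Suc k)) \<longlonglongrightarrow> 0" using LIMSEQ_inverse_real_of_nat by (simp add: inverse_eq_divide)
  have "(\<lambda>k. 1 / real (Suc k) + 2 * B * (\<Sum>t\<in>T. (\<xi> s t)\<^sup>2) * (1 / real (Suc k))\<^sup>2) \<longlonglongrightarrow> 0 + 2 * B * (\<Sum>t\<in>T. (\<xi> s t)\<^sup>2) * 0\<^sup>2"
   by (intro tendsto_intros z)
  hence lim: "(\<lambda>k. 1 / real (Suc k) + 2 * B * ((\<Sum>t\<in>T. (\<xi> s t)\<^sup>2) / (real (Suc k))\<^sup>2)) \<longlonglongrightarrow> 0"
   by (simp add: power_divide del: of_nat_Suc)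
  have "norm (q k (\<xi> s) - F (\<xi> s)) \<le> 1 / real (Suc k) + 2 * B * ((\<Sum>t\<in>T. (\<xi> s t)\<^sup>2) / (real (Suc k))\<^sup>2)" for k
   using qa[of "\<xi> s" k] by (simp only: real_norm_def abs_minus_commute)
  hence "(\<lambda>k. q k (\<xi> s) - F (\<xi> s)) \<longlonglongrightarrow> 0" by (intro Lim_null_comparison[OF always_eventually lim] allI)
  thus "(\<lambda>k. q k (\<xi> s)) \<longlonglongrightarrow> F (\<xi> s)" by (rule LIM_zero_cancel)
 qed
qed

text \<open>Uniform second moments play the role of tightness: they bound the expected cost of
  leaving the box, so that one trigonometric polynomial approximates F in mean for all
  \<open>X n\<close> and for Y at once.\<close>

lemma fidi_lipschitz:
 fixes X :: "nat => 'a => 't => real" and Y :: "'b => 't => real"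
 assumes M: "prob_space M" and N: "prob_space N" and T: "finite T"
  and X: "\<And>n t. (\<lambda>s. X n s t) \<in> borel_measurable M" and Y: "\<And>t. (\<lambda>s. Y s t) \<in> borel_measurable N"
  and sq: "\<And>n t. t \<in> T ==> integrable M (\<lambda>s. (X n s t)\<^sup>2)" "\<And>n t. t \<in> T ==> integral\<^sup>L M (\<lambda>s. (X n s t)\<^sup>2) \<le> c"
   "\<And>t. t \<in> T ==> integrable N (\<lambda>s. (Y s t)\<^sup>2)" "\<And>t. t \<in> T ==> integral\<^sup>L N (\<lambda>s. (Y s t)\<^sup>2) \<le> c"
  and conv: "\<And>b. (\<lambda>n. integral\<^sup>L M (\<lambda>s. iexp (\<Sum>t\<in>T. b t * X n s t))) \<longlonglongrightarrow> integral\<^sup>L N (\<lambda>s. iexp (\<Sum>t\<in>T. b t * Y s t))"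
  and B: "\<And>x. \<bar>F x\<bar> \<le> B"
  and L: "\<And>x y \<delta>. (\<And>t. t \<in> T ==> \<bar>x t - y t\<bar> \<le> \<delta>) ==> 0 \<le> \<delta> ==> \<bar>F x - F y\<bar> \<le> L * \<delta>"
 shows "(\<lambda>n. integral\<^sup>L M (\<lambda>s. F (X n s))) \<longlonglongrightarrow> integral\<^sup>L N (\<lambda>s. F (Y s))"
proof (rule LIMSEQ_I)
 fix e :: real assume e: "e > 0"
 have B0: "B \<ge> 0" using B[of undefined] by linarith
 obtain m :: nat where m: "2 * B * (real (card T) * c) / (e / 8) < real m" using reals_Archimedean2 by blast
 define R where "R = real (Suc m)"
 have R: "R \<ge> 1" "2 * B * (real (card T) * c / R\<^sup>2) \<le> e / 8"
 proof -
  show 1: "R \<ge> 1" by (simp add: R_def)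
  have "2 * B * (real (card T) * c) \<le> e / 8 * R" using m e by (simp add: R_def pos_divide_less_eq algebra_simps)
  also have "... \<le> e / 8 * R\<^sup>2" using 1 e by (intro mult_left_mono) (auto simp: power2_eq_square)
  finally show "2 * B * (real (card T) * c / R\<^sup>2) \<le> e / 8" using 1 by (simp add: pos_divide_le_eq)
 qed
 obtain q where q: "(\<lambda>x. complex_of_real (q x)) \<in> trig T"
  and qa: "\<And>x. \<bar>F x - q x\<bar> \<le> e / 8 + 2 * B * ((\<Sum>t\<in>T. (x t)\<^sup>2) / R\<^sup>2)"
  using trig_approx[of T F B L R "e / 8", OF T B L] R(1) e by auto
 note tc = trig_convergence[OF M N X Y conv q]
 have close: "\<bar>integral\<^sup>L P (\<lambda>s. F (Z s)) - integral\<^sup>L P (\<lambda>s. q (Z s))\<bar> \<le> e / 4"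
  if P: "prob_space P" and Z: "\<And>t. (\<lambda>s. Z s t) \<in> borel_measurable P" and iq: "integrable P (\<lambda>s. complex_of_real (q (Z s)))"
   and i2: "\<And>t. t \<in> T ==> integrable P (\<lambda>s. (Z s t)\<^sup>2)" "\<And>t. t \<in> T ==> integral\<^sup>L P (\<lambda>s. (Z s t)\<^sup>2) \<le> c"
  for P :: "'z measure" and Z
 proof -
  interpret P: prob_space P by (rule P)
  have iF: "integrable P (\<lambda>s. F (Z s))"
   using lipschitz_coordinates_measurable[OF T Z B L] B by (intro P.integrable_bdd[where B=B]) auto
  have iq': "integrable P (\<lambda>s. q (Z s))" using integrable_Re[OF iq] by (simp only: Re_complex_of_real)
  have i: "integrable P (\<lambda>s. e / 8 + 2 * B * ((\<Sum>t\<in>T. (Z s t)\<^sup>2) / R\<^sup>2))" using i2 by auto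
  have "\<bar>integral\<^sup>L P (\<lambda>s. F (Z s)) - integral\<^sup>L P (\<lambda>s. q (Z s))\<bar> = \<bar>P.expectation (\<lambda>s. F (Z s) - q (Z s))\<bar>" using iF iq' by simp
  also have "... \<le> P.expectation (\<lambda>s. \<bar>F (Z s) - q (Z s)\<bar>)" by (rule integral_abs_bound)
  also have "... \<le> P.expectation (\<lambda>s. e / 8 + 2 * B * ((\<Sum>t\<in>T. (Z s t)\<^sup>2) / R\<^sup>2))"
   using iF iq' i qa by (intro integral_mono) auto
  also have "... = e / 8 + 2 * B * ((\<Sum>t\<in>T. P.expectation (\<lambda>s. (Z s t)\<^sup>2)) / R\<^sup>2)"
   using i2 by (simp add: P.prob_space Bochner_Integration.integral_sum)
  also have "... \<le> e / 8 + 2 * B * (real (card T) * c / R\<^sup>2)"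
   using B0 i2(2) by (intro add_left_mono mult_left_mono divide_right_mono sum_bounded_above) auto
  finally show ?thesis using R(2) by linarith
 qed
 have qr: "integral\<^sup>L P (\<lambda>s. complex_of_real (q (Z s))) = of_real (integral\<^sup>L P (\<lambda>s. q (Z s)))" for P :: "'z measure" and Z
  by simp
 have "(\<lambda>n. integral\<^sup>L M (\<lambda>s. q (X n s))) \<longlonglongrightarrow> integral\<^sup>L N (\<lambda>s. q (Y s))"
  using tc unfolding qr tendsto_of_real_iff by blast
 from LIMSEQ_D[OF this, of "e / 4"] e obtain n0
  where n0: "\<And>n. n \<ge> n0 ==> \<bar>integral\<^sup>L M (\<lambda>s. q (X n s)) - integral\<^sup>L N (\<lambda>s. q (Y s))\<bar> < e / 4" by auto
 have cN: "\<bar>integral\<^sup>L N (\<lambda>s. F (Y s)) - integral\<^sup>L N (\<lambda>s. q (Y s))\<bar> \<le> e / 4" by (rule close[OF N Y _ sq(3,4)]) (use tc in blast)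
 have cM: "\<bar>integral\<^sup>L M (\<lambda>s. F (X n s)) - integral\<^sup>L M (\<lambda>s. q (X n s))\<bar> \<le> e / 4" for n by (rule close[OF M X _ sq(1,2)]) (use tc in blast)
 have "norm (integral\<^sup>L M (\<lambda>s. F (X n s)) - integral\<^sup>L N (\<lambda>s. F (Y s))) < e" if "n \<ge> n0" for n
  using cN n0[OF that] cM[of n] e unfolding real_norm_def by linarith
 thus "\<exists>no. \<forall>n\<ge>no. norm (integral\<^sup>L M (\<lambda>s. F (X n s)) - integral\<^sup>L N (\<lambda>s. F (Y s))) < e" by blast
qed

section \<open>A criterion for weak convergence in a metric space\<close>

lemma openin_Pow_mspace: "{G. openin (mtopology_of E) G} \<subseteq> Pow (mspace E)"
proof
 fix G assume "G \<in> {G. openin (mtopology_of E) G}"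
 thus "G \<in> Pow (mspace E)" using openin_subset[of "mtopology_of E" G] by simp
qed

lemma space_metric_borel [simp]: "space (metric_borel E) = mspace E"
 unfolding metric_borel_def by (rule space_measure_of[OF openin_Pow_mspace])

lemma sets_metric_borel: "sets (metric_borel E) = sigma_sets (mspace E) {G. openin (mtopology_of E) G}"
 unfolding metric_borel_def by (rule sets_measure_of[OF openin_Pow_mspace])

lemma continuous_map_metric_borel:
 assumes "continuous_map (mtopology_of E) euclideanreal f"
 shows "f \<in> borel_measurable (metric_borel E)"
proof (rule borel_measurableI)
 fix S :: "real set" assume "open S"
 hence "openin (mtopology_of E) {x \<in> topspace (mtopology_of E). f x \<in> S}"
  using openin_continuous_map_preimage[OF assms, of S] by simp
 moreover have "{x \<in> topspace (mtopology_of E). f x \<in> S} = f -` S \<inter> space (metric_borel E)"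
  by (auto simp: topspace_mtopology_of)
 ultimately show "f -` S \<inter> space (metric_borel E) \<in> sets (metric_borel E)"
  unfolding sets_metric_borel by (auto intro: sigma_sets.Basic)
qed

lemma lipschitz_continuous_map:
 fixes f :: "'e => real"
 assumes "\<And>x y. x \<in> mspace E ==> y \<in> mspace E ==> \<bar>f x - f y\<bar> \<le> L * mdist E x y"
 shows "continuous_map (mtopology_of E) euclideanreal f"
proof -
 have "Lipschitz_continuous_map E euclidean_metric f"
  unfolding Lipschitz_continuous_map_def
 proof (intro conjI exI[of _ L] ballI)
  fix x y assume "x \<in> mspace E" "y \<in> mspace E"
  from assms[OF this] show "mdist euclidean_metric (f x) (f y) \<le> L * mdist E x y" by (simp add: dist_real_def)
 qed simp
 from Lipschitz_continuous_imp_continuous_map[OF this] show ?thesis by (simp only: mtopology_of_euclidean)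
qed

lemma (in prob_space) outer_expectation_le:
 assumes T: "\<And>s. \<bar>T s\<bar> \<le> B" and W: "integrable M W" "\<And>s. s \<in> space M ==> T s \<le> W s"
 shows "outer_expectation M T \<le> expectation W"
 unfolding outer_expectation_def
proof (rule cINF_lower)
 show "bdd_below (integral\<^sup>L M ` {U. integrable M U \<and> (\<forall>s\<in>space M. T s \<le> U s)})"
 proof (rule bdd_belowI2)
  fix U assume U: "U \<in> {U. integrable M U \<and> (\<forall>s\<in>space M. T s \<le> U s)}"
  have "- B \<le> U s" if "s \<in> space M" for s using U that T[of s] by (auto simp: abs_le_iff intro: order.trans)
  hence "expectation (\<lambda>_. - B) \<le> expectation U" using U by (intro integral_mono) auto
  thus "- B \<le> expectation U" by (simp add: prob_space)
 qed
qed (use W in auto)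

text \<open>Turns an upper bound for the outer expectation of - f into a lower bound for that of
  f.\<close>

lemma (in prob_space) outer_expectation_neg:
 assumes T: "\<And>s. \<bar>T s\<bar> \<le> B"
 shows "- outer_expectation M (\<lambda>s. - T s) \<le> outer_expectation M T"
 unfolding outer_expectation_def[of M T]
proof (rule cINF_greatest)
 have "(\<lambda>_. B) \<in> {U. integrable M U \<and> (\<forall>s\<in>space M. T s \<le> U s)}" using T by (auto simp: abs_le_iff)
 thus "{U. integrable M U \<and> (\<forall>s\<in>space M. T s \<le> U s)} \<noteq> {}" by blast
 fix W assume W: "W \<in> {U. integrable M U \<and> (\<forall>s\<in>space M. T s \<le> U s)}"
 have "expectation (\<lambda>s. - W s) \<le> outer_expectation M (\<lambda>s. - T s)" unfolding outer_expectation_def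
 proof (rule cINF_greatest)
  have "(\<lambda>_. B) \<in> {U. integrable M U \<and> (\<forall>s\<in>space M. - T s \<le> U s)}" using T by (auto simp: abs_le_iff)
  thus "{U. integrable M U \<and> (\<forall>s\<in>space M. - T s \<le> U s)} \<noteq> {}" by blast
  fix V assume V: "V \<in> {U. integrable M U \<and> (\<forall>s\<in>space M. - T s \<le> U s)}"
  have "- W s \<le> V s" if "s \<in> space M" for s using V W that by fastforce
  thus "expectation (\<lambda>s. - W s) \<le> expectation V" using V W by (intro integral_mono) auto
 qed
 thus "- outer_expectation M (\<lambda>s. - T s) \<le> expectation W" by simp
qed

lemma mdist_self: "x \<in> mspace E ==> mdist E x x = 0"
 by simp

text \<open>On \<open>mspace E\<close> the Pasch-Hausdorff envelope, the least L-Lipschitz majorant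
  of a bounded f. Elsewhere it is f itself, so that majorisation and the bound by B hold on the
  whole type, as outer expectations of maps that leave the space on a null set demand.\<close>

definition upper_env :: "'e metric => real => ('e => real) => 'e => real" where
 "upper_env E L f x = (if x \<in> mspace E then SUP y\<in>mspace E. f y - L * mdist E x y else f x)"

lemma upper_env:
 assumes B: "\<And>x. \<bar>f x\<bar> \<le> B" and L: "L \<ge> 0"
 shows "f x \<le> upper_env E L f x" and "\<bar>upper_env E L f x\<bar> \<le> B"
  and "x \<in> mspace E ==> y \<in> mspace E ==> \<bar>upper_env E L f x - upper_env E L f y\<bar> \<le> L * mdist E x y"
proof -
 have b: "f y - L * mdist E x y \<le> B" for x y
 proof -
  have "0 \<le> L * mdist E x y" using L by simp
  thus ?thesis using B[of y] by linarith
 qed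
 have bdd: "bdd_above ((\<lambda>y. f y - L * mdist E x y) ` mspace E)" for x
  by (rule bdd_aboveI2) (rule b)
 show 1: "f x \<le> upper_env E L f x"
 proof (cases "x \<in> mspace E")
  case True
  have "f x - L * mdist E x x \<le> (SUP y\<in>mspace E. f y - L * mdist E x y)" by (rule cSUP_upper[OF True bdd])
  thus ?thesis using True by (simp add: upper_env_def mdist_self)
 qed (simp add: upper_env_def)
 have "upper_env E L f x \<le> B"
 proof (cases "x \<in> mspace E")
  case True
  hence "(SUP y\<in>mspace E. f y - L * mdist E x y) \<le> B" by (intro cSUP_least b) auto
  thus ?thesis using True by (simp add: upper_env_def)
 qed (use B[of x] in \<open>simp add: upper_env_def\<close>)
 thus "\<bar>upper_env E L f x\<bar> \<le> B" using 1 B[of x] by linarith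
 have le: "upper_env E L f x \<le> upper_env E L f y + L * mdist E x y" if xy: "x \<in> mspace E" "y \<in> mspace E" for x y
 proof -
  have "(SUP z\<in>mspace E. f z - L * mdist E x z) \<le> upper_env E L f y + L * mdist E x y"
  proof (rule cSUP_least)
   fix z assume z: "z \<in> mspace E"
   have "f z - L * mdist E y z \<le> (SUP z\<in>mspace E. f z - L * mdist E y z)" by (rule cSUP_upper[OF z bdd])
   hence "f z - L * mdist E y z \<le> upper_env E L f y" using xy by (simp add: upper_env_def)
   moreover have "L * mdist E y z \<le> L * (mdist E x y + mdist E x z)"
    using mdist_triangle[of y E x z] xy z L mdist_commute[of E x y] by (intro mult_left_mono) auto
   ultimately show "f z - L * mdist E x z \<le> upper_env E L f y + L * mdist E x y" unfolding distrib_left by linarith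
  qed (use xy in auto)
  thus ?thesis using xy by (simp add: upper_env_def)
 qed
 assume "x \<in> mspace E" "y \<in> mspace E"
 thus "\<bar>upper_env E L f x - upper_env E L f y\<bar> \<le> L * mdist E x y"
  using le[of x y] le[of y x] mdist_commute[of E x y] by (simp add: abs_le_iff)
qed

lemma openin_ball:
 assumes "openin (mtopology_of E) S" "x \<in> S"
 obtains r where "r > 0" "\<And>y. y \<in> mspace E ==> mdist E x y < r ==> y \<in> S"
proof -
 have "x \<in> mspace E" using openin_subset[OF assms(1)] assms(2) by auto
 thus thesis using assms that unfolding mtopology_of_def Metric_space.openin_mtopology[OF Metric_space_mspace_mdist]
  by (meson Metric_space.in_mball Metric_space_mspace_mdist subset_iff)
qed

text \<open>Points at distance at least r contribute at most B - n r, which is below f x once n r >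
  2 B; closer points are handled by continuity.\<close>

lemma upper_env_limit:
 assumes f: "continuous_map (mtopology_of E) euclideanreal f" and B: "\<And>x. \<bar>f x\<bar> \<le> B" and x: "x \<in> mspace E"
 shows "(\<lambda>k. upper_env E (real k) f x) \<longlonglongrightarrow> f x"
proof (rule LIMSEQ_I)
 fix e :: real assume e: "e > 0"
 let ?G = "{y \<in> topspace (mtopology_of E). f y \<in> ball (f x) (e / 2)}"
 have "openin (mtopology_of E) ?G"
  using openin_continuous_map_preimage[OF f, of "ball (f x) (e / 2)"] by simp
 moreover have "x \<in> ?G" using x e by simp
 ultimately obtain r where r: "r > 0" "\<And>y. y \<in> mspace E ==> mdist E x y < r ==> y \<in> ?G" by (rule openin_ball) blast
 obtain k0 where k0: "2 * B / r < real k0" using reals_Archimedean2 by blast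
 show "\<exists>no. \<forall>n\<ge>no. norm (upper_env E (real n) f x - f x) < e"
 proof (intro exI[of _ k0] allI impI)
  fix n assume n: "n \<ge> k0"
  have "upper_env E (real n) f x \<le> f x + e / 2"
  proof -
   have "(SUP y\<in>mspace E. f y - real n * mdist E x y) \<le> f x + e / 2"
   proof (rule cSUP_least)
    fix y assume y: "y \<in> mspace E"
    show "f y - real n * mdist E x y \<le> f x + e / 2"
    proof (cases "mdist E x y < r")
     case True
     hence "\<bar>f x - f y\<bar> < e / 2" using r(2)[OF y] by (simp add: dist_real_def)
     moreover have "0 \<le> real n * mdist E x y" by simp
     ultimately show ?thesis by linarith
    next
     case False
     have "2 * B < real k0 * r" using k0 r(1) by (simp add: field_simps)
     also have "... \<le> real n * mdist E x y" using n False r(1) by (intro mult_mono) auto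
     finally show ?thesis using B[of x] B[of y] e by linarith
    qed
   qed (use x in auto)
   thus ?thesis using x by (simp add: upper_env_def)
  qed
  moreover have "f x \<le> upper_env E (real n) f x" by (rule upper_env(1)[where f=f, OF B]) simp
  ultimately show "norm (upper_env E (real n) f x - f x) < e" using e by simp
 qed
qed

text \<open>An open set is the positivity set of a Lipschitz function, an envelope of its indicator.\<close>

lemma measurable_metric_borel_lipschitz:
 fixes X :: "'a => 'e"
 assumes X: "\<And>s. s \<in> space N ==> X s \<in> mspace E"
  and lip: "\<And>f. (\<And>x y. x \<in> mspace E ==> y \<in> mspace E ==> \<bar>f x - f y\<bar> \<le> mdist E x y) ==> (\<And>x. \<bar>f x\<bar> \<le> (1 :: real)) ==>
   (\<lambda>s. f (X s)) \<in> borel_measurable N"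
 shows "X \<in> N \<rightarrow>\<^sub>M metric_borel E"
 unfolding metric_borel_def
proof (rule measurable_measure_of)
 show "{G. openin (mtopology_of E) G} \<subseteq> Pow (mspace E)" by (rule openin_Pow_mspace)
 fix G assume "G \<in> {G. openin (mtopology_of E) G}"
 hence G: "openin (mtopology_of E) G" by simp
 define h where "h = upper_env E 1 (\<lambda>x. - of_bool (x \<in> G))"
 have B: "\<bar>- of_bool (x \<in> G)\<bar> \<le> (1 :: real)" for x by (simp add: of_bool_def)
 note env = upper_env[where L=1 and E=E and f="\<lambda>x. - of_bool (x \<in> G)", OF B, folded h_def, simplified]
 have [measurable]: "(\<lambda>s. h (X s)) \<in> borel_measurable N" by (rule lip) (use env in auto)
 have "x \<in> G \<longleftrightarrow> h x < 0" if x: "x \<in> mspace E" for x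
 proof
  assume "x \<in> G"
  from openin_ball[OF G this] obtain r where r: "r > 0" "\<And>y. y \<in> mspace E ==> mdist E x y < r ==> y \<in> G" by blast
  have "(SUP y\<in>mspace E. - of_bool (y \<in> G) - 1 * mdist E x y) \<le> max (- 1) (- r)"
  proof (rule cSUP_least)
   fix y assume y: "y \<in> mspace E"
   have "0 \<le> mdist E x y" by simp
   moreover have "y \<notin> G ==> r \<le> mdist E x y" using r(2)[OF y] by force
   ultimately show "- of_bool (y \<in> G) - 1 * mdist E x y \<le> max (- 1) (- r)"
    unfolding le_max_iff_disj by (cases "y \<in> G") (simp_all del: mdist_nonneg)
  qed (use x in auto)
  thus "h x < 0" using x r(1) by (auto simp: h_def upper_env_def)
 qed (use env(1)[of x] in \<open>auto simp: of_bool_def split: if_splits\<close>)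
 hence "X -` G \<inter> space N = {s \<in> space N. h (X s) < 0}" using X by auto
 thus "X -` G \<inter> space N \<in> sets N" by simp
qed (use X in auto)

lemma measurable_metric_borel_limit:
 assumes Xk: "\<And>k. Xk k \<in> N \<rightarrow>\<^sub>M metric_borel E" and X: "\<And>s. s \<in> space N ==> X s \<in> mspace E"
  and lim: "\<And>s. s \<in> space N ==> (\<lambda>k. mdist E (Xk k s) (X s)) \<longlonglongrightarrow> 0"
 shows "X \<in> N \<rightarrow>\<^sub>M metric_borel E"
proof (rule measurable_metric_borel_lipschitz[OF X])
 fix f :: "'b => real" assume f: "\<And>x y. x \<in> mspace E ==> y \<in> mspace E ==> \<bar>f x - f y\<bar> \<le> mdist E x y"
 show "(\<lambda>s. f (X s)) \<in> borel_measurable N"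
 proof (rule borel_measurable_LIMSEQ_real)
  show "(\<lambda>s. f (Xk k s)) \<in> borel_measurable N" for k
   by (rule measurable_compose[OF Xk continuous_map_metric_borel[OF lipschitz_continuous_map[where L=1]]]) (use f in simp)
  fix s assume s: "s \<in> space N"
  have Xks: "Xk k s \<in> mspace E" for k using measurable_space[OF Xk s] by simp
  have "(\<lambda>k. f (Xk k s) - f (X s)) \<longlonglongrightarrow> 0"
   by (rule Lim_null_comparison[OF _ lim[OF s]]) (use f[OF Xks X[OF s]] in auto)
  thus "(\<lambda>k. f (Xk k s)) \<longlonglongrightarrow> f (X s)" by (rule LIM_zero_cancel)
 qed
qed

lemma measurable_metric_borel_coordinates:
 fixes \<xi> :: "'a => 't => real" and \<Phi> :: "('t => real) => 'e"
 assumes T: "finite T" and meas: "\<And>t. (\<lambda>s. \<xi> s t) \<in> borel_measurable N"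
  and \<Phi>: "\<And>x. \<Phi> x \<in> mspace E"
  and L: "\<And>x y \<delta>. (\<And>t. t \<in> T ==> \<bar>x t - y t\<bar> \<le> \<delta>) ==> 0 \<le> \<delta> ==> mdist E (\<Phi> x) (\<Phi> y) \<le> L * \<delta>"
 shows "(\<lambda>s. \<Phi> (\<xi> s)) \<in> N \<rightarrow>\<^sub>M metric_borel E"
proof (rule measurable_metric_borel_lipschitz[OF \<Phi>])
 fix f :: "'e => real" assume f: "\<And>x y. x \<in> mspace E ==> y \<in> mspace E ==> \<bar>f x - f y\<bar> \<le> mdist E x y" "\<And>x. \<bar>f x\<bar> \<le> 1"
 show "(\<lambda>s. f (\<Phi> (\<xi> s))) \<in> borel_measurable N"
  by (rule lipschitz_coordinates_measurable[where F="\<lambda>x. f (\<Phi> x)" and \<xi>=\<xi> and L=L and B=1, OF T meas]; intro f(2) order.trans[OF f(1) L] \<Phi>)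
qed

text \<open>Every bounded continuous function is the decreasing limit of its Lipschitz envelopes, which gives the upper bound
 for the outer expectations; the lower bound follows by passing to the negative.\<close>

lemma weakly_converges_HJ_criterion:
 fixes Xn :: "nat => 'a => 'e" and Y :: "'b => 'e"
 assumes M: "prob_space M" and N: "prob_space N"
  and mem: "\<And>n. AE s in M. Xn n s \<in> mspace E" and Y: "Y \<in> N \<rightarrow>\<^sub>M metric_borel E"
  and approx: "\<And>\<epsilon>. \<epsilon> > 0 ==> \<exists>Z Z'. (\<forall>n s. Z n s \<in> mspace E) \<and> (\<forall>s. Z' s \<in> mspace E) \<and>
   (\<forall>f L B. (\<forall>x\<in>mspace E. \<forall>y\<in>mspace E. \<bar>f x - f y\<bar> \<le> L * mdist E x y) --> (\<forall>x. \<bar>f x\<bar> \<le> B) --> L \<ge> 0 -->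
     (\<forall>n. (\<lambda>s. f (Z n s)) \<in> borel_measurable M) \<and> (\<lambda>s. f (Z' s)) \<in> borel_measurable N \<and>
     (\<lambda>n. integral\<^sup>L M (\<lambda>s. f (Z n s))) \<longlonglongrightarrow> integral\<^sup>L N (\<lambda>s. f (Z' s))) \<and>
   (\<forall>\<^sub>F n in sequentially. \<exists>A\<in>sets M. measure M A \<ge> 1 - \<epsilon> \<and> (\<forall>s\<in>A. Xn n s \<in> mspace E \<and> mdist E (Xn n s) (Z n s) \<le> \<epsilon>)) \<and>
   (\<exists>A\<in>sets N. measure N A \<ge> 1 - \<epsilon> \<and> (\<forall>s\<in>A. mdist E (Y s) (Z' s) \<le> \<epsilon>))"
 shows "weakly_converges_HJ E M Xn N Y"
proof -
 interpret M: prob_space M by (rule M)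
 interpret N: prob_space N by (rule N)
 have Ysp: "Y s \<in> mspace E" if "s \<in> space N" for s using measurable_space[OF Y that] by simp
 have up: "\<forall>\<^sub>F n in sequentially. outer_expectation M (\<lambda>s. f (Xn n s)) < N.expectation (\<lambda>s. f (Y s)) + e"
  if f: "continuous_map (mtopology_of E) euclideanreal f" and B: "\<And>x. \<bar>f x\<bar> \<le> B" and e: "e > 0" for f B e
 proof -
  note fe = upper_env[where f=f, OF B]
  have um: "(\<lambda>s. upper_env E (real k) f (Y s)) \<in> borel_measurable N" for k
   by (rule measurable_compose[OF Y continuous_map_metric_borel[OF lipschitz_continuous_map[where L="real k"]]])
    (rule fe(3); simp)
  have "(\<lambda>k. N.expectation (\<lambda>s. upper_env E (real k) f (Y s))) \<longlonglongrightarrow> N.expectation (\<lambda>s. f (Y s))"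
  proof (rule integral_dominated_convergence[where w="\<lambda>_. B"])
   show "(\<lambda>s. f (Y s)) \<in> borel_measurable N" by (rule measurable_compose[OF Y continuous_map_metric_borel[OF f]])
   show "AE s in N. (\<lambda>k. upper_env E (real k) f (Y s)) \<longlonglongrightarrow> f (Y s)" by (intro AE_I2 upper_env_limit[OF f B] Ysp)
   show "AE s in N. norm (upper_env E (real k) f (Y s)) \<le> B" for k unfolding real_norm_def by (intro AE_I2 fe(2)) simp
  qed (use um in simp_all)
  from LIMSEQ_D[OF this, of "e / 4"] e obtain k
   where "\<bar>N.expectation (\<lambda>s. upper_env E (real k) f (Y s)) - N.expectation (\<lambda>s. f (Y s))\<bar> < e / 4" by auto
  hence k: "N.expectation (\<lambda>s. upper_env E (real k) f (Y s)) < N.expectation (\<lambda>s. f (Y s)) + e / 4" by linarith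
  define u where "u = upper_env E (real k) f"
  have u: "f x \<le> u x" "\<bar>u x\<bar> \<le> B" "x \<in> mspace E ==> y \<in> mspace E ==> \<bar>u x - u y\<bar> \<le> real k * mdist E x y" for x y
   unfolding u_def by (rule fe; simp)+
  have B0: "B \<ge> 0" using B[of undefined] by linarith
  \<comment> \<open>Leaves e / 4 for the Lipschitz error k \<epsilon> on the good event together
    with the trivial bound 2 B on its complement.\<close>
  define \<epsilon> where "\<epsilon> = e / 4 / (real k + 2 * B + 1)"
  have den: "real k + 2 * B + 1 > 0" using B0 by simp
  have \<epsilon>: "\<epsilon> > 0" using e den by (simp add: \<epsilon>_def)
  have "(real k + 2 * B + 1) * \<epsilon> = e / 4"
   using nonzero_mult_div_cancel_left[of "real k + 2 * B + 1" "e / 4"] den unfolding \<epsilon>_def times_divide_eq_right by simp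
  hence \<epsilon>e: "real k * \<epsilon> + 2 * B * \<epsilon> \<le> e / 4" using \<epsilon> by (simp add: distrib_right)
  \<comment> \<open>Shared by the comparison of Z' with Y and of \<open>Xn n\<close> with
    \<open>Z n\<close>: F stands for anything dominated by the integrals of majorants, hence for an
    ordinary as well as an outer expectation.\<close>
  have step: "F \<le> integral\<^sup>L P V + e / 4"
   if P: "prob_space P" and A: "A \<in> sets P" "measure P A \<ge> 1 - \<epsilon>" and V: "integrable P V"
    and F: "\<And>W. integrable P W ==> (\<And>s. s \<in> space P ==> u (x s) \<le> W s) ==> F \<le> integral\<^sup>L P W"
    and close: "\<And>s. s \<in> A ==> x s \<in> mspace E \<and> z s \<in> mspace E \<and> mdist E (x s) (z s) \<le> \<epsilon>" and Vz: "\<And>s. V s = u (z s)"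
   for P :: "'z measure" and A V F x z
  proof -
   interpret P: prob_space P by (rule P)
   let ?r = "\<lambda>s. real k * \<epsilon> + 2 * B * indicator (space P - A) s"
   have i: "integrable P (indicat_real (space P - A))" using A(1) by (intro integrable_real_indicator) (auto simp: P.emeasure_eq_measure)
   have "F \<le> P.expectation (\<lambda>s. V s + ?r s)"
   proof (rule F)
    show "integrable P (\<lambda>s. V s + ?r s)" using V i by simp
    fix s assume s: "s \<in> space P"
    show "u (x s) \<le> V s + ?r s"
    proof (cases "s \<in> A")
     case True
     have "real k * mdist E (x s) (z s) \<le> real k * \<epsilon>" using close[OF True] by (intro mult_left_mono) auto
     thus ?thesis using u(3)[of "x s" "z s"] close[OF True] True unfolding Vz by simp
    next
     case False
     have "0 \<le> real k * \<epsilon>" using \<epsilon> by simp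
     thus ?thesis using False s u(2)[of "x s"] u(2)[of "z s"] unfolding Vz by simp
    qed
   qed
   also have "... = P.expectation V + (real k * \<epsilon> + 2 * B * P.prob (space P - A))"
    using V i A(1) by (simp add: P.prob_space)
   also have "2 * B * P.prob (space P - A) \<le> 2 * B * \<epsilon>" using A B0 by (intro mult_left_mono) (auto simp: P.prob_compl)
   finally show ?thesis using \<epsilon>e by linarith
  qed
  from approx[OF \<epsilon>] obtain Z Z' where H1: "\<forall>n s. Z n s \<in> mspace E" and H2: "\<forall>s. Z' s \<in> mspace E"
   and H3: "\<forall>f L B. (\<forall>x\<in>mspace E. \<forall>y\<in>mspace E. \<bar>f x - f y\<bar> \<le> L * mdist E x y) --> (\<forall>x. \<bar>f x\<bar> \<le> B) --> L \<ge> 0 -->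
     (\<forall>n. (\<lambda>s. f (Z n s)) \<in> borel_measurable M) \<and> (\<lambda>s. f (Z' s)) \<in> borel_measurable N \<and>
     (\<lambda>n. M.expectation (\<lambda>s. f (Z n s))) \<longlonglongrightarrow> N.expectation (\<lambda>s. f (Z' s))"
   and evA: "\<forall>\<^sub>F n in sequentially. \<exists>A\<in>sets M. M.prob A \<ge> 1 - \<epsilon> \<and> (\<forall>s\<in>A. Xn n s \<in> mspace E \<and> mdist E (Xn n s) (Z n s) \<le> \<epsilon>)"
   and A': "\<exists>A\<in>sets N. N.prob A \<ge> 1 - \<epsilon> \<and> (\<forall>s\<in>A. mdist E (Y s) (Z' s) \<le> \<epsilon>)"
   by (elim exE conjE) (rule that)
  have "\<forall>x\<in>mspace E. \<forall>y\<in>mspace E. \<bar>u x - u y\<bar> \<le> real k * mdist E x y" "\<forall>x. \<bar>u x\<bar> \<le> B" using u by blast+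
  note H4 = H3[THEN spec, THEN spec, THEN spec, THEN mp, THEN mp, THEN mp, OF this of_nat_0_le_iff]
  have meas: "\<And>n. (\<lambda>s. u (Z n s)) \<in> borel_measurable M" "(\<lambda>s. u (Z' s)) \<in> borel_measurable N"
   and conv: "(\<lambda>n. M.expectation (\<lambda>s. u (Z n s))) \<longlonglongrightarrow> N.expectation (\<lambda>s. u (Z' s))"
   using H4 by blast+
  have iY: "integrable N (\<lambda>s. u (Y s))" using um u by (intro N.integrable_bdd[where B=B]) (auto simp: u_def)
  obtain A where A: "A \<in> sets N" "N.prob A \<ge> 1 - \<epsilon>" "\<And>s. s \<in> A ==> mdist E (Y s) (Z' s) \<le> \<epsilon>" using A' by blast
  have ZY: "N.expectation (\<lambda>s. u (Z' s)) \<le> N.expectation (\<lambda>s. u (Y s)) + e / 4"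
  proof (rule step[of N A _ Z' _ Y, OF N A(1,2) iY])
   show "Z' s \<in> mspace E \<and> Y s \<in> mspace E \<and> mdist E (Z' s) (Y s) \<le> \<epsilon>" if "s \<in> A" for s
    using that A H2 Ysp sets.sets_into_space[OF A(1)] by (auto simp: mdist_commute)
   have "integrable N (\<lambda>s. u (Z' s))" using meas u by (intro N.integrable_bdd[where B=B]) auto
   thus "N.expectation (\<lambda>s. u (Z' s)) \<le> N.expectation W" if "integrable N W" "\<And>s. s \<in> space N ==> u (Z' s) \<le> W s" for W
    using that by (intro integral_mono) auto
  qed simp
  have "\<forall>\<^sub>F n in sequentially. M.expectation (\<lambda>s. u (Z n s)) < N.expectation (\<lambda>s. u (Z' s)) + e / 4"
   using e by (intro order_tendstoD(2)[OF conv]) simp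
  thus ?thesis using evA
  proof eventually_elim
   case (elim n)
   obtain A where A: "A \<in> sets M" "M.prob A \<ge> 1 - \<epsilon>" "\<And>s. s \<in> A ==> Xn n s \<in> mspace E \<and> mdist E (Xn n s) (Z n s) \<le> \<epsilon>" using elim(2) by blast
   have iZ: "integrable M (\<lambda>s. u (Z n s))" using meas u by (intro M.integrable_bdd[where B=B]) auto
   have "outer_expectation M (\<lambda>s. f (Xn n s)) \<le> M.expectation (\<lambda>s. u (Z n s)) + e / 4"
   proof (rule step[of M A _ "Xn n" _ "Z n", OF M A(1,2) iZ])
    show "outer_expectation M (\<lambda>s. f (Xn n s)) \<le> M.expectation W"
     if W: "integrable M W" "\<And>s. s \<in> space M ==> u (Xn n s) \<le> W s" for W
     by (rule M.outer_expectation_le[OF B W(1)]) (use W(2) u(1) order.trans in blast)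
   qed (use A(3) H1 in auto)
   thus ?case using elim(1) ZY k unfolding u_def by linarith
  qed
 qed
 show ?thesis unfolding weakly_converges_HJ_def
 proof (intro conjI allI impI mem Y)
  fix f :: "'e => real" assume "continuous_map (mtopology_of E) euclideanreal f \<and> bounded (range f)"
  hence f: "continuous_map (mtopology_of E) euclideanreal f" and "bounded (range f)" by auto
  then obtain B where B: "\<And>x. \<bar>f x\<bar> \<le> B" by (auto simp: bounded_iff)
  have nf: "continuous_map (mtopology_of E) euclideanreal (\<lambda>x. - f x)" using f by (intro continuous_intros)
  have nB: "\<bar>- f x\<bar> \<le> B" for x using B[of x] by simp
  let ?O = "\<lambda>f n. outer_expectation M (\<lambda>s. f (Xn n s))"
  show "?O f \<longlonglongrightarrow> N.expectation (\<lambda>s. f (Y s))"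
  proof (rule order_tendstoI)
   fix a assume "N.expectation (\<lambda>s. f (Y s)) < a"
   from up[OF f B, of "a - N.expectation (\<lambda>s. f (Y s))"] this show "\<forall>\<^sub>F n in sequentially. ?O f n < a" by simp
  next
   fix a assume "a < N.expectation (\<lambda>s. f (Y s))"
   with up[OF nf nB, of "N.expectation (\<lambda>s. f (Y s)) - a"] have "\<forall>\<^sub>F n in sequentially. ?O (\<lambda>x. - f x) n < - a" by simp
   thus "\<forall>\<^sub>F n in sequentially. a < ?O f n"
   proof eventually_elim
    case (elim n)
    thus ?case using M.outer_expectation_neg[of "\<lambda>s. f (Xn n s)" B] B by simp
   qed
  qed
 qed
qed

section \<open>Gaussian families with a prescribed covariance\<close>

text \<open>Index sequences \<tau> with possible repetitions make it easy to append one further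
  index, which is what the Schur complement uses.\<close>

definition psd :: "(nat => nat => real) => bool" where
 "psd S \<longleftrightarrow> (\<forall>i j. S i j = S j i) \<and> (\<forall>n c \<tau>. 0 \<le> (\<Sum>i<n::nat. \<Sum>j<n. c i * c j * S (\<tau> i) (\<tau> j)))"

lemma psdD: "psd S ==> 0 \<le> (\<Sum>i<n::nat. \<Sum>j<n. c i * c j * S (\<tau> i) (\<tau> j))"
 by (simp add: psd_def)

lemma psd_diag: "psd S ==> 0 \<le> S k k"
 using psdD[of S "\<lambda>_. 1" "\<lambda>_. k" 1] by simp

text \<open>Otherwise the form S i i + 2 y S i k on the pair i, k would be unbounded below in
  y.\<close>

lemma psd_zero_row:
 assumes S: "psd S" and 0: "S k k = 0"
 shows "S i k = 0"
proof (rule ccontr)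
 assume nz: "S i k \<noteq> 0"
 have q: "0 \<le> S i i + 2 * y * S i k" for y
  using psdD[OF S, of "\<lambda>l. if l = 0 then 1 else y" "\<lambda>l. if l = 0 then i else k" 2] S 0
  by (simp add: numeral_2_eq_2 psd_def)
 have "0 \<le> S i i + 2 * (- (S i i + 1) / (2 * S i k)) * S i k" by (rule q)
 also have "... = - 1" using nz by (simp add: field_simps)
 finally show False by simp
qed

text \<open>The covariance that remains after regression on the k-th variable. For S k k = 0
  division by zero gives 0, so S is left unchanged.\<close>

definition schur :: "(nat => nat => real) => nat => nat => nat => real" where
 "schur S k i j = S i j - S i k * S k j / S k k"

text \<open>The form of the Schur complement is the original form with an additional index k, whose
  weight - b / S k k is the minimising one.\<close>

lemma psd_schur:
 assumes S: "psd S"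
 shows "psd (schur S k)"
proof (cases "S k k = 0")
 case True
 hence "schur S k = S" by (simp add: schur_def fun_eq_iff)
 thus ?thesis using S by simp
next
 case False
 have sym: "S i j = S j i" for i j using S by (simp add: psd_def)
 show ?thesis unfolding psd_def
 proof (intro conjI allI)
  show "schur S k i j = schur S k j i" for i j unfolding schur_def using sym[of i j] sym[of i k] sym[of k j] by simp
  fix n :: nat and c :: "nat => real" and \<tau> :: "nat => nat"
  define b where "b = (\<Sum>i<n. c i * S (\<tau> i) k)"
  have b': "(\<Sum>j<n. c j * S k (\<tau> j)) = b" unfolding b_def using sym by metis
  define x where "x = - b / S k k"
  let ?c = "\<lambda>i. if i < n then c i else x" and ?\<tau> = "\<lambda>i. if i < n then \<tau> i else k"
  have "0 \<le> (\<Sum>i<Suc n. \<Sum>j<Suc n. ?c i * ?c j * S (?\<tau> i) (?\<tau> j))" by (rule psdD[OF S])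
  also have "... = (\<Sum>i<n. \<Sum>j<n. c i * c j * S (\<tau> i) (\<tau> j)) + x * b + (x * (\<Sum>j<n. c j * S k (\<tau> j)) + x * x * S k k)"
   by (simp add: sum.distrib b_def sum_distrib_left mult_ac)
  also have "... = (\<Sum>i<n. \<Sum>j<n. c i * c j * S (\<tau> i) (\<tau> j)) - b * (\<Sum>j<n. c j * S k (\<tau> j)) / S k k"
   unfolding b' using False by (simp add: x_def)
  also have "... = (\<Sum>i<n. \<Sum>j<n. c i * c j * schur S k (\<tau> i) (\<tau> j))"
   unfolding b_def sum_product by (simp add: schur_def right_diff_distrib sum_subtractf sum_divide_distrib mult_ac)
  finally show "0 \<le> (\<Sum>i<n. \<Sum>j<n. c i * c j * schur S k (\<tau> i) (\<tau> j))" .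
 qed
qed

text \<open>Successive Schur complements clear one row and column after another, and the k-th column
  of L is what step k subtracts. The recursion runs over all naturals, so one infinite lower
  triangular factor results in which every row is finite.\<close>

lemma cholesky:
 assumes G: "psd S"
 shows "\<exists>L. (\<forall>i k. k > i --> L i k = 0) \<and> (\<forall>i j. S i j = (\<Sum>k\<le>i. L i k * L j k :: real))"
proof -
 define R where "R = rec_nat S (\<lambda>k P. schur P k)"
 have R0: "R 0 = S" and RS: "R (Suc k) = schur (R k) k" for k by (simp_all add: R_def)
 have psdR: "psd (R k)" for k by (induction k) (simp_all add: R0 RS G psd_schur)
 have symR: "R k i j = R k j i" for k i j using psdR[of k] by (simp add: psd_def)
 have zero: "i < k ==> R k i j = 0" for i j k
 proof (induction k arbitrary: i j)
  case (Suc k)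
  show ?case
  proof (cases "i = k")
   case True
   show ?thesis
   proof (cases "R k k k = 0")
    case z: True
    have "R k k j = 0" using psd_zero_row[OF psdR z, of j] symR[of k j k] by simp
    thus ?thesis using True by (simp add: RS schur_def)
   qed (simp add: True RS schur_def)
  next
   case False
   hence "i < k" using Suc.prems by simp
   thus ?thesis using Suc.IH[of i] by (simp add: RS schur_def)
  qed
 qed simp
 define L where "L i k = R k i k / sqrt (R k k k)" for i k
 have LL: "L i k * L j k = R k i k * R k k j / R k k k" for i j k
 proof -
  have "sqrt (R k k k) * sqrt (R k k k) = R k k k" using psd_diag[OF psdR, of k k] by simp
  thus ?thesis using symR[of k j k] by (simp add: L_def)
 qed
 have tel: "S i j = (\<Sum>k<m. L i k * L j k) + R m i j" for i j m
  by (induction m) (simp_all add: R0 RS schur_def LL)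
 show ?thesis
 proof (intro exI[of _ L] conjI allI impI)
  show "L i k = 0" if "k > i" for i k using zero[OF that] by (simp add: L_def)
  show "S i j = (\<Sum>k\<le>i. L i k * L j k)" for i j
   using tel[of i j "Suc i"] zero[of i "Suc i" j] by (simp add: lessThan_Suc_atMost)
 qed
qed

section \<open>Countable Gaussian families and laws with Gaussian characteristic function\<close>

abbreviation std_normal :: "real measure" where "std_normal \<equiv> density lborel std_normal_density"

definition gauss_space :: "(nat => real) measure" where
 "gauss_space = Pi\<^sub>M UNIV (\<lambda>_. std_normal)"

lemma prob_space_std_normal: "prob_space std_normal"
 using prob_space_normal_density[of 1 0] by simp

lemma prob_space_gauss: "prob_space gauss_space"
 unfolding gauss_space_def by (rule prob_space_PiM[OF prob_space_std_normal])

lemma gauss_coord_meas [measurable]: "(\<lambda>\<omega>. \<omega> k) \<in> borel_measurable gauss_space"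
proof -
 have "(\<lambda>\<omega>. \<omega> k) \<in> gauss_space \<rightarrow>\<^sub>M std_normal" unfolding gauss_space_def by (rule measurable_component_singleton) simp
 thus ?thesis by simp
qed

lemma gauss_char:
 assumes "finite A"
 shows "integral\<^sup>L gauss_space (\<lambda>\<omega>. iexp (\<Sum>k\<in>A. c k * \<omega> k)) = of_real (exp (- (\<Sum>k\<in>A. (c k)\<^sup>2) / 2))"
proof -
 interpret P: prob_space gauss_space by (rule prob_space_gauss)
 interpret PP: product_prob_space "\<lambda>_. std_normal" UNIV
  by (intro product_prob_spaceI prob_space_std_normal)
 have law: "distr gauss_space borel (\<lambda>\<omega>. \<omega> k) = std_normal" for k
 proof -
  have "distr gauss_space borel (\<lambda>\<omega>. \<omega> k) = distr gauss_space std_normal (\<lambda>\<omega>. \<omega> k)" by (intro distr_cong) auto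
  also have "... = std_normal" unfolding gauss_space_def by (rule PP.PiM_component) simp
  finally show ?thesis .
 qed
 have ind: "P.indep_vars (\<lambda>_. std_normal) (\<lambda>k \<omega>. \<omega> k) UNIV"
 proof (subst P.indep_vars_iff_distr_eq_PiM)
  have "distr gauss_space (Pi\<^sub>M UNIV (\<lambda>_. std_normal)) (\<lambda>\<omega>. restrict \<omega> UNIV) = gauss_space"
  proof -
   have "(\<lambda>\<omega> :: nat => real. restrict \<omega> UNIV) = (\<lambda>\<omega>. \<omega>)" by (simp add: restrict_def)
   thus ?thesis unfolding gauss_space_def by (simp only: distr_id)
  qed
  moreover have "Pi\<^sub>M UNIV (\<lambda>k. distr gauss_space std_normal (\<lambda>\<omega>. \<omega> k)) = gauss_space"
   unfolding gauss_space_def by (intro PiM_cong refl PP.PiM_component) simp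
  ultimately show "distr gauss_space (Pi\<^sub>M UNIV (\<lambda>_. std_normal)) (\<lambda>\<omega>. \<lambda>k\<in>UNIV. \<omega> k) = Pi\<^sub>M UNIV (\<lambda>k. distr gauss_space std_normal (\<lambda>\<omega>. \<omega> k))"
   by simp
  show "(\<lambda>\<omega>. \<omega> k) \<in> gauss_space \<rightarrow>\<^sub>M std_normal" for k
   unfolding gauss_space_def by (rule measurable_component_singleton) simp
 qed simp
 have "P.indep_vars (\<lambda>_. borel) (\<lambda>k \<omega>. c k * \<omega> k) UNIV"
  by (rule P.indep_vars_compose2[OF ind, where Y="\<lambda>k x. c k * x"]) simp
 hence ind': "P.indep_vars (\<lambda>_. borel) (\<lambda>k \<omega>. c k * \<omega> k) A" by (rule P.indep_vars_subset) simp
 have ch: "char (distr gauss_space borel (\<lambda>\<omega>. c k * \<omega> k)) 1 = of_real (exp (- (c k)\<^sup>2 / 2))" for k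
 proof -
  have "char (distr gauss_space borel (\<lambda>\<omega>. c k * \<omega> k)) 1 = integral\<^sup>L gauss_space (\<lambda>\<omega>. iexp (c k * \<omega> k))"
   unfolding char_def by (subst integral_distr) auto
  also have "... = char (distr gauss_space borel (\<lambda>\<omega>. \<omega> k)) (c k)"
   unfolding char_def by (subst integral_distr) auto
  finally show ?thesis unfolding law char_std_normal_distribution .
 qed
 have "integral\<^sup>L gauss_space (\<lambda>\<omega>. iexp (\<Sum>k\<in>A. c k * \<omega> k)) = char (distr gauss_space borel (\<lambda>\<omega>. \<Sum>k\<in>A. c k * \<omega> k)) 1"
  unfolding char_def by (subst integral_distr) (auto simp: gauss_coord_meas intro!: borel_measurable_sum borel_measurable_times)
 also have "... = (\<Prod>k\<in>A. of_real (exp (- (c k)\<^sup>2 / 2)))"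
  by (simp only: P.char_distr_sum[OF ind'] ch)
 also have "... = of_real (exp (\<Sum>k\<in>A. - (c k)\<^sup>2 / 2))"
  using assms by (simp only: of_real_prod[symmetric] exp_sum)
 also have "(\<Sum>k\<in>A. - (c k)\<^sup>2 / 2) = - (\<Sum>k\<in>A. (c k)\<^sup>2) / 2"
  by (simp add: sum_divide_distrib[symmetric] sum_negf)
 finally show ?thesis .
qed

text \<open>The Cholesky factor maps independent standard normals to a family with the prescribed
  covariance. Indices i are kept apart from the points \<tau> i because several i may share a point,
  as happens when points are rounded to a grid.\<close>

lemma ex_gaussian_family:
 fixes \<Gamma> :: "'t => 't => real"
 assumes D: "countable D" and sym: "\<And>s t. \<Gamma> s t = \<Gamma> t s"
  and pos: "\<And>n c \<tau>. 0 \<le> (\<Sum>i<n::nat. \<Sum>j<n. c i * c j * \<Gamma> (\<tau> i) (\<tau> j))"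
 shows "\<exists>A. (\<forall>t. A t \<in> borel_measurable gauss_space) \<and>
  (\<forall>(I::'i set) b \<tau>. finite I --> (\<forall>i\<in>I. \<tau> i \<in> D) -->
    integral\<^sup>L gauss_space (\<lambda>\<omega>. iexp (\<Sum>i\<in>I. b i * A (\<tau> i) \<omega>)) = of_real (exp (- (\<Sum>i\<in>I. \<Sum>j\<in>I. b i * b j * \<Gamma> (\<tau> i) (\<tau> j)) / 2)))"
proof -
 let ?d = "from_nat_into D" and ?e = "to_nat_on D"
 have de: "t \<in> D ==> ?d (?e t) = t" for t by (rule from_nat_into_to_nat_on[OF D])
 have "psd (\<lambda>i j. \<Gamma> (?d i) (?d j))" unfolding psd_def by (intro conjI allI sym pos)
 from cholesky[OF this] obtain L where L0: "\<And>i k. k > i ==> L i k = 0"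
  and L: "\<And>i j. \<Gamma> (?d i) (?d j) = (\<Sum>k\<le>i. L i k * L j k)" by blast
 define A where "A t \<omega> = (\<Sum>k\<le>?e t. L (?e t) k * \<omega> k)" for t \<omega>
 show ?thesis
 proof (intro exI[of _ A] conjI allI impI)
  show "A t \<in> borel_measurable gauss_space" for t unfolding A_def by measurable
  fix I :: "'i set" and b \<tau> assume I: "finite I" "\<forall>i\<in>I. \<tau> i \<in> D"
  define m where "m = Max (insert 0 (?e ` \<tau> ` I))"
  have m: "?e (\<tau> i) \<le> m" if "i \<in> I" for i unfolding m_def using I that by (intro Max_ge) auto
  have ext: "(\<Sum>k\<le>?e (\<tau> i). L (?e (\<tau> i)) k * h k) = (\<Sum>k\<le>m. L (?e (\<tau> i)) k * h k)" if "i \<in> I" for i and h :: "nat => real"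
   using m[OF that] L0 by (intro sum.mono_neutral_left) auto
  define c where "c k = (\<Sum>i\<in>I. b i * L (?e (\<tau> i)) k)" for k
  have "(\<Sum>i\<in>I. b i * A (\<tau> i) \<omega>) = (\<Sum>k\<le>m. c k * \<omega> k)" for \<omega>
  proof -
   have "(\<Sum>i\<in>I. b i * A (\<tau> i) \<omega>) = (\<Sum>i\<in>I. \<Sum>k\<le>m. b i * L (?e (\<tau> i)) k * \<omega> k)"
    unfolding A_def using ext by (simp add: sum_distrib_left mult.assoc)
   also have "... = (\<Sum>k\<le>m. \<Sum>i\<in>I. b i * L (?e (\<tau> i)) k * \<omega> k)" by (rule sum.swap)
   finally show ?thesis by (simp add: c_def sum_distrib_right)
  qed
  moreover have "(\<Sum>k\<le>m. (c k)\<^sup>2) = (\<Sum>i\<in>I. \<Sum>j\<in>I. b i * b j * \<Gamma> (\<tau> i) (\<tau> j))"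
  proof -
   have "(\<Sum>k\<le>m. (c k)\<^sup>2) = (\<Sum>k\<le>m. \<Sum>i\<in>I. \<Sum>j\<in>I. b i * b j * (L (?e (\<tau> i)) k * L (?e (\<tau> j)) k))"
    unfolding c_def power2_eq_square sum_product by (simp add: mult_ac)
   also have "... = (\<Sum>i\<in>I. \<Sum>j\<in>I. \<Sum>k\<le>m. b i * b j * (L (?e (\<tau> i)) k * L (?e (\<tau> j)) k))"
    by (subst sum.swap) (intro sum.cong refl sum.swap)
   also have "... = (\<Sum>i\<in>I. \<Sum>j\<in>I. b i * b j * \<Gamma> (\<tau> i) (\<tau> j))"
   proof (intro sum.cong refl)
    fix i j assume ij: "i \<in> I" "j \<in> I"
    have "\<Gamma> (\<tau> i) (\<tau> j) = (\<Sum>k\<le>m. L (?e (\<tau> i)) k * L (?e (\<tau> j)) k)"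
     using L[of "?e (\<tau> i)" "?e (\<tau> j)"] I ij by (simp add: de ext)
    thus "(\<Sum>k\<le>m. b i * b j * (L (?e (\<tau> i)) k * L (?e (\<tau> j)) k)) = b i * b j * \<Gamma> (\<tau> i) (\<tau> j)"
     by (simp add: sum_distrib_left)
   qed
   finally show ?thesis .
  qed
  ultimately show "integral\<^sup>L gauss_space (\<lambda>\<omega>. iexp (\<Sum>i\<in>I. b i * A (\<tau> i) \<omega>)) = of_real (exp (- (\<Sum>i\<in>I. \<Sum>j\<in>I. b i * b j * \<Gamma> (\<tau> i) (\<tau> j)) / 2))"
   using gauss_char[of "{..m}" c] by simp
 qed
qed

text \<open>Levy's uniqueness theorem identifies the law. The case v = 0 is the point mass at 0,
  without a density, and is therefore treated separately throughout.\<close>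

lemma (in prob_space) normal_of_char:
 fixes Y :: "'a => real"
 assumes Y [measurable]: "Y \<in> borel_measurable M" and v: "v \<ge> 0"
  and ch: "\<And>t. expectation (\<lambda>x. iexp (t * Y x)) = of_real (exp (- (t\<^sup>2 * v / 2)))"
 shows "v = 0 ==> AE x in M. Y x = 0"
  and "normal_rv M Y" and "integrable M (\<lambda>x. (Y x)\<^sup>2)" and "expectation (\<lambda>x. (Y x)\<^sup>2) = v" and "expectation Y = 0"
proof -
 have chd: "char (distr M borel (\<lambda>x. Y x / \<sigma>)) t = of_real (exp (- ((t / \<sigma>)\<^sup>2 * v / 2)))" for \<sigma> t
 proof -
  have "char (distr M borel (\<lambda>x. Y x / \<sigma>)) t = expectation (\<lambda>x. iexp (t / \<sigma> * Y x))"
   unfolding char_def by (subst integral_distr) auto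
  thus ?thesis by (simp only: ch)
 qed
 have z: "AE x in M. Y x = 0" if v0: "v = 0"
 proof -
  have "distr M borel Y = return borel 0"
  proof (rule Levy_uniqueness)
   show "real_distribution (distr M borel Y)" by (rule real_distribution_distr) simp
   show "real_distribution (return borel (0::real))"
    unfolding real_distribution_def real_distribution_axioms_def by (simp add: prob_space_return)
   show "char (distr M borel Y) = char (return borel 0)"
   proof
    fix t
    have "char (distr M borel Y) t = 1" using chd[of 1 t] v0 by simp
    thus "char (distr M borel Y) t = char (return borel 0) t"
     unfolding char_def by (subst integral_return) auto
   qed
  qed
  hence "measure (distr M borel Y) {0} = 1" by (simp add: measure_return)
  hence "prob {x \<in> space M. Y x = 0} = 1" by (simp add: measure_distr vimage_def Int_def conj_commute)
  thus ?thesis by (subst (asm) prob_Collect_eq_1) auto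
 qed
 show "AE x in M. Y x = 0" if "v = 0" by (rule z[OF that])
 have pos: "distributed M lborel Y (normal_density 0 (sqrt v))" "distributed M lborel (\<lambda>x. Y x / sqrt v) std_normal_density" if v: "v > 0"
 proof -
  have "distr M borel (\<lambda>x. Y x / sqrt v) = std_normal_distribution"
  proof (rule Levy_uniqueness)
   show "real_distribution (distr M borel (\<lambda>x. Y x / sqrt v))" by (rule real_distribution_distr) simp
   show "real_distribution std_normal_distribution" by (rule real_dist_normal_dist)
   show "char (distr M borel (\<lambda>x. Y x / sqrt v)) = char std_normal_distribution"
    unfolding char_std_normal_distribution using v by (intro ext) (simp add: chd power_divide)
  qed
  hence "distr M lborel (\<lambda>x. Y x / sqrt v) = density lborel std_normal_density"
   by (metis (no_types, lifting) distr_cong sets_lborel)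
  thus d: "distributed M lborel (\<lambda>x. Y x / sqrt v) std_normal_density"
   unfolding distributed_def by auto
  show "distributed M lborel Y (normal_density 0 (sqrt v))"
   using normal_standard_normal_convert[of "sqrt v" Y 0] d v by simp
 qed
 show "normal_rv M Y"
 proof (cases "v = 0")
  case True
  show ?thesis unfolding normal_rv_def
   by (intro conjI Y exI[of _ 0] disjI1 refl z True)
 next
  case False
  hence "v > 0" using v by simp
  hence "sqrt v > 0" "distributed M lborel Y (normal_density 0 (sqrt v))" using pos by auto
  thus ?thesis unfolding normal_rv_def
   by (intro conjI Y exI[of _ 0] exI[of _ "sqrt v"] disjI2)
 qed
 show "integrable M (\<lambda>x. (Y x)\<^sup>2)" "expectation (\<lambda>x. (Y x)\<^sup>2) = v"
 proof (atomize(full), cases "v = 0")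
  case True
  have ae: "AE x in M. (Y x)\<^sup>2 = 0" using z[OF True] by eventually_elim simp
  have "integrable M (\<lambda>x. (Y x)\<^sup>2) \<longleftrightarrow> integrable M (\<lambda>x. 0 :: real)" by (rule integrable_cong_AE) (use ae in auto)
  moreover have "expectation (\<lambda>x. (Y x)\<^sup>2) = expectation (\<lambda>x. 0)" by (rule integral_cong_AE) (use ae in auto)
  ultimately show "integrable M (\<lambda>x. (Y x)\<^sup>2) \<and> expectation (\<lambda>x. (Y x)\<^sup>2) = v" using True by simp
 next
  case False
  hence v0: "v > 0" using v by simp
  have hb: "has_bochner_integral lborel (\<lambda>x. std_normal_density x * x\<^sup>2) 1" using std_normal_moment_even[of 1] by (simp add: fact_numeral)
  have "integrable M (\<lambda>x. (Y x / sqrt v)\<^sup>2)" "expectation (\<lambda>x. (Y x / sqrt v)\<^sup>2) = 1"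
   using distributed_integrable[OF pos(2)[OF v0], of "\<lambda>x. x\<^sup>2"] integrable.intros[OF hb]
    distributed_integral[OF pos(2)[OF v0], of "\<lambda>x. x\<^sup>2"] has_bochner_integral_integral_eq[OF hb] by simp_all
  moreover have "(Y x)\<^sup>2 = v * (Y x / sqrt v)\<^sup>2" for x using v0 by (simp add: power_divide)
  ultimately show "integrable M (\<lambda>x. (Y x)\<^sup>2) \<and> expectation (\<lambda>x. (Y x)\<^sup>2) = v" by simp
 qed
 show "expectation Y = 0"
 proof (cases "v = 0")
  case True
  have "expectation Y = expectation (\<lambda>x. 0)" by (rule integral_cong_AE) (use z[OF True] in auto)
  thus ?thesis by simp
 next
  case False
  hence "v > 0" using v by simp
  thus ?thesis using normal_distributed_expectation[OF _ pos(1)] by simp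
 qed
qed

section \<open>Limits of the finite-dimensional distributions\<close>

context geometric_mixing
begin

abbreviation Gamma_C :: "real ^ 'd => real ^ 'd => real" where "Gamma_C u v \<equiv> Gam (phi u) (phi v)"

lemma alpha_prod_limit: "(\<lambda>n. expectation (\<lambda>s. \<alpha>n n s u * \<alpha>n n s v)) \<longlonglongrightarrow> Gamma_C u v"
proof (rule Lim_transform_eventually[OF variance_limit[OF centered_phi centered_phi]])
 show "\<forall>\<^sub>F n in sequentially. expectation (\<lambda>s. (\<Sum>i\<in>{1..int n}. phi u (X i s)) * (\<Sum>k\<in>{1..int n}. phi v (X k s))) / real n
  = expectation (\<lambda>s. \<alpha>n n s u * \<alpha>n n s v)"
  using eventually_ge_at_top[of 1]
 proof eventually_elim
  case (elim n)
  have "expectation (\<lambda>s. \<alpha>n n s u * \<alpha>n n s v) = expectation (\<lambda>s. (\<Sum>i\<in>{1..int n}. phi u (X i s)) * (\<Sum>k\<in>{1..int n}. phi v (X k s)) / real n)"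
   using elim by (intro Bochner_Integration.integral_cong refl) (simp add: alpha_eq)
  thus ?case by simp
 qed
qed

lemma alpha_int: "integrable M (\<lambda>s. \<alpha>n n s u)" "integrable M (\<lambda>s. \<alpha>n n s u * \<alpha>n n s v)"
proof -
 show "integrable M (\<lambda>s. \<alpha>n n s u)" using alpha_bound by (intro int_bounded[where B="sqrt n"]) auto
 show "integrable M (\<lambda>s. \<alpha>n n s u * \<alpha>n n s v)"
 proof (rule int_bounded[where B="sqrt n * sqrt n"])
  show "norm (\<alpha>n n s u * \<alpha>n n s v) \<le> sqrt n * sqrt n" for s
   unfolding real_norm_def abs_mult by (intro mult_mono alpha_bound) auto
 qed measurable
qed

lemma Gamma_C_sym: "Gamma_C u v = Gamma_C v u"
 by (rule LIMSEQ_unique[OF alpha_prod_limit]) (use alpha_prod_limit[of v u] in \<open>simp add: mult.commute\<close>)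

lemma quadratic_limit:
 assumes "finite I"
 shows "(\<lambda>n. expectation (\<lambda>s. (\<Sum>i\<in>I. c i * \<alpha>n n s (\<tau> i))\<^sup>2)) \<longlonglongrightarrow> (\<Sum>i\<in>I. \<Sum>j\<in>I. c i * c j * Gamma_C (\<tau> i) (\<tau> j))"
proof -
 have "expectation (\<lambda>s. (\<Sum>i\<in>I. c i * \<alpha>n n s (\<tau> i))\<^sup>2) = (\<Sum>i\<in>I. \<Sum>j\<in>I. c i * c j * expectation (\<lambda>s. \<alpha>n n s (\<tau> i) * \<alpha>n n s (\<tau> j)))" for n
 proof -
  have "expectation (\<lambda>s. (\<Sum>i\<in>I. c i * \<alpha>n n s (\<tau> i))\<^sup>2) = expectation (\<lambda>s. \<Sum>i\<in>I. \<Sum>j\<in>I. c i * c j * (\<alpha>n n s (\<tau> i) * \<alpha>n n s (\<tau> j)))"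
   unfolding power2_eq_square sum_product by (simp add: mult_ac)
  thus ?thesis using alpha_int by (simp add: Bochner_Integration.integral_sum Bochner_Integration.integrable_sum)
 qed
 thus ?thesis by (simp only:) (intro tendsto_sum tendsto_mult tendsto_const alpha_prod_limit)
qed

lemma Gamma_C_psd: "0 \<le> (\<Sum>i<n::nat. \<Sum>j<n. c i * c j * Gamma_C (\<tau> i) (\<tau> j))"
 by (rule LIMSEQ_le_const[OF quadratic_limit]) (auto intro!: integral_nonneg_AE)

lemma alpha_square_le: "expectation (\<lambda>s. (\<alpha>n n s u)\<^sup>2) \<le> T0"
proof (cases "n = 0")
 case False
 have "expectation (\<lambda>s. (\<alpha>n n s u)\<^sup>2) = expectation (\<lambda>s. (\<Sum>i\<in>{1..int n}. phi u (X i s))\<^sup>2) / real n"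
  using False by (simp add: alpha_eq power_divide)
 also have "... \<le> T0" using second_moment_le[OF centered_phi, of "{1..int n}" u] False by (simp add: divide_le_eq)
 finally show ?thesis .
qed (simp add: alpha_n_def T0_nonneg)

lemma Gamma_C_diag_le: "Gamma_C u u \<le> T0"
 by (rule LIMSEQ_le_const2[OF alpha_prod_limit]) (use alpha_square_le in \<open>simp add: power2_eq_square\<close>)

text \<open>At such points \<open>phi u (X 0 s)\<close> vanishes almost surely, hence so do all
  autocovariances. This is the source of the zeros of the limit process on the lower faces and at
  1.\<close>

lemma Gamma_C_zero:
 assumes "Cop u = 0 \<or> u = 1"
 shows "Gamma_C u u = 0"
proof -
 have "expectation (\<lambda>s. \<bar>phi u (X 0 s)\<bar>) = 0"
  using assms
 proof
  assume "Cop u = 0"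
  hence "\<bar>phi u x\<bar> = of_bool (Uf x \<le> u)" for x by (simp add: phi_def)
  thus ?thesis using expectation_ind[of 0 u] \<open>Cop u = 0\<close> by simp
 next
  assume "u = 1"
  hence "phi u x = 0" for x using Uf_cube[of x] by (simp add: phi_def Cop_1)
  thus ?thesis by simp
 qed
 moreover have "\<bar>acov (phi u) (phi u) h\<bar> \<le> expectation (\<lambda>s. \<bar>phi u (X 0 s)\<bar>)" for h
  unfolding acov_def
 proof (rule expectation_mono_bound)
  show "integrable M (\<lambda>s. \<bar>phi u (X 0 s)\<bar>)" using phi_bound by (intro int_bounded[where B=1]) auto
  show "\<bar>phi u (X 0 s) * phi u (X h s)\<bar> \<le> \<bar>phi u (X 0 s)\<bar>" for s
   using phi_bound[of u "X h s"] by (simp add: abs_mult mult_left_le)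
 qed measurable
 ultimately have "acov (phi u) (phi u) = (\<lambda>_. 0)" by (intro ext) simp
 thus ?thesis by (simp add: Gam_def)
qed

text \<open>Cramer-Wold: a linear combination of values of \<alpha>_n is, up to the scale B, the
  normalised sum of one \<open>centered\<close> function. Its long-run variance is identified by
  uniqueness of the limit of second moments.\<close>

lemma comb_clt:
 assumes I: "finite I"
 shows "(\<lambda>n. expectation (\<lambda>s. iexp (\<Sum>i\<in>I. b i * \<alpha>n n s (\<tau> i)))) \<longlonglongrightarrow> of_real (exp (- (\<Sum>i\<in>I. \<Sum>j\<in>I. b i * b j * Gamma_C (\<tau> i) (\<tau> j)) / 2))"
proof -
 \<comment> \<open>Scales the combination into [-1, 1]; the summand 1 avoids a division by
   0.\<close>
 define B where "B = 1 + (\<Sum>i\<in>I. \<bar>b i\<bar>)"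
 have B: "B \<ge> 1" by (auto simp: B_def intro!: sum_nonneg)
 define \<phi> where "\<phi> x = (\<Sum>i\<in>I. b i * phi (\<tau> i) x) / B" for x
 have bd: "\<bar>\<phi> x\<bar> \<le> 1" for x
 proof -
  have "\<bar>\<Sum>i\<in>I. b i * phi (\<tau> i) x\<bar> \<le> (\<Sum>i\<in>I. \<bar>b i\<bar>)"
   using phi_bound by (intro order.trans[OF sum_abs] sum_mono) (auto simp: abs_mult mult_left_le)
  also have "... \<le> B" by (simp add: B_def)
  finally show ?thesis using B by (simp add: \<phi>_def abs_divide)
 qed
 have ip: "integrable M (\<lambda>s. phi t (X i s))" for t i using phi_bound by (intro int_bounded[where B=1]) auto
 have "expectation (\<lambda>s. \<phi> (X 0 s)) = (\<Sum>i\<in>I. b i * expectation (\<lambda>s. phi (\<tau> i) (X 0 s))) / B"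
  unfolding \<phi>_def using ip by (simp add: Bochner_Integration.integral_sum)
 hence c: "centered \<phi>" using bd by (auto simp: centered_def phi_mean \<phi>_def[abs_def])
 have eq: "(\<Sum>i\<in>I. b i * \<alpha>n n s (\<tau> i)) = B / sqrt n * (\<Sum>k\<in>{1..int n}. \<phi> (X k s))" if "n \<ge> 1" for n s
 proof -
  have "(\<Sum>k\<in>{1..int n}. \<phi> (X k s)) = (\<Sum>i\<in>I. b i * (\<Sum>k\<in>{1..int n}. phi (\<tau> i) (X k s))) / B"
   unfolding \<phi>_def sum_divide_distrib[symmetric] by (subst sum.swap) (simp add: sum_distrib_left)
  thus ?thesis using B that by (simp add: alpha_eq sum_divide_distrib[symmetric])
 qed
 have l1: "(\<lambda>n. expectation (\<lambda>s. iexp (\<Sum>i\<in>I. b i * \<alpha>n n s (\<tau> i)))) \<longlonglongrightarrow> of_real (exp (- (B\<^sup>2 * Gam \<phi> \<phi> / 2)))"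
 proof (rule Lim_transform_eventually[OF clt[OF c, of B]])
  show "\<forall>\<^sub>F n in sequentially. expectation (\<lambda>s. iexp (B / sqrt n * (\<Sum>i\<in>{1..int n}. \<phi> (X i s)))) = expectation (\<lambda>s. iexp (\<Sum>i\<in>I. b i * \<alpha>n n s (\<tau> i)))"
   using eventually_ge_at_top[of 1] by eventually_elim (simp only: eq)
 qed
 have q1: "(\<lambda>n. B\<^sup>2 * (expectation (\<lambda>s. (\<Sum>i\<in>{1..int n}. \<phi> (X i s)) * (\<Sum>k\<in>{1..int n}. \<phi> (X k s))) / real n)) \<longlonglongrightarrow> B\<^sup>2 * Gam \<phi> \<phi>"
  by (intro tendsto_mult tendsto_const variance_limit c)
 have q2: "\<forall>\<^sub>F n in sequentially. expectation (\<lambda>s. (\<Sum>i\<in>I. b i * \<alpha>n n s (\<tau> i))\<^sup>2) = B\<^sup>2 * (expectation (\<lambda>s. (\<Sum>i\<in>{1..int n}. \<phi> (X i s)) * (\<Sum>k\<in>{1..int n}. \<phi> (X k s))) / real n)"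
  (is "\<forall>\<^sub>F n in sequentially. ?l n = ?r n")
  using eventually_ge_at_top[of 1]
 proof eventually_elim
  case (elim n)
  have "expectation (\<lambda>s. (\<Sum>i\<in>I. b i * \<alpha>n n s (\<tau> i))\<^sup>2) = expectation (\<lambda>s. B\<^sup>2 / real n * ((\<Sum>i\<in>{1..int n}. \<phi> (X i s)) * (\<Sum>k\<in>{1..int n}. \<phi> (X k s))))"
   by (intro Bochner_Integration.integral_cong refl, subst eq[OF elim]) (simp add: power2_eq_square)
  thus ?case by simp
 qed
 have "\<forall>\<^sub>F n in sequentially. ?r n = ?l n" using q2 by (rule eventually_mono) (rule sym)
 from Lim_transform_eventually[OF q1 this]
 have "B\<^sup>2 * Gam \<phi> \<phi> = (\<Sum>i\<in>I. \<Sum>j\<in>I. b i * b j * Gamma_C (\<tau> i) (\<tau> j))"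
  by (rule LIMSEQ_unique[OF _ quadratic_limit[OF I]])
 thus ?thesis using l1 by simp
qed

end

section \<open>Dyadic points and continuity of the limit process\<close>

lemma grid_mono: "k \<le> l ==> grid k \<subseteq> grid l"
 by (rule lift_Suc_mono_le[of grid, OF grid_Suc])

text \<open>Ensures that for n \<ge> 2^k the cut-off 1/n in the modulus of \<alpha>_n is inactive
  between distinct grid points.\<close>

lemma grid_separated:
 assumes "s \<in> grid k" "t \<in> grid k" "s \<noteq> t"
 shows "1 / 2 ^ k \<le> norm (s - t)"
proof -
 obtain j where j: "s $ j \<noteq> t $ j" using assms(3) by (auto simp: vec_eq_iff)
 obtain a b :: int where ab: "s $ j = of_int a / 2 ^ k" "t $ j = of_int b / 2 ^ k" using assms(1,2) unfolding grid_iff by blast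
 have "a \<noteq> b" using j ab by auto
 hence "1 \<le> \<bar>real_of_int a - of_int b\<bar>" by linarith
 hence "1 / 2 ^ k \<le> \<bar>(s - t) $ j\<bar>" by (simp add: ab diff_divide_distrib[symmetric] divide_right_mono)
 also have "... \<le> norm (s - t)" by (rule component_le_norm_cart)
 finally show ?thesis .
qed

lemma norm_iexp_diff: "norm (iexp x - iexp y) \<le> \<bar>x - y\<bar>"
proof -
 have "iexp x - iexp y = iexp y * (iexp (x - y) - 1)" by (simp add: right_diff_distrib flip: exp_add)
 thus ?thesis using iexp_approx1[of "x - y" 0] by (simp add: norm_mult)
qed

lemma cube_norm_diff:
 fixes u v :: "real ^ 'd"
 assumes "\<And>k. \<bar>u $ k - v $ k\<bar> \<le> x"
 shows "norm (u - v) \<le> real CARD('d) * x"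
proof -
 have "norm (u - v) \<le> (\<Sum>k\<in>UNIV. \<bar>(u - v) $ k\<bar>)" by (rule norm_le_l1_cart)
 also have "... \<le> (\<Sum>k\<in>(UNIV :: 'd set). x)" using assms by (intro sum_mono) simp
 finally show ?thesis by simp
qed

lemma fl_norm: "norm (u - fl k u) \<le> real CARD('d) * (1 / 2 ^ k)" for u :: "real ^ 'd"
 by (rule cube_norm_diff) (rule fl_dist)

lemma fl_cube: "u \<in> unit_cube ==> fl k u \<in> unit_cube"
 using fl_grid[of u k] by (simp add: grid_iff)

lemma fl_tendsto: "(\<lambda>k. fl k u) \<longlonglongrightarrow> (u :: real ^ 'd)"
proof (rule LIM_zero_cancel, rule Lim_null_comparison[OF always_eventually], rule allI)
 show "norm (fl k u - u) \<le> real CARD('d) * (1 / 2) ^ k" for k using fl_norm[of u k] by (simp add: norm_minus_commute power_divide)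
 show "(\<lambda>k. real CARD('d) * (1 / 2) ^ k) \<longlonglongrightarrow> 0" by (intro tendsto_mult_right_zero LIMSEQ_realpow_zero) auto
qed

lemma dyadic_powr_tendsto:
 fixes c :: real
 assumes \<theta>: "0 < \<theta>" and c: "c \<ge> 0"
 shows "(\<lambda>k. L * (c * (1 / 2 ^ k)) powr \<theta>) \<longlonglongrightarrow> 0"
proof -
 have "(\<lambda>k. (1/2 :: real) ^ k) \<longlonglongrightarrow> 0" by (rule LIMSEQ_realpow_zero) auto
 hence "(\<lambda>k. L * (c * (1 / 2 ^ k)) powr \<theta>) \<longlonglongrightarrow> L * (c * 0) powr \<theta>"
  using \<theta> c by (intro tendsto_mult tendsto_const tendsto_powr2) (auto simp: power_one_over)
 thus ?thesis using \<theta> by simp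
qed

context geometric_mixing
begin

text \<open>Transfers the modulus of \<open>\<alpha>\<^sub>n\<close> to a limit of its finite-dimensional distributions.\<close>

lemma grid_modulus_limit:
 assumes N: "prob_space N" and Am: "\<And>t. A t \<in> borel_measurable N"
  and sq: "\<And>t. t \<in> grid k ==> integrable N (\<lambda>\<omega>. (A t \<omega>)\<^sup>2)" "\<And>t. t \<in> grid k ==> integral\<^sup>L N (\<lambda>\<omega>. (A t \<omega>)\<^sup>2) \<le> T0"
  and char: "\<And>b. integral\<^sup>L N (\<lambda>\<omega>. iexp (\<Sum>t\<in>grid k. b t * A t \<omega>)) = of_real (exp (- (\<Sum>i\<in>grid k. \<Sum>j\<in>grid k. b i * b j * Gamma_C i j) / 2))"
  and E: "\<And>n. n \<ge> 1 ==> \<exists>E\<in>sets M. prob E \<ge> 1 - \<eta> \<and>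
   (\<forall>s\<in>E. \<forall>u\<in>unit_cube. \<forall>v\<in>unit_cube. \<bar>\<alpha>n n s u - \<alpha>n n s v\<bar> \<le> L * max (norm (u - v)) (1 / real n) powr \<theta>)"
  and \<theta>: "0 < \<theta>" "\<theta> < 1/2" and L: "L \<ge> 1"
 shows "measure N {\<omega> \<in> space N. \<exists>s\<in>grid k. \<exists>t\<in>grid k. 2 * L * norm (s - t) powr \<theta> < \<bar>A s \<omega> - A t \<omega>\<bar>} \<le> \<eta>"
proof -
 interpret N: prob_space N by (rule N)
 let ?g = "grid k \<times> grid k :: ((real ^ 'd) \<times> (real ^ 'd)) set"
 define q where "q x = (\<lambda>(s, t). max 0 (\<bar>x s - x t\<bar> - L * norm (s - t) powr \<theta>))" for x :: "real ^ 'd => real"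
 \<comment> \<open>A Lipschitz substitute for the indicator that the modulus fails: F is 0 if the
   modulus holds with L, and 1 if it fails with 2 L, because then the excess over L is at least
   2^-k.\<close>
 define F where "F x = min 1 (2 ^ k * (\<Sum>p\<in>?g. q x p))" for x
 have q0: "0 \<le> q x p" for x p by (cases p) (simp add: q_def)
 hence F01: "0 \<le> F x" "F x \<le> 1" for x by (simp_all add: F_def sum_nonneg)
 have FL: "\<bar>F x - F y\<bar> \<le> 2 ^ k * (real (card ?g) * 2) * \<delta>" if h: "\<And>t. t \<in> grid k ==> \<bar>x t - y t\<bar> \<le> \<delta>" "0 \<le> \<delta>" for x y \<delta>
 proof -
  have "\<bar>q x p - q y p\<bar> \<le> 2 * \<delta>" if pg: "p \<in> ?g" for p
  proof -
   obtain s t where p: "p = (s, t)" "s \<in> grid k" "t \<in> grid k" using pg by auto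
   show ?thesis using h(1)[OF p(2)] h(1)[OF p(3)] by (simp add: p(1) q_def)
  qed
  hence "\<bar>\<Sum>p\<in>?g. q x p - q y p\<bar> \<le> real (card ?g) * (2 * \<delta>)"
   by (intro order.trans[OF sum_abs] sum_bounded_above)
  hence "2 ^ k * \<bar>\<Sum>p\<in>?g. q x p - q y p\<bar> \<le> 2 ^ k * (real (card ?g) * (2 * \<delta>))" by (rule mult_left_mono) simp
  moreover have "2 ^ k * (\<Sum>p\<in>?g. q x p) - 2 ^ k * (\<Sum>p\<in>?g. q y p) = 2 ^ k * (\<Sum>p\<in>?g. q x p - q y p)"
   by (simp add: sum_subtractf right_diff_distrib)
  ultimately have "\<bar>2 ^ k * (\<Sum>p\<in>?g. q x p) - 2 ^ k * (\<Sum>p\<in>?g. q y p)\<bar> \<le> 2 ^ k * (real (card ?g) * 2) * \<delta>"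
   by (simp only: abs_mult mult.assoc) simp
  moreover have "\<bar>min 1 a - min 1 b\<bar> \<le> \<bar>a - b\<bar>" for a b :: real by (auto simp: min_def)
  ultimately show ?thesis unfolding F_def by (rule order.trans[rotated])
 qed
 have B: "\<bar>F x\<bar> \<le> 1" for x using F01[of x] by simp
 have lim: "(\<lambda>n. expectation (\<lambda>s. F (\<alpha>n n s))) \<longlonglongrightarrow> N.expectation (\<lambda>\<omega>. F (\<lambda>t. A t \<omega>))"
 proof (rule fidi_lipschitz[where T="grid k" and c=T0, OF prob_space_axioms N finite_grid alpha_meas Am])
  show "integrable M (\<lambda>s. (\<alpha>n n s t)\<^sup>2)" for n t using alpha_int(2)[of n t t] by (simp add: power2_eq_square)
  show "(\<lambda>n. expectation (\<lambda>s. iexp (\<Sum>t\<in>grid k. b t * \<alpha>n n s t))) \<longlonglongrightarrow> N.expectation (\<lambda>\<omega>. iexp (\<Sum>t\<in>grid k. b t * A t \<omega>))" for b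
   unfolding char by (rule comb_clt) simp
 qed (rule alpha_square_le sq B FL | assumption)+
 have "N.expectation (\<lambda>\<omega>. F (\<lambda>t. A t \<omega>)) \<le> \<eta>"
 proof (rule LIMSEQ_le_const2[OF lim], intro exI[of _ "2 ^ k"] allI impI)
  fix n :: nat assume n: "2 ^ k \<le> n"
  have n1: "n \<ge> 1" using n by (metis le_trans one_le_numeral one_le_power)
  have rn: "1 / real n \<le> 1 / 2 ^ k"
  proof -
   have "real (2 ^ k) \<le> real n" using n by (rule of_nat_mono)
   thus ?thesis by (intro divide_left_mono) (use n1 in auto)
  qed
  obtain S where S: "S \<in> sets M" "prob S \<ge> 1 - \<eta>"
   and m: "\<And>s u v. s \<in> S ==> u \<in> unit_cube ==> v \<in> unit_cube ==> \<bar>\<alpha>n n s u - \<alpha>n n s v\<bar> \<le> L * max (norm (u - v)) (1 / real n) powr \<theta>"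
   using E[OF n1] by blast
  have z: "F (\<alpha>n n s) = 0" if s: "s \<in> S" for s
  proof -
   have "q (\<alpha>n n s) p = 0" if pg: "p \<in> ?g" for p
   proof -
    obtain u v where p: "p = (u, v)" "u \<in> grid k" "v \<in> grid k" using pg by auto
    show ?thesis
    proof (cases "u = v")
     case False
     from grid_separated[OF p(2,3) False] rn have "max (norm (u - v)) (1 / real n) = norm (u - v)" by simp
     moreover have "u \<in> unit_cube" "v \<in> unit_cube" using p grid_subset_cube by blast+
     ultimately show ?thesis using m[OF s, of u v] by (simp add: p(1) q_def del: atLeastAtMost_iff)
    qed (simp add: p(1) q_def)
   qed
   thus ?thesis by (simp add: F_def)
  qed
  have "expectation (\<lambda>s. F (\<alpha>n n s)) \<le> expectation (indicat_real (space M - S))"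
  proof (rule integral_mono)
   show "integrable M (\<lambda>s. F (\<alpha>n n s))"
    using lipschitz_coordinates_measurable[where F=F and \<xi>="\<alpha>n n", OF finite_grid alpha_meas B FL] B by (intro integrable_bdd[where B=1]) auto
   show "integrable M (indicat_real (space M - S))" using S by (intro integrable_real_indicator) (auto simp: emeasure_eq_measure)
   show "F (\<alpha>n n s) \<le> indicat_real (space M - S) s" if "s \<in> space M" for s
    using z[of s] F01[of "\<alpha>n n s"] that by (cases "s \<in> S") auto
  qed
  also have "... \<le> \<eta>" using S by (simp add: prob_compl)
  finally show "expectation (\<lambda>s. F (\<alpha>n n s)) \<le> \<eta>" .
 qed
 moreover let ?B = "{\<omega> \<in> space N. \<exists>s\<in>grid k. \<exists>t\<in>grid k. 2 * L * norm (s - t) powr \<theta> < \<bar>A s \<omega> - A t \<omega>\<bar>}"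
 have "N.expectation (indicat_real ?B) \<le> N.expectation (\<lambda>\<omega>. F (\<lambda>t. A t \<omega>))"
 proof (rule integral_mono)
  note [measurable] = Am
  have "?B \<in> sets N" by (intro sets.sets_Collect_finite_Ex finite_grid) measurable
  thus "integrable N (indicat_real ?B)" by (intro integrable_real_indicator) (auto simp: N.emeasure_eq_measure)
  show "integrable N (\<lambda>\<omega>. F (\<lambda>t. A t \<omega>))"
   using lipschitz_coordinates_measurable[where F=F and \<xi>="\<lambda>\<omega> t. A t \<omega>", OF finite_grid Am B FL] B by (intro N.integrable_bdd[where B=1]) auto
  fix \<omega> assume "\<omega> \<in> space N"
  show "indicat_real ?B \<omega> \<le> F (\<lambda>t. A t \<omega>)"
  proof (cases "\<omega> \<in> ?B")
   case True
   then obtain s t where st: "s \<in> grid k" "t \<in> grid k" "2 * L * norm (s - t) powr \<theta> < \<bar>A s \<omega> - A t \<omega>\<bar>" by blast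
   have "s \<noteq> t" using st(3) by auto
   note sep = grid_separated[OF st(1,2) this]
   have "1 / 2 ^ k = (1 / 2 ^ k :: real) powr 1" by simp
   also have "... \<le> (1 / 2 ^ k) powr \<theta>" using \<theta> by (intro powr_mono') auto
   also have "... \<le> norm (s - t) powr \<theta>" using sep \<theta> by (intro powr_mono2) auto
   also have "... \<le> L * norm (s - t) powr \<theta>" using mult_right_mono[OF L, of "norm (s - t) powr \<theta>"] by simp
   also have "... \<le> q (\<lambda>t. A t \<omega>) (s, t)" using st(3) by (simp add: q_def)
   also have "... \<le> (\<Sum>p\<in>?g. q (\<lambda>t. A t \<omega>) p)" using st q0 by (intro member_le_sum) auto
   finally have "1 \<le> 2 ^ k * (\<Sum>p\<in>?g. q (\<lambda>t. A t \<omega>) p)" by (simp add: divide_le_eq mult.commute)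
   thus ?thesis using True by (simp add: F_def)
  qed (use F01 in simp)
 qed
 ultimately show ?thesis by (simp add: Int_absorb2 subset_eq)
qed

text \<open>Continuity of the kernel along dyadic floors is read off the processes: at
  \<open>fl k u\<close> and at u the characteristic functions of \<alpha>_n differ by at most the
  mean absolute increments, which are small uniformly in n \<ge> 2^k.\<close>

lemma char_fl_limit:
 fixes b :: "real ^ 'd => real"
 assumes I: "finite I" "I \<subseteq> unit_cube"
 defines "Q \<equiv> \<lambda>\<tau>. \<Sum>i\<in>I. \<Sum>j\<in>I. b i * b j * Gamma_C (\<tau> i) (\<tau> j)"
 shows "(\<lambda>k. exp (- Q (fl k) / 2)) \<longlonglongrightarrow> exp (- Q (\<lambda>u. u) / 2)"
proof -
 let ?d = "real CARD('d)"
 obtain K where K: "K \<ge> 0" "\<And>n u v \<rho>. n \<ge> 1 ==> u \<in> unit_cube ==> v \<in> unit_cube ==> (\<Sum>j\<in>UNIV. \<bar>u $ j - v $ j\<bar>) \<le> \<rho> ==> 1 / 2 \<le> real n * \<rho> ==>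
  expectation (\<lambda>s. (\<alpha>n n s u - \<alpha>n n s v) ^ (2 * 1)) \<le> K * (\<rho> powr (1 - 1/2)) ^ 1"
  using alpha_moment[of "1/2" 1] by auto
 define r where "r k = sqrt (K * (?d * (1 / 2 ^ k)) powr (1/2))" for k
 have cmp: "\<bar>exp (- Q (fl k) / 2) - exp (- Q (\<lambda>u. u) / 2)\<bar> \<le> (\<Sum>i\<in>I. \<bar>b i\<bar> * r k)" for k
 proof -
  have "norm (complex_of_real (exp (- Q (fl k) / 2)) - of_real (exp (- Q (\<lambda>u. u) / 2))) \<le> (\<Sum>i\<in>I. \<bar>b i\<bar> * r k)"
   unfolding Q_def
  proof (rule LIMSEQ_le_const2[OF tendsto_norm[OF tendsto_diff[OF comb_clt[OF I(1)] comb_clt[OF I(1)]]]], intro exI[of _ "2 ^ k"] allI impI)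
   fix n :: nat assume n: "2 ^ k \<le> n"
   have n1: "n \<ge> 1" using n by (metis le_trans one_le_numeral one_le_power)
   have "real (2 ^ k) \<le> real n" using n by (rule of_nat_mono)
   hence "2 ^ k * 1 \<le> real n * ?d" by (intro mult_mono) (auto simp: Suc_leI)
   hence "1 \<le> real n * ?d / 2 ^ k" by (simp add: le_divide_eq)
   hence "1 / 2 \<le> real n * ?d / 2 ^ k" by linarith
   hence np: "1 / 2 \<le> real n * (?d * (1 / 2 ^ k))" by simp
   let ?S = "\<lambda>\<tau> s. \<Sum>i\<in>I. b i * \<alpha>n n s (\<tau> i)" and ?D = "\<lambda>i s. \<alpha>n n s (fl k i) - \<alpha>n n s i"
   have iD: "integrable M (\<lambda>s. \<bar>?D i s\<bar>)" for i
   proof -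
    have "\<bar>?D i s\<bar> \<le> 2 * sqrt n" for s using alpha_bound[of n s "fl k i"] alpha_bound[of n s i] by linarith
    thus ?thesis by (intro int_bounded[where B="2 * sqrt n"]) auto
   qed
   have D: "expectation (\<lambda>s. \<bar>?D i s\<bar>) \<le> r k" if i: "i \<in> I" for i
   proof -
    have ic: "i \<in> unit_cube" using i I by blast
    have "integrable M (\<lambda>s. \<bar>?D i s\<bar>\<^sup>2)" by (simp add: power2_eq_square left_diff_distrib right_diff_distrib alpha_int)
    hence "(expectation (\<lambda>s. \<bar>?D i s\<bar>))\<^sup>2 \<le> expectation (\<lambda>s. \<bar>?D i s\<bar>\<^sup>2)"
     using variance_eq[OF iD[of i]] variance_positive[of "\<lambda>s. \<bar>?D i s\<bar>"] by simp
    also have "... \<le> K * (?d * (1 / 2 ^ k)) powr (1/2)"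
    proof -
     have "(\<Sum>j\<in>UNIV. \<bar>fl k i $ j - i $ j\<bar>) \<le> (\<Sum>j\<in>(UNIV::'d set). 1 / 2 ^ k)"
      using fl_dist[of i _ k] by (intro sum_mono) (simp add: abs_minus_commute)
     thus ?thesis using K(2)[OF n1 fl_cube[OF ic] ic _ np] by simp
    qed
    finally show ?thesis unfolding r_def by (intro real_le_rsqrt)
   qed
   have m: "(\<lambda>s. iexp (?S \<tau> s)) \<in> borel_measurable M" for \<tau> by measurable
   have iS: "integrable M (\<lambda>s. iexp (?S \<tau> s))" for \<tau> by (rule int_bounded[OF m, where B=1]) simp
   have "norm (expectation (\<lambda>s. iexp (?S (fl k) s)) - expectation (\<lambda>s. iexp (?S (\<lambda>u. u) s))) = norm (expectation (\<lambda>s. iexp (?S (fl k) s) - iexp (?S (\<lambda>u. u) s)))"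
    by (simp only: Bochner_Integration.integral_diff[OF iS iS])
   also have "... \<le> expectation (\<lambda>s. norm (iexp (?S (fl k) s) - iexp (?S (\<lambda>u. u) s)))" by (rule integral_norm_bound)
   also have "... \<le> expectation (\<lambda>s. \<Sum>i\<in>I. \<bar>b i\<bar> * \<bar>?D i s\<bar>)"
   proof (rule integral_mono)
    show "integrable M (\<lambda>s. norm (iexp (?S (fl k) s) - iexp (?S (\<lambda>u. u) s)))" by (intro integrable_norm Bochner_Integration.integrable_diff iS)
    show "integrable M (\<lambda>s. \<Sum>i\<in>I. \<bar>b i\<bar> * \<bar>?D i s\<bar>)" by (intro Bochner_Integration.integrable_sum integrable_mult_right iD)
    fix s
    have "norm (iexp (?S (fl k) s) - iexp (?S (\<lambda>u. u) s)) \<le> \<bar>?S (fl k) s - ?S (\<lambda>u. u) s\<bar>" by (rule norm_iexp_diff)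
    also have "?S (fl k) s - ?S (\<lambda>u. u) s = (\<Sum>i\<in>I. b i * ?D i s)" by (simp add: sum_subtractf right_diff_distrib)
    also have "\<bar>...\<bar> \<le> (\<Sum>i\<in>I. \<bar>b i\<bar> * \<bar>?D i s\<bar>)" unfolding abs_mult[symmetric] by (rule sum_abs)
    finally show "norm (iexp (?S (fl k) s) - iexp (?S (\<lambda>u. u) s)) \<le> (\<Sum>i\<in>I. \<bar>b i\<bar> * \<bar>?D i s\<bar>)" .
   qed
   also have "... = (\<Sum>i\<in>I. \<bar>b i\<bar> * expectation (\<lambda>s. \<bar>?D i s\<bar>))"
    using iD by (subst Bochner_Integration.integral_sum) auto
   also have "... \<le> (\<Sum>i\<in>I. \<bar>b i\<bar> * r k)" by (intro sum_mono mult_left_mono D) auto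
   finally show "norm (expectation (\<lambda>s. iexp (?S (fl k) s)) - expectation (\<lambda>s. iexp (?S (\<lambda>u. u) s))) \<le> (\<Sum>i\<in>I. \<bar>b i\<bar> * r k)" .
  qed
  thus ?thesis by (simp only: of_real_diff[symmetric] norm_of_real)
 qed
 have "r \<longlonglongrightarrow> sqrt 0" unfolding r_def by (intro tendsto_real_sqrt dyadic_powr_tendsto) auto
 hence "(\<lambda>k. \<Sum>i\<in>I. \<bar>b i\<bar> * r k) \<longlonglongrightarrow> (\<Sum>i\<in>I. \<bar>b i\<bar> * 0)" by (intro tendsto_sum tendsto_mult tendsto_const) simp
 hence z: "(\<lambda>k. \<Sum>i\<in>I. \<bar>b i\<bar> * r k) \<longlonglongrightarrow> 0" by simp
 show ?thesis by (rule LIM_zero_cancel, rule Lim_null_comparison[OF always_eventually z]) (use cmp in simp)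
qed

text \<open>A Gaussian family on the dyadic points is extended by limits along
  \<open>fl k u\<close>. On the null set where the modulus or a zero fails, the process is put equal
  to 0, so that Hoelder continuity and the zeros hold at every sample point.\<close>

lemma ex_limit_process:
 shows "\<exists>\<alpha> :: (nat => real) => real ^ 'd => real.
  (\<forall>u. (\<lambda>\<omega>. \<alpha> \<omega> u) \<in> borel_measurable gauss_space) \<and> (\<forall>\<omega>. \<alpha> \<omega> \<in> extensional unit_cube) \<and>
  (\<forall>\<omega> \<theta>. 0 < \<theta> --> \<theta> < 1/2 --> (\<exists>L\<ge>0. \<forall>u\<in>unit_cube. \<forall>v\<in>unit_cube. \<bar>\<alpha> \<omega> u - \<alpha> \<omega> v\<bar> \<le> L * norm (u - v) powr \<theta>)) \<and>
  (\<forall>\<omega> u j. u \<in> unit_cube --> u $ j = 0 --> \<alpha> \<omega> u = 0) \<and> (\<forall>\<omega>. \<alpha> \<omega> 1 = 0) \<and>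
  (\<forall>I b. finite I --> I \<subseteq> unit_cube -->
   integral\<^sup>L gauss_space (\<lambda>\<omega>. iexp (\<Sum>u\<in>I. b u * \<alpha> \<omega> u)) = of_real (exp (- (\<Sum>u\<in>I. \<Sum>v\<in>I. b u * b v * Gamma_C u v) / 2)))"
proof -
 interpret P: prob_space gauss_space by (rule prob_space_gauss)
 let ?d = "real CARD('d)"
 let ?Q = "\<lambda>(I :: (real ^ 'd) set) b \<tau>. \<Sum>i\<in>I. \<Sum>j\<in>I. b i * b j * Gamma_C (\<tau> i) (\<tau> j)"
 define D :: "(real ^ 'd) set" where "D = (\<Union>k. grid k)"
 have cD: "countable D" unfolding D_def by (rule countable_UN, rule countableI_type, rule countable_finite, rule finite_grid)
 have gD: "grid k \<subseteq> D" for k by (auto simp: D_def)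
 have flD: "fl k u \<in> D" if "u \<in> unit_cube" for k u using fl_grid[OF that] by (auto simp: D_def)
 have DC: "D \<subseteq> unit_cube" using grid_subset_cube unfolding D_def by blast
 have oc: "(1 :: real ^ 'd) \<in> unit_cube" by (rule cubeI) auto
 define char_eq where "char_eq A \<longleftrightarrow> (\<forall>I b \<tau>. finite I --> (\<forall>i\<in>I. \<tau> i \<in> D) -->
    integral\<^sup>L gauss_space (\<lambda>\<omega>. iexp (\<Sum>i\<in>I. b i * A (\<tau> i) \<omega>)) = of_real (exp (- ?Q I b \<tau> / 2)))" for A
 have "\<exists>A. (\<forall>t. A t \<in> borel_measurable gauss_space) \<and> char_eq A"
  unfolding char_eq_def by (rule ex_gaussian_family[where \<Gamma>=Gamma_C and 'i="real ^ 'd", OF cD Gamma_C_sym Gamma_C_psd])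
 then obtain A where Am [measurable]: "\<And>t. A t \<in> borel_measurable gauss_space" and char: "char_eq A" by blast
 have Ach: "integral\<^sup>L gauss_space (\<lambda>\<omega>. iexp (\<Sum>i\<in>I. b i * A (\<tau> i) \<omega>)) = of_real (exp (- ?Q I b \<tau> / 2))"
  if "finite I" "\<And>i. i \<in> I ==> \<tau> i \<in> D" for I b \<tau>
  using char[unfolded char_eq_def, rule_format, of I \<tau> b] that by blast
 have G0: "0 \<le> Gamma_C t t" for t using Gamma_C_psd[of "\<lambda>_. 1" "\<lambda>_. t" 1] by simp
 have A1: "P.expectation (\<lambda>\<omega>. iexp (x * A t \<omega>)) = of_real (exp (- (x\<^sup>2 * Gamma_C t t / 2)))" if "t \<in> D" for x t
  using Ach[of "{t}" "\<lambda>u. u" "\<lambda>_. x"] that by (simp add: power2_eq_square)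
 note normal = P.normal_of_char[OF Am G0 A1]
 \<comment> \<open>The dyadic points where the limit must vanish. Rounding down maps the lower faces
   and the corner 1 into themselves, so these countably many points determine the zeros.\<close>
 define D0 where "D0 = {t \<in> D. (\<exists>j. t $ j = 0) \<or> t = 1}"
 have cD0: "countable D0" unfolding D0_def by (rule countable_subset[OF _ cD]) auto
 have zero: "AE \<omega> in gauss_space. \<forall>t\<in>D0. A t \<omega> = 0"
 proof (subst AE_ball_countable[OF cD0], intro ballI)
  fix t assume t: "t \<in> D0"
  hence "t \<in> D" by (simp add: D0_def)
  moreover have "Gamma_C t t = 0" using t DC by (intro Gamma_C_zero) (auto simp: D0_def intro: Cop_0)
  ultimately show "AE \<omega> in gauss_space. A t \<omega> = 0" by (rule normal(1))
 qed
 \<comment> \<open>Countably many exponents increasing to 1/2 let one null set serve all \<theta> <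
   1/2.\<close>
 define \<Theta> where "\<Theta> m = 1/2 - 1 / (real m + 3)" for m :: nat
 have \<Theta>: "0 < \<Theta> m" "\<Theta> m < 1/2" for m by (simp_all add: \<Theta>_def field_simps)
 \<comment> \<open>A natural number as constant keeps the quantifier countable and the event
   measurable.\<close>
 define good where "good m \<omega> \<longleftrightarrow> (\<exists>L::nat. \<forall>k. \<forall>s\<in>grid k. \<forall>t\<in>grid k. \<bar>A s \<omega> - A t \<omega>\<bar> \<le> real L * norm (s - t) powr \<Theta> m)" for m \<omega>
 have goodm [measurable]: "Measurable.pred gauss_space (good m)" for m unfolding good_def by measurable
 have AEgood: "AE \<omega> in gauss_space. good m \<omega>" for m
 proof -
  have "1 \<le> P.prob {\<omega> \<in> space gauss_space. good m \<omega>}"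
  proof (rule field_le_epsilon)
   fix \<eta> :: real assume \<eta>: "\<eta> > 0"
   obtain L where L: "L \<ge> 1" and E: "\<And>n. n \<ge> 1 ==> \<exists>E\<in>sets M. prob E \<ge> 1 - \<eta> \<and>
    (\<forall>s\<in>E. \<forall>u\<in>unit_cube. \<forall>v\<in>unit_cube. \<bar>\<alpha>n n s u - \<alpha>n n s v\<bar> \<le> L * max (norm (u - v)) (1 / real n) powr \<Theta> m)"
    using alpha_modulus[OF \<Theta> \<eta>] by blast
   define B where "B k = {\<omega> \<in> space gauss_space. \<exists>s\<in>grid k. \<exists>t\<in>grid k. 2 * L * norm (s - t) powr \<Theta> m < \<bar>A s \<omega> - A t \<omega>\<bar>}" for k
   have Bs: "B k \<in> sets gauss_space" for k unfolding B_def by (intro sets.sets_Collect_finite_Ex finite_grid) measurable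
   have pB: "P.prob (B k) \<le> \<eta>" for k unfolding B_def
   proof (rule grid_modulus_limit[OF prob_space_gauss Am _ _ _ E \<Theta> L])
    fix t :: "real ^ 'd" assume "t \<in> grid k"
    hence t: "t \<in> D" using gD by blast
    show "integrable gauss_space (\<lambda>\<omega>. (A t \<omega>)\<^sup>2)" "P.expectation (\<lambda>\<omega>. (A t \<omega>)\<^sup>2) \<le> T0"
     using normal(3,4)[OF t] Gamma_C_diag_le[of t] by simp_all
   next
    show "P.expectation (\<lambda>\<omega>. iexp (\<Sum>t\<in>grid k. b t * A t \<omega>)) = of_real (exp (- (\<Sum>i\<in>grid k. \<Sum>j\<in>grid k. b i * b j * Gamma_C i j) / 2))" for b
     by (rule Ach[of "grid k" "\<lambda>u. u" b]) (use gD in auto)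
   qed
   have "B k \<subseteq> B l" if "k \<le> l" for k l using grid_mono[OF that] unfolding B_def by blast
   hence "incseq B" by (simp add: incseq_def)
   hence "(\<lambda>k. P.prob (B k)) \<longlonglongrightarrow> P.prob (\<Union>k. B k)" using Bs by (intro P.finite_Lim_measure_incseq) auto
   hence pU: "P.prob (\<Union>k. B k) \<le> \<eta>" by (rule LIMSEQ_le_const2) (use pB in blast)
   obtain L' :: nat where L': "2 * L \<le> real L'" using real_arch_simple by blast
   have "space gauss_space - (\<Union>k. B k) \<subseteq> {\<omega> \<in> space gauss_space. good m \<omega>}"
   proof
    fix \<omega> assume w: "\<omega> \<in> space gauss_space - (\<Union>k. B k)"
    have "\<bar>A s \<omega> - A t \<omega>\<bar> \<le> real L' * norm (s - t) powr \<Theta> m" if "s \<in> grid k" "t \<in> grid k" for k s t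
    proof -
     have "\<bar>A s \<omega> - A t \<omega>\<bar> \<le> 2 * L * norm (s - t) powr \<Theta> m" using w that unfolding B_def by force
     also have "... \<le> real L' * norm (s - t) powr \<Theta> m" using L' by (intro mult_right_mono) auto
     finally show ?thesis .
    qed
    thus "\<omega> \<in> {\<omega> \<in> space gauss_space. good m \<omega>}" using w unfolding good_def by blast
   qed
   hence "P.prob (space gauss_space - (\<Union>k. B k)) \<le> P.prob {\<omega> \<in> space gauss_space. good m \<omega>}" by (rule P.finite_measure_mono) measurable
   moreover have "P.prob (space gauss_space - (\<Union>k. B k)) = 1 - P.prob (\<Union>k. B k)" using Bs by (intro P.prob_compl) auto
   ultimately show "1 \<le> P.prob {\<omega> \<in> space gauss_space. good m \<omega>} + \<eta>" using pU by linarith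
  qed
  hence "P.prob {\<omega> \<in> space gauss_space. good m \<omega>} = 1" using P.prob_le_1 by (intro antisym) auto
  thus ?thesis by (subst (asm) P.prob_Collect_eq_1) auto
 qed
 define W where "W \<omega> \<longleftrightarrow> (\<forall>m. good m \<omega>) \<and> (\<forall>t\<in>D0. A t \<omega> = 0)" for \<omega>
 have Wm [measurable]: "Measurable.pred gauss_space W"
  unfolding W_def using cD0 by measurable
 have AEW: "AE \<omega> in gauss_space. W \<omega>"
  unfolding W_def using zero by (auto simp: AE_all_countable intro!: AE_conjI AEgood)
 define \<alpha> where "\<alpha> \<omega> u = (if u \<in> unit_cube then (if W \<omega> then lim (\<lambda>k. A (fl k u) \<omega>) else 0) else undefined)" for \<omega> u
 define f where "f k u \<omega> = (if W \<omega> then A (fl k u) \<omega> else 0)" for k u \<omega>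
 have hold: "\<exists>L\<ge>0. \<forall>s\<in>D. \<forall>t\<in>D. \<bar>A s \<omega> - A t \<omega>\<bar> \<le> L * norm (s - t) powr \<Theta> m" if "W \<omega>" for \<omega> m
 proof -
  obtain L :: nat where L: "\<And>k s t. s \<in> grid k ==> t \<in> grid k ==> \<bar>A s \<omega> - A t \<omega>\<bar> \<le> real L * norm (s - t) powr \<Theta> m"
   using \<open>W \<omega>\<close> unfolding W_def good_def by blast
  have "\<bar>A s \<omega> - A t \<omega>\<bar> \<le> real L * norm (s - t) powr \<Theta> m" if st: "s \<in> D" "t \<in> D" for s t
  proof -
   obtain k l where "s \<in> grid k" "t \<in> grid l" using st unfolding D_def by blast
   thus ?thesis using L[of s "max k l" t] grid_mono[of k "max k l"] grid_mono[of l "max k l"] by auto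
  qed
  thus ?thesis by (intro exI[of _ "real L"]) auto
 qed
 have conv: "(\<lambda>k. f k u \<omega>) \<longlonglongrightarrow> \<alpha> \<omega> u" if u: "u \<in> unit_cube" for u \<omega>
 proof (cases "W \<omega>")
  case True
  obtain L where L: "0 \<le> L" and H: "\<And>s t. s \<in> D ==> t \<in> D ==> \<bar>A s \<omega> - A t \<omega>\<bar> \<le> L * norm (s - t) powr \<Theta> 0"
   using hold[OF True, of 0] by blast
  have "Cauchy (\<lambda>k. A (fl k u) \<omega>)"
  proof (rule metric_CauchyI)
   fix e :: real assume e: "e > 0"
   have "(\<lambda>k. L * (2 * ?d * (1 / 2 ^ k)) powr \<Theta> 0) \<longlonglongrightarrow> 0" by (rule dyadic_powr_tendsto) (use \<Theta> in auto)
   from order_tendstoD(2)[OF this e] obtain k0 where k0: "L * (2 * ?d * (1 / 2 ^ k0)) powr \<Theta> 0 < e"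
    by (auto simp: eventually_sequentially)
   show "\<exists>M. \<forall>m\<ge>M. \<forall>n\<ge>M. dist (A (fl m u) \<omega>) (A (fl n u) \<omega>) < e"
   proof (intro exI[of _ k0] allI impI)
    fix m n assume mn: "k0 \<le> m" "k0 \<le> n"
    have c: "norm (u - fl k u) \<le> ?d * (1 / 2 ^ k0)" if "k0 \<le> k" for k
     using that by (intro order.trans[OF fl_norm] mult_left_mono divide_left_mono power_increasing) auto
    have "norm (fl m u - fl n u) \<le> norm (fl m u - u) + norm (u - fl n u)" using norm_triangle_ineq[of "fl m u - u" "u - fl n u"] by simp
    also have "... \<le> 2 * ?d * (1 / 2 ^ k0)" using c[OF mn(1)] c[OF mn(2)] by (simp add: norm_minus_commute)
    finally have "L * norm (fl m u - fl n u) powr \<Theta> 0 \<le> L * (2 * ?d * (1 / 2 ^ k0)) powr \<Theta> 0"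
     using L \<Theta>(1)[of 0] by (intro mult_left_mono powr_mono2) auto
    thus "dist (A (fl m u) \<omega>) (A (fl n u) \<omega>) < e"
     using H[OF flD[OF u, of m] flD[OF u, of n]] k0 unfolding dist_real_def by linarith
   qed
  qed
  hence "convergent (\<lambda>k. A (fl k u) \<omega>)" by (rule Cauchy_convergent)
  thus ?thesis using True u unfolding f_def \<alpha>_def by (simp add: convergent_LIMSEQ_iff)
 qed (use u in \<open>simp add: f_def \<alpha>_def del: atLeastAtMost_iff\<close>)
 have fm [measurable]: "f k u \<in> borel_measurable gauss_space" for k u unfolding f_def by measurable
 have am: "(\<lambda>\<omega>. \<alpha> \<omega> u) \<in> borel_measurable gauss_space" for u
 proof (cases "u \<in> unit_cube")
  case True
  show ?thesis by (rule borel_measurable_LIMSEQ_real[OF conv[OF True] fm])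
 next
  case False
  hence "(\<lambda>\<omega>. \<alpha> \<omega> u) = (\<lambda>_. undefined)" by (simp add: \<alpha>_def fun_eq_iff del: atLeastAtMost_iff)
  thus ?thesis by simp
 qed
 have z: "\<alpha> \<omega> u = 0" if u: "u \<in> unit_cube" and D0: "\<And>k. fl k u \<in> D0" for u \<omega>
 proof -
  have "f k u \<omega> = 0" for k using D0[of k] by (auto simp: f_def W_def)
  thus ?thesis using conv[OF u, of \<omega>] by (auto simp: LIMSEQ_const_iff)
 qed
 show ?thesis
 proof (intro exI[of _ \<alpha>] conjI allI impI am)
  show "\<alpha> \<omega> \<in> extensional unit_cube" for \<omega> by (simp add: \<alpha>_def extensional_def del: atLeastAtMost_iff)
  show "\<alpha> \<omega> u = 0" if u: "u \<in> unit_cube" "u $ j = 0" for \<omega> u j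
   using flD[OF u(1)] u(2) by (intro z u) (auto simp: D0_def fl_def intro!: exI[of _ j])
  have "fl k 1 = (1 :: real ^ 'd)" for k by (simp add: fl_def vec_eq_iff)
  thus "\<alpha> \<omega> 1 = 0" for \<omega> using flD[OF oc] by (intro z oc) (simp add: D0_def)
  show "\<exists>L\<ge>0. \<forall>u\<in>unit_cube. \<forall>v\<in>unit_cube. \<bar>\<alpha> \<omega> u - \<alpha> \<omega> v\<bar> \<le> L * norm (u - v) powr \<theta>" if \<theta>: "0 < \<theta>" "\<theta> < 1/2" for \<omega> \<theta>
  proof (cases "W \<omega>")
   case False
   hence "\<alpha> \<omega> u = 0" if "u \<in> unit_cube" for u using that by (simp add: \<alpha>_def del: atLeastAtMost_iff)
   thus ?thesis by (intro exI[of _ 0]) auto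
  next
   case True
   obtain m :: nat where m: "1 / (1/2 - \<theta>) < real m" using reals_Archimedean2 by blast
   have "1 < (1/2 - \<theta>) * real m" using m \<theta> by (simp add: field_simps)
   also have "... \<le> (1/2 - \<theta>) * (real m + 3)" using \<theta> by (intro mult_left_mono) auto
   finally have "1 / (real m + 3) < 1/2 - \<theta>" by (simp add: divide_less_eq)
   hence \<theta>m: "\<theta> \<le> \<Theta> m" by (simp add: \<Theta>_def)
   obtain L where L: "0 \<le> L" and H: "\<And>s t. s \<in> D ==> t \<in> D ==> \<bar>A s \<omega> - A t \<omega>\<bar> \<le> L * norm (s - t) powr \<Theta> m"
    using hold[OF True, of m] by blast
   have "\<bar>\<alpha> \<omega> u - \<alpha> \<omega> v\<bar> \<le> (L * ?d) * norm (u - v) powr \<theta>" if u: "u \<in> unit_cube" "v \<in> unit_cube" for u v :: "real ^ 'd"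
   proof -
    have "\<bar>\<alpha> \<omega> u - \<alpha> \<omega> v\<bar> \<le> L * norm (u - v) powr \<Theta> m"
    proof (rule LIMSEQ_le)
     show "(\<lambda>k. \<bar>f k u \<omega> - f k v \<omega>\<bar>) \<longlonglongrightarrow> \<bar>\<alpha> \<omega> u - \<alpha> \<omega> v\<bar>" by (intro tendsto_intros conv u)
     show "(\<lambda>k. L * norm (fl k u - fl k v) powr \<Theta> m) \<longlonglongrightarrow> L * norm (u - v) powr \<Theta> m"
      using \<Theta>(1)[of m] by (intro tendsto_mult tendsto_const tendsto_powr2 tendsto_norm tendsto_diff fl_tendsto) auto
     show "\<exists>N. \<forall>k\<ge>N. \<bar>f k u \<omega> - f k v \<omega>\<bar> \<le> L * norm (fl k u - fl k v) powr \<Theta> m"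
      using H[OF flD[OF u(1)] flD[OF u(2)]] True by (simp add: f_def)
    qed
    also have "norm (u - v) powr \<Theta> m \<le> ?d * norm (u - v) powr \<theta>"
    proof -
     have "norm (u - v) \<le> ?d * 1"
     proof (rule cube_norm_diff)
      show "\<bar>u $ j - v $ j\<bar> \<le> 1" for j
       using cube_ge0[OF u(1), of j] cube_le1[OF u(1), of j] cube_ge0[OF u(2), of j] cube_le1[OF u(2), of j] by linarith
     qed
     hence "norm (u - v) powr (\<Theta> m - \<theta>) \<le> ?d powr (\<Theta> m - \<theta>)" using \<theta>m by (intro powr_mono2) auto
     also have "... \<le> ?d powr 1" using \<Theta>(2)[of m] \<theta> by (intro powr_mono) (auto simp: Suc_leI)
     finally have "norm (u - v) powr (\<Theta> m - \<theta>) * norm (u - v) powr \<theta> \<le> ?d * norm (u - v) powr \<theta>" by (intro mult_right_mono) auto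
     thus ?thesis by (simp add: powr_add[symmetric])
    qed
    hence "L * norm (u - v) powr \<Theta> m \<le> (L * ?d) * norm (u - v) powr \<theta>" using L unfolding mult.assoc by (rule mult_left_mono)
    finally show ?thesis .
   qed
   thus ?thesis using L by (intro exI[of _ "L * ?d"]) auto
  qed
  show "integral\<^sup>L gauss_space (\<lambda>\<omega>. iexp (\<Sum>u\<in>I. b u * \<alpha> \<omega> u)) = of_real (exp (- (\<Sum>u\<in>I. \<Sum>v\<in>I. b u * b v * Gamma_C u v) / 2))"
   if I: "finite I" "I \<subseteq> unit_cube" for I b
  proof (rule LIMSEQ_unique)
   have Ic: "u \<in> unit_cube" if "u \<in> I" for u using I that by blast
   have fa: "(\<lambda>\<omega>. \<Sum>u\<in>I. b u * \<alpha> \<omega> u) \<in> borel_measurable gauss_space" using am by measurable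
   show "(\<lambda>k. P.expectation (\<lambda>\<omega>. iexp (\<Sum>u\<in>I. b u * f k u \<omega>))) \<longlonglongrightarrow> P.expectation (\<lambda>\<omega>. iexp (\<Sum>u\<in>I. b u * \<alpha> \<omega> u))"
   proof (rule integral_dominated_convergence[where w="\<lambda>_. 1"])
    show "AE \<omega> in gauss_space. (\<lambda>k. iexp (\<Sum>u\<in>I. b u * f k u \<omega>)) \<longlonglongrightarrow> iexp (\<Sum>u\<in>I. b u * \<alpha> \<omega> u)"
     by (intro AE_I2 tendsto_exp tendsto_mult tendsto_const tendsto_of_real tendsto_sum conv Ic)
    show "(\<lambda>\<omega>. iexp (\<Sum>u\<in>I. b u * \<alpha> \<omega> u)) \<in> borel_measurable gauss_space" using fa by measurable
   qed simp_all
   have eq: "P.expectation (\<lambda>\<omega>. iexp (\<Sum>u\<in>I. b u * f k u \<omega>)) = of_real (exp (- ?Q I b (fl k) / 2))" for k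
   proof -
    have "P.expectation (\<lambda>\<omega>. iexp (\<Sum>u\<in>I. b u * f k u \<omega>)) = P.expectation (\<lambda>\<omega>. iexp (\<Sum>u\<in>I. b u * A (fl k u) \<omega>))"
    proof (rule integral_cong_AE)
     show "AE \<omega> in gauss_space. iexp (\<Sum>u\<in>I. b u * f k u \<omega>) = iexp (\<Sum>u\<in>I. b u * A (fl k u) \<omega>)"
      using AEW by eventually_elim (simp add: f_def)
    qed measurable
    also have "... = of_real (exp (- ?Q I b (fl k) / 2))" by (rule Ach[OF I(1)]) (use flD Ic in blast)
    finally show ?thesis .
   qed
   show "(\<lambda>k. P.expectation (\<lambda>\<omega>. iexp (\<Sum>u\<in>I. b u * f k u \<omega>))) \<longlonglongrightarrow> of_real (exp (- ?Q I b (\<lambda>u. u) / 2))"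
    unfolding eq by (rule tendsto_of_real[OF char_fl_limit[OF I]])
  qed
 qed
qed

end

section \<open>Partial derivatives of the copula\<close>

definition upd :: "real ^ 'd => 'd => real => real ^ 'd" where
 "upd u j x = (\<chi> k. if k = j then x else u $ k)"

lemma upd_nth: "upd u j x $ k = (if k = j then x else u $ k)"
 by (simp add: upd_def)

lemma upd_same [simp]: "upd u j (u $ j) = u" and upd_upd [simp]: "upd (upd u j x) j y = upd u j y"
 by (simp_all add: upd_def vec_eq_iff)

lemma upd_cube: "u \<in> unit_cube ==> 0 \<le> x ==> x \<le> 1 ==> upd u j x \<in> unit_cube"
 by (intro cubeI) (auto simp: upd_nth cube_ge0 cube_le1)

lemma V_iff: "u \<in> V j \<longleftrightarrow> u \<in> unit_cube \<and> 0 < u $ j \<and> u $ j < 1"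
 by (simp add: V_def)

lemma upd_V: "u \<in> unit_cube ==> 0 < x ==> x < 1 ==> upd u j x \<in> V j"
 using upd_cube[of u x j] by (simp add: V_iff upd_nth)

text \<open>On \<open>V j\<close> the admissible increments contain a neighbourhood of 0, so the
  restricted derivative is the ordinary one along the coordinate line.\<close>

lemma has_partial_iff:
 assumes u: "u \<in> V j"
 shows "has_partial f j D u \<longleftrightarrow> ((\<lambda>x. f (upd u j x)) has_real_derivative D) (at (u $ j))"
proof -
 have uc: "u \<in> unit_cube" using u by (simp add: V_iff)
 have a: "u + h *\<^sub>R axis j 1 = upd u j (u $ j + h)" for h
  by (auto simp: vec_eq_iff upd_nth axis_def)
 have "increments j u = {- u $ j..1 - u $ j}"
 proof (intro set_eqI iffI)
  fix h assume "h \<in> increments j u"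
  hence "upd u j (u $ j + h) \<in> unit_cube" unfolding increments_def a by (simp del: atLeastAtMost_iff)
  from cube_ge0[OF this, of j] cube_le1[OF this, of j] show "h \<in> {- u $ j..1 - u $ j}" by (simp add: upd_nth)
 next
  fix h assume "h \<in> {- u $ j..1 - u $ j}"
  hence "upd u j (u $ j + h) \<in> unit_cube" by (intro upd_cube uc) auto
  thus "h \<in> increments j u" unfolding increments_def a by (simp del: atLeastAtMost_iff)
 qed
 hence "at 0 within increments j u = at 0" using u by (simp add: at_within_Icc_at V_iff)
 hence "has_partial f j D u \<longleftrightarrow> ((\<lambda>h. f (upd u j (h + u $ j))) has_real_derivative D) (at 0)"
  unfolding has_partial_def a by (simp add: add.commute)
 also have "... \<longleftrightarrow> ((\<lambda>x. f (upd u j x)) has_real_derivative D) (at (u $ j))"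
  using DERIV_shift[of "\<lambda>x. f (upd u j x)" D 0 "u $ j"] by simp
 finally show ?thesis .
qed

lemma partial_deriv_line:
 assumes u: "u \<in> V j" and ex: "partial_exists f j u"
 shows "((\<lambda>x. f (upd u j x)) has_real_derivative partial_deriv f j u) (at (u $ j))"
proof -
 obtain D where D: "has_partial f j D u" using ex by (auto simp: partial_exists_def)
 have "partial_deriv f j u = D" unfolding partial_deriv_def
  by (rule the_equality[where P="\<lambda>D. has_partial f j D u", OF D]) (use D in \<open>auto simp: has_partial_iff[OF u] intro: DERIV_unique\<close>)
 thus ?thesis using D by (simp add: has_partial_iff[OF u])
qed

text \<open>A corner of the box spanned by u and v. Switching the coordinates one at a time leads
  from u to v along segments parallel to the axes, where partial derivatives apply.\<close>

definition mix :: "real ^ 'd => real ^ 'd => 'd set => real ^ 'd" where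
 "mix u v S = (\<chi> k. if k \<in> S then v $ k else u $ k)"

lemma mix_insert: "mix u v (insert k S) = upd (mix u v S) k (v $ k)"
 by (auto simp: mix_def upd_def vec_eq_iff)

lemma mix_upd: "k \<notin> S ==> mix u v S = upd (mix u v S) k (u $ k)"
 by (auto simp: mix_def upd_def vec_eq_iff)

lemma mix_cube: "u \<in> unit_cube ==> v \<in> unit_cube ==> mix u v S \<in> unit_cube"
 by (intro cubeI) (auto simp: mix_def cube_ge0 cube_le1)

lemma mix_telescope:
 fixes f :: "real ^ 'd => real"
 assumes step: "\<And>S k. k \<notin> S ==> \<bar>f (upd (mix u v S) k (v $ k)) - f (upd (mix u v S) k (u $ k)) - e k\<bar> \<le> r k"
 shows "\<bar>f v - f u - (\<Sum>k\<in>UNIV. e k)\<bar> \<le> (\<Sum>k\<in>UNIV. r k)"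
proof -
 have "\<bar>f (mix u v S) - f u - (\<Sum>k\<in>S. e k)\<bar> \<le> (\<Sum>k\<in>S. r k)" if "finite S" for S
  using that
 proof (induction S)
  case empty
  show ?case by (simp add: mix_def)
 next
  case (insert k S)
  have "\<bar>f (mix u v (insert k S)) - f (mix u v S) - e k\<bar> \<le> r k"
   using step[OF insert.hyps(2)] mix_upd[OF insert.hyps(2), of u v] by (simp add: mix_insert)
  thus ?case using insert by simp
 qed
 from this[of UNIV] show ?thesis by (simp add: mix_def)
qed

lemma only_coord_nth: "only_coord j u $ k = (if k = j then u $ k else 1)"
 by (simp add: only_coord_def)

lemma only_coord_cube: "u \<in> unit_cube ==> only_coord j u \<in> unit_cube"
 by (intro cubeI) (auto simp: only_coord_nth cube_ge0 cube_le1)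

text \<open>Concavity of x (1 - x); it carries a lower bound from the ends of a segment to its
  interior.\<close>

lemma parabola_between:
 fixes x :: real
 assumes "D \<le> a * (1 - a)" "D \<le> b * (1 - b)" "min a b \<le> x" "x \<le> max a b"
 shows "D \<le> x * (1 - x)"
proof -
 have *: "D \<le> x * (1 - x)" if "D \<le> a * (1 - a)" "D \<le> b * (1 - b)" "a \<le> x" "x \<le> b" for a b
 proof (cases "x \<le> 1/2")
  case True
  hence "0 \<le> (x - a) * (1 - x - a)" using that by (intro mult_nonneg_nonneg) auto
  thus ?thesis using that(1) by (simp add: algebra_simps)
 next
  case False
  hence "0 \<le> (b - x) * (x + b - 1)" using that by (intro mult_nonneg_nonneg) auto
  thus ?thesis using that(2) by (simp add: algebra_simps)
 qed
 show ?thesis using *[of a b] *[of b a] assms by (cases "a \<le> b") auto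
qed

lemma parabola_lower:
 fixes x :: real assumes "0 \<le> x" "x \<le> 1" "\<beta> \<le> x" "\<beta> \<le> 1 - x"
 shows "\<beta> / 2 \<le> x * (1 - x)"
proof -
 have "min x (1 - x) / 2 \<le> x * (1 - x)"
 proof (cases "x \<le> 1/2")
  case True
  hence "x * (1/2) \<le> x * (1 - x)" using assms by (intro mult_left_mono) auto
  thus ?thesis using True by simp
 next
  case False
  hence "(1/2) * (1 - x) \<le> x * (1 - x)" using assms by (intro mult_right_mono) auto
  thus ?thesis using False by simp
 qed
 moreover have "\<beta> / 2 \<le> min x (1 - x) / 2" using assms by simp
 ultimately show ?thesis by (rule order.trans[rotated])
qed

text \<open>The trade-off behind all boundary estimates. Here s is the distance of a coordinate from
  {0, 1}, t the distance from the zero set of the weight, and r a derivative, bounded by 1 and,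
  through the growth condition, by c t / s. For s \<le> t the first bound is used; otherwise t / s
  times s^\<theta> is at most t^\<theta> because \<theta> < 1.\<close>

lemma min_powr_bound:
 fixes s t :: real
 assumes s: "s > 0" and t: "t \<ge> 0" and c: "c \<ge> 0" and \<theta>: "0 < \<theta>" "\<theta> < 1" and r: "r \<le> 1" "r \<le> c * t / s"
 shows "r * s powr \<theta> \<le> (1 + c) * t powr \<theta>"
proof (cases "s \<le> t")
 case True
 have "r * s powr \<theta> \<le> 1 * t powr \<theta>" using True s \<theta> r(1)
  by (intro order.trans[OF mult_right_mono[OF r(1)]]) (auto intro: powr_mono2)
 also have "... \<le> (1 + c) * t powr \<theta>" using c by (intro mult_right_mono) auto
 finally show ?thesis .
next
 case False
 have "r * s powr \<theta> \<le> c * t / s * s powr \<theta>" using r(2) by (intro mult_right_mono) auto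
 also have "... \<le> c * t powr \<theta>"
 proof (cases "t = 0")
  case False
  have "t powr (1 - \<theta>) \<le> s powr (1 - \<theta>)" using \<open>\<not> s \<le> t\<close> t \<theta> by (intro powr_mono2) auto
  hence "t powr (1 - \<theta>) / s powr (1 - \<theta>) \<le> 1" using s by (simp add: divide_le_eq)
  moreover have "t / s * s powr \<theta> = t powr \<theta> * (t powr (1 - \<theta>) / s powr (1 - \<theta>))"
   using s t False by (simp add: powr_diff)
  ultimately have "t / s * s powr \<theta> \<le> t powr \<theta> * 1" by (simp only:) (intro mult_left_mono, auto)
  from mult_left_mono[OF this c] show ?thesis by (simp add: mult_ac)
 qed simp
 also have "... \<le> (1 + c) * t powr \<theta>" by (intro mult_right_mono) auto
 finally show ?thesis .
qed

text \<open>The analytic properties of the copula on which the boundary estimates rest, separated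
  from the probability space.\<close>

locale smooth_copula =
 fixes C :: "real ^ 'd => real" and K :: real
 assumes card2: "CARD('d) \<ge> 2"
  and C_mono: "\<And>u v. u \<le> v ==> C u \<le> C v"
  and C_lip: "\<And>u v. u \<in> unit_cube ==> v \<in> unit_cube ==> \<bar>C u - C v\<bar> \<le> (\<Sum>j\<in>UNIV. \<bar>u $ j - v $ j\<bar>)"
  and C_margin: "\<And>u j. u \<in> unit_cube ==> C (only_coord j u) = u $ j"
  and C_zero: "\<And>u j. u \<in> unit_cube ==> u $ j = 0 ==> C u = 0"
  and C_partial: "\<And>j u. u \<in> V j ==> partial_exists C j u"
  and C_dot_cont: "\<And>j. continuous_on (V j) (C_dot C j)"
  and C_dot_partial: "\<And>j\<^sub>1 j\<^sub>2 u. u \<in> V j\<^sub>1 \<inter> V j\<^sub>2 ==> partial_exists (C_dot C j\<^sub>2) j\<^sub>1 u"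
  and K: "K > 0"
  and C_ddot_bound: "\<And>j\<^sub>1 j\<^sub>2 u. u \<in> V j\<^sub>1 \<inter> V j\<^sub>2 ==>
     \<bar>C_ddot C j\<^sub>1 j\<^sub>2 u\<bar> \<le> K * min (1 / (u $ j\<^sub>1 * (1 - u $ j\<^sub>1))) (1 / (u $ j\<^sub>2 * (1 - u $ j\<^sub>2)))"
begin

lemma ex_other: "\<exists>k. k \<noteq> (j :: 'd)"
proof (rule ccontr)
 assume "\<not> ?thesis"
 hence "(UNIV :: 'd set) = {j}" by auto
 hence "CARD('d) = 1" by (metis card_1_singleton_iff One_nat_def)
 thus False using card2 by simp
qed

lemma C_dot_line:
 assumes "u \<in> V j"
 shows "((\<lambda>x. C (upd u j x)) has_real_derivative C_dot C j u) (at (u $ j))"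
 using partial_deriv_line[OF assms C_partial[OF assms]] C_partial[OF assms] by (simp add: C_dot_def)

lemma C_upd_lip:
 assumes u: "u \<in> unit_cube" and xy: "0 \<le> x" "x \<le> y" "y \<le> 1"
 shows "0 \<le> C (upd u j y) - C (upd u j x)" "C (upd u j y) - C (upd u j x) \<le> y - x"
proof -
 show "0 \<le> C (upd u j y) - C (upd u j x)"
  using C_mono[of "upd u j x" "upd u j y"] xy by (auto simp: less_eq_vec_def upd_nth)
 have "\<bar>C (upd u j y) - C (upd u j x)\<bar> \<le> (\<Sum>k\<in>UNIV. \<bar>upd u j y $ k - upd u j x $ k\<bar>)"
  by (intro C_lip upd_cube u) (use xy in auto)
 also have "... = (\<Sum>k\<in>UNIV. if k = j then \<bar>y - x\<bar> else 0)" by (intro sum.cong) (auto simp: upd_nth)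
 finally show "C (upd u j y) - C (upd u j x) \<le> y - x" using xy by simp
qed

lemma C_dot_bounds:
 assumes u: "u \<in> V j"
 shows "0 \<le> C_dot C j u" "C_dot C j u \<le> 1"
proof -
 have uc: "u \<in> unit_cube" "0 < u $ j" "u $ j < 1" using u by (auto simp: V_iff simp del: atLeastAtMost_iff)
 let ?q = "\<lambda>h. (C (upd u j (u $ j + h)) - C (upd u j (u $ j))) / h"
 have lim: "?q \<midarrow>0\<rightarrow> C_dot C j u" using C_dot_line[OF u] unfolding DERIV_def .
 have q: "0 \<le> ?q h \<and> ?q h \<le> 1" if "h \<noteq> 0" "\<bar>h\<bar> < min (u $ j) (1 - u $ j)" for h
 proof (cases "h > 0")
  case True
  thus ?thesis using C_upd_lip[OF uc(1), of "u $ j" "u $ j + h" j] uc that by (simp add: divide_le_eq)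
 next
  case False
  hence "h < 0" using that by simp
  moreover have "0 \<le> C (upd u j (u $ j)) - C (upd u j (u $ j + h))"
   "C (upd u j (u $ j)) - C (upd u j (u $ j + h)) \<le> - h"
   using C_upd_lip[OF uc(1), of "u $ j + h" "u $ j" j] uc that False by auto
  ultimately show ?thesis by (auto simp: divide_le_eq zero_le_divide_iff)
 qed
 have ev: "\<forall>\<^sub>F h in at 0. 0 \<le> ?q h \<and> ?q h \<le> 1"
  unfolding eventually_at using uc q by (intro exI[of _ "min (u $ j) (1 - u $ j)"]) (auto simp: dist_real_def)
 show "0 \<le> C_dot C j u" by (rule tendsto_lowerbound[OF lim]) (use ev in \<open>auto elim: eventually_mono\<close>)
 show "C_dot C j u \<le> 1" by (rule tendsto_upperbound[OF lim]) (use ev in \<open>auto elim: eventually_mono\<close>)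
qed

lemma C_mean_value:
 assumes u: "u \<in> unit_cube" and xy: "0 \<le> x" "x < y" "y \<le> 1"
 shows "\<exists>\<xi>. x < \<xi> \<and> \<xi> < y \<and> C (upd u j y) - C (upd u j x) = (y - x) * C_dot C j (upd u j \<xi>)"
proof -
 have lip: "\<bar>C (upd u j s) - C (upd u j t)\<bar> \<le> \<bar>s - t\<bar>" if "0 \<le> s" "s \<le> 1" "0 \<le> t" "t \<le> 1" for s t
  using C_upd_lip[OF u, of s t j] C_upd_lip[OF u, of t s j] that by linarith
 have "\<exists>\<xi>. \<xi> \<in> {x<..<y} \<and> C (upd u j y) - C (upd u j x) = (*) (C_dot C j (upd u j \<xi>)) (y - x)"
 proof (rule mvt[OF xy(2), where f="\<lambda>x. C (upd u j x)" and f'="\<lambda>\<xi>. (*) (C_dot C j (upd u j \<xi>))", simplified bex_simps])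
  show "continuous_on {x..y} (\<lambda>x. C (upd u j x))"
  proof (rule continuous_onI)
   fix s e :: real assume "s \<in> {x..y}" "e > 0"
   thus "\<exists>d>0. \<forall>t\<in>{x..y}. dist t s < d --> dist (C (upd u j t)) (C (upd u j s)) \<le> e"
    using xy by (intro exI[of _ e]) (auto simp: dist_real_def intro!: order.trans[OF lip])
  qed
  fix \<xi> assume "x < \<xi>" "\<xi> < y"
  thus "((\<lambda>x. C (upd u j x)) has_derivative (*) (C_dot C j (upd u j \<xi>))) (at \<xi>)"
   using C_dot_line[OF upd_V[OF u, of \<xi> j]] xy by (simp add: upd_nth has_field_derivative_def)
 qed auto
 thus ?thesis by (auto simp: mult.commute)
qed

text \<open>Mean value theorem in direction k for the j-th derivative. The term of the growth bound
  that belongs to j stays bounded even when the segment ends on a face where u_k is 0 or 1.\<close>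

lemma C_dot_step:
 assumes u: "u \<in> unit_cube" and xy: "0 \<le> x" "x \<le> 1" "0 \<le> y" "y \<le> 1" and D: "D > 0"
  and b: "D \<le> upd u k x $ j * (1 - upd u k x $ j)" "D \<le> upd u k y $ j * (1 - upd u k y $ j)"
 shows "\<bar>C_dot C j (upd u k y) - C_dot C j (upd u k x)\<bar> \<le> K / D * \<bar>y - x\<bar>"
proof -
 have *: "\<bar>C_dot C j (upd u k y) - C_dot C j (upd u k x)\<bar> \<le> K / D * \<bar>y - x\<bar>"
  if xy: "0 \<le> x" "x < y" "y \<le> 1" and b: "D \<le> upd u k x $ j * (1 - upd u k x $ j)" "D \<le> upd u k y $ j * (1 - upd u k y $ j)" for x y
 proof -
  have Dz: "D \<le> upd u k z $ j * (1 - upd u k z $ j)" if "x \<le> z" "z \<le> y" for z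
  proof (cases "k = j")
   case True
   show ?thesis using parabola_between[of D x y z] b that by (simp add: True upd_nth)
  next
   case False
   thus ?thesis using b by (simp add: upd_nth)
  qed
  have Vz: "upd u k z \<in> V j" if z: "x \<le> z" "z \<le> y" for z
  proof -
   have c: "upd u k z \<in> unit_cube" using z xy by (intro upd_cube u) auto
   moreover have "0 < upd u k z $ j * (1 - upd u k z $ j)" using Dz[OF z] D by simp
   ultimately show ?thesis using cube_ge0[OF c, of j] cube_le1[OF c, of j]
    unfolding V_iff by (cases "upd u k z $ j = 0"; cases "upd u k z $ j = 1") auto
  qed
  have Vk: "upd u k z \<in> V k \<inter> V j" if z: "x < z" "z < y" for z
   using Vz[of z] upd_V[OF u, of z k] z xy by simp
  have "continuous_on {x..y} (\<lambda>x. if i = k then x else u $ i)" for i by (cases "i = k") simp_all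
  hence cu: "continuous_on {x..y} (upd u k)" unfolding upd_def by (intro continuous_on_vec_lambda)
  have "\<exists>\<xi>. \<xi> \<in> {x<..<y} \<and> C_dot C j (upd u k y) - C_dot C j (upd u k x) = (*) (C_ddot C k j (upd u k \<xi>)) (y - x)"
  proof (rule mvt[OF xy(2), where f="\<lambda>x. C_dot C j (upd u k x)" and f'="\<lambda>\<xi>. (*) (C_ddot C k j (upd u k \<xi>))", simplified bex_simps])
   show "continuous_on {x..y} (\<lambda>x. C_dot C j (upd u k x))"
    by (rule continuous_on_compose2[OF C_dot_cont cu]) (use Vz in auto)
   fix \<xi> assume \<xi>: "x < \<xi>" "\<xi> < y"
   have "((\<lambda>x. C_dot C j (upd (upd u k \<xi>) k x)) has_real_derivative partial_deriv (C_dot C j) k (upd u k \<xi>)) (at (upd u k \<xi> $ k))"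
    by (rule partial_deriv_line[OF _ C_dot_partial[OF Vk[OF \<xi>]]]) (use Vk[OF \<xi>] in blast)
   thus "((\<lambda>x. C_dot C j (upd u k x)) has_derivative (*) (C_ddot C k j (upd u k \<xi>))) (at \<xi>)"
    by (simp add: upd_nth C_ddot_def has_field_derivative_def)
  qed auto
  then obtain \<xi> where "\<xi> \<in> {x<..<y}" and eq: "C_dot C j (upd u k y) - C_dot C j (upd u k x) = C_ddot C k j (upd u k \<xi>) * (y - x)" by blast
  hence \<xi>: "x < \<xi>" "\<xi> < y" by simp_all
  have "\<bar>C_ddot C k j (upd u k \<xi>)\<bar> \<le> K * (1 / (upd u k \<xi> $ j * (1 - upd u k \<xi> $ j)))"
   by (rule order.trans[OF C_ddot_bound[OF Vk[OF \<xi>]] mult_left_mono[OF min.cobounded2]]) (use K in simp)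
  also have "... \<le> K * (1 / D)"
   using divide_left_mono[of D "upd u k \<xi> $ j * (1 - upd u k \<xi> $ j)" 1] Dz[of \<xi>] \<xi> D K by (intro mult_left_mono) auto
  finally have "\<bar>C_ddot C k j (upd u k \<xi>)\<bar> \<le> K * (1 / D)" .
  from mult_right_mono[OF this, of "\<bar>y - x\<bar>"] show ?thesis unfolding eq abs_mult by simp
 qed
 consider "x < y" | "y < x" | "x = y" using less_linear by blast
 thus ?thesis
 proof cases
  case 1 thus ?thesis using * xy b by blast
 next
  case 2 thus ?thesis using *[of y x] xy b by (simp add: abs_minus_commute)
 qed (use D K in simp)
qed

lemma C_dot_lipschitz:
 assumes u: "u \<in> unit_cube" "v \<in> unit_cube" and D: "D > 0" "D \<le> u $ j * (1 - u $ j)" "D \<le> v $ j * (1 - v $ j)"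
 shows "\<bar>C_dot C j u - C_dot C j v\<bar> \<le> K / D * (\<Sum>k\<in>UNIV. \<bar>u $ k - v $ k\<bar>)"
proof -
 have "\<bar>C_dot C j u - C_dot C j v - (\<Sum>k\<in>(UNIV :: 'd set). 0)\<bar> \<le> (\<Sum>k\<in>UNIV. K / D * \<bar>u $ k - v $ k\<bar>)"
 proof (rule mix_telescope)
  fix S and k :: 'd assume k: "k \<notin> S"
  have "\<bar>C_dot C j (upd (mix v u S) k (u $ k)) - C_dot C j (upd (mix v u S) k (v $ k))\<bar> \<le> K / D * \<bar>u $ k - v $ k\<bar>"
   by (rule C_dot_step) (use u D in \<open>auto simp: upd_nth mix_def cube_ge0 cube_le1 intro!: mix_cube[unfolded mix_def] simp del: atLeastAtMost_iff\<close>)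
  thus "\<bar>C_dot C j (upd (mix v u S) k (u $ k)) - C_dot C j (upd (mix v u S) k (v $ k)) - 0\<bar> \<le> K / D * \<bar>u $ k - v $ k\<bar>" by simp
 qed
 thus ?thesis by (simp add: sum_distrib_left)
qed

text \<open>On the face where u_j = 0 the copula vanishes, hence so does its k-th derivative; the
  Lipschitz bound compares u with its projection to that face.\<close>

lemma C_dot_upper:
 assumes u: "u \<in> V k" and jk: "j \<noteq> k"
 shows "C_dot C k u \<le> K * u $ j / (u $ k * (1 - u $ k))"
proof -
 have uc: "u \<in> unit_cube" "0 < u $ k" "u $ k < 1" using u by (auto simp: V_iff simp del: atLeastAtMost_iff)
 let ?w = "upd u j 0"
 have w: "?w \<in> unit_cube" by (intro upd_cube uc) auto
 have wV: "?w \<in> V k" using w uc jk by (simp add: V_iff upd_nth del: atLeastAtMost_iff)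
 have "C_dot C k ?w = 0"
 proof (rule DERIV_unique[OF C_dot_line[OF wV]])
  have "((\<lambda>x. 0 :: real) has_real_derivative 0) (at (?w $ k))" by simp
  moreover have "\<forall>\<^sub>F x in nhds (?w $ k). 0 < x \<and> x < 1"
   using uc jk eventually_nhds_in_open[of "{0<..<1}" "?w $ k"] by (simp add: upd_nth)
  hence "\<forall>\<^sub>F x in nhds (?w $ k). C (upd ?w k x) = 0"
  proof eventually_elim
   case (elim x)
   show ?case by (rule C_zero[where j=j]) (use elim w jk in \<open>auto simp: upd_nth intro!: upd_cube simp del: atLeastAtMost_iff\<close>)
  qed
  ultimately show "((\<lambda>x. C (upd ?w k x)) has_real_derivative 0) (at (?w $ k))"
   by (subst DERIV_cong_ev[OF refl _ refl, where g="\<lambda>_. 0"])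
 qed
 moreover have "\<bar>C_dot C k u - C_dot C k ?w\<bar> \<le> K / (u $ k * (1 - u $ k)) * (\<Sum>l\<in>UNIV. \<bar>u $ l - ?w $ l\<bar>)"
  by (rule C_dot_lipschitz) (use uc w jk in \<open>auto simp: upd_nth simp del: atLeastAtMost_iff\<close>)
 moreover have "(\<Sum>l\<in>UNIV. \<bar>u $ l - ?w $ l\<bar>) = (\<Sum>l\<in>UNIV. if l = j then u $ j else 0)"
  using cube_ge0[OF uc(1), of j] by (intro sum.cong) (auto simp: upd_nth)
 ultimately show ?thesis by simp
qed

text \<open>Where all coordinates but the j-th are 1, the copula is the identity in u_j and its j-th
  derivative is 1; the Lipschitz bound compares u with that edge.\<close>

lemma C_dot_lower:
 assumes u: "u \<in> V j" and x: "\<And>k. k \<noteq> j ==> 1 - u $ k \<le> x" "x \<ge> 0"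
 shows "1 - C_dot C j u \<le> K * real CARD('d) * x / (u $ j * (1 - u $ j))"
proof -
 have uc: "u \<in> unit_cube" "0 < u $ j" "u $ j < 1" using u by (auto simp: V_iff simp del: atLeastAtMost_iff)
 let ?w = "only_coord j u"
 have w: "?w \<in> unit_cube" by (intro only_coord_cube uc)
 have wV: "?w \<in> V j" using w uc by (simp add: V_iff only_coord_nth del: atLeastAtMost_iff)
 have "C_dot C j ?w = 1"
 proof (rule DERIV_unique[OF C_dot_line[OF wV]])
  have "((\<lambda>x. x) has_real_derivative 1) (at (?w $ j))" by simp
  moreover have "\<forall>\<^sub>F x in nhds (?w $ j). 0 < x \<and> x < 1"
   using uc eventually_nhds_in_open[of "{0<..<1}" "?w $ j"] by (simp add: only_coord_nth)
  hence "\<forall>\<^sub>F x in nhds (?w $ j). C (upd ?w j x) = x"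
  proof eventually_elim
   case (elim x)
   have "upd ?w j x = only_coord j (upd u j x)" by (simp add: vec_eq_iff upd_nth only_coord_nth)
   thus ?case using C_margin[OF upd_cube[OF uc(1), of x j], of j] elim by (simp add: upd_nth)
  qed
  ultimately show "((\<lambda>x. C (upd ?w j x)) has_real_derivative 1) (at (?w $ j))"
   by (subst DERIV_cong_ev[OF refl _ refl, where g="\<lambda>x. x"])
 qed
 moreover have "\<bar>C_dot C j u - C_dot C j ?w\<bar> \<le> K / (u $ j * (1 - u $ j)) * (\<Sum>l\<in>UNIV. \<bar>u $ l - ?w $ l\<bar>)"
  by (rule C_dot_lipschitz) (use uc w in \<open>auto simp: only_coord_nth simp del: atLeastAtMost_iff\<close>)
 moreover have "K / (u $ j * (1 - u $ j)) * (\<Sum>l\<in>UNIV. \<bar>u $ l - ?w $ l\<bar>) \<le> K / (u $ j * (1 - u $ j)) * (real CARD('d) * x)"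
 proof (intro mult_left_mono sum_bounded_above)
  fix l show "\<bar>u $ l - ?w $ l\<bar> \<le> x" using x cube_le1[OF uc(1), of l] by (auto simp: only_coord_nth)
 qed (use uc K in auto)
 ultimately show ?thesis by (simp add: mult_ac)
qed

text \<open>A linearisation with freely chosen slopes e: they will be 0 near a lower face, 1 in one
  direction and 0 in the others near an upper edge, and the derivatives at u in the
  interior.\<close>

lemma C_increment:
 assumes uv: "u \<in> unit_cube" "v \<in> unit_cube"
  and e: "\<And>k \<xi>. \<xi> \<in> V k ==> (\<And>l. min (u $ l) (v $ l) \<le> \<xi> $ l \<and> \<xi> $ l \<le> max (u $ l) (v $ l)) ==> \<bar>C_dot C k \<xi> - e k\<bar> \<le> r k"
 shows "\<bar>C v - C u - (\<Sum>k\<in>UNIV. (v $ k - u $ k) * e k)\<bar> \<le> (\<Sum>k\<in>UNIV. \<bar>v $ k - u $ k\<bar> * r k)"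
proof (rule mix_telescope)
 fix S and k :: 'd assume k: "k \<notin> S"
 let ?m = "mix u v S"
 have m: "?m \<in> unit_cube" by (rule mix_cube[OF uv])
 have *: "\<bar>C (upd ?m k y) - C (upd ?m k x) - (y - x) * e k\<bar> \<le> \<bar>y - x\<bar> * r k"
  if xy: "0 \<le> x" "x < y" "y \<le> 1" "min (u $ k) (v $ k) = x" "max (u $ k) (v $ k) = y" for x y
 proof -
  obtain \<xi> where \<xi>: "x < \<xi>" "\<xi> < y" and eq: "C (upd ?m k y) - C (upd ?m k x) = (y - x) * C_dot C k (upd ?m k \<xi>)"
   using C_mean_value[OF m xy(1-3)] by blast
  have "\<bar>C_dot C k (upd ?m k \<xi>) - e k\<bar> \<le> r k"
  proof (rule e)
   show "upd ?m k \<xi> \<in> V k" using \<xi> xy by (intro upd_V m) auto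
   show "min (u $ l) (v $ l) \<le> upd ?m k \<xi> $ l \<and> upd ?m k \<xi> $ l \<le> max (u $ l) (v $ l)" for l
    using \<xi> xy by (auto simp: upd_nth mix_def)
  qed
  hence "\<bar>y - x\<bar> * \<bar>C_dot C k (upd ?m k \<xi>) - e k\<bar> \<le> \<bar>y - x\<bar> * r k" by (intro mult_left_mono) auto
  thus ?thesis unfolding eq by (simp add: abs_mult[symmetric] right_diff_distrib)
 qed
 consider "u $ k < v $ k" | "v $ k < u $ k" | "u $ k = v $ k" by linarith
 thus "\<bar>C (upd ?m k (v $ k)) - C (upd ?m k (u $ k)) - (v $ k - u $ k) * e k\<bar> \<le> \<bar>v $ k - u $ k\<bar> * r k"
 proof cases
  case 1 thus ?thesis using *[of "u $ k" "v $ k"] cube_ge0[OF uv(1)] cube_le1[OF uv(2)] by auto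
 next
  case 2
  hence "\<bar>C (upd ?m k (u $ k)) - C (upd ?m k (v $ k)) - (u $ k - v $ k) * e k\<bar> \<le> \<bar>u $ k - v $ k\<bar> * r k"
   using *[of "v $ k" "u $ k"] cube_ge0[OF uv(2)] cube_le1[OF uv(1)] by auto
  thus ?thesis by (simp add: algebra_simps abs_le_iff abs_minus_commute[of "u $ k" "v $ k"])
 qed simp
qed

end

text \<open>The weight before taking the power \<omega>. On the cube it vanishes on the lower faces
  and on the edges where all coordinates but one are 1.\<close>

definition base :: "real ^ 'd => real" where
 "base u = min (MIN j. u $ j) (MIN j. 1 - (MIN k\<in>UNIV - {j}. u $ k))"

text \<open>What a modulus of order \<theta> gives for a function vanishing on the lower faces and
  at 1: decay towards a lower face, and closeness to the margin towards an upper edge. Both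
  \<alpha>_n and its limit will satisfy it.\<close>

definition edge_bound :: "(real ^ 'd => real) => real => real => bool" where
 "edge_bound a L \<theta> \<longleftrightarrow> (\<forall>w\<in>unit_cube. (\<forall>j. \<bar>a w\<bar> \<le> L * (w $ j) powr \<theta>) \<and>
  (\<forall>j. \<forall>x\<ge>0. (\<forall>k. k \<noteq> j --> 1 - w $ k \<le> x) --> \<bar>a w - a (only_coord j w)\<bar> \<le> L * x powr \<theta>)) \<and> a 1 = 0"

lemma edge_boundD:
 assumes "edge_bound a L \<theta>"
 shows "w \<in> unit_cube ==> \<bar>a w\<bar> \<le> L * (w $ j) powr \<theta>"
  and "w \<in> unit_cube ==> x \<ge> 0 ==> (\<And>k. k \<noteq> j ==> 1 - w $ k \<le> x) ==> \<bar>a w - a (only_coord j w)\<bar> \<le> L * x powr \<theta>"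
  and "a 1 = 0"
 using assms unfolding edge_bound_def by blast+

lemma g_base: "g \<omega> u = base u powr \<omega>"
 by (simp add: g_def base_def)

lemma base_le: "base u \<le> u $ j"
 unfolding base_def by (intro min.coboundedI1 Min_le) auto

lemma min_cases: "min x y = x \<or> min x y = (y :: real)"
 by (simp add: min_def)

text \<open>The active minimum decides the model for the copula: near a lower face it is close to 0,
  near an upper edge close to one coordinate.\<close>

lemma base_cases:
 obtains (low) j where "base u = u $ j" | (high) j where "\<And>k. k \<noteq> j ==> 1 - u $ k \<le> base u"
proof -
 consider "base u = (MIN j. u $ j)" | "base u = (MIN j. 1 - (MIN k\<in>UNIV - {j}. u $ k))"
  using min_cases unfolding base_def by blast
 thus thesis
 proof cases
  case 1
  have "(MIN j. u $ j) \<in> range (\<lambda>j. u $ j)" by (intro Min_in) auto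
  then obtain j where "(MIN j. u $ j) = u $ j" by (rule imageE)
  with 1 have "base u = u $ j" by (rule trans)
  thus thesis by (rule low)
 next
  case 2
  have "(MIN j. 1 - (MIN k\<in>UNIV - {j}. u $ k)) \<in> range (\<lambda>j. 1 - (MIN k\<in>UNIV - {j}. u $ k))" by (intro Min_in) auto
  then obtain j where "(MIN j. 1 - (MIN k\<in>UNIV - {j}. u $ k)) = 1 - (MIN k\<in>UNIV - {j}. u $ k)" by (rule imageE)
  with 2 have j: "base u = 1 - (MIN k\<in>UNIV - {j}. u $ k)" by (rule trans)
  have "1 - u $ k \<le> base u" if "k \<noteq> j" for k
  proof -
   have "(MIN k\<in>UNIV - {j}. u $ k) \<le> u $ k" using that by (intro Min_le) auto
   thus ?thesis using j by simp
  qed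
  thus thesis by (rule high)
 qed
qed

context smooth_copula
begin

lemma base_ge:
 fixes u :: "real ^ 'd"
 assumes "\<And>j. t \<le> u $ j" "\<And>j. t \<le> 1 - u $ j"
 shows "t \<le> base u"
proof -
 have "t \<le> (MIN j. u $ j)" using assms(1) by (intro Min.boundedI) auto
 moreover have "t \<le> 1 - (MIN k\<in>UNIV - {j}. u $ k)" for j
 proof -
  obtain k where k: "k \<noteq> j" using ex_other by blast
  have "(MIN k\<in>UNIV - {j}. u $ k) \<le> u $ k" using k by (intro Min_le) auto
  thus ?thesis using assms(2)[of k] by simp
 qed
 hence "t \<le> (MIN j. 1 - (MIN k\<in>UNIV - {j}. u $ k))" by (intro Min.boundedI) auto
 ultimately show ?thesis by (simp add: base_def)
qed

lemma base_nonneg: "(u :: real ^ 'd) \<in> unit_cube ==> 0 \<le> base u"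
 by (rule base_ge) (auto simp: cube_ge0 cube_le1 simp del: atLeastAtMost_iff)

text \<open>For the second bound the edge clause is applied to the margin with another index j:
  replacing all coordinates except the j-th by 1 gives the point 1, where the function vanishes. Two
  coordinates are essential here.\<close>

lemma margin_bound:
 fixes u :: "real ^ 'd"
 assumes a: "edge_bound a L \<theta>" and u: "u \<in> unit_cube"
 shows "\<bar>a (only_coord k u)\<bar> \<le> L * (u $ k) powr \<theta>" "\<bar>a (only_coord k u)\<bar> \<le> L * (1 - u $ k) powr \<theta>"
proof -
 note w = only_coord_cube[OF u, of k]
 show "\<bar>a (only_coord k u)\<bar> \<le> L * (u $ k) powr \<theta>" using edge_boundD(1)[OF a w, of k] by (simp add: only_coord_nth)
 obtain j where j: "j \<noteq> k" using ex_other by blast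
 have "only_coord j (only_coord k u) = 1" using j by (simp add: vec_eq_iff only_coord_nth)
 thus "\<bar>a (only_coord k u)\<bar> \<le> L * (1 - u $ k) powr \<theta>"
  using edge_boundD(2)[OF a w, of "1 - u $ k" j] edge_boundD(3)[OF a] cube_le1[OF u, of k] by (auto simp: only_coord_nth)
qed

text \<open>Near a lower face u_j = 0 the margin j is small, and the other derivatives are small by
  \<open>C_dot_upper\<close>. Near an upper edge the term \<open>a u\<close> almost cancels against
  the margin j, whose derivative is nearly 1 by \<open>C_dot_lower\<close>, and the other margins
  are close to 1, where a is small.\<close>

lemma transform_bound:
 fixes u :: "real ^ 'd"
 assumes \<theta>: "0 < \<theta>" "\<theta> < 1" and L: "L \<ge> 0"
  and a: "edge_bound a L \<theta>" and u: "u \<in> unit_cube"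
 shows "\<bar>copula_transform C a u\<bar> \<le> (3 + (3 + 2 * K) * real CARD('d)) * L * base u powr \<theta>"
proof -
 note mb = margin_bound[OF a u]
 let ?t = "base u" and ?d = "real CARD('d)"
 have t: "?t \<ge> 0" by (rule base_nonneg[OF u])
 \<comment> \<open>On these faces \<open>C_dot\<close> may be a mere upper limit, but its factor is
   0 there.\<close>
 have trivial: "a (only_coord k u) = 0" if "u \<notin> V k" for k
 proof -
  have "u $ k = 0 \<or> u $ k = 1" using that u cube_ge0[OF u, of k] cube_le1[OF u, of k] unfolding V_iff by auto
  thus ?thesis using mb(1)[of k] mb(2)[of k] by (elim disjE) simp_all
 qed
 have wt: "r * \<bar>a (only_coord k u)\<bar> \<le> L * ((1 + 2 * c) * ?t powr \<theta>)"
  if V: "u \<in> V k" and r: "0 \<le> r" "r \<le> 1" "r \<le> c * ?t / (u $ k * (1 - u $ k))" and c: "c \<ge> 0" for r c k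
 proof -
  have uk: "0 < u $ k" "u $ k < 1" using V by (auto simp: V_iff)
  let ?s = "min (u $ k) (1 - u $ k)"
  have s: "?s > 0" using uk by simp
  have "?s / 2 \<le> u $ k * (1 - u $ k)" using uk by (intro parabola_lower) auto
  hence "c * ?t / (u $ k * (1 - u $ k)) \<le> c * ?t / (?s / 2)"
   using c t s uk by (intro divide_left_mono mult_pos_pos mult_nonneg_nonneg) auto
  hence "r \<le> 2 * c * ?t / ?s" using r(3) by (simp add: mult_ac)
  from min_powr_bound[OF s t _ \<theta> r(2) this] have "r * ?s powr \<theta> \<le> (1 + 2 * c) * ?t powr \<theta>" using c by simp
  from mult_left_mono[OF this L] have "L * (r * ?s powr \<theta>) \<le> L * ((1 + 2 * c) * ?t powr \<theta>)" .
  moreover have "\<bar>a (only_coord k u)\<bar> \<le> L * ?s powr \<theta>" using mb[of k] by (simp add: min_def)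
  from mult_left_mono[OF this r(1)] have "r * \<bar>a (only_coord k u)\<bar> \<le> L * (r * ?s powr \<theta>)" by (simp add: mult_ac)
  ultimately show ?thesis by linarith
 qed
 let ?A = "L * ?t powr \<theta>"
 have A: "?A \<ge> 0" using L by simp
 have tri: "\<bar>copula_transform C a u\<bar> \<le> \<bar>a u - x\<bar> + (\<Sum>k\<in>UNIV. y k)"
  if "\<And>k. \<bar>C_dot C k u * a (only_coord k u) - z k\<bar> \<le> y k" "(\<Sum>k\<in>UNIV. z k) = x" for x y and z :: "'d => real"
 proof -
  have "\<bar>(\<Sum>k\<in>UNIV. C_dot C k u * a (only_coord k u) - z k)\<bar> \<le> (\<Sum>k\<in>UNIV. y k)"
   by (intro order.trans[OF sum_abs] sum_mono that(1))
  hence "\<bar>(\<Sum>k\<in>UNIV. C_dot C k u * a (only_coord k u)) - x\<bar> \<le> (\<Sum>k\<in>UNIV. y k)"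
   by (simp add: sum_subtractf that(2))
  thus ?thesis unfolding copula_transform_def by linarith
 qed
 show ?thesis
 proof (cases u rule: base_cases)
  case (low j)
  have "\<bar>C_dot C k u * a (only_coord k u) - 0\<bar> \<le> (1 + 2 * K) * ?A" for k
  proof (cases "u \<in> V k")
   case False
   thus ?thesis using trivial[OF False] A K by simp
  next
   case V: True
   note cb = C_dot_bounds[OF V]
   show ?thesis
   proof (cases "k = j")
    case True
    have "C_dot C k u * \<bar>a (only_coord k u)\<bar> \<le> 1 * ?A"
     using cb mb(1)[of k] low True by (intro mult_mono) auto
    also have "... \<le> (1 + 2 * K) * ?A" using K A by (intro mult_right_mono) auto
    finally show ?thesis using cb by (simp add: abs_mult)
   next
    case False
    have "C_dot C k u * \<bar>a (only_coord k u)\<bar> \<le> L * ((1 + 2 * K) * ?t powr \<theta>)"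
     by (rule wt[OF V cb]) (use C_dot_upper[OF V, of j] False low K in auto)
    thus ?thesis using cb by (simp add: abs_mult mult_ac)
   qed
  qed
  from tri[OF this] have "\<bar>copula_transform C a u\<bar> \<le> \<bar>a u - 0\<bar> + (\<Sum>k\<in>(UNIV :: 'd set). (1 + 2 * K) * ?A)" by simp
  also have "\<bar>a u - 0\<bar> \<le> ?A" using edge_boundD(1)[OF a u, of j] low by simp
  also have "?A + (\<Sum>k\<in>(UNIV :: 'd set). (1 + 2 * K) * ?A) = (1 + (1 + 2 * K) * ?d) * ?A"
   by (simp add: algebra_simps)
  also have "... \<le> (3 + (3 + 2 * K) * ?d) * ?A" using K A by (intro mult_right_mono add_mono) auto
  finally show ?thesis by (simp add: mult.assoc)
 next
  case (high j)
  have "\<bar>C_dot C k u * a (only_coord k u) - (if k = j then a (only_coord j u) else 0)\<bar> \<le> ?A + (if k = j then (1 + 2 * K * ?d) * ?A else 0)" for k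
  proof (cases "u \<in> V k")
   case False
   thus ?thesis using trivial[OF False] A K by auto
  next
   case V: True
   note cb = C_dot_bounds[OF V]
   show ?thesis
   proof (cases "k = j")
    case True
    have "(1 - C_dot C j u) * \<bar>a (only_coord j u)\<bar> \<le> L * ((1 + 2 * (K * ?d)) * ?t powr \<theta>)"
     by (rule wt) (use V True cb C_dot_lower[of u j ?t] high t K in auto)
    moreover have "C_dot C j u * a (only_coord j u) - a (only_coord j u) = - ((1 - C_dot C j u) * a (only_coord j u))"
     by (simp add: algebra_simps)
    hence "\<bar>C_dot C j u * a (only_coord j u) - a (only_coord j u)\<bar> = (1 - C_dot C j u) * \<bar>a (only_coord j u)\<bar>"
     using cb True by (simp only: abs_minus_cancel abs_mult)
    ultimately show ?thesis using True A by (simp add: mult_ac)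
   next
    case False
    have "C_dot C k u * \<bar>a (only_coord k u)\<bar> \<le> 1 * (L * (1 - u $ k) powr \<theta>)" using cb mb(2)[of k] by (intro mult_mono) auto
    also have "... \<le> 1 * ?A" using high[OF False] cube_le1[OF u, of k] L \<theta> by (intro mult_left_mono powr_mono2) auto
    finally show ?thesis using False cb by (simp add: abs_mult)
   qed
  qed
  from tri[OF this] have "\<bar>copula_transform C a u\<bar> \<le> \<bar>a u - a (only_coord j u)\<bar> + (\<Sum>k\<in>(UNIV :: 'd set). ?A + (if k = j then (1 + 2 * K * ?d) * ?A else 0))" by simp
  also have "\<bar>a u - a (only_coord j u)\<bar> \<le> ?A" by (intro edge_boundD(2)[OF a] u t high)
  also have "?A + (\<Sum>k\<in>(UNIV :: 'd set). ?A + (if k = j then (1 + 2 * K * ?d) * ?A else 0)) = (1 + ?d + (1 + 2 * K * ?d)) * ?A"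
   by (simp add: sum.distrib algebra_simps)
  also have "... \<le> (3 + (3 + 2 * K) * ?d) * ?A" using A by (intro mult_right_mono) (auto simp: algebra_simps)
  finally show ?thesis by (simp add: mult.assoc)
 qed
qed

end

section \<open>The weighted modulus and the rank transformation\<close>

text \<open>Since H is increasing, the rank condition is W i \<le> v with v the largest observation
  that fulfils it, or 0 if there is none. The value H v exceeds u by at most 1/N, owing to the
  factor N / (N + 1), and falls short of it by at most the jump of H at the next
  observation.\<close>

lemma rank_point:
 fixes W :: "int => real" and I :: "int set" and N u \<rho> :: real
 defines "H \<equiv> \<lambda>x. (\<Sum>i\<in>I. of_bool (W i \<le> x)) / N"
 assumes fin: "finite I" and W: "\<And>i. i \<in> I ==> 0 < W i" "\<And>i. i \<in> I ==> W i \<le> 1" and N: "N = real (card I)" "N > 0"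
  and u: "0 \<le> u" "u \<le> 1"
  and jump: "\<And>x. 0 < x ==> x \<le> 1 ==> H x - (\<Sum>i\<in>I. of_bool (W i < x)) / N \<le> \<rho>" and \<rho>: "1 / N \<le> \<rho>"
 shows "\<exists>v. 0 \<le> v \<and> v \<le> 1 \<and> (\<forall>i\<in>I. N / (N + 1) * H (W i) \<le> u \<longleftrightarrow> W i \<le> v) \<and> \<bar>H v - u\<bar> \<le> \<rho>"
proof -
 define S where "S = {i \<in> I. N / (N + 1) * H (W i) \<le> u}"
 define v where "v = Max (insert 0 (W ` S))"
 have finS: "finite (insert 0 (W ` S))" using fin by (simp add: S_def)
 have SI: "S \<subseteq> I" by (auto simp: S_def)
 have S_iff: "i \<in> S \<longleftrightarrow> H (W i) \<le> u + u / N" if "i \<in> I" for i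
 proof -
  have "N / (N + 1) * H (W i) \<le> u \<longleftrightarrow> N * H (W i) \<le> u * (N + 1)" using N(2) by (simp add: field_simps)
  also have "... \<longleftrightarrow> H (W i) \<le> u + u / N" using N(2) by (simp add: field_simps)
  finally show ?thesis using that by (simp add: S_def)
 qed
 have Hmono: "H x \<le> H y" if "x \<le> y" for x y unfolding H_def using N that
  by (intro divide_right_mono sum_mono) auto
 have H0: "H 0 = 0" unfolding H_def using W(1) by (force intro: sum.neutral)
 have v01: "0 \<le> v" "v \<le> 1" unfolding v_def using finS W(2) SI by (auto intro!: Max_ge)
 have vin: "v = 0 \<or> v \<in> W ` S" using Max_in[OF finS] by (auto simp: v_def)
 have Hv: "H v \<le> u + u / N" using vin S_iff SI H0 u N by auto
 have iff: "i \<in> S \<longleftrightarrow> W i \<le> v" if i: "i \<in> I" for i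
 proof
  assume "i \<in> S" thus "W i \<le> v" unfolding v_def by (intro Max_ge finS) auto
 next
  assume "W i \<le> v"
  from Hmono[OF this] Hv show "i \<in> S" using S_iff[OF i] by simp
 qed
 have "u - H v \<le> \<rho>"
 proof (cases "S = I")
  case True
  hence "(\<Sum>i\<in>I. of_bool (W i \<le> v)) = (\<Sum>i\<in>I. 1 :: real)" using iff by (intro sum.cong) auto
  hence "H v = 1" using N by (simp add: H_def)
  thus ?thesis using u \<rho> N by (smt (verit) divide_pos_pos)
 next
  case False
  define w where "w = Min (W ` (I - S))"
  have fw: "finite (W ` (I - S))" "W ` (I - S) \<noteq> {}" using fin SI False by auto
  have "w \<in> W ` (I - S)" unfolding w_def by (rule Min_in[OF fw])
  then obtain i where i: "i \<in> I" "i \<notin> S" "w = W i" by auto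
  have "W k < w \<longleftrightarrow> W k \<le> v" if k: "k \<in> I" for k
  proof
   assume "W k < w"
   have "k \<in> S"
   proof (rule ccontr)
    assume "k \<notin> S"
    hence "w \<le> W k" unfolding w_def using k fw by (intro Min_le) auto
    thus False using \<open>W k < w\<close> by simp
   qed
   thus "W k \<le> v" using iff[OF k] by simp
  next
   assume "W k \<le> v" thus "W k < w" using iff[OF i(1)] i by simp
  qed
  hence "(\<Sum>i\<in>I. of_bool (W i < w)) / N = H v" unfolding H_def
   by (intro arg_cong2[where f="(/)"] sum.cong) (auto simp: of_bool_def)
  moreover have "u \<le> H w" using S_iff[OF i(1)] i u N by (smt (verit) divide_nonneg_pos)
  moreover have "H w - (\<Sum>i\<in>I. of_bool (W i < w)) / N \<le> \<rho>" using W i by (intro jump) auto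
  ultimately show ?thesis by linarith
 qed
 moreover have "H v - u \<le> \<rho>"
 proof -
  have "u / N \<le> 1 / N" using u N by (intro divide_right_mono) auto
  thus ?thesis using Hv \<rho> by linarith
 qed
 ultimately show ?thesis using v01 iff by (intro exI[of _ v]) (auto simp: S_def)
qed

text \<open>A self-bounding argument, with x = sqrt n, \<sigma> a bound for the distance of u_k from
  {0, 1} and \<Delta> = |v_k - u_k| on both sides. If \<Delta> exceeded \<sigma>, the right-hand
  side would be at most 3 L \<Delta>^\<theta>, while \<open>big\<close> makes the left-hand side at
  least 6 L \<Delta>^\<theta>.\<close>

lemma sum_split_bound:
 fixes \<sigma> \<Delta> :: real
 assumes \<theta>: "0 < \<theta>" "\<theta> < 1/2" and L: "L \<ge> 1" and x: "x > 0" and \<sigma>: "\<sigma> > 0" and \<Delta>: "\<Delta> \<ge> 0"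
  and big: "6 * L \<le> x * \<sigma> powr (1 - \<theta>)"
  and self: "x * \<Delta> \<le> L * (\<sigma> + \<Delta>) powr \<theta> + L * \<sigma> powr \<theta>"
 shows "x * \<Delta> \<le> 3 * L * \<sigma> powr \<theta>" "\<Delta> \<le> \<sigma> / 2"
proof -
 have two: "(2 * y) powr \<theta> \<le> 2 * y powr \<theta>" if "y > 0" for y :: real
 proof -
  have "2 powr \<theta> \<le> 2 powr (1::real)" using \<theta> by (intro powr_mono) auto
  from mult_right_mono[OF this, of "y powr \<theta>"] show ?thesis using that by (simp add: powr_mult)
 qed
 have dec: "y = y powr (1 - \<theta>) * y powr \<theta>" if "y > 0" for y :: real
  using that by (simp add: powr_add[symmetric])
 have le: "\<Delta> \<le> \<sigma>"
 proof (rule ccontr)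
  assume "\<not> \<Delta> \<le> \<sigma>"
  hence d: "\<sigma> < \<Delta>" "\<Delta> > 0" using \<sigma> by auto
  have "x * \<Delta> \<le> L * (2 * \<Delta>) powr \<theta> + L * \<Delta> powr \<theta>"
   using d \<sigma> L \<theta> by (intro order.trans[OF self] add_mono mult_left_mono powr_mono2) auto
  also have "... \<le> L * (2 * \<Delta> powr \<theta>) + L * \<Delta> powr \<theta>" using L two[OF d(2)] by (intro add_mono mult_left_mono) auto
  also have "... = 3 * L * \<Delta> powr \<theta>" by simp
  finally have 1: "x * \<Delta> \<le> 3 * L * \<Delta> powr \<theta>" .
  have "6 * L \<le> x * \<Delta> powr (1 - \<theta>)"
   using big d \<sigma> \<theta> x by (intro order.trans[OF big] mult_left_mono powr_mono2) auto
  hence "6 * L * \<Delta> powr \<theta> \<le> x * \<Delta> powr (1 - \<theta>) * \<Delta> powr \<theta>" by (intro mult_right_mono) auto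
  also have "... = x * \<Delta>" using dec[OF d(2)] by (simp add: mult.assoc)
  finally have "6 * L * \<Delta> powr \<theta> \<le> 3 * L * \<Delta> powr \<theta>" using 1 by linarith
  moreover have "0 < L * \<Delta> powr \<theta>" using L d by simp
  ultimately show False by simp
 qed
 have "x * \<Delta> \<le> L * (2 * \<sigma>) powr \<theta> + L * \<sigma> powr \<theta>"
  using le \<Delta> \<sigma> L \<theta> by (intro order.trans[OF self] add_mono mult_left_mono powr_mono2) auto
 also have "... \<le> L * (2 * \<sigma> powr \<theta>) + L * \<sigma> powr \<theta>" using L two[OF \<sigma>] by (intro add_mono mult_left_mono) auto
 finally show 2: "x * \<Delta> \<le> 3 * L * \<sigma> powr \<theta>" by simp
 have "6 * L * \<sigma> powr \<theta> \<le> x * \<sigma> powr (1 - \<theta>) * \<sigma> powr \<theta>" using big by (intro mult_right_mono) auto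
 also have "... = x * \<sigma>" using dec[OF \<sigma>] by (simp add: mult.assoc)
 finally have "x * (2 * \<Delta>) \<le> x * \<sigma>" using 2 by linarith
 thus "\<Delta> \<le> \<sigma> / 2" using x by simp
qed

section \<open>Good events for the empirical process\<close>

context geometric_mixing
begin

abbreviation "Gn \<equiv> G M X"

definition modulus :: "nat => real => real => 'a => bool" where
 "modulus n L \<theta> s \<longleftrightarrow> (\<forall>u\<in>unit_cube. \<forall>v\<in>unit_cube. \<bar>\<alpha>n n s u - \<alpha>n n s v\<bar> \<le> L * max (norm (u - v)) (1 / real n) powr \<theta>)"

text \<open>Almost surely no observation falls into a flat stretch of a marginal distribution function,
 so that the observations are ordered like their transforms.\<close>

definition regular :: "'a => bool" where
 "regular s \<longleftrightarrow> (\<forall>i j. 0 < Uf (X i s) $ j \<and>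
  (\<forall>q\<in>\<rat>. marginal_cdf M X j (X i s $ j) \<le> marginal_cdf M X j q --> X i s $ j \<le> q))"

lemma marg_mono: "x \<le> y ==> marginal_cdf M X j x \<le> marginal_cdf M X j y"
proof -
 interpret D: real_distribution "distr M borel (\<lambda>s. X 0 s $ j)" by (rule real_dist)
 show "x \<le> y ==> marginal_cdf M X j x \<le> marginal_cdf M X j y"
  unfolding marginal_cdf_def by (rule D.cdf_nondecreasing)
qed

lemma prob_X_le: "prob {s \<in> space M. X i s $ j \<le> q} = marginal_cdf M X j q"
proof -
 have e: "prob {s \<in> space M. X k s $ j \<le> q} = expectation (\<lambda>s. indicator {x. x $ j \<le> q} (X k s))" for k
 proof -
  have "expectation (\<lambda>s. indicator {x. x $ j \<le> q} (X k s)) = expectation (indicat_real {s \<in> space M. X k s $ j \<le> q})"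
   by (intro Bochner_Integration.integral_cong refl) (auto simp: indicator_def)
  thus ?thesis by (simp add: Int_absorb2 subset_eq)
 qed
 have "prob {s \<in> space M. X i s $ j \<le> q} = prob {s \<in> space M. X 0 s $ j \<le> q}"
  unfolding e by (rule stationary_1) measurable
 also have "... = measure (distr M borel (\<lambda>s. X 0 s $ j)) {..q}"
  by (subst measure_distr) (auto simp: vimage_def Int_def conj_commute)
 finally show ?thesis by (simp add: marginal_cdf_def cdf_def)
qed

text \<open>For fixed q the event that the transform is at most F(q) contains the event that the
  observation is at most q, and both have probability F(q). Rational q keep the number of
  exceptional sets countable.\<close>

lemma AE_regular: "AE s in M. regular s"
proof -
 have 1: "AE s in M. 0 < Uf (X i s) $ j" for i j
 proof -
  have "prob {s \<in> space M. Uf (X i s) $ j \<le> 0} = 0" by (rule prob_U_le) auto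
  hence "AE s in M. \<not> Uf (X i s) $ j \<le> 0"
   by (subst AE_iff_measurable[OF _ refl]) (auto simp: emeasure_eq_measure)
  thus ?thesis by eventually_elim simp
 qed
 have 2: "AE s in M. marginal_cdf M X j (X i s $ j) \<le> marginal_cdf M X j q --> X i s $ j \<le> q" for i j q
 proof -
  let ?A = "{s \<in> space M. Uf (X i s) $ j \<le> marginal_cdf M X j q}" and ?B = "{s \<in> space M. X i s $ j \<le> q}"
  have "prob ?A = marginal_cdf M X j q"
   by (rule prob_U_le) (simp_all add: prob_X_le[of 0 j q, symmetric])
  moreover have "?B \<subseteq> ?A" using marg_mono[of _ q j] by (auto simp: Uf_def)
  ultimately have "prob (?A - ?B) = 0" using prob_X_le[of i j q]
   by (subst finite_measure_Diff) auto
  hence "AE s in M. s \<notin> ?A - ?B" by (subst (asm) prob_eq_0) auto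
  with AE_space show ?thesis by eventually_elim (auto simp: Uf_def)
 qed
 have cQ: "countable (\<rat> :: real set)" by (rule countable_rat)
 show ?thesis unfolding regular_def
  by (intro AE_all_countable[THEN iffD2] allI AE_conjI 1 AE_ball_countable[THEN iffD2, OF cQ] ballI 2)
qed

text \<open>The modulus says nothing below the scale 1/n, but with high probability no transformed
  coordinate of the sample is within a = \<delta>/n of 0 or 1. At such distances the empirical part
  vanishes or cancels, and sqrt n times an increment of C remains, which is of order y^\<theta> for
  y < a. At larger distances the modulus applies with an enlarged constant.\<close>

lemma weighted_modulus:
 assumes \<theta>: "0 < \<theta>" "\<theta> < 1/2" and \<eta>: "\<eta> > 0"
 shows "\<exists>L\<ge>1. \<forall>n\<ge>1. \<exists>E\<in>sets M. prob E \<ge> 1 - \<eta> \<and>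
  (\<forall>s\<in>E. regular s \<and> modulus n L \<theta> s \<and> edge_bound (\<alpha>n n s) L \<theta>)"
proof -
 let ?d = "real CARD('d)"
 have d: "?d \<ge> 1" by (simp add: Suc_leI)
 obtain L0 where L0: "L0 \<ge> 1" and E0: "\<And>n. n \<ge> 1 ==> \<exists>E\<in>sets M. prob E \<ge> 1 - \<eta> / 2 \<and> (\<forall>s\<in>E. modulus n L0 \<theta> s)"
  using alpha_modulus[OF \<theta>, of "\<eta> / 2"] \<eta> unfolding modulus_def by auto
 \<comment> \<open>The union bound over n observations and d coordinates costs n d (2 \<delta> / n)
   \<le> \<eta> / 2.\<close>
 define \<delta> where "\<delta> = min (1/2) (\<eta> / (4 * ?d))"
 have \<delta>: "0 < \<delta>" "\<delta> \<le> 1/2" "4 * ?d * \<delta> \<le> \<eta>" using \<eta> d by (auto simp: \<delta>_def min_def field_simps)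
 define L where "L = L0 * (?d / \<delta>)"
 have q: "1 \<le> ?d / \<delta>" "1 / \<delta> \<le> ?d / \<delta>" "?d \<le> ?d / \<delta>"
 proof -
  have "\<delta> \<le> ?d" using d \<delta> by linarith
  thus "1 \<le> ?d / \<delta>" using \<delta> by (subst le_divide_eq_1_pos)
  show "1 / \<delta> \<le> ?d / \<delta>" by (rule divide_right_mono[OF d]) (use \<delta> in simp)
  show "?d \<le> ?d / \<delta>" using \<delta> mult_left_mono[of \<delta> 1 ?d] by (simp add: le_divide_eq)
 qed
 have LL: "L0 \<le> L" "?d \<le> L"
 proof -
  have "L0 * 1 \<le> L0 * (?d / \<delta>)" using q(1) L0 by (intro mult_left_mono) linarith+
  thus "L0 \<le> L" by (simp add: L_def)
  have "1 * ?d \<le> L0 * (?d / \<delta>)" using q(3) L0 by (intro mult_mono) linarith+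
  thus "?d \<le> L" by (simp add: L_def)
 qed
 show ?thesis
 proof (intro exI[of _ L] conjI allI impI)
  show "L \<ge> 1" using LL L0 by simp
  fix n :: nat assume n: "n \<ge> 1"
  define a where "a = \<delta> / real n"
  have a: "0 < a" "a \<le> 1/2" using n \<delta> by (auto simp: a_def field_simps intro: order.trans[of _ 1])
  obtain E where E: "E \<in> sets M" "prob E \<ge> 1 - \<eta> / 2" and Em: "\<And>s. s \<in> E ==> modulus n L0 \<theta> s"
   using E0[OF n] by blast
  obtain R where R: "R \<in> sets M" "prob R = 1" and "R \<subseteq> {s \<in> space M. regular s}"
   by (rule AE_E_prob[OF AE_regular])
  hence Rr: "\<And>s. s \<in> R ==> regular s" by blast
  define B where "B i j = {s \<in> space M. Uf (X i s) $ j \<le> a} \<union> {s \<in> space M. \<not> Uf (X i s) $ j \<le> 1 - a}" for i j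
  have Um: "(\<lambda>s. Uf (X i s) $ j) \<in> borel_measurable M" for i j
   by (rule measurable_compose[OF X_meas Uf_comp_meas])
  have les: "{s \<in> space M. Uf (X i s) $ j \<le> x} \<in> sets M" for i j x
   by (rule borel_measurable_le[OF Um borel_measurable_const])
  have neq: "{s \<in> space M. \<not> Uf (X i s) $ j \<le> x} = space M - {s \<in> space M. Uf (X i s) $ j \<le> x}" for i j x by auto
  have nles: "{s \<in> space M. \<not> Uf (X i s) $ j \<le> x} \<in> sets M" for i j x
   unfolding neq by (rule sets.compl_sets[OF les])
  have Bs: "B i j \<in> sets M" for i j unfolding B_def by (rule sets.Un[OF les nles])
  have pB: "prob (B i j) \<le> 2 * a" for i j
  proof -
   have "prob (B i j) \<le> prob {s \<in> space M. Uf (X i s) $ j \<le> a} + prob {s \<in> space M. \<not> Uf (X i s) $ j \<le> 1 - a}"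
    unfolding B_def by (rule measure_Un_le[OF les nles])
   also have "prob {s \<in> space M. \<not> Uf (X i s) $ j \<le> 1 - a} = 1 - prob {s \<in> space M. Uf (X i s) $ j \<le> 1 - a}"
    unfolding neq by (rule prob_compl[OF les])
   also have "prob {s \<in> space M. Uf (X i s) $ j \<le> a} + (1 - prob {s \<in> space M. Uf (X i s) $ j \<le> 1 - a}) = 2 * a"
    using prob_U_le[of a i j] prob_U_le[of "1 - a" i j] a by linarith
   finally show ?thesis .
  qed
  define BB where "BB = (\<Union>(i, j)\<in>{1..int n} \<times> UNIV. B i j)"
  have BBs: "BB \<in> sets M" unfolding BB_def case_prod_beta by (intro sets.finite_UN Bs) auto
  have "prob BB \<le> (\<Sum>(i, j)\<in>{1..int n} \<times> (UNIV :: 'd set). prob (B i j))"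
   unfolding BB_def by (rule order.trans[OF measure_UNION_le]) (auto simp: case_prod_beta Bs)
  also have "... \<le> (\<Sum>(i, j)\<in>{1..int n} \<times> (UNIV :: 'd set). 2 * a)"
   using pB by (intro sum_mono) auto
  also have "... = 2 * ?d * \<delta>" using n by (simp add: a_def card_cartesian_product)
  also have "... \<le> \<eta> / 2" using \<delta>(3) by simp
  finally have pBB: "prob BB \<le> \<eta> / 2" .
  have "1 - \<eta> \<le> prob ((E \<inter> R) - BB)"
  proof -
   have "prob (E \<inter> R) = prob E" by (rule measure_eq_AE) (use E R prob_eq_1[of R] in \<open>auto elim: eventually_mono\<close>)
   moreover have "prob (E \<inter> R) \<le> prob (((E \<inter> R) - BB) \<union> BB)" using E R BBs by (intro finite_measure_mono) auto
   moreover have "prob (((E \<inter> R) - BB) \<union> BB) \<le> prob ((E \<inter> R) - BB) + prob BB"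
    using E R BBs by (intro measure_Un_le) auto
   ultimately show ?thesis using E(2) pBB by linarith
  qed
  moreover have "regular s \<and> modulus n L \<theta> s \<and> edge_bound (\<alpha>n n s) L \<theta>" if s: "s \<in> (E \<inter> R) - BB" for s
  proof (intro conjI)
   show reg: "regular s" using s Rr by blast
   have mod: "modulus n L0 \<theta> s" using s Em by blast
   show "modulus n L \<theta> s" using mod LL(1) unfolding modulus_def
    by (meson mult_right_mono order.trans powr_ge_zero)
   have sp: "s \<in> space M" using s E(1) sets.sets_into_space by blast
   have Ub: "a < Uf (X i s) $ j" "Uf (X i s) $ j \<le> 1 - a" if "i \<in> {1..int n}" for i j
   proof -
    have "s \<notin> B i j" using s that unfolding BB_def by blast
    thus "a < Uf (X i s) $ j" "Uf (X i s) $ j \<le> 1 - a" using sp by (auto simp: B_def not_le)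
   qed
   have sm: "sqrt n * y \<le> y powr \<theta>" if y: "0 \<le> y" "y < a" for y
   proof (cases "y = 0")
    case False
    have "y powr (1 - \<theta>) \<le> y powr (1/2)" using y a \<theta> False by (intro powr_mono') auto
    also have "... \<le> (1 / real n) powr (1/2)" using y a \<delta> n by (intro powr_mono2) (auto simp: a_def field_simps)
    also have "... = 1 / sqrt n" using n by (simp add: powr_half_sqrt real_sqrt_divide)
    finally have "sqrt n * y powr (1 - \<theta>) \<le> 1" using n by (simp add: field_simps)
    from mult_right_mono[OF this, of "y powr \<theta>"] show ?thesis
     using False y by (simp add: mult.assoc powr_add[symmetric])
   qed simp
   \<comment> \<open>For x \<ge> a the cut-off 1/n is at most x / \<delta>, so it is absorbed by the
     factor d / \<delta> in L.\<close>
   have large: "L0 * max y (1 / real n) powr \<theta> \<le> L * x powr \<theta>" if x: "a \<le> x" "0 \<le> y" "y \<le> ?d * x" for x y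
   proof -
    have "1 / real n \<le> ?d / \<delta> * x"
    proof -
     have "1 / real n = 1 / \<delta> * a" using \<delta> by (simp add: a_def)
     also have "... \<le> ?d / \<delta> * x" using q x a d \<delta> by (intro mult_mono) auto
     finally show ?thesis .
    qed
    moreover have "?d * x \<le> ?d / \<delta> * x" using q(3) x a by (intro mult_right_mono) auto
    ultimately have "max y (1 / real n) powr \<theta> \<le> (?d / \<delta> * x) powr \<theta>"
     using x \<theta> by (intro powr_mono2) auto
    also have "... = (?d / \<delta>) powr \<theta> * x powr \<theta>" by (rule powr_mult)
    also have "... \<le> (?d / \<delta>) powr 1 * x powr \<theta>" using q(1) \<theta> by (intro mult_right_mono powr_mono) auto
    also have "... = ?d / \<delta> * x powr \<theta>" using d \<delta> by simp
    finally have "max y (1 / real n) powr \<theta> \<le> ?d / \<delta> * x powr \<theta>" .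
    from mult_left_mono[OF this, of L0] show ?thesis using L0 by (simp add: L_def mult_ac)
   qed
   have G0: "Gn n s w = 0" if "w $ j \<le> a" for w j
   proof -
    have "\<not> U M X i s \<le> w" if "i \<in> {1..int n}" for i
     using Ub(1)[OF that, of j] \<open>w $ j \<le> a\<close> by (auto simp: U_eq less_eq_vec_def not_le intro!: exI[of _ j])
    thus ?thesis by (simp add: G_def)
   qed
   show "edge_bound (\<alpha>n n s) L \<theta>" unfolding edge_bound_def
   proof (intro conjI ballI allI impI)
    fix w :: "real ^ 'd" and j assume w: "w \<in> unit_cube"
    have wj: "0 \<le> w $ j" "w $ j \<le> 1" using w by (auto intro: cube_ge0 cube_le1)
    show "\<bar>\<alpha>n n s w\<bar> \<le> L * w $ j powr \<theta>"
    proof (cases "w $ j < a")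
     case True
     have "\<bar>\<alpha>n n s w\<bar> = sqrt n * Cop w" using G0[of w j] True Cop_bounds(1)[of w] by (simp add: alpha_n_def abs_mult)
     also have "... \<le> sqrt n * w $ j" using Cop_le[OF w] by (intro mult_left_mono) auto
     also have "... \<le> 1 * w $ j powr \<theta>" using sm[OF wj(1) True] by simp
     also have "... \<le> L * w $ j powr \<theta>" using LL L0 by (intro mult_right_mono) auto
     finally show ?thesis .
    next
     case False
     let ?v = "upd w j 0"
     have v: "?v \<in> unit_cube" by (intro upd_cube w) auto
     have "\<alpha>n n s ?v = 0" using G0[of ?v j] Cop_0[OF v, of j] a by (simp add: alpha_n_def upd_nth)
     hence "\<bar>\<alpha>n n s w\<bar> \<le> L0 * max (norm (w - ?v)) (1 / real n) powr \<theta>" using mod w v unfolding modulus_def by fastforce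
     also have "... \<le> L * w $ j powr \<theta>"
     proof (rule large)
      have "norm (w - ?v) \<le> (\<Sum>k\<in>UNIV. \<bar>(w - ?v) $ k\<bar>)" by (rule norm_le_l1_cart)
      also have "... = (\<Sum>k\<in>UNIV. if k = j then w $ j else 0)" using wj by (intro sum.cong) (auto simp: upd_nth)
      also have "... = 1 * w $ j" by simp
      also have "... \<le> ?d * w $ j" using d wj by (intro mult_right_mono) auto
      finally show "norm (w - ?v) \<le> ?d * w $ j" .
     qed (use False in auto)
     finally show ?thesis .
    qed
   next
    fix w :: "real ^ 'd" and j and x :: real
    assume w: "w \<in> unit_cube" and x: "0 \<le> x" "\<forall>k. k \<noteq> j --> 1 - w $ k \<le> x"
    let ?v = "only_coord j w"
    have v: "?v \<in> unit_cube" by (rule only_coord_cube[OF w])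
    have "(\<Sum>k\<in>UNIV. \<bar>w $ k - ?v $ k\<bar>) \<le> (\<Sum>k\<in>(UNIV :: 'd set). x)"
     using x cube_le1[OF w] by (intro sum_mono) (auto simp: only_coord_nth)
    hence l1: "(\<Sum>k\<in>UNIV. \<bar>w $ k - ?v $ k\<bar>) \<le> ?d * x" by simp
    show "\<bar>\<alpha>n n s w - \<alpha>n n s ?v\<bar> \<le> L * x powr \<theta>"
    proof (cases "x < a")
     case True
     have "U M X i s \<le> w \<longleftrightarrow> U M X i s \<le> ?v" if i: "i \<in> {1..int n}" for i
     proof -
      have "Uf (X i s) $ k \<le> w $ k" if "k \<noteq> j" for k using Ub(2)[OF i, of k] x(2) True that by force
      moreover have "Uf (X i s) $ k \<le> 1" for k by (rule cube_le1[OF Uf_cube])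
      ultimately have "Uf (X i s) $ k \<le> w $ k \<longleftrightarrow> Uf (X i s) $ k \<le> ?v $ k" for k
       by (cases "k = j") (simp_all add: only_coord_nth)
      thus ?thesis unfolding U_eq less_eq_vec_def by simp
     qed
     hence "Gn n s w = Gn n s ?v" unfolding G_def by simp
     hence "\<bar>\<alpha>n n s w - \<alpha>n n s ?v\<bar> = sqrt n * \<bar>Cop w - Cop ?v\<bar>"
      by (simp add: alpha_n_def right_diff_distrib[symmetric] abs_mult abs_minus_commute)
     also have "... \<le> sqrt n * (?d * x)" using order.trans[OF Cop_lipschitz[OF w v] l1] by (intro mult_left_mono) auto
     also have "... = ?d * (sqrt n * x)" by simp
     also have "... \<le> L * x powr \<theta>" using sm[OF x(1) True] LL d x(1) by (intro mult_mono) auto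
     finally show ?thesis .
    next
     case False
     have "\<bar>\<alpha>n n s w - \<alpha>n n s ?v\<bar> \<le> L0 * max (norm (w - ?v)) (1 / real n) powr \<theta>" using mod w v unfolding modulus_def by (elim ballE) auto
     also have "... \<le> L * x powr \<theta>"
      by (rule large) (use False l1 norm_le_l1_cart[of "w - ?v"] in auto)
     finally show ?thesis .
    qed
   next
    have "U M X i s \<le> 1" for i using cube_le1[OF Uf_cube] by (simp add: U_eq less_eq_vec_def)
    thus "\<alpha>n n s 1 = 0" using n by (simp add: alpha_n_def G_def Cop_1)
   qed
  qed
  ultimately show "\<exists>E\<in>sets M. prob E \<ge> 1 - \<eta> \<and> (\<forall>s\<in>E. regular s \<and> modulus n L \<theta> s \<and> edge_bound (\<alpha>n n s) L \<theta>)"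
   using E(1) R(1) BBs by (intro bexI[of _ "(E \<inter> R) - BB"]) auto
 qed
qed

end

section \<open>From ranks to the empirical process at a random point\<close>

context geometric_mixing
begin

lemma only_coord_upd: "only_coord j v = upd 1 j (v $ j)"
 by (simp add: vec_eq_iff only_coord_nth upd_nth)

lemma Gn_upd: "Gn n s (upd 1 j x) = (\<Sum>i\<in>{1..int n}. of_bool (Uf (X i s) $ j \<le> x)) / real n"
proof -
 have "U M X i s \<le> upd 1 j x \<longleftrightarrow> Uf (X i s) $ j \<le> x" for i
 proof -
  have "Uf (X i s) $ k \<le> 1" for k by (rule cube_le1[OF Uf_cube])
  thus ?thesis unfolding U_eq less_eq_vec_def by (auto simp: upd_nth)
 qed
 thus ?thesis by (simp add: G_def)
qed

lemma one_cube: "(1 :: real ^ 'd) \<in> unit_cube"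
 by (rule cubeI) auto

lemma Cop_upd: "0 \<le> x ==> x \<le> 1 ==> Cop (upd 1 j x) = x"
 using Cop_only_coord[OF upd_cube[OF one_cube], of x j j] by (simp add: only_coord_upd upd_nth)

text \<open>Observations and transforms are ordered alike: if X_k exceeded X_i without its transform
  doing so, a rational number strictly between them would contradict \<open>regular\<close>.\<close>

lemma emp_cdf_eq:
 assumes "regular s"
 shows "emp_cdf X n s j (X i s $ j) = Gn n s (upd 1 j (Uf (X i s) $ j))"
proof -
 have "X k s $ j \<le> X i s $ j \<longleftrightarrow> Uf (X k s) $ j \<le> Uf (X i s) $ j" for k
 proof
  assume "X k s $ j \<le> X i s $ j"
  thus "Uf (X k s) $ j \<le> Uf (X i s) $ j" by (simp add: Uf_def marg_mono)
 next
  assume le: "Uf (X k s) $ j \<le> Uf (X i s) $ j"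
  show "X k s $ j \<le> X i s $ j"
  proof (rule ccontr)
   assume "\<not> ?thesis"
   then obtain q where q: "q \<in> \<rat>" "X i s $ j < q" "q < X k s $ j" using Rats_dense_in_real[of "X i s $ j" "X k s $ j"] by auto
   have "marginal_cdf M X j (X i s $ j) \<le> marginal_cdf M X j q" using q by (intro marg_mono) simp
   with le have "marginal_cdf M X j (X k s $ j) \<le> marginal_cdf M X j q" by (simp add: Uf_def)
   hence "X k s $ j \<le> q" using assms q(1) unfolding regular_def by blast
   thus False using q(3) by simp
  qed
 qed
 thus ?thesis by (simp add: emp_cdf_def Gn_upd)
qed

text \<open>Serial dependence may produce ties, so a jump can exceed 1/n and is bounded through the
  modulus instead. The sum over observations strictly below x is the empirical distribution function
  at some y < x as close to x as desired.\<close>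

lemma jump_bound:
 assumes n: "n \<ge> 1" and m: "modulus n L \<theta> s" and x: "0 < x" "x \<le> 1"
 shows "Gn n s (upd 1 j x) - (\<Sum>i\<in>{1..int n}. of_bool (Uf (X i s) $ j < x)) / real n \<le> L * (1 / real n) powr \<theta> / sqrt n"
proof (rule field_le_epsilon)
 fix e :: real assume e: "e > 0"
 let ?W = "\<lambda>i. Uf (X i s) $ j"
 define t where "t = min e (min x (1 / real n))"
 have t: "0 < t" "t \<le> e" "t \<le> x" "t \<le> 1 / real n" using e x n by (auto simp: t_def)
 define A where "A = insert (x - t) (?W ` {i \<in> {1..int n}. ?W i < x})"
 have "finite {i \<in> {1..int n}. ?W i < x}" by (rule finite_subset[of _ "{1..int n}"]) auto
 hence A: "finite A" "A \<noteq> {}" unfolding A_def by blast+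
 define y where "y = Max A"
 have y: "x - t \<le> y" "y < x" using A t by (auto simp: y_def A_def)
 have "?W i < x \<longleftrightarrow> ?W i \<le> y" if "i \<in> {1..int n}" for i
 proof
  assume "?W i < x" thus "?W i \<le> y" unfolding y_def using that by (intro Max_ge A) (auto simp: A_def)
 qed (use y in simp)
 hence H: "(\<Sum>i\<in>{1..int n}. of_bool (?W i < x)) / real n = Gn n s (upd 1 j y)"
  unfolding Gn_upd by simp
 have y0: "0 \<le> y" "y \<le> 1" using y t x by linarith+
 have "norm (upd 1 j x - upd 1 j y) \<le> (\<Sum>k\<in>UNIV. \<bar>(upd 1 j x - upd 1 j y :: real ^ 'd) $ k\<bar>)" by (rule norm_le_l1_cart)
 also have "... = (\<Sum>k\<in>UNIV. if k = j then x - y else 0)" using y by (intro sum.cong) (auto simp: upd_nth)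
 finally have "max (norm (upd 1 j x - upd 1 j y)) (1 / real n) = 1 / real n" using y t by simp
 moreover have "\<bar>\<alpha>n n s (upd 1 j x) - \<alpha>n n s (upd 1 j y)\<bar> \<le> L * max (norm (upd 1 j x - upd 1 j y)) (1 / real n) powr \<theta>"
  using m upd_cube[OF one_cube, of x j] upd_cube[OF one_cube, of y j] x y0 unfolding modulus_def by (simp del: atLeastAtMost_iff)
 ultimately have "\<bar>\<alpha>n n s (upd 1 j x) - \<alpha>n n s (upd 1 j y)\<bar> \<le> L * (1 / real n) powr \<theta>" by simp
 moreover have "\<alpha>n n s (upd 1 j x) - \<alpha>n n s (upd 1 j y) = sqrt n * (Gn n s (upd 1 j x) - Gn n s (upd 1 j y) - (x - y))"
  using x y0 by (simp add: alpha_n_def Cop_upd algebra_simps)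
 ultimately have "sqrt n * (Gn n s (upd 1 j x) - Gn n s (upd 1 j y) - (x - y)) \<le> L * (1 / real n) powr \<theta>" by linarith
 hence "Gn n s (upd 1 j x) - Gn n s (upd 1 j y) - (x - y) \<le> L * (1 / real n) powr \<theta> / sqrt n"
  using n by (simp add: pos_le_divide_eq mult.commute)
 thus "Gn n s (upd 1 j x) - (\<Sum>i\<in>{1..int n}. of_bool (?W i < x)) / real n \<le> L * (1 / real n) powr \<theta> / sqrt n + e"
  unfolding H using y t by linarith
qed

text \<open>The coordinatewise thresholds of \<open>rank_point\<close> form v. The only record of
  its position is that the empirical margins at v reproduce u up to the size of a jump.\<close>

lemma rank_vector:
 assumes n: "n \<ge> 1" and r: "regular s" and m: "modulus n L \<theta> s" and L: "L \<ge> 1" and \<theta>: "0 < \<theta>" "\<theta> < 1/2" and u: "u \<in> unit_cube"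
 shows "\<exists>v\<in>unit_cube. C_hat X n s u = Gn n s v \<and> (\<forall>k. sqrt n * \<bar>Gn n s (only_coord k v) - u $ k\<bar> \<le> L * (1 / real n) powr \<theta>)"
proof -
 let ?\<rho> = "L * (1 / real n) powr \<theta> / sqrt n"
 have \<rho>: "1 / real n \<le> ?\<rho>"
 proof -
  have "1 / sqrt n = (1 / real n) powr (1/2)" using n by (simp add: powr_half_sqrt real_sqrt_divide)
  also have "... \<le> (1 / real n) powr \<theta>" using n \<theta> by (intro powr_mono') auto
  also have "... \<le> L * (1 / real n) powr \<theta>" using L by (simp add: mult_le_cancel_right1)
  finally have "1 / sqrt n / sqrt n \<le> ?\<rho>" by (intro divide_right_mono) auto
  thus ?thesis by simp
 qed
 have "\<exists>v. 0 \<le> v \<and> v \<le> 1 \<and> (\<forall>i\<in>{1..int n}. real n / (real n + 1) * Gn n s (upd 1 j (Uf (X i s) $ j)) \<le> u $ j \<longleftrightarrow> Uf (X i s) $ j \<le> v) \<and>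
  \<bar>Gn n s (upd 1 j v) - u $ j\<bar> \<le> ?\<rho>" for j
  unfolding Gn_upd
 proof (rule rank_point)
  show "0 < Uf (X i s) $ j" for i using r by (simp add: regular_def)
  show "Uf (X i s) $ j \<le> 1" for i by (rule cube_le1[OF Uf_cube])
  show "0 \<le> u $ j" "u $ j \<le> 1" using u by (auto intro: cube_ge0 cube_le1)
  show "1 / real n \<le> ?\<rho>" by (rule \<rho>)
  show "(\<Sum>i\<in>{1..int n}. of_bool (Uf (X i s) $ j \<le> x)) / real n - (\<Sum>i\<in>{1..int n}. of_bool (Uf (X i s) $ j < x)) / real n \<le> ?\<rho>"
   if "0 < x" "x \<le> 1" for x
   using jump_bound[OF n m that, of j] by (simp add: Gn_upd)
 qed (use n in auto)
 then obtain V where V: "\<And>j. 0 \<le> V j" "\<And>j. V j \<le> 1"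
  and iff: "\<And>i j. i \<in> {1..int n} ==> real n / (real n + 1) * Gn n s (upd 1 j (Uf (X i s) $ j)) \<le> u $ j \<longleftrightarrow> Uf (X i s) $ j \<le> V j"
  and d: "\<And>j. \<bar>Gn n s (upd 1 j (V j)) - u $ j\<bar> \<le> ?\<rho>" by metis
 let ?v = "\<chi> j. V j"
 have "U_hat X n i s \<le> u \<longleftrightarrow> U M X i s \<le> ?v" if "i \<in> {1..int n}" for i
  unfolding less_eq_vec_def U_hat_def U_eq using iff[OF that] by (simp only: emp_cdf_eq[OF r] vec_lambda_beta)
 hence "C_hat X n s u = Gn n s ?v" unfolding C_hat_def G_def by simp
 moreover have "sqrt n * \<bar>Gn n s (only_coord k ?v) - u $ k\<bar> \<le> L * (1 / real n) powr \<theta>" for k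
  using d[of k] n by (simp add: only_coord_upd pos_le_divide_eq mult.commute)
 moreover have "?v \<in> unit_cube" by (rule cubeI) (simp_all add: V)
 ultimately show ?thesis by blast
qed

end

section \<open>Comparison of the two processes at one point of the cube\<close>

locale mixing_copula = geometric_mixing M X a + smooth_copula "copula M X" K
 for M :: "'a measure" and X :: "int => 'a => real ^ 'd" and a K

text \<open>The hypothesis \<open>rank\<close> retains what is known about v. The scale \<nu> is the
  one below which distances from the boundary are not resolved, and \<open>big\<close> supplies the
  hypothesis of \<open>sum_split_bound\<close> for every \<sigma> \<ge> \<nu>.\<close>

locale ranked = mixing_copula M X a K
 for M :: "'a measure" and X :: "int => 'a => real ^ 'd" and a K +
 fixes n :: nat and s L \<theta> \<nu> u v
 assumes n: "n \<ge> 1" and L: "L \<ge> 1" and \<theta>: "0 < \<theta>" "\<theta> < 1/2"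
  and modulus: "modulus n L \<theta> s" and edge: "edge_bound (alpha_n M X n s) L \<theta>"
  and u: "u \<in> unit_cube" and v: "v \<in> unit_cube"
  and rank: "\<And>k. sqrt n * \<bar>Gn n s (only_coord k v) - u $ k\<bar> \<le> L * (1 / real n) powr \<theta>"
  and \<nu>: "0 < \<nu>" "\<nu> \<le> 1" "1 / real n \<le> \<nu>" and big: "6 * L \<le> sqrt n * \<nu> powr (1 - \<theta>)"
begin

abbreviation "\<alpha> \<equiv> alpha_n M X n s"
text \<open>The difference of the two processes at u, once \<open>C_hat\<close> at u is replaced by
  \<open>G\<close> at v.\<close>

abbreviation "D \<equiv> \<alpha> v + sqrt n * (Cop v - Cop u) - copula_transform Cop \<alpha> u"

lemma margin: "sqrt n * (v $ k - u $ k) + \<alpha> (only_coord k v) = sqrt n * (Gn n s (only_coord k v) - u $ k)"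
 by (simp add: alpha_n_def Cop_only_coord[OF v] algebra_simps)

text \<open>By \<open>margin\<close> the displacement is the rank error minus \<alpha> at the margin
  of v. The latter is small if v_k is close to 0 or 1, but this closeness again involves the
  displacement, hence the self-bounding argument.\<close>

lemma dist:
 assumes \<sigma>: "\<nu> \<le> \<sigma>" "min (u $ k) (1 - u $ k) \<le> \<sigma>"
 shows "sqrt n * \<bar>v $ k - u $ k\<bar> \<le> 3 * L * \<sigma> powr \<theta>" "\<bar>v $ k - u $ k\<bar> \<le> \<sigma> / 2"
proof -
 let ?\<Delta> = "\<bar>v $ k - u $ k\<bar>"
 have s0: "\<sigma> > 0" using \<sigma> \<nu> by linarith
 have b: "6 * L \<le> sqrt n * \<sigma> powr (1 - \<theta>)"
  using \<sigma> \<nu> \<theta> by (intro order.trans[OF big] mult_left_mono powr_mono2) auto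
 note vk = cube_ge0[OF v, of k] cube_le1[OF v, of k]
 have "\<bar>\<alpha> (only_coord k v)\<bar> \<le> L * (min (v $ k) (1 - v $ k)) powr \<theta>"
  using margin_bound[OF edge v, of k] by (simp add: min_def)
 also have "... \<le> L * (\<sigma> + ?\<Delta>) powr \<theta>"
  using L \<theta> vk \<sigma> by (intro mult_left_mono powr_mono2) (auto simp: min_def abs_if split: if_splits)
 finally have 1: "\<bar>\<alpha> (only_coord k v)\<bar> \<le> L * (\<sigma> + ?\<Delta>) powr \<theta>" .
 have "L * (1 / real n) powr \<theta> \<le> L * \<sigma> powr \<theta>" using L \<nu> \<sigma> \<theta> by (intro mult_left_mono powr_mono2) auto
 with rank[of k] have 2: "\<bar>sqrt n * (Gn n s (only_coord k v) - u $ k)\<bar> \<le> L * \<sigma> powr \<theta>" by (simp add: abs_mult)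
 have "sqrt n * ?\<Delta> = \<bar>sqrt n * (v $ k - u $ k)\<bar>" by (simp add: abs_mult)
 also have "... \<le> L * (\<sigma> + ?\<Delta>) powr \<theta> + L * \<sigma> powr \<theta>" using 1 2 margin[of k] by linarith
 finally have self: "sqrt n * ?\<Delta> \<le> L * (\<sigma> + ?\<Delta>) powr \<theta> + L * \<sigma> powr \<theta>" .
 show "sqrt n * ?\<Delta> \<le> 3 * L * \<sigma> powr \<theta>" "?\<Delta> \<le> \<sigma> / 2"
  by (rule sum_split_bound[OF \<theta> L _ s0 _ b self]; use n in simp)+
qed

lemma increment:
 assumes "\<And>k \<xi>. \<xi> \<in> V k ==> (\<And>l. min (u $ l) (v $ l) \<le> \<xi> $ l \<and> \<xi> $ l \<le> max (u $ l) (v $ l)) ==> \<bar>C_dot Cop k \<xi> - e k\<bar> \<le> r k"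
  and b: "\<And>k. sqrt n * \<bar>v $ k - u $ k\<bar> * r k \<le> b"
 shows "\<bar>sqrt n * (Cop v - Cop u) - (\<Sum>k\<in>UNIV. sqrt n * (v $ k - u $ k) * e k)\<bar> \<le> real CARD('d) * b"
proof -
 have "\<bar>Cop v - Cop u - (\<Sum>k\<in>UNIV. (v $ k - u $ k) * e k)\<bar> \<le> (\<Sum>k\<in>UNIV. \<bar>v $ k - u $ k\<bar> * r k)"
  by (rule C_increment[OF u v assms(1)])
 hence "sqrt n * \<bar>Cop v - Cop u - (\<Sum>k\<in>UNIV. (v $ k - u $ k) * e k)\<bar> \<le> sqrt n * (\<Sum>k\<in>UNIV. \<bar>v $ k - u $ k\<bar> * r k)"
  by (rule mult_left_mono) simp
 also have "... = (\<Sum>k\<in>UNIV. sqrt n * \<bar>v $ k - u $ k\<bar> * r k)" by (simp add: sum_distrib_left mult.assoc)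
 also have "... \<le> real CARD('d) * b" using sum_mono[of UNIV, OF b] by simp
 also have "sqrt n * \<bar>Cop v - Cop u - (\<Sum>k\<in>UNIV. (v $ k - u $ k) * e k)\<bar> =
  \<bar>sqrt n * (Cop v - Cop u - (\<Sum>k\<in>UNIV. (v $ k - u $ k) * e k))\<bar>" by (simp add: abs_mult)
 also have "sqrt n * (Cop v - Cop u - (\<Sum>k\<in>UNIV. (v $ k - u $ k) * e k)) = sqrt n * (Cop v - Cop u) - (\<Sum>k\<in>UNIV. sqrt n * (v $ k - u $ k) * e k)"
  by (subst right_diff_distrib) (simp only: sum_distrib_left mult.assoc)
 finally show ?thesis .
qed

text \<open>If \<sigma> k \<le> \<tau>, the displacement is of order \<tau>^\<theta> / sqrt n and
  any slope error up to 1 is allowed. Otherwise the segment from u to v stays at distance \<sigma> k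
  / 2 from {0, 1}, and the derivative is within the order \<tau> / \<sigma> k of its value 0 or 1 on
  the nearby face or edge. Either way sqrt n times displacement times slope error is of order
  \<tau>^\<theta>.\<close>

lemma edge_estimate:
 "\<bar>D\<bar> \<le> (6 + (3 + 2 * K) * real CARD('d) + real CARD('d) * (3 * (1 + 8 * K * real CARD('d))) + 3) * L * max (base u) \<nu> powr \<theta>"
proof -
 define \<tau> where "\<tau> = max (base u) \<nu>"
 let ?d = "real CARD('d)" and ?A = "L * \<tau> powr \<theta>"
 have d: "?d \<ge> 1" by (simp add: Suc_leI)
 have \<tau>: "\<nu> \<le> \<tau>" "base u \<le> \<tau>" "0 < \<tau>" using \<nu> by (auto simp: \<tau>_def)
 have A: "0 \<le> ?A" using L by simp
 have n\<tau>: "L * (1 / real n) powr \<theta> \<le> ?A" using L \<nu> \<tau> \<theta> by (intro mult_left_mono powr_mono2) auto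
 have two: "L * (2 * \<tau>) powr \<theta> \<le> 2 * ?A"
 proof -
  have "2 powr \<theta> \<le> 2 powr (1::real)" using \<theta> by (intro powr_mono) auto
  from mult_right_mono[OF this, of "\<tau> powr \<theta>"] have "(2 * \<tau>) powr \<theta> \<le> 2 * \<tau> powr \<theta>" by (simp add: powr_mult)
  from mult_left_mono[OF this, of L] show ?thesis using L by simp
 qed
 have tb: "\<bar>copula_transform Cop \<alpha> u\<bar> \<le> (3 + (3 + 2 * K) * ?d) * ?A"
 proof -
  have "\<bar>copula_transform Cop \<alpha> u\<bar> \<le> (3 + (3 + 2 * K) * ?d) * L * base u powr \<theta>"
   by (rule transform_bound[OF \<theta>(1) _ _ edge u]) (use \<theta> L in auto)
  also have "... \<le> (3 + (3 + 2 * K) * ?d) * L * \<tau> powr \<theta>"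
   using base_nonneg[OF u] \<tau> \<theta> L K by (intro mult_left_mono powr_mono2 mult_nonneg_nonneg) auto
  finally show ?thesis by (simp only: mult.assoc)
 qed
 define \<sigma> where "\<sigma> k = max (min (u $ k) (1 - u $ k)) \<nu>" for k
 define r where "r c k = (if \<sigma> k \<le> \<tau> then 1 else min 1 (c * \<tau> / \<sigma> k))" for c k
 let ?c = "8 * K * ?d"
 have c: "?c \<ge> 8 * K" "?c \<ge> 0" using K d by auto
 have wt: "sqrt n * \<bar>v $ k - u $ k\<bar> * r ?c k \<le> 3 * (1 + ?c) * ?A" for k
 proof (cases "\<sigma> k \<le> \<tau>")
  case True
  hence "sqrt n * \<bar>v $ k - u $ k\<bar> \<le> 3 * L * \<tau> powr \<theta>" by (intro dist) (auto simp: \<sigma>_def)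
  also have "... = 3 * 1 * ?A" by simp
  also have "... \<le> 3 * (1 + ?c) * ?A" using A c by (intro mult_right_mono) auto
  finally show ?thesis using True by (simp add: r_def)
 next
  case False
  have "sqrt n * \<bar>v $ k - u $ k\<bar> \<le> 3 * L * \<sigma> k powr \<theta>" by (intro dist) (auto simp: \<sigma>_def)
  moreover have r0: "0 \<le> r ?c k" using False \<tau> c by (auto simp: r_def)
  ultimately have "sqrt n * \<bar>v $ k - u $ k\<bar> * r ?c k \<le> 3 * L * \<sigma> k powr \<theta> * r ?c k" by (intro mult_right_mono)
  also have "... = 3 * L * (r ?c k * \<sigma> k powr \<theta>)" by (simp only: mult_ac)
  also have "... \<le> 3 * L * ((1 + ?c) * \<tau> powr \<theta>)"
  proof (intro mult_left_mono min_powr_bound)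
   show "r ?c k \<le> ?c * \<tau> / \<sigma> k" using False unfolding r_def by auto
  qed (use False \<tau> c \<theta> L in \<open>auto simp: r_def\<close>)
  finally show ?thesis by (simp add: mult_ac)
 qed
 have mid: "\<sigma> k / 4 \<le> \<xi> $ k * (1 - \<xi> $ k)"
  if k: "\<not> \<sigma> k \<le> \<tau>" and \<xi>: "min (u $ k) (v $ k) \<le> \<xi> $ k" "\<xi> $ k \<le> max (u $ k) (v $ k)" for k and \<xi> :: "real ^ 'd"
 proof -
  have s: "\<sigma> k = min (u $ k) (1 - u $ k)" using k \<tau> by (auto simp: \<sigma>_def)
  have "\<bar>v $ k - u $ k\<bar> \<le> \<sigma> k / 2" by (intro dist) (auto simp: \<sigma>_def)
  hence "\<sigma> k / 2 \<le> \<xi> $ k" "\<sigma> k / 2 \<le> 1 - \<xi> $ k" using \<xi> s by linarith+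
  moreover have "0 \<le> \<xi> $ k" "\<xi> $ k \<le> 1" using \<xi> cube_ge0[OF u, of k] cube_ge0[OF v, of k] cube_le1[OF u, of k] cube_le1[OF v, of k] by linarith+
  ultimately have "\<sigma> k / 2 / 2 \<le> \<xi> $ k * (1 - \<xi> $ k)" by (intro parabola_lower)
  thus ?thesis by simp
 qed
 have quot: "\<kappa> * (2 * \<tau>) / (\<xi> $ k * (1 - \<xi> $ k)) \<le> 8 * \<kappa> * \<tau> / \<sigma> k"
  if "\<sigma> k / 4 \<le> \<xi> $ k * (1 - \<xi> $ k)" "\<not> \<sigma> k \<le> \<tau>" "\<kappa> \<ge> 0" for \<kappa> k and \<xi> :: "real ^ 'd"
 proof -
  have "0 < \<sigma> k / 4" using that(2) \<tau> by simp
  moreover from this have "0 < \<xi> $ k * (1 - \<xi> $ k)" using that(1) by linarith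
  ultimately have "\<kappa> * (2 * \<tau>) / (\<xi> $ k * (1 - \<xi> $ k)) \<le> \<kappa> * (2 * \<tau>) / (\<sigma> k / 4)"
   using that \<tau> by (intro divide_left_mono mult_pos_pos[of "\<xi> $ k * (1 - \<xi> $ k)" "\<sigma> k / 4"]) auto
  thus ?thesis by simp
 qed
 have "\<bar>D\<bar> \<le> (3 + (3 + 2 * K) * ?d) * ?A + 3 * ?A + ?d * (3 * (1 + ?c) * ?A)"
 proof (cases u rule: base_cases)
  case (low j)
  have dj: "\<bar>v $ j - u $ j\<bar> \<le> \<tau> / 2" using low \<tau> by (intro dist) auto
  have inc: "\<bar>sqrt n * (Cop v - Cop u) - (\<Sum>k\<in>UNIV. sqrt n * (v $ k - u $ k) * 0)\<bar> \<le> ?d * (3 * (1 + ?c) * ?A)"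
  proof (rule increment[where r="r ?c"])
   fix k and \<xi> :: "real ^ 'd"
   assume \<xi>: "\<xi> \<in> V k" and bt: "\<And>l. min (u $ l) (v $ l) \<le> \<xi> $ l \<and> \<xi> $ l \<le> max (u $ l) (v $ l)"
   note cb = C_dot_bounds[OF \<xi>]
   show "\<bar>C_dot Cop k \<xi> - 0\<bar> \<le> r ?c k"
   proof (cases "\<sigma> k \<le> \<tau>")
    case False
    have kj: "j \<noteq> k" using False low \<tau> by (auto simp: \<sigma>_def)
    have xj: "\<xi> $ j \<le> 2 * \<tau>" using bt[of j] dj low \<tau> by linarith
    have q: "\<sigma> k / 4 \<le> \<xi> $ k * (1 - \<xi> $ k)" using mid[OF False] bt by blast
    have q0: "0 < \<xi> $ k * (1 - \<xi> $ k)" using \<xi> by (simp add: V_iff)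
    have "C_dot Cop k \<xi> \<le> K * \<xi> $ j / (\<xi> $ k * (1 - \<xi> $ k))" by (rule C_dot_upper[OF \<xi> kj])
    also have "... \<le> K * (2 * \<tau>) / (\<xi> $ k * (1 - \<xi> $ k))" using xj q0 K by (intro divide_right_mono mult_left_mono) auto
    also have "... \<le> 8 * K * \<tau> / \<sigma> k" using K by (intro quot q False) auto
    also have "... \<le> ?c * \<tau> / \<sigma> k" using False \<tau> by (intro divide_right_mono mult_right_mono c) auto
    finally show ?thesis using cb False by (simp add: r_def)
   qed (use cb in \<open>simp add: r_def\<close>)
  qed (rule wt)
  have "\<bar>\<alpha> v\<bar> \<le> L * v $ j powr \<theta>" by (rule edge_boundD(1)[OF edge v])
  also have "... \<le> L * (2 * \<tau>) powr \<theta>"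
  proof (intro mult_left_mono powr_mono2)
   show "v $ j \<le> 2 * \<tau>" using dj low \<tau> by linarith
  qed (use \<theta> L cube_ge0[OF v, of j] in auto)
  finally show ?thesis using two inc tb A by simp
 next
  case (high j)
  have dk: "\<bar>v $ k - u $ k\<bar> \<le> \<tau> / 2" if "k \<noteq> j" for k using high[OF that] \<tau> by (intro dist) auto
  have inc: "\<bar>sqrt n * (Cop v - Cop u) - (\<Sum>k\<in>UNIV. sqrt n * (v $ k - u $ k) * (if k = j then 1 else 0))\<bar> \<le> ?d * (3 * (1 + ?c) * ?A)"
  proof (rule increment[where r="r ?c"])
   fix k and \<xi> :: "real ^ 'd"
   assume \<xi>: "\<xi> \<in> V k" and bt: "\<And>l. min (u $ l) (v $ l) \<le> \<xi> $ l \<and> \<xi> $ l \<le> max (u $ l) (v $ l)"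
   note cb = C_dot_bounds[OF \<xi>]
   show "\<bar>C_dot Cop k \<xi> - (if k = j then 1 else 0)\<bar> \<le> r ?c k"
   proof (cases "\<sigma> k \<le> \<tau>")
    case False
    have kj: "k = j"
    proof (rule ccontr)
     assume "k \<noteq> j"
     from high[OF this] have "1 - u $ k \<le> \<tau>" using \<tau> by linarith
     thus False using False \<tau> by (auto simp: \<sigma>_def)
    qed
    have q: "\<sigma> k / 4 \<le> \<xi> $ k * (1 - \<xi> $ k)" using mid[OF False] bt by blast
    have "1 - \<xi> $ l \<le> 2 * \<tau>" if "l \<noteq> j" for l using bt[of l] dk[OF that] high[OF that] \<tau> by linarith
    hence "1 - C_dot Cop k \<xi> \<le> K * ?d * (2 * \<tau>) / (\<xi> $ k * (1 - \<xi> $ k))"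
     using \<tau> kj by (intro C_dot_lower[OF \<xi>]) auto
    also have "... \<le> 8 * (K * ?d) * \<tau> / \<sigma> k" using K by (intro quot q False) auto
    finally have "1 - C_dot Cop k \<xi> \<le> ?c * \<tau> / \<sigma> k" by (simp only: mult.assoc)
    thus ?thesis using cb False kj by (simp add: r_def)
   qed (use cb in \<open>auto simp: r_def\<close>)
  qed (rule wt)
  have "(\<Sum>k\<in>UNIV. sqrt n * (v $ k - u $ k) * (if k = j then 1 else 0)) = (\<Sum>k\<in>UNIV. if k = j then sqrt n * (v $ j - u $ j) else 0)"
   by (intro sum.cong) auto
  hence inc': "\<bar>sqrt n * (Cop v - Cop u) - sqrt n * (v $ j - u $ j)\<bar> \<le> ?d * (3 * (1 + ?c) * ?A)" using inc by simp
  have "\<bar>\<alpha> v - \<alpha> (only_coord j v)\<bar> \<le> L * (2 * \<tau>) powr \<theta>"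
  proof (rule edge_boundD(2)[OF edge v])
   show "1 - v $ k \<le> 2 * \<tau>" if "k \<noteq> j" for k using dk[OF that] high[OF that] \<tau> by linarith
  qed (use \<tau> in simp)
  \<comment> \<open>Near an upper edge the slope 1 leaves the displacement of coordinate j, which
    cancels against \<alpha> at the margin of v up to the rank error.\<close>
  moreover have "\<bar>sqrt n * (v $ j - u $ j) + \<alpha> (only_coord j v)\<bar> \<le> ?A"
   unfolding margin using rank[of j] n\<tau> by (simp add: abs_mult)
  ultimately show ?thesis using two inc' tb A by linarith
 qed
 also have "... = (6 + (3 + 2 * K) * ?d + ?d * (3 * (1 + ?c))) * ?A" by (simp add: algebra_simps)
 also have "... \<le> (6 + (3 + 2 * K) * ?d + ?d * (3 * (1 + ?c)) + 3) * ?A" using A by (intro mult_right_mono) auto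
 finally show ?thesis by (simp only: \<tau>_def mult.assoc)
qed

text \<open>Away from the zeros of the weight a single coordinate may still be close to 1, where its
  derivative is not controlled; there sqrt n times the displacement is of order b^\<theta>. For the
  other coordinates the derivative is Lipschitz with constant 4 K / b, which gives a second-order
  error of order 1 / (b sqrt n).\<close>

lemma interior_estimate:
 assumes b: "\<nu> \<le> b" "b \<le> base u" "6 * L \<le> b * sqrt n" and u1: "\<And>k. u $ k < 1"
 shows "\<bar>D\<bar> \<le> (1 + 2 * real CARD('d)) * (L * (3 * L * real CARD('d) / sqrt n) powr \<theta>) +
  real CARD('d) * (3 * L * b powr \<theta> + 36 * K * L\<^sup>2 * real CARD('d) / (b * sqrt n))"
proof -
 let ?d = "real CARD('d)" and ?x = "sqrt n"
 have d: "?d \<ge> 1" by (simp add: Suc_leI)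
 have b0: "0 < b" using b \<nu> by linarith
 have x: "?x \<ge> 1" using n by simp
 have ub: "b \<le> u $ k" for k using b(2) base_le[of u k] by linarith
 have uV: "u \<in> V k" for k using ub[of k] b0 u1[of k] u by (simp add: V_iff del: atLeastAtMost_iff)
 have dl: "\<bar>v $ k - u $ k\<bar> \<le> 3 * L / ?x" for k
 proof -
  have "?x * \<bar>v $ k - u $ k\<bar> \<le> 3 * L * 1 powr \<theta>"
   using \<nu> cube_le1[OF u, of k] by (intro dist) auto
  thus ?thesis using x by (simp add: pos_le_divide_eq mult.commute)
 qed
 let ?h = "3 * L * ?d / ?x"
 have l1: "(\<Sum>k\<in>UNIV. \<bar>v $ k - u $ k\<bar>) \<le> ?h"
 proof -
  have "(\<Sum>k\<in>UNIV. \<bar>v $ k - u $ k\<bar>) \<le> (\<Sum>k\<in>(UNIV :: 'd set). 3 * L / ?x)" by (intro sum_mono dl)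
  thus ?thesis by (simp add: mult.commute)
 qed
 have nh: "1 / real n \<le> ?h"
 proof -
  have "1 / real n = 1 / ?x * (1 / ?x)" by simp
  also have "... \<le> 1 / ?x * 1" using x by (intro mult_left_mono) auto
  also have "... \<le> ?h" using L d x mult_mono[of 1 "3 * L" 1 ?d] by (simp add: divide_right_mono)
  finally show ?thesis .
 qed
 have mh: "\<bar>\<alpha> w - \<alpha> w'\<bar> \<le> L * ?h powr \<theta>"
  if "w \<in> unit_cube" "w' \<in> unit_cube" "\<And>k. \<bar>w $ k - w' $ k\<bar> \<le> \<bar>v $ k - u $ k\<bar>" for w w'
 proof -
  have "norm (w - w') \<le> (\<Sum>k\<in>UNIV. \<bar>(w - w') $ k\<bar>)" by (rule norm_le_l1_cart)
  also have "... \<le> (\<Sum>k\<in>UNIV. \<bar>v $ k - u $ k\<bar>)" using that(3) by (intro sum_mono) simp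
  also note l1
  finally have "max (norm (w - w')) (1 / real n) \<le> ?h" using nh by simp
  moreover have "0 \<le> max (norm (w - w')) (1 / real n)" by (rule max.coboundedI1) simp
  ultimately have "L * max (norm (w - w')) (1 / real n) powr \<theta> \<le> L * ?h powr \<theta>"
   using L \<theta> by (intro mult_left_mono powr_mono2) auto
  moreover have "\<bar>\<alpha> w - \<alpha> w'\<bar> \<le> L * max (norm (w - w')) (1 / real n) powr \<theta>"
   using modulus that(1,2) unfolding modulus_def by (simp del: atLeastAtMost_iff)
  ultimately show ?thesis by linarith
 qed
 have rh: "L * (1 / real n) powr \<theta> \<le> L * ?h powr \<theta>" using nh L \<theta> by (intro mult_left_mono powr_mono2) auto
 let ?B = "3 * L * b powr \<theta> + 36 * K * L\<^sup>2 * ?d / (b * ?x)"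
 define r where "r k = (if 1 - u $ k \<le> b then 1 else K / (b / 4) * ?h)" for k
 have inc: "\<bar>?x * (Cop v - Cop u) - (\<Sum>k\<in>UNIV. ?x * (v $ k - u $ k) * C_dot Cop k u)\<bar> \<le> ?d * ?B"
 proof (rule increment[where r=r])
  fix k and \<xi> :: "real ^ 'd"
  assume \<xi>: "\<xi> \<in> V k" and bt: "\<And>l. min (u $ l) (v $ l) \<le> \<xi> $ l \<and> \<xi> $ l \<le> max (u $ l) (v $ l)"
  show "\<bar>C_dot Cop k \<xi> - C_dot Cop k u\<bar> \<le> r k"
  proof (cases "1 - u $ k \<le> b")
   case True
   thus ?thesis using C_dot_bounds[OF \<xi>] C_dot_bounds[OF uV, of k] by (simp add: r_def)
  next
   case False
   have xc: "\<xi> \<in> unit_cube" using \<xi> by (simp add: V_iff)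
   have bx: "3 * L / ?x \<le> b / 2" using b(3) x by (simp add: field_simps)
   have "b / 2 \<le> \<xi> $ k" "b / 2 \<le> 1 - \<xi> $ k" using bt[of k] dl[of k] ub[of k] False bx b0 by linarith+
   hence "b / 2 / 2 \<le> \<xi> $ k * (1 - \<xi> $ k)" by (intro parabola_lower cube_ge0[OF xc] cube_le1[OF xc])
   moreover have "b / 2 \<le> u $ k * (1 - u $ k)" using ub[of k] False by (intro parabola_lower cube_ge0[OF u] cube_le1[OF u]) auto
   ultimately have "\<bar>C_dot Cop k \<xi> - C_dot Cop k u\<bar> \<le> K / (b / 4) * (\<Sum>l\<in>UNIV. \<bar>\<xi> $ l - u $ l\<bar>)"
    using b0 by (intro C_dot_lipschitz xc u) auto
   also have "... \<le> K / (b / 4) * (\<Sum>l\<in>UNIV. \<bar>v $ l - u $ l\<bar>)"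
   proof (intro mult_left_mono sum_mono)
    fix l show "\<bar>\<xi> $ l - u $ l\<bar> \<le> \<bar>v $ l - u $ l\<bar>" using bt[of l] by linarith
   qed (use K b0 in simp)
   also have "... \<le> K / (b / 4) * ?h" using l1 K b0 by (intro mult_left_mono) auto
   finally show ?thesis using False by (simp add: r_def)
  qed
 next
  fix k
  have p: "0 \<le> 3 * L * b powr \<theta>" "0 \<le> 36 * K * L\<^sup>2 * ?d / (b * ?x)" using L K b0 x by auto
  show "?x * \<bar>v $ k - u $ k\<bar> * r k \<le> ?B"
  proof (cases "1 - u $ k \<le> b")
   case True
   have "?x * \<bar>v $ k - u $ k\<bar> \<le> 3 * L * b powr \<theta>" by (rule dist) (use True b in auto)
   thus ?thesis using True p by (simp add: r_def)
  next
   case False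
   have "?x * \<bar>v $ k - u $ k\<bar> \<le> 3 * L" using dl[of k] x by (simp add: pos_le_divide_eq mult.commute)
   moreover have "r k = K / (b / 4) * ?h" using False by (simp add: r_def)
   moreover have "0 \<le> K / (b / 4) * ?h" using K b0 L by simp
   ultimately have "?x * \<bar>v $ k - u $ k\<bar> * r k \<le> (3 * L) * (K / (b / 4) * ?h)" by (simp only: mult_right_mono)
   also have "... = 36 * K * L\<^sup>2 * ?d / (b * ?x)" by (simp add: power2_eq_square)
   finally show ?thesis using p by linarith
  qed
 qed
 have av: "\<bar>\<alpha> v - \<alpha> u\<bar> \<le> L * ?h powr \<theta>" by (intro mh u v) auto
 \<comment> \<open>The linear term and the margin term share the derivative as a factor; by
   \<open>margin\<close> what they multiply is the rank error plus an increment of \<alpha> between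
   the margins of u and v.\<close>
 have tk: "\<bar>?x * (v $ k - u $ k) * C_dot Cop k u + C_dot Cop k u * \<alpha> (only_coord k u)\<bar> \<le> 2 * (L * ?h powr \<theta>)" for k
 proof -
  have "?x * (v $ k - u $ k) + \<alpha> (only_coord k u) = ?x * (Gn n s (only_coord k v) - u $ k) + (\<alpha> (only_coord k u) - \<alpha> (only_coord k v))"
   using margin[of k] by simp
  moreover have "\<bar>?x * (Gn n s (only_coord k v) - u $ k)\<bar> \<le> L * ?h powr \<theta>" using rank[of k] rh by (simp add: abs_mult)
  moreover have "\<bar>\<alpha> (only_coord k u) - \<alpha> (only_coord k v)\<bar> \<le> L * ?h powr \<theta>"
   by (intro mh only_coord_cube u v) (auto simp: only_coord_nth)
  ultimately have "\<bar>?x * (v $ k - u $ k) + \<alpha> (only_coord k u)\<bar> \<le> 2 * (L * ?h powr \<theta>)" by linarith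
  hence "C_dot Cop k u * \<bar>?x * (v $ k - u $ k) + \<alpha> (only_coord k u)\<bar> \<le> 1 * (2 * (L * ?h powr \<theta>))"
   using C_dot_bounds[OF uV, of k] by (intro mult_mono) auto
  moreover have "?x * (v $ k - u $ k) * C_dot Cop k u + C_dot Cop k u * \<alpha> (only_coord k u) = C_dot Cop k u * (?x * (v $ k - u $ k) + \<alpha> (only_coord k u))"
   by (simp add: algebra_simps)
  ultimately show ?thesis using C_dot_bounds[OF uV, of k] by (simp add: abs_mult)
 qed
 have "\<bar>\<Sum>k\<in>UNIV. ?x * (v $ k - u $ k) * C_dot Cop k u + C_dot Cop k u * \<alpha> (only_coord k u)\<bar> \<le> (\<Sum>k\<in>(UNIV :: 'd set). 2 * (L * ?h powr \<theta>))"
  by (intro order.trans[OF sum_abs] sum_mono tk)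
 hence "\<bar>(\<Sum>k\<in>UNIV. ?x * (v $ k - u $ k) * C_dot Cop k u) + (\<Sum>k\<in>UNIV. C_dot Cop k u * \<alpha> (only_coord k u))\<bar> \<le> 2 * ?d * (L * ?h powr \<theta>)"
  by (simp add: sum.distrib)
 hence "\<bar>D\<bar> \<le> L * ?h powr \<theta> + 2 * ?d * (L * ?h powr \<theta>) + ?d * ?B"
  using inc av unfolding copula_transform_def by linarith
 also have "L * ?h powr \<theta> + 2 * ?d * (L * ?h powr \<theta>) = (1 + 2 * ?d) * (L * ?h powr \<theta>)" by (simp add: algebra_simps)
 finally show ?thesis .
qed

end

section \<open>Uniform comparison on the shrinking cubes\<close>

lemma outer_prob_le: "B \<in> sets M ==> A \<inter> space M \<subseteq> B ==> outer_prob M A \<le> measure M B"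
 unfolding outer_prob_def by (intro cINF_lower bdd_belowI[where m=0]) auto

lemma outer_prob_nonneg: "0 \<le> outer_prob M A"
 unfolding outer_prob_def by (rule cINF_greatest) auto

context mixing_copula
begin

text \<open>Three zones for \<open>base u\<close>: from c/n to \<nu>, from \<nu> to e0, and above
  e0. The edge estimate covers the first two, with \<nu>^\<theta> compared to the smallest weight
  and m^\<theta> to m^\<omega>; the interior estimate covers the third.\<close>

lemma rank_uniform:
 assumes \<omega>: "0 < \<omega>" "\<omega> < \<theta>" and \<theta>: "\<theta> < 1/2" and \<gamma>: "0 < \<gamma>" "\<gamma> < 1" "\<omega> < \<gamma> * \<theta>" "\<gamma> * (1 - \<theta>) < 1/2"
  and c: "0 < c" and \<epsilon>: "\<epsilon> > 0" and L: "L \<ge> 1"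
 shows "\<forall>\<^sub>F n in sequentially. \<forall>s u. regular s --> modulus n L \<theta> s --> edge_bound (\<alpha>n n s) L \<theta> --> u \<in> {vec (c / real n)..vec (1 - c / real n)} -->
  \<bar>emp_copula_process M X n s u / g \<omega> u - C_bar M X n s u / g \<omega> u\<bar> \<le> \<epsilon>"
proof -
 let ?d = "real CARD('d)"
 have d: "?d \<ge> 1" by (simp add: Suc_leI)
 define Q where "Q = (6 + (3 + 2 * K) * ?d + ?d * (3 * (1 + 8 * K * ?d)) + 3) * L"
 have Q: "Q > 0" unfolding Q_def using K L by (intro mult_pos_pos add_nonneg_pos) auto
 \<comment> \<open>The solution of Q e0^\<theta> = \<epsilon> e0^\<omega>; below it the edge
   estimate is dominated by \<epsilon> times the weight.\<close>
 define e0 where "e0 = (\<epsilon> / Q) powr (1 / (\<theta> - \<omega>))"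
 have e0: "e0 > 0" "Q * e0 powr (\<theta> - \<omega>) = \<epsilon>" using Q \<epsilon> \<omega> by (simp_all add: e0_def powr_powr)
 \<comment> \<open>Chosen after e0, such that the coordinates within b of 1 contribute at most half
   of \<epsilon> e0^\<omega>, a lower bound for \<epsilon> times the weight in the third
   zone.\<close>
 define b where "b = min e0 ((\<epsilon> * e0 powr \<omega> / (6 * ?d * L)) powr (1 / \<theta>))"
 have b: "b > 0" "b \<le> e0" using e0 \<epsilon> L d by (auto simp: b_def)
 have b3: "?d * (3 * L * b powr \<theta>) \<le> \<epsilon> * e0 powr \<omega> / 2"
 proof -
  have "b powr \<theta> \<le> ((\<epsilon> * e0 powr \<omega> / (6 * ?d * L)) powr (1 / \<theta>)) powr \<theta>"
   using b \<omega> by (intro powr_mono2) (auto simp: b_def)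
  also have "... = \<epsilon> * e0 powr \<omega> / (6 * ?d * L)" using \<omega> \<epsilon> e0 d L by (simp add: powr_powr)
  finally have "?d * (3 * L) * b powr \<theta> \<le> ?d * (3 * L) * (\<epsilon> * e0 powr \<omega> / (6 * ?d * L))"
   using d L by (intro mult_left_mono) auto
  also have "... = \<epsilon> * e0 powr \<omega> / 2" using d L by (simp add: field_simps)
  finally show ?thesis by (simp add: mult.assoc)
 qed
 have lim: "(\<lambda>n. real n powr - p) \<longlonglongrightarrow> 0" if "p > 0" for p
  using that by (intro tendsto_neg_powr filterlim_real_sequentially) auto
 have ev: "\<forall>\<^sub>F n in sequentially. f n < x" if "f \<longlonglongrightarrow> 0" "x > 0" for f and x :: real
  using order_tendstoD(2)[OF that] .
 have sq: "(\<lambda>n. 1 / sqrt n) \<longlonglongrightarrow> 0"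
  by (rule tendsto_divide_0[OF tendsto_const filterlim_at_top_imp_at_infinity[OF filterlim_compose[OF sqrt_at_top filterlim_real_sequentially]]])
 have E1: "\<forall>\<^sub>F n in sequentially. n \<ge> (1::nat)" by (rule eventually_ge_at_top)
 \<comment> \<open>E2 will be the hypothesis \<open>big\<close> of \<open>ranked\<close>, E3
   compares \<nu>^\<theta> with the smallest weight (c/n)^\<omega>, and E4 to E6 serve the interior
   estimate.\<close>
 have E2: "\<forall>\<^sub>F n in sequentially. real n powr - (1/2 - \<gamma> * (1 - \<theta>)) < 1 / (6 * L)"
  by (intro ev lim) (use \<gamma> L in auto)
 have E3: "\<forall>\<^sub>F n in sequentially. real n powr - (\<gamma> * \<theta> - \<omega>) < \<epsilon> * c powr \<omega> / Q"
  by (intro ev lim) (use \<gamma> \<epsilon> c Q in auto)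
 have E4: "\<forall>\<^sub>F n in sequentially. real n powr - \<gamma> < b" by (intro ev lim) (use \<gamma> b in auto)
 have E5: "\<forall>\<^sub>F n in sequentially. 1 / sqrt n < b / (6 * L)" by (intro ev sq) (use b L in auto)
 let ?f = "\<lambda>n. (1 + 2 * ?d) * (L * (3 * L * ?d / sqrt n) powr \<theta>) + ?d * (36 * K * L\<^sup>2 * ?d / (b * sqrt n))"
 have E6: "\<forall>\<^sub>F n in sequentially. ?f n < \<epsilon> * e0 powr \<omega> / 2"
 proof (rule ev)
  have "(\<lambda>n. (1 + 2 * ?d) * (L * (3 * L * ?d * (1 / sqrt n)) powr \<theta>) + ?d * (36 * K * L\<^sup>2 * ?d / b * (1 / sqrt n))) \<longlonglongrightarrow>
   (1 + 2 * ?d) * (L * (3 * L * ?d * 0) powr \<theta>) + ?d * (36 * K * L\<^sup>2 * ?d / b * 0)"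
   by (intro tendsto_intros sq) (use \<omega> L d in auto)
  thus "?f \<longlonglongrightarrow> 0" using \<omega> by simp
 qed (use \<epsilon> e0 in auto)
 show ?thesis
  using E1 E2 E3 E4 E5 E6
 proof eventually_elim
  case (elim n)
  note n = elim(1)
  show ?case
  proof (intro allI impI)
   fix s and u :: "real ^ 'd"
   assume reg: "regular s" and mod: "modulus n L \<theta> s" and edge: "edge_bound (\<alpha>n n s) L \<theta>"
    and ubox: "u \<in> {vec (c / real n)..vec (1 - c / real n)}"
   have cn: "0 < c / real n" using c n by simp
   have ub: "c / real n \<le> u $ j" "u $ j \<le> 1 - c / real n" for j using ubox by (auto simp: less_eq_vec_def)
   have u0: "0 \<le> u $ j" "u $ j < 1" for j using ub[of j] cn by linarith+
   have uc: "u \<in> unit_cube" by (rule cubeI) (use u0 in \<open>auto intro: less_imp_le\<close>)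
   have \<theta>0: "0 < \<theta>" using \<omega> by simp
   obtain v where v: "v \<in> unit_cube" "C_hat X n s u = Gn n s v"
    and rk: "\<And>k. sqrt n * \<bar>Gn n s (only_coord k v) - u $ k\<bar> \<le> L * (1 / real n) powr \<theta>"
    using rank_vector[OF n reg mod L \<theta>0 \<theta> uc] by blast
   define \<nu> where "\<nu> = real n powr - \<gamma>"
   have \<nu>: "0 < \<nu>" "\<nu> \<le> 1" "1 / real n \<le> \<nu>"
   proof -
    show "0 < \<nu>" using n by (simp add: \<nu>_def)
    have "real n powr - \<gamma> \<le> real n powr 0" using n \<gamma> by (intro powr_mono) auto
    thus "\<nu> \<le> 1" using n by (simp add: \<nu>_def)
    have "real n powr - 1 \<le> real n powr - \<gamma>" using n \<gamma> by (intro powr_mono) auto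
    thus "1 / real n \<le> \<nu>" using n by (simp add: \<nu>_def powr_minus_divide)
   qed
   have big: "6 * L \<le> sqrt n * \<nu> powr (1 - \<theta>)"
   proof -
    have e: "sqrt n * \<nu> powr (1 - \<theta>) = 1 / (real n powr - (1/2 - \<gamma> * (1 - \<theta>)))"
     using n by (simp add: \<nu>_def powr_powr powr_half_sqrt[symmetric] powr_add[symmetric] powr_minus_divide[symmetric] powr_minus[symmetric] field_simps del: powr_half_sqrt_powr)
    have "1 / (1 / (6 * L)) \<le> 1 / (real n powr - (1/2 - \<gamma> * (1 - \<theta>)))"
     using elim(2) n L by (intro divide_left_mono) auto
    thus ?thesis unfolding e by simp
   qed
   interpret R: ranked M X a K n s L \<theta> \<nu> u v
    by unfold_locales (use n L \<theta>0 \<theta> mod edge uc v(1) rk \<nu> big in auto)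
   let ?m = "base u"
   have m: "c / real n \<le> ?m" by (rule base_ge) (use ub in \<open>auto simp: algebra_simps\<close>)
   hence m0: "?m > 0" using cn by linarith
   have emp: "emp_copula_process M X n s u = R.\<alpha> v + sqrt n * (Cop v - Cop u)"
    by (simp add: emp_copula_process_def alpha_n_def v(2) algebra_simps)
   have Db: "\<bar>R.D\<bar> \<le> \<epsilon> * ?m powr \<omega>"
   proof (cases "?m < e0")
    case True
    have D: "\<bar>R.D\<bar> \<le> Q * max ?m \<nu> powr \<theta>" unfolding Q_def by (rule R.edge_estimate)
    show ?thesis
    proof (cases "\<nu> \<le> ?m")
     case le: True
     have "?m powr \<theta> = ?m powr (\<theta> - \<omega>) * ?m powr \<omega>" by (simp add: powr_add[symmetric])
     also have "... \<le> e0 powr (\<theta> - \<omega>) * ?m powr \<omega>" using True m0 \<omega> by (intro mult_right_mono powr_mono2) auto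
     finally have "Q * ?m powr \<theta> \<le> Q * (e0 powr (\<theta> - \<omega>) * ?m powr \<omega>)" using Q by (intro mult_left_mono) auto
     also have "... = \<epsilon> * ?m powr \<omega>" using e0(2) by (simp only: mult.assoc[symmetric])
     finally show ?thesis using D le by (simp add: max_def)
    next
     case False
     have "\<nu> powr \<theta> = real n powr - (\<gamma> * \<theta> - \<omega>) * real n powr - \<omega>" by (simp add: \<nu>_def powr_powr powr_add[symmetric])
     also have "... \<le> \<epsilon> * c powr \<omega> / Q * real n powr - \<omega>" using elim(3) by (intro mult_right_mono) auto
     finally have "Q * \<nu> powr \<theta> \<le> Q * (\<epsilon> * c powr \<omega> / Q * real n powr - \<omega>)" using Q by (intro mult_left_mono) auto
     also have "... = \<epsilon> * (c / real n) powr \<omega>" using Q c n by (simp add: powr_divide powr_minus_divide)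
     also have "... \<le> \<epsilon> * ?m powr \<omega>" using m cn \<omega> \<epsilon> by (intro mult_left_mono powr_mono2) auto
     finally show ?thesis using D False by (simp add: max_def split: if_splits)
    qed
   next
    case False
    have 6: "6 * L \<le> b * sqrt n" using elim(5) n L b by (simp add: field_simps)
    have "\<bar>R.D\<bar> \<le> (1 + 2 * ?d) * (L * (3 * L * ?d / sqrt n) powr \<theta>) + ?d * (3 * L * b powr \<theta> + 36 * K * L\<^sup>2 * ?d / (b * sqrt n))"
     by (rule R.interior_estimate) (use elim(4) False b 6 u0 in \<open>auto simp: \<nu>_def\<close>)
    also have "... = ?f n + ?d * (3 * L * b powr \<theta>)" by (simp add: distrib_left)
    also have "... \<le> \<epsilon> * e0 powr \<omega> / 2 + \<epsilon> * e0 powr \<omega> / 2" by (intro add_mono b3 less_imp_le[OF elim(6)])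
    also have "... = \<epsilon> * e0 powr \<omega>" by (rule field_sum_of_halves)
    also have "... \<le> \<epsilon> * ?m powr \<omega>" using False e0 \<omega> \<epsilon> by (intro mult_left_mono powr_mono2) auto
    finally show ?thesis .
   qed
   have "emp_copula_process M X n s u / g \<omega> u - C_bar M X n s u / g \<omega> u = R.D / ?m powr \<omega>"
    by (simp only: emp C_bar_def g_base diff_divide_distrib)
   hence "\<bar>emp_copula_process M X n s u / g \<omega> u - C_bar M X n s u / g \<omega> u\<bar> = \<bar>R.D\<bar> / ?m powr \<omega>" by (simp only: abs_divide) simp
   also have "... \<le> \<epsilon>" using Db m0 by (simp only: pos_divide_le_eq powr_gt_zero)
   finally show "\<bar>emp_copula_process M X n s u / g \<omega> u - C_bar M X n s u / g \<omega> u\<bar> \<le> \<epsilon>" .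
  qed
 qed
qed

lemma emp_copula_small_o:
 assumes c: "0 < c" and \<omega>: "0 < \<omega>" "\<omega> < 1/2"
 shows "small_o_P_1 M (\<lambda>n s. SUP u\<in>{vec (c / real n)..vec (1 - c / real n)}.
     ereal \<bar>emp_copula_process M X n s u / g \<omega> u - C_bar M X n s u / g \<omega> u\<bar>)"
proof -
 \<comment> \<open>The lower limit 2 \<omega> / (1 + 2 \<omega>) is where 2 \<omega> (1 - \<theta>)
   = \<theta>; above it an exponent \<gamma> exists. The midpoint with 1/2 is taken.\<close>
 define \<theta> where "\<theta> = (2 * \<omega> / (1 + 2 * \<omega>) + 1/2) / 2"
 have \<theta>: "2 * \<omega> / (1 + 2 * \<omega>) < \<theta>" "\<theta> < 1/2"
 proof -
  have "2 * \<omega> / (1 + 2 * \<omega>) < 1/2" using \<omega> by (simp add: field_simps)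
  thus "2 * \<omega> / (1 + 2 * \<omega>) < \<theta>" "\<theta> < 1/2" unfolding \<theta>_def by auto
 qed
 have "2 * \<omega> < \<theta> * (1 + 2 * \<omega>)" using \<theta>(1) \<omega> by (simp add: field_simps)
 moreover have "\<omega> \<le> 2 * \<omega> / (1 + 2 * \<omega>)"
 proof -
  have "\<omega> * (1 + 2 * \<omega>) \<le> \<omega> * 2" using \<omega> by (intro mult_left_mono) auto
  thus ?thesis using \<omega> by (simp add: le_divide_eq)
 qed
 ultimately have \<omega>\<theta>: "\<omega> < \<theta>" "2 * \<omega> * (1 - \<theta>) < \<theta>" using \<theta>(1) by (auto simp: algebra_simps)
 \<comment> \<open>The midpoint of the admissible interval between \<omega> / \<theta> and 1 / (2 (1
   - \<theta>)).\<close>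
 define \<gamma> where "\<gamma> = (\<omega> / \<theta> + 1 / (2 * (1 - \<theta>))) / 2"
 have lt: "\<omega> / \<theta> < 1 / (2 * (1 - \<theta>))" using \<omega>\<theta> \<omega> \<theta> by (simp add: divide_simps) (simp add: algebra_simps)
 have \<gamma>: "\<omega> / \<theta> < \<gamma>" "\<gamma> < 1 / (2 * (1 - \<theta>))"
 proof -
  have "x < (x + y) / 2 \<and> (x + y) / 2 < y" if "x < y" for x y :: real using that by simp
  from this[OF lt] show "\<omega> / \<theta> < \<gamma>" "\<gamma> < 1 / (2 * (1 - \<theta>))" by (simp_all only: \<gamma>_def)
 qed
 have "0 < \<omega> / \<theta>" using \<omega> \<omega>\<theta> by simp
 hence \<gamma>0: "0 < \<gamma>" using \<gamma>(1) by linarith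
 have "1 / (2 * (1 - \<theta>)) \<le> 1" using \<theta> by simp
 hence \<gamma>1: "\<gamma> < 1" using \<gamma>(2) by linarith
 have \<gamma>2: "\<omega> < \<gamma> * \<theta>" "\<gamma> * (1 - \<theta>) < 1/2"
  using \<gamma> \<omega> \<omega>\<theta> \<theta>(2) by (simp_all add: pos_divide_less_eq pos_less_divide_eq algebra_simps)
 let ?Z = "\<lambda>n s. SUP u\<in>{vec (c / real n)..vec (1 - c / real n)}. ereal \<bar>emp_copula_process M X n s u / g \<omega> u - C_bar M X n s u / g \<omega> u\<bar>"
 show ?thesis unfolding small_o_P_1_def
 proof (intro allI impI LIMSEQ_I)
  fix \<epsilon> \<eta> :: real assume \<epsilon>: "\<epsilon> > 0" and \<eta>: "\<eta> > 0"
  have \<theta>0: "0 < \<theta>" using \<omega> \<omega>\<theta> by simp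
  obtain L where L: "L \<ge> 1" and E: "\<And>n. n \<ge> 1 ==> \<exists>E\<in>sets M. prob E \<ge> 1 - \<eta> / 2 \<and> (\<forall>s\<in>E. regular s \<and> modulus n L \<theta> s \<and> edge_bound (\<alpha>n n s) L \<theta>)"
   using weighted_modulus[OF \<theta>0 \<theta>(2), of "\<eta> / 2"] \<eta> by auto
  obtain N where N: "\<And>n s u. n \<ge> N ==> regular s ==> modulus n L \<theta> s ==> edge_bound (\<alpha>n n s) L \<theta> ==> u \<in> {vec (c / real n)..vec (1 - c / real n)} ==>
   \<bar>emp_copula_process M X n s u / g \<omega> u - C_bar M X n s u / g \<omega> u\<bar> \<le> \<epsilon>"
   using rank_uniform[OF \<omega>(1) \<omega>\<theta>(1) \<theta>(2) \<gamma>0 \<gamma>1 \<gamma>2 c \<epsilon> L] unfolding eventually_sequentially by blast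
  show "\<exists>n0. \<forall>n\<ge>n0. norm (outer_prob M {s \<in> space M. ereal \<epsilon> < ?Z n s} - 0) < \<eta>"
  proof (intro exI[of _ "max 1 N"] allI impI)
   fix n assume "max 1 N \<le> n"
   hence n: "n \<ge> 1" "n \<ge> N" by auto
   obtain A where A: "A \<in> sets M" "prob A \<ge> 1 - \<eta> / 2" and As: "\<And>s. s \<in> A ==> regular s \<and> modulus n L \<theta> s \<and> edge_bound (\<alpha>n n s) L \<theta>"
    using E[OF n(1)] by blast
   have "?Z n s \<le> ereal \<epsilon>" if "s \<in> A" for s
    by (rule SUP_least) (use N[OF n(2)] As[OF that] in \<open>simp del: atLeastAtMost_iff\<close>)
   hence "{s \<in> space M. ereal \<epsilon> < ?Z n s} \<inter> space M \<subseteq> space M - A" by (force simp: not_le[symmetric])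
   hence "outer_prob M {s \<in> space M. ereal \<epsilon> < ?Z n s} \<le> prob (space M - A)" by (intro outer_prob_le) (use A in auto)
   also have "... \<le> \<eta> / 2" using A by (simp add: prob_compl)
   finally show "norm (outer_prob M {s \<in> space M. ereal \<epsilon> < ?Z n s} - 0) < \<eta>"
    using \<eta> outer_prob_nonneg[of M "{s \<in> space M. ereal \<epsilon> < ?Z n s}"] by simp
  qed
 qed
qed

end

section \<open>The space of bounded functions\<close>

lemma mspace_linf: "f \<in> mspace (linf T) \<longleftrightarrow> f \<in> extensional T \<and> (\<exists>B. \<forall>u\<in>T. \<bar>f u\<bar> \<le> B)"
proof -
 have "f \<in> mspace (linf T) \<longleftrightarrow> f \<in> extensional T \<and> Met_TC.mbounded (f ` T)"
  unfolding linf_def by (simp add: Met_TC.fspace_def)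
 also have "Met_TC.mbounded (f ` T) \<longleftrightarrow> (\<exists>B. \<forall>u\<in>T. \<bar>f u\<bar> \<le> B)"
 proof
  assume "Met_TC.mbounded (f ` T)"
  then obtain x B where "f ` T \<subseteq> Met_TC.mcball x B" unfolding Met_TC.mbounded_def by blast
  hence "dist x (f u) \<le> B" if "u \<in> T" for u using that by auto
  hence "\<bar>f u\<bar> \<le> B + \<bar>x\<bar>" if "u \<in> T" for u
   using abs_triangle_ineq[of "f u - x" x] that by (force simp: dist_real_def abs_minus_commute)
  thus "\<exists>B. \<forall>u\<in>T. \<bar>f u\<bar> \<le> B" by blast
 next
  assume "\<exists>B. \<forall>u\<in>T. \<bar>f u\<bar> \<le> B"
  then obtain B where "\<And>u. u \<in> T ==> \<bar>f u\<bar> \<le> B" by blast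
  hence "f ` T \<subseteq> Met_TC.mcball 0 B" by (auto simp: dist_real_def)
  thus "Met_TC.mbounded (f ` T)" unfolding Met_TC.mbounded_def by blast
 qed
 finally show ?thesis .
qed

lemma mdist_linf_le:
 assumes "f \<in> mspace (linf T)" "h \<in> mspace (linf T)" "T \<noteq> {}"
 shows "mdist (linf T) f h \<le> a \<longleftrightarrow> (\<forall>u\<in>T. \<bar>f u - h u\<bar> \<le> a)"
 using funspace_mdist_le[OF assms[unfolded linf_def], of a] by (simp add: linf_def dist_real_def)

lemma closedin_sets_metric_borel:
 assumes "closedin (mtopology_of E) F"
 shows "F \<in> sets (metric_borel E)"
proof -
 have "openin (mtopology_of E) (mspace E - F)" using assms by (simp add: closedin_def)
 hence "mspace E - F \<in> sets (metric_borel E)" unfolding sets_metric_borel by (auto intro: sigma_sets.Basic)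
 hence "space (metric_borel E) - (mspace E - F) \<in> sets (metric_borel E)" by (rule sets.compl_sets)
 moreover have "F \<subseteq> mspace E" using closedin_subset[OF assms] by simp
 hence "space (metric_borel E) - (mspace E - F) = F" by auto
 ultimately show ?thesis by simp
qed

lemma (in prob_space) ex_large_set:
 assumes A: "\<And>n. A n \<in> sets M" "incseq A" "(\<Union>n. A n) = space M" and \<epsilon>: "\<epsilon> > 0"
 shows "\<exists>n::nat. prob (A n) \<ge> 1 - \<epsilon>"
proof -
 have "(\<lambda>n. prob (A n)) \<longlonglongrightarrow> prob (\<Union>n. A n)" using A by (intro finite_Lim_measure_incseq) auto
 hence "(\<lambda>n. prob (A n)) \<longlonglongrightarrow> 1" using A(3) by (simp add: prob_space)
 from order_tendstoD(1)[OF this, of "1 - \<epsilon>"] \<epsilon> show ?thesis by (auto simp: eventually_sequentially intro: less_imp_le)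
qed

lemma cube_ne: "(unit_cube :: (real ^ 'd) set) \<noteq> {}"
 using cubeI[of "0 :: real ^ 'd"] by fastforce

text \<open>Hoelder balls, compact by Arzela-Ascoli. The normalisation at 1 turns the Hoelder
  condition into a uniform bound.\<close>

definition hball :: "real => real => (real ^ 'd => real) set" where
 "hball L \<theta> = {f \<in> extensional unit_cube. (\<forall>u\<in>unit_cube. \<forall>v\<in>unit_cube. \<bar>f u - f v\<bar> \<le> L * norm (u - v) powr \<theta>) \<and> f 1 = 0}"

lemma hball_bound:
 assumes "f \<in> hball L \<theta>" "u \<in> unit_cube" "L \<ge> 0" "\<theta> > 0"
 shows "\<bar>f (u :: real ^ 'd)\<bar> \<le> L * real CARD('d) powr \<theta>"
proof -
 have o: "(1 :: real ^ 'd) \<in> unit_cube" by (rule cubeI) auto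
 have "\<bar>f u - f 1\<bar> \<le> L * norm (u - 1) powr \<theta>" using assms(1,2) o unfolding hball_def by blast
 also have "norm (u - 1) \<le> real CARD('d) * 1"
 proof (rule cube_norm_diff)
  show "\<bar>u $ k - 1 $ k\<bar> \<le> 1" for k using cube_ge0[OF assms(2), of k] cube_le1[OF assms(2), of k] by simp
 qed
 hence "L * norm (u - 1) powr \<theta> \<le> L * real CARD('d) powr \<theta>" using assms by (intro mult_left_mono powr_mono2) auto
 finally show ?thesis using assms(1) by (simp add: hball_def)
qed

lemma hball_mspace: "L \<ge> 0 ==> \<theta> > 0 ==> hball L \<theta> \<subseteq> mspace (linf unit_cube)"
proof
 fix f :: "real ^ 'd => real" assume *: "0 \<le> L" "0 < \<theta>" and f: "f \<in> hball L \<theta>"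
 have "\<bar>f u\<bar> \<le> L * real CARD('d) powr \<theta>" if "u \<in> unit_cube" for u by (rule hball_bound[OF f that *])
 thus "f \<in> mspace (linf unit_cube)" using f unfolding mspace_linf hball_def by blast
qed

lemma compactin_hball:
 assumes L: "L \<ge> 0" and \<theta>: "\<theta> > 0"
 shows "compactin (mtopology_of (linf unit_cube)) (hball L \<theta> :: (real ^ 'd => real) set)"
proof -
 let ?E = "linf (unit_cube :: (real ^ 'd) set)"
 let ?C = "unit_cube :: (real ^ 'd) set"
 interpret Metric_space "mspace ?E" "mdist ?E" by (rule Metric_space_mspace_mdist)
 have o: "(1 :: real ^ 'd) \<in> ?C" by (rule cubeI) auto
 have "\<exists>l r. l \<in> hball L \<theta> \<and> strict_mono r \<and> limitin mtopology (f \<circ> r) l sequentially"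
  if f: "range f \<subseteq> (hball L \<theta> :: (real ^ 'd => real) set)" for f :: "nat => real ^ 'd => real"
 proof -
  have fh: "f n \<in> hball L \<theta>" for n using f by blast
  have H: "\<bar>f n u - f n v\<bar> \<le> L * norm (u - v) powr \<theta>" if "u \<in> ?C" "v \<in> ?C" for n u v
   using fh[of n] that unfolding hball_def by blast
  have "compact ?C" by (metis compact_cbox interval_cbox)
  then obtain g k where "continuous_on ?C g" and k: "strict_mono (k :: nat => nat)"
   and lim: "\<And>e. 0 < e ==> \<exists>N. \<forall>n x. n \<ge> N \<and> x \<in> ?C --> norm (f (k n) x - g x) < e"
  proof (rule Arzela_Ascoli)
   show "norm (f n u) \<le> L * real CARD('d) powr \<theta>" if "u \<in> ?C" for n u
    using hball_bound[OF fh that L \<theta>] by simp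
   show "\<exists>d. 0 < d \<and> (\<forall>n v. v \<in> ?C \<and> norm (u - v) < d --> norm (f n u - f n v) < e)"
    if u: "u \<in> ?C" and e: "0 < e" for u e
   proof (intro exI[of _ "(e / (L + 1)) powr (1 / \<theta>)"] conjI allI impI; (elim conjE)?)
    show "0 < (e / (L + 1)) powr (1 / \<theta>)" using e L by simp
    fix n v assume v: "v \<in> ?C" "norm (u - v) < (e / (L + 1)) powr (1 / \<theta>)"
    have "norm (u - v) powr \<theta> \<le> ((e / (L + 1)) powr (1 / \<theta>)) powr \<theta>" using v \<theta> by (intro powr_mono2) auto
    also have "... = e / (L + 1)" using e L \<theta> by (simp add: powr_powr)
    finally have "L * norm (u - v) powr \<theta> \<le> L * (e / (L + 1))" using L by (intro mult_left_mono)
    also have "... < e" using e L by (simp add: field_simps)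
    finally show "norm (f n u - f n v) < e" using H[OF u v(1), of n] by simp
   qed
  qed blast
  have conv: "(\<lambda>n. f (k n) u) \<longlonglongrightarrow> g u" if "u \<in> ?C" for u
   using lim that unfolding LIMSEQ_iff by blast
  \<comment> \<open>Elements of \<open>linf\<close> are extensional, so the limit function is cut
    down to the cube.\<close>
  define l where "l = restrict g ?C"
  have lh: "l \<in> hball L \<theta>"
  proof -
   have "\<bar>g u - g v\<bar> \<le> L * norm (u - v) powr \<theta>" if uv: "u \<in> ?C" "v \<in> ?C" for u v
   proof (rule LIMSEQ_le_const2)
    show "(\<lambda>n. \<bar>f (k n) u - f (k n) v\<bar>) \<longlonglongrightarrow> \<bar>g u - g v\<bar>" by (intro tendsto_intros conv uv)
    show "\<exists>N. \<forall>n\<ge>N. \<bar>f (k n) u - f (k n) v\<bar> \<le> L * norm (u - v) powr \<theta>" using H[OF uv] by blast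
   qed
   moreover have "g 1 = 0"
    using conv[OF o] fh by (simp add: hball_def LIMSEQ_const_iff)
   ultimately show ?thesis using o by (simp add: hball_def l_def del: atLeastAtMost_iff)
  qed
  have sub: "f (k n) \<in> mspace ?E" "l \<in> mspace ?E" for n using hball_mspace[OF L \<theta>] fh lh by blast+
  have "limitin mtopology (f \<circ> k) l sequentially"
   unfolding limit_metric_sequentially
  proof (intro conjI allI impI sub)
   fix e :: real assume e: "e > 0"
   obtain N where N: "\<And>n x. n \<ge> N ==> x \<in> ?C ==> norm (f (k n) x - g x) < e / 2" using lim[of "e / 2"] e by (auto simp del: atLeastAtMost_iff)
   show "\<exists>N. \<forall>n\<ge>N. (f \<circ> k) n \<in> mspace ?E \<and> mdist ?E ((f \<circ> k) n) l < e"
   proof (intro exI[of _ N] allI impI conjI)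
    fix n assume n: "n \<ge> N"
    show "(f \<circ> k) n \<in> mspace ?E" using sub by simp
    have "mdist ?E (f (k n)) l \<le> e / 2"
     using N[OF n] by (subst mdist_linf_le[OF sub cube_ne]) (auto simp: l_def less_imp_le simp del: atLeastAtMost_iff)
    thus "mdist ?E ((f \<circ> k) n) l < e" using e by simp
   qed
  qed
  thus ?thesis using lh k by blast
 qed
 thus ?thesis unfolding mtopology_of_def compactin_sequentially using hball_mspace[OF L \<theta>] by blast
qed

lemma hball_sets: "L \<ge> 0 ==> \<theta> > 0 ==> hball L \<theta> \<in> sets (metric_borel (linf unit_cube))"
 by (intro closedin_sets_metric_borel compactin_imp_closedin compactin_hball)
  (simp add: mtopology_of_def Metric_space.Hausdorff_space_mtopology)

section \<open>The limit process as a random element\<close>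

context geometric_mixing
begin

text \<open>Transports the probability space to the type required for \<open>N\<close>: the projection \<open>w \<mapsto> (\<lambda>n. w (vec n))\<close>
 has a section, so \<open>gauss_space\<close> is the image of a probability measure under it.\<close>

lemma ex_limit_measure:
 shows "\<exists>(N :: (real ^ 'd => real) measure) \<alpha> :: (real ^ 'd => real) => real ^ 'd => real. prob_space N \<and>
  (\<forall>u. (\<lambda>\<omega>. \<alpha> \<omega> u) \<in> borel_measurable N) \<and> (\<forall>\<omega>. \<alpha> \<omega> \<in> extensional unit_cube) \<and>
  (\<forall>\<omega> \<theta>. 0 < \<theta> --> \<theta> < 1/2 --> (\<exists>L\<ge>0. \<forall>u\<in>unit_cube. \<forall>v\<in>unit_cube. \<bar>\<alpha> \<omega> u - \<alpha> \<omega> v\<bar> \<le> L * norm (u - v) powr \<theta>)) \<and>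
  (\<forall>\<omega> u j. u \<in> unit_cube --> u $ j = 0 --> \<alpha> \<omega> u = 0) \<and> (\<forall>\<omega>. \<alpha> \<omega> 1 = 0) \<and>
  (\<forall>I b. finite I --> I \<subseteq> unit_cube -->
   integral\<^sup>L N (\<lambda>\<omega>. iexp (\<Sum>u\<in>I. b u * \<alpha> \<omega> u)) = of_real (exp (- (\<Sum>u\<in>I. \<Sum>v\<in>I. b u * b v * Gamma_C u v) / 2)))"
proof -
 obtain A :: "(nat => real) => real ^ 'd => real" where Am: "\<forall>u. (\<lambda>\<omega>. A \<omega> u) \<in> borel_measurable gauss_space"
  and Ae: "\<forall>\<omega>. A \<omega> \<in> extensional unit_cube"
  and Ah: "\<forall>\<omega> \<theta>. 0 < \<theta> --> \<theta> < 1/2 --> (\<exists>L\<ge>0. \<forall>u\<in>unit_cube. \<forall>v\<in>unit_cube. \<bar>A \<omega> u - A \<omega> v\<bar> \<le> L * norm (u - v) powr \<theta>)"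
  and A0: "\<forall>\<omega> u j. u \<in> unit_cube --> u $ j = 0 --> A \<omega> u = 0" and A1: "\<forall>\<omega>. A \<omega> 1 = 0"
  and Ac: "\<forall>I b. finite I --> I \<subseteq> unit_cube -->
   integral\<^sup>L gauss_space (\<lambda>\<omega>. iexp (\<Sum>u\<in>I. b u * A \<omega> u)) = of_real (exp (- (\<Sum>u\<in>I. \<Sum>v\<in>I. b u * b v * Gamma_C u v) / 2))"
  using ex_limit_process by (elim exE conjE)
 \<comment> \<open>An arbitrary coordinate is read, which on the constant vectors used by r returns
   n.\<close>
 define e :: "(nat => real) => real ^ 'd => real" where "e z = (\<lambda>u. z (nat \<lfloor>u $ undefined\<rfloor>))" for z
 define r :: "(real ^ 'd => real) => nat => real" where "r w = (\<lambda>n. w (vec (real n)))" for w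
 have re: "r (e z) = z" for z by (simp add: r_def e_def)
 have spg: "space gauss_space = UNIV" by (simp add: gauss_space_def space_PiM PiE_UNIV_domain)
 let ?V = "vimage_algebra UNIV r gauss_space"
 define N where "N = distr gauss_space ?V e"
 have em: "e \<in> gauss_space \<rightarrow>\<^sub>M ?V"
  by (rule measurable_vimage_algebra2) (simp_all add: re)
 have rV: "r \<in> ?V \<rightarrow>\<^sub>M gauss_space" by (rule measurable_vimage_algebra1) (simp add: spg)
 have rN: "r \<in> N \<rightarrow>\<^sub>M gauss_space" unfolding N_def by (simp add: rV)
 have pN: "prob_space N" unfolding N_def by (rule prob_space.prob_space_distr[OF prob_space_gauss em])
 have int: "integral\<^sup>L N (\<lambda>w. f (r w)) = integral\<^sup>L gauss_space f" if "f \<in> borel_measurable gauss_space" for f :: "_ => complex"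
  unfolding N_def by (subst integral_distr[OF em measurable_compose[OF rV that]]) (simp add: re)
 have char: "integral\<^sup>L N (\<lambda>w. iexp (\<Sum>u\<in>I. b u * A (r w) u)) = of_real (exp (- (\<Sum>u\<in>I. \<Sum>v\<in>I. b u * b v * Gamma_C u v) / 2))"
  if I: "finite I" "I \<subseteq> unit_cube" for I b
 proof -
  have [measurable]: "(\<lambda>\<omega>. A \<omega> u) \<in> borel_measurable gauss_space" for u using Am by blast
  have m: "(\<lambda>\<omega>. iexp (\<Sum>u\<in>I. b u * A \<omega> u)) \<in> borel_measurable gauss_space" by measurable
  show ?thesis using int[OF m] Ac I by simp
 qed
 show ?thesis
 proof (rule exI[of _ N], rule exI[of _ "\<lambda>w. A (r w)"], intro conjI)
  show "\<forall>u. (\<lambda>w. A (r w) u) \<in> borel_measurable N" using Am measurable_compose[OF rN] by blast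
  show "\<forall>I b. finite I --> I \<subseteq> unit_cube -->
   integral\<^sup>L N (\<lambda>w. iexp (\<Sum>u\<in>I. b u * A (r w) u)) = of_real (exp (- (\<Sum>u\<in>I. \<Sum>v\<in>I. b u * b v * Gamma_C u v) / 2))"
   using char by blast
 qed (use pN Ae Ah A0 A1 in blast)+
qed

end

locale limit_process = geometric_mixing M X a + N: prob_space N
 for M :: "'a measure" and X :: "int => 'a => real ^ 'd" and a and N :: "'b measure" +
 fixes \<alpha> :: "'b => real ^ 'd => real"
 assumes \<alpha>_meas [measurable]: "\<And>u. (\<lambda>\<omega>. \<alpha> \<omega> u) \<in> borel_measurable N" and \<alpha>_ext: "\<And>\<omega>. \<alpha> \<omega> \<in> extensional unit_cube"
  and \<alpha>_hoelder: "\<And>\<omega> \<theta>. 0 < \<theta> ==> \<theta> < 1/2 ==> \<exists>L\<ge>0. \<forall>u\<in>unit_cube. \<forall>v\<in>unit_cube. \<bar>\<alpha> \<omega> u - \<alpha> \<omega> v\<bar> \<le> L * norm (u - v) powr \<theta>"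
  and \<alpha>_zero: "\<And>\<omega> u j. u \<in> unit_cube ==> u $ j = 0 ==> \<alpha> \<omega> u = 0" and \<alpha>_one: "\<And>\<omega>. \<alpha> \<omega> 1 = 0"
  and \<alpha>_char: "\<And>I b. finite I ==> I \<subseteq> unit_cube ==>
   integral\<^sup>L N (\<lambda>\<omega>. iexp (\<Sum>u\<in>I. b u * \<alpha> \<omega> u)) = of_real (exp (- (\<Sum>u\<in>I. \<Sum>v\<in>I. b u * b v * Gamma_C u v) / 2))"
begin

lemma gaussian_comb:
 fixes b :: "real ^ 'd => real"
 assumes I: "finite I" "I \<subseteq> unit_cube"
 defines "v \<equiv> \<Sum>i\<in>I. \<Sum>j\<in>I. b i * b j * Gamma_C i j"
 shows "normal_rv N (\<lambda>\<omega>. \<Sum>u\<in>I. b u * \<alpha> \<omega> u)" "N.expectation (\<lambda>\<omega>. \<Sum>u\<in>I. b u * \<alpha> \<omega> u) = 0"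
  "N.expectation (\<lambda>\<omega>. (\<Sum>u\<in>I. b u * \<alpha> \<omega> u)\<^sup>2) = v" "integrable N (\<lambda>\<omega>. (\<Sum>u\<in>I. b u * \<alpha> \<omega> u)\<^sup>2)"
proof -
 let ?Y = "\<lambda>\<omega>. \<Sum>u\<in>I. b u * \<alpha> \<omega> u"
 have m: "?Y \<in> borel_measurable N" by measurable
 have v0: "v \<ge> 0" unfolding v_def
  by (rule LIMSEQ_le_const[OF quadratic_limit[OF I(1), of b "\<lambda>i. i"]]) (auto intro!: integral_nonneg_AE)
 have ch: "N.expectation (\<lambda>\<omega>. iexp (t * ?Y \<omega>)) = of_real (exp (- (t\<^sup>2 * v / 2)))" for t
 proof -
  have "(\<Sum>i\<in>I. \<Sum>j\<in>I. t * b i * (t * b j) * Gamma_C i j) = t\<^sup>2 * v"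
   unfolding v_def by (simp add: sum_distrib_left power2_eq_square mult_ac)
  thus ?thesis using \<alpha>_char[OF I, of "\<lambda>i. t * b i"] by (simp add: sum_distrib_left mult.assoc)
 qed
 note normal = N.normal_of_char[OF m v0 ch]
 show "normal_rv N ?Y" by (rule normal)
 show "N.expectation ?Y = 0" by (rule normal)
 show "N.expectation (\<lambda>\<omega>. (?Y \<omega>)\<^sup>2) = v" by (rule normal)
 show "integrable N (\<lambda>\<omega>. (?Y \<omega>)\<^sup>2)" by (rule normal)
qed

lemma gaussian_process: "centered_gaussian_process N unit_cube \<alpha>"
 unfolding centered_gaussian_process_def
proof (intro conjI allI impI ballI; (elim conjE)?)
 show "normal_rv N (\<lambda>s. \<Sum>t\<in>I. b t * \<alpha> s t)" if "finite I" "I \<subseteq> unit_cube" for I b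
  by (rule gaussian_comb(1)[OF that])
 show "N.expectation (\<lambda>s. \<alpha> s t) = 0" if "t \<in> unit_cube" for t
  using gaussian_comb(2)[of "{t}" "\<lambda>_. 1"] that by simp
qed

text \<open>Polarisation of the second moments of linear combinations.\<close>

lemma gaussian_product:
 assumes uv: "u \<in> unit_cube" "v \<in> unit_cube"
 shows "N.expectation (\<lambda>s. \<alpha> s u * \<alpha> s v) = Gamma_C u v"
proof -
 have sq: "N.expectation (\<lambda>s. (\<alpha> s t)\<^sup>2) = Gamma_C t t" "integrable N (\<lambda>s. (\<alpha> s t)\<^sup>2)" if "t \<in> unit_cube" for t
  using gaussian_comb(3,4)[of "{t}" "\<lambda>_. 1"] that by simp_all
 show ?thesis
 proof (cases "u = v")
  case True
  thus ?thesis using sq(1)[OF uv(1)] by (simp add: power2_eq_square)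
 next
  case False
  have s: "N.expectation (\<lambda>s. (\<alpha> s u + \<alpha> s v)\<^sup>2) = Gamma_C u u + 2 * Gamma_C u v + Gamma_C v v" "integrable N (\<lambda>s. (\<alpha> s u + \<alpha> s v)\<^sup>2)"
   using gaussian_comb(3,4)[of "{u, v}" "\<lambda>_. 1"] uv False Gamma_C_sym[of v u] by (simp_all del: atLeastAtMost_iff)
  have eq: "(\<lambda>s. \<alpha> s u * \<alpha> s v) = (\<lambda>s. ((\<alpha> s u + \<alpha> s v)\<^sup>2 - (\<alpha> s u)\<^sup>2 - (\<alpha> s v)\<^sup>2) / 2)" by (simp add: fun_eq_iff power2_eq_square algebra_simps)
  show ?thesis unfolding eq using s sq[OF uv(1)] sq[OF uv(2)] by simp
 qed
qed

lemma limit_covariance: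
 assumes uv: "u \<in> unit_cube" "v \<in> unit_cube"
 shows "((\<lambda>i. covariance M (\<lambda>s. of_bool (U M X 0 s \<le> u)) (\<lambda>s. of_bool (U M X i s \<le> v)))
      has_sum covariance N (\<lambda>s. \<alpha> s u) (\<lambda>s. \<alpha> s v)) UNIV"
proof -
 have "N.expectation (\<lambda>s. \<alpha> s t) = 0" if "t \<in> unit_cube" for t
  using gaussian_process that by (simp add: centered_gaussian_process_def)
 hence "covariance N (\<lambda>s. \<alpha> s u) (\<lambda>s. \<alpha> s v) = Gamma_C u v"
  using uv gaussian_product[OF uv] by (simp add: covariance_def del: atLeastAtMost_iff)
 moreover have "covariance M (\<lambda>s. of_bool (U M X 0 s \<le> u)) (\<lambda>s. of_bool (U M X i s \<le> v)) = acov (phi u) (phi v) i" for i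
  unfolding covariance_def acov_def U_eq expectation_ind phi_def ..
 ultimately show ?thesis using acov_has_sum[OF centered_phi centered_phi, of u v] by simp
qed

text \<open>An approximation of the process that depends on finitely many coordinates. Such maps
  into \<open>linf\<close> are measurable, and measurability passes to uniform limits.\<close>

definition restr :: "nat => (real ^ 'd => real) => real ^ 'd => real" where
 "restr k x = (\<lambda>u\<in>unit_cube. x (fl k u))"

lemma grid_bound:
 fixes x :: "real ^ 'd => real" assumes "u \<in> unit_cube"
 shows "\<bar>x (fl k u)\<bar> \<le> (\<Sum>t\<in>grid k. \<bar>x t\<bar>)"
 by (rule member_le_sum[of "fl k u" "grid k" "\<lambda>t. \<bar>x t\<bar>"]) (use fl_grid[OF assms] in auto)

lemma \<alpha>_hball: "0 < \<theta> ==> \<theta> < 1/2 ==> \<exists>L\<ge>0. \<alpha> \<omega> \<in> hball L \<theta>"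
 using \<alpha>_hoelder[of \<theta> \<omega>] \<alpha>_ext[of \<omega>] \<alpha>_one[of \<omega>] unfolding hball_def by blast

lemma \<alpha>_mspace: "\<alpha> \<omega> \<in> mspace (linf unit_cube)"
 using \<alpha>_hball[of "1/4" \<omega>] hball_mspace[of _ "1/4"] by auto

lemma \<alpha>_borel: "\<alpha> \<in> N \<rightarrow>\<^sub>M metric_borel (linf unit_cube)"
proof (rule measurable_metric_borel_limit)
 have rs: "restr k x \<in> mspace (linf unit_cube)" for k x
  unfolding mspace_linf restr_def using grid_bound[of _ x k] by (auto simp del: atLeastAtMost_iff)
 show "(\<lambda>\<omega>. restr k (\<alpha> \<omega>)) \<in> N \<rightarrow>\<^sub>M metric_borel (linf unit_cube)" for k
 proof (rule measurable_metric_borel_coordinates[where T="grid k" and \<xi>=\<alpha> and \<Phi>="restr k"])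
  show "mdist (linf unit_cube) (restr k x) (restr k y) \<le> 1 * \<delta>"
   if "\<And>t. t \<in> grid k ==> \<bar>x t - y t\<bar> \<le> \<delta>" "0 \<le> \<delta>" for x y \<delta>
   using that(1)[OF fl_grid] by (subst mdist_linf_le[OF rs rs cube_ne]) (simp add: restr_def del: atLeastAtMost_iff)
 qed (use rs in auto)
 show "\<alpha> \<omega> \<in> mspace (linf unit_cube)" for \<omega> by (rule \<alpha>_mspace)
 show "(\<lambda>k. mdist (linf unit_cube) (restr k (\<alpha> \<omega>)) (\<alpha> \<omega>)) \<longlonglongrightarrow> 0" for \<omega>
 proof -
  obtain L where L: "L \<ge> 0" "\<And>u v. u \<in> unit_cube ==> v \<in> unit_cube ==> \<bar>\<alpha> \<omega> u - \<alpha> \<omega> v\<bar> \<le> L * norm (u - v) powr (1/4)"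
   using \<alpha>_hoelder[of "1/4" \<omega>] by (auto simp del: atLeastAtMost_iff)
  have "mdist (linf unit_cube) (restr k (\<alpha> \<omega>)) (\<alpha> \<omega>) \<le> L * (real CARD('d) * (1 / 2 ^ k)) powr (1/4)" for k
  proof (subst mdist_linf_le[OF rs \<alpha>_mspace cube_ne], intro ballI)
   fix u :: "real ^ 'd" assume u: "u \<in> unit_cube"
   have "\<bar>\<alpha> \<omega> u - \<alpha> \<omega> (fl k u)\<bar> \<le> L * norm (u - fl k u) powr (1/4)" by (rule L(2)[OF u fl_cube[OF u]])
   also have "... \<le> L * (real CARD('d) * (1 / 2 ^ k)) powr (1/4)" using L(1) fl_norm by (intro mult_left_mono powr_mono2) auto
   finally show "\<bar>restr k (\<alpha> \<omega>) u - \<alpha> \<omega> u\<bar> \<le> L * (real CARD('d) * (1 / 2 ^ k)) powr (1/4)"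
    using u by (simp add: restr_def abs_minus_commute del: atLeastAtMost_iff)
  qed
  thus ?thesis by (intro tendsto_sandwich[OF _ _ tendsto_const dyadic_powr_tendsto[of "1/4" "real CARD('d)" L]]) auto
 qed
qed

lemma ex_hball_prob:
 assumes \<theta>: "0 < \<theta>" "\<theta> < 1/2" and \<epsilon>: "\<epsilon> > 0"
 shows "\<exists>L\<ge>0. {s \<in> space N. \<alpha> s \<in> hball L \<theta>} \<in> sets N \<and> N.prob {s \<in> space N. \<alpha> s \<in> hball L \<theta>} \<ge> 1 - \<epsilon>"
proof -
 define A where "A n = {s \<in> space N. \<alpha> s \<in> hball (real n) \<theta>}" for n
 have As: "A n \<in> sets N" for n
 proof -
  have "\<alpha> -` hball (real n) \<theta> \<inter> space N \<in> sets N" using \<theta> by (intro measurable_sets[OF \<alpha>_borel] hball_sets) auto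
  thus ?thesis by (simp add: A_def vimage_def Int_def conj_commute)
 qed
 have mono: "hball L \<theta> \<subseteq> (hball L' \<theta> :: (real ^ 'd => real) set)" if "L \<le> L'" for L L'
 proof
  fix f :: "real ^ 'd => real" assume f: "f \<in> hball L \<theta>"
  have "L * norm (u - v) powr \<theta> \<le> L' * norm (u - v) powr \<theta>" for u v :: "real ^ 'd" using that by (rule mult_right_mono) simp
  thus "f \<in> hball L' \<theta>" using f unfolding hball_def by (blast intro: order.trans)
 qed
 have "A m \<subseteq> A n" if "m \<le> n" for m n using mono[of "real m" "real n"] that unfolding A_def by auto
 hence "incseq A" by (simp add: incseq_def)
 moreover have "(\<Union>n. A n) = space N"
 proof -
  have "\<exists>n. \<alpha> s \<in> hball (real n) \<theta>" for s
  proof -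
   obtain L where "\<alpha> s \<in> hball L \<theta>" using \<alpha>_hball[OF \<theta>] by blast
   moreover obtain n where "L \<le> real n" using real_arch_simple by blast
   ultimately show ?thesis using mono by blast
  qed
  thus ?thesis by (auto simp: A_def)
 qed
 ultimately obtain n where "N.prob (A n) \<ge> 1 - \<epsilon>" using N.ex_large_set[of A, OF As _ _ \<epsilon>] by blast
 thus ?thesis using As[of n] unfolding A_def by (intro exI[of _ "real n"]) auto
qed

lemma tight: "tight_random_element N (linf unit_cube) \<alpha>"
 unfolding tight_random_element_def
proof (intro conjI allI impI \<alpha>_borel)
 fix \<epsilon> :: real assume "\<epsilon> > 0"
 then obtain L where "L \<ge> 0" "N.prob {s \<in> space N. \<alpha> s \<in> hball L (1/4)} \<ge> 1 - \<epsilon>" using ex_hball_prob[of "1/4" \<epsilon>] by auto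
 thus "\<exists>K. compactin (mtopology_of (linf unit_cube)) K \<and> 1 - \<epsilon> \<le> N.prob {s \<in> space N. \<alpha> s \<in> K}"
  using compactin_hball[of L "1/4"] by (intro exI[of _ "hball L (1/4)"]) auto
qed

end

section \<open>Weak convergence of the weighted process\<close>

locale weak_limit = limit_process M X a N \<alpha> + mixing_copula M X a K
 for M :: "'a measure" and X :: "int => 'a => real ^ 'd" and a and N :: "'b measure" and \<alpha> :: "'b => real ^ 'd => real" and K +
 fixes \<omega> :: real
 assumes \<omega>: "0 < \<omega>" "\<omega> < 1/2"
begin

abbreviation "E \<equiv> linf (unit_cube :: (real ^ 'd) set)"

definition \<theta> :: real where "\<theta> = (\<omega> + 1/2) / 2"

lemma \<theta>: "0 < \<theta>" "\<omega> < \<theta>" "\<theta> < 1/2"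
 using \<omega> by (auto simp: \<theta>_def)

lemma d1: "1 \<le> real CARD('d)"
 by (simp add: Suc_leI)

definition weighted :: "(real ^ 'd => real) => real ^ 'd => real" where
 "weighted x = (\<lambda>u\<in>unit_cube. copula_transform Cop x u / g_tilde \<omega> u)"

text \<open>The derivative is put to 0 on the faces where u_j is 0 or 1. The processes vanish at the
  corresponding margin, so nothing is lost, while \<open>proj\<close> becomes Lipschitz in arbitrary
  grid values.\<close>

definition inner_dot :: "'d => real ^ 'd => real" where
 "inner_dot j u = (if u \<in> V j then C_dot Cop j u else 0)"

definition grid_transform :: "nat => (real ^ 'd => real) => real ^ 'd => real" where
 "grid_transform k x u = x (fl k u) - (\<Sum>j\<in>UNIV. inner_dot j u * x (fl k (only_coord j u)))"

text \<open>A finite-dimensional approximation of \<open>weighted\<close>: it only uses the values on the grid, and the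
 region where the weight is small is cut off.\<close>

definition proj :: "nat => (real ^ 'd => real) => real ^ 'd => real" where
 "proj k x = (\<lambda>u\<in>unit_cube. if 1 / 2 ^ k \<le> base u then grid_transform k x u / base u powr \<omega> else 0)"

lemma inner_dot_bounds: "0 \<le> inner_dot j u" "inner_dot j u \<le> 1"
 using C_dot_bounds[of u j] by (auto simp: inner_dot_def)

lemma linear_bound:
 fixes p h :: real
 assumes "\<bar>p - p'\<bar> \<le> h" "\<And>j. \<bar>e j * q j - e' j * q' j\<bar> \<le> h"
 shows "\<bar>(p - (\<Sum>j\<in>UNIV. e j * q j)) - (p' - (\<Sum>j\<in>(UNIV :: 'd set). e' j * q' j))\<bar> \<le> (1 + real CARD('d)) * h"
proof -
 have "\<bar>\<Sum>j\<in>UNIV. e j * q j - e' j * q' j\<bar> \<le> (\<Sum>j\<in>(UNIV :: 'd set). h)"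
  by (intro order.trans[OF sum_abs] sum_mono assms(2))
 hence "\<bar>(\<Sum>j\<in>UNIV. e j * q j) - (\<Sum>j\<in>UNIV. e' j * q' j)\<bar> \<le> real CARD('d) * h" by (simp add: sum_subtractf)
 thus ?thesis using assms(1) by (simp add: distrib_right)
qed

lemma weight_lower: "1 / 2 ^ k \<le> base u ==> (1 / 2 ^ k) powr \<omega> \<le> base u powr \<omega>"
 using \<omega> by (intro powr_mono2) auto

lemma proj_lipschitz:
 assumes h: "\<And>t. t \<in> grid k ==> \<bar>x t - y t\<bar> \<le> h" "0 \<le> h" and u: "u \<in> unit_cube"
 shows "\<bar>proj k x u - proj k y u\<bar> \<le> (1 + real CARD('d)) / (1 / 2 ^ k) powr \<omega> * h"
proof (cases "1 / 2 ^ k \<le> base u")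
 case True
 have "\<bar>grid_transform k x u - grid_transform k y u\<bar> \<le> (1 + real CARD('d)) * h"
  unfolding grid_transform_def
 proof (rule linear_bound)
  show "\<bar>x (fl k u) - y (fl k u)\<bar> \<le> h" by (intro h fl_grid u)
  fix j
  have "inner_dot j u * \<bar>x (fl k (only_coord j u)) - y (fl k (only_coord j u))\<bar> \<le> 1 * h"
   using inner_dot_bounds[of j u] by (intro mult_mono h(1) fl_grid only_coord_cube u) auto
  thus "\<bar>inner_dot j u * x (fl k (only_coord j u)) - inner_dot j u * y (fl k (only_coord j u))\<bar> \<le> h"
   using inner_dot_bounds[of j u] by (simp add: right_diff_distrib[symmetric] abs_mult)
 qed
 hence "\<bar>grid_transform k x u - grid_transform k y u\<bar> / base u powr \<omega> \<le> (1 + real CARD('d)) * h / (1 / 2 ^ k) powr \<omega>"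
  using weight_lower[OF True] h(2) by (intro frac_le mult_nonneg_nonneg) auto
 thus ?thesis using u True by (simp add: proj_def diff_divide_distrib[symmetric] del: atLeastAtMost_iff)
qed (use u h(2) in \<open>simp add: proj_def del: atLeastAtMost_iff\<close>)

lemma proj_mspace: "proj k x \<in> mspace E"
proof -
 have "proj k (\<lambda>_. 0) u = 0" if "u \<in> unit_cube" for u using that by (simp add: proj_def grid_transform_def del: atLeastAtMost_iff)
 moreover have "\<bar>x t\<bar> \<le> (\<Sum>t\<in>grid k. \<bar>x t\<bar>)" if "t \<in> grid k" for t
  using that by (intro member_le_sum[of t "grid k" "\<lambda>t. \<bar>x t\<bar>"]) auto
 ultimately have "\<bar>proj k x u\<bar> \<le> (1 + real CARD('d)) / (1 / 2 ^ k) powr \<omega> * (\<Sum>t\<in>grid k. \<bar>x t\<bar>)" if "u \<in> unit_cube" for u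
  using proj_lipschitz[of k x "\<lambda>_. 0" "\<Sum>t\<in>grid k. \<bar>x t\<bar>" u] that by (simp add: sum_nonneg del: atLeastAtMost_iff)
 hence "\<exists>B. \<forall>u\<in>unit_cube. \<bar>proj k x u\<bar> \<le> B" by blast
 thus ?thesis unfolding mspace_linf by (simp add: proj_def)
qed

lemma proj_mdist:
 assumes "\<And>t. t \<in> grid k ==> \<bar>x t - y t\<bar> \<le> h" "0 \<le> h"
 shows "mdist E (proj k x) (proj k y) \<le> (1 + real CARD('d)) / (1 / 2 ^ k) powr \<omega> * h"
 by (subst mdist_linf_le[OF proj_mspace proj_mspace cube_ne], intro ballI proj_lipschitz) (use assms in auto)

text \<open>The constant of \<open>transform_bound\<close> with D in place of the dimension;
  \<open>cE\<close> adds the rounding error of \<open>grid_transform\<close>.\<close>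

definition cB :: "real => real" where "cB D = 3 + (3 + 2 * K) * D"
definition cE :: "real => real" where "cE D = cB D + (1 + D) * D powr \<theta>"

lemma cB: "0 \<le> cB (real CARD('d))" using K by (simp add: cB_def)

text \<open>The surplus exponent \<theta> - \<omega> makes the weighted process small near the zeros
  of the weight. On the zero set itself the transform vanishes, so the value 1 of
  \<open>g_tilde\<close> is harmless.\<close>

lemma weighted_edge:
 assumes edge: "edge_bound x L \<theta>" and L: "L \<ge> 0" and u: "u \<in> unit_cube"
 shows "\<bar>weighted x u\<bar> \<le> cB (real CARD('d)) * L * base u powr (\<theta> - \<omega>)"
proof -
 have tb: "\<bar>copula_transform Cop x u\<bar> \<le> cB (real CARD('d)) * L * base u powr \<theta>"
  unfolding cB_def by (rule transform_bound[OF \<theta>(1) _ L edge u]) (use \<theta> in simp)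
 show ?thesis
 proof (cases "base u = 0")
  case True
  thus ?thesis using tb u by (simp add: weighted_def del: atLeastAtMost_iff)
 next
  case False
  hence b: "base u > 0" using base_nonneg[OF u] by simp
  have "\<bar>weighted x u\<bar> = \<bar>copula_transform Cop x u\<bar> / base u powr \<omega>" using u b by (simp add: weighted_def g_tilde_def g_base del: atLeastAtMost_iff)
  also have "... \<le> cB (real CARD('d)) * L * base u powr \<theta> / base u powr \<omega>" using tb by (intro divide_right_mono) auto
  also have "... = cB (real CARD('d)) * L * base u powr (\<theta> - \<omega>)" by (simp add: powr_diff)
  finally show ?thesis .
 qed
qed

lemma weighted_mspace:
 assumes edge: "edge_bound x L \<theta>" and L: "L \<ge> 0"
 shows "weighted x \<in> mspace E"
proof -
 have "\<bar>weighted x u\<bar> \<le> cB (real CARD('d)) * L * 1" if u: "u \<in> unit_cube" for u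
 proof (rule order.trans[OF weighted_edge[OF edge L u] mult_left_mono])
  have "base u \<le> 1" using base_le[of u undefined] cube_le1[OF u, of undefined] by linarith
  thus "base u powr (\<theta> - \<omega>) \<le> 1" using base_nonneg[OF u] \<theta> by (intro powr_le1) auto
 qed (use cB L in simp)
 hence "\<exists>B. \<forall>u\<in>unit_cube. \<bar>weighted x u\<bar> \<le> B" by blast
 thus ?thesis unfolding mspace_linf by (simp add: weighted_def)
qed

text \<open>Where \<open>base u\<close> is below 2^-k the projection is 0 and the weighted process
  is small. Elsewhere the rounding error, of order 2^(-k \<theta>), is divided by a weight of at
  least 2^(-k \<omega>).\<close>

lemma proj_close:
 assumes edge: "edge_bound x L \<theta>" and L: "L \<ge> 0"
  and h: "\<And>u. u \<in> unit_cube ==> \<bar>x u - x (fl k u)\<bar> \<le> L * (real CARD('d) * (1 / 2 ^ k)) powr \<theta>"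
 shows "mdist E (weighted x) (proj k x) \<le> cE (real CARD('d)) * L * (1 / 2 ^ k) powr (\<theta> - \<omega>)"
proof (subst mdist_linf_le[OF weighted_mspace[OF edge L] proj_mspace cube_ne], intro ballI)
 fix u :: "real ^ 'd" assume u: "u \<in> unit_cube"
 let ?\<delta> = "1 / 2 ^ k :: real" and ?h = "L * (real CARD('d) * (1 / 2 ^ k)) powr \<theta>"
 have h0: "0 \<le> ?h" using L by simp
 show "\<bar>weighted x u - proj k x u\<bar> \<le> cE (real CARD('d)) * L * ?\<delta> powr (\<theta> - \<omega>)"
 proof (cases "?\<delta> \<le> base u")
  case False
  have "\<bar>weighted x u - proj k x u\<bar> \<le> cB (real CARD('d)) * L * base u powr (\<theta> - \<omega>)"
   using weighted_edge[OF edge L u] u False by (simp add: proj_def del: atLeastAtMost_iff)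
  also have "... \<le> cB (real CARD('d)) * L * ?\<delta> powr (\<theta> - \<omega>)"
   using False base_nonneg[OF u] cB L \<theta> by (intro mult_left_mono powr_mono2) auto
  also have "... \<le> cE (real CARD('d)) * L * ?\<delta> powr (\<theta> - \<omega>)" using L d1 by (intro mult_right_mono) (auto simp: cE_def)
  finally show ?thesis .
 next
  case True
  have b: "base u > 0" using True by (rule less_le_trans[rotated]) simp
  have "\<bar>copula_transform Cop x u - grid_transform k x u\<bar> \<le> (1 + real CARD('d)) * ?h"
   unfolding grid_transform_def copula_transform_def
  proof (rule linear_bound)
   show "\<bar>x u - x (fl k u)\<bar> \<le> ?h" by (rule h[OF u])
   fix j
   show "\<bar>C_dot Cop j u * x (only_coord j u) - inner_dot j u * x (fl k (only_coord j u))\<bar> \<le> ?h"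
   proof (cases "u \<in> V j")
    case True
    hence "C_dot Cop j u = inner_dot j u" by (simp add: inner_dot_def)
    moreover have "inner_dot j u * \<bar>x (only_coord j u) - x (fl k (only_coord j u))\<bar> \<le> 1 * ?h"
     using inner_dot_bounds[of j u] by (intro mult_mono h only_coord_cube u) auto
    ultimately show ?thesis using inner_dot_bounds[of j u] by (simp add: right_diff_distrib[symmetric] abs_mult)
   next
    case False
    have "u $ j = 0 \<or> u $ j = 1" using False u cube_ge0[OF u, of j] cube_le1[OF u, of j] unfolding V_iff by auto
    hence "x (only_coord j u) = 0" using margin_bound[OF edge u, of j] by (elim disjE) simp_all
    thus ?thesis using False h0 by (simp add: inner_dot_def)
   qed
  qed
  hence "\<bar>copula_transform Cop x u - grid_transform k x u\<bar> / base u powr \<omega> \<le> (1 + real CARD('d)) * ?h / ?\<delta> powr \<omega>"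
   using weight_lower[OF True] L by (intro frac_le mult_nonneg_nonneg) auto
  also have "(1 + real CARD('d)) * ?h / ?\<delta> powr \<omega> = (1 + real CARD('d)) * real CARD('d) powr \<theta> * L * ?\<delta> powr (\<theta> - \<omega>)"
   by (simp only: powr_mult powr_diff) simp
  also have "... \<le> cE (real CARD('d)) * L * ?\<delta> powr (\<theta> - \<omega>)" using L cB by (intro mult_right_mono) (auto simp: cE_def)
  also have "\<bar>copula_transform Cop x u - grid_transform k x u\<bar> / base u powr \<omega> = \<bar>weighted x u - proj k x u\<bar>"
   using u b True by (simp add: weighted_def proj_def g_tilde_def g_base diff_divide_distrib[symmetric] del: atLeastAtMost_iff)
  finally show ?thesis .
 qed
qed

text \<open>Puts the limit process on the same footing as \<alpha>_n: moving one coordinate to 0, or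
  all but one to 1, is paid for by the Hoelder condition. The factor d accounts for the number of
  coordinates moved.\<close>

lemma hoelder_edge:
 fixes x :: "real ^ 'd => real"
 assumes x: "x \<in> hball L \<theta>" and L: "L \<ge> 0" and zero: "\<And>u j. u \<in> unit_cube ==> u $ j = 0 ==> x u = 0"
 shows "edge_bound x (L * real CARD('d)) \<theta>" "u \<in> unit_cube ==> \<bar>x u - x (fl k u)\<bar> \<le> (L * real CARD('d)) * (real CARD('d) * (1 / 2 ^ k)) powr \<theta>"
proof -
 have H: "\<bar>x u - x v\<bar> \<le> L * norm (u - v) powr \<theta>" if "u \<in> unit_cube" "v \<in> unit_cube" for u v using x that unfolding hball_def by blast
 have up: "L * y powr \<theta> \<le> (L * real CARD('d)) * y powr \<theta>" for y using L d1 mult_left_mono[of 1 "real CARD('d)" L] by (intro mult_right_mono) auto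
 show "\<bar>x u - x (fl k u)\<bar> \<le> (L * real CARD('d)) * (real CARD('d) * (1 / 2 ^ k)) powr \<theta>" if u: "u \<in> unit_cube"
 proof -
  have "\<bar>x u - x (fl k u)\<bar> \<le> L * norm (u - fl k u) powr \<theta>" by (rule H[OF u fl_cube[OF u]])
  also have "... \<le> L * (real CARD('d) * (1 / 2 ^ k)) powr \<theta>" using L fl_norm \<theta> by (intro mult_left_mono powr_mono2) auto
  also note up
  finally show ?thesis .
 qed
 show "edge_bound x (L * real CARD('d)) \<theta>"
  unfolding edge_bound_def
 proof (intro conjI ballI allI impI)
  fix w :: "real ^ 'd" and j assume w: "w \<in> unit_cube"
  have v: "upd w j 0 \<in> unit_cube" by (intro upd_cube w) auto
  have "w - upd w j 0 = axis j (w $ j)" by (simp add: vec_eq_iff upd_nth axis_def)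
  hence "norm (w - upd w j 0) = w $ j" using cube_ge0[OF w, of j] by (simp add: norm_eq_sqrt_inner inner_axis_axis)
  hence "\<bar>x w\<bar> \<le> L * (w $ j) powr \<theta>" using H[OF w v] zero[OF v, of j] by (simp add: upd_nth)
  also note up
  finally show "\<bar>x w\<bar> \<le> L * real CARD('d) * (w $ j) powr \<theta>" .
 next
  fix w :: "real ^ 'd" and j and y :: real
  assume w: "w \<in> unit_cube" and y: "0 \<le> y" "\<forall>k. k \<noteq> j --> 1 - w $ k \<le> y"
  have "\<bar>x w - x (only_coord j w)\<bar> \<le> L * norm (w - only_coord j w) powr \<theta>" by (intro H w only_coord_cube)
  also have "... \<le> L * (real CARD('d) * y) powr \<theta>"
  proof (intro mult_left_mono powr_mono2 cube_norm_diff)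
   show "\<bar>w $ k - only_coord j w $ k\<bar> \<le> y" for k using y cube_le1[OF w, of k] by (auto simp: only_coord_nth)
  qed (use L \<theta> in auto)
  also have "... = L * (real CARD('d) powr \<theta> * y powr \<theta>)" by (simp add: powr_mult)
  also have "... \<le> L * (real CARD('d) powr 1 * y powr \<theta>)" using L d1 \<theta> by (intro mult_left_mono mult_right_mono powr_mono) auto
  finally show "\<bar>x w - x (only_coord j w)\<bar> \<le> L * real CARD('d) * y powr \<theta>" using d1 by (simp add: mult.assoc)
 qed (use x in \<open>simp add: hball_def\<close>)
qed

lemma limit_close:
 assumes "\<alpha> s \<in> hball L \<theta>" "L \<ge> 0"
 shows "weighted (\<alpha> s) \<in> mspace E" "mdist E (weighted (\<alpha> s)) (proj k (\<alpha> s)) \<le> cE (real CARD('d)) * (L * real CARD('d)) * (1 / 2 ^ k) powr (\<theta> - \<omega>)"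
proof -
 have Ld: "0 \<le> L * real CARD('d)" using assms(2) by simp
 note he = hoelder_edge[OF assms \<alpha>_zero]
 show "weighted (\<alpha> s) \<in> mspace E" by (rule weighted_mspace[OF he(1) Ld])
 show "mdist E (weighted (\<alpha> s)) (proj k (\<alpha> s)) \<le> cE (real CARD('d)) * (L * real CARD('d)) * (1 / 2 ^ k) powr (\<theta> - \<omega>)"
  by (rule proj_close[OF he(1) Ld he(2)])
qed

lemma rate_tendsto: "(\<lambda>k. c * (1 / 2 ^ k) powr (\<theta> - \<omega>)) \<longlonglongrightarrow> 0" for c :: real
proof -
 have "(\<lambda>k. (1/2 :: real) ^ k) \<longlonglongrightarrow> 0" by (rule LIMSEQ_realpow_zero) auto
 hence "(\<lambda>k. c * (1 / 2 ^ k) powr (\<theta> - \<omega>)) \<longlonglongrightarrow> c * 0 powr (\<theta> - \<omega>)"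
  using \<theta> by (intro tendsto_mult tendsto_const tendsto_powr2) (auto simp: power_one_over)
 thus ?thesis using \<theta> by simp
qed

lemma proj_meas: "(\<And>t. (\<lambda>s. \<xi> s t) \<in> borel_measurable P) ==> (\<lambda>s. proj k (\<xi> s)) \<in> P \<rightarrow>\<^sub>M metric_borel E"
 by (rule measurable_metric_borel_coordinates[where T="grid k" and \<xi>=\<xi> and \<Phi>="proj k"]) (auto intro: proj_mspace proj_mdist)

lemma weighted_limit_borel: "(\<lambda>s. weighted (\<alpha> s)) \<in> N \<rightarrow>\<^sub>M metric_borel E"
proof (rule measurable_metric_borel_limit)
 show "(\<lambda>s. proj k (\<alpha> s)) \<in> N \<rightarrow>\<^sub>M metric_borel E" for k by (rule proj_meas) simp
 fix s
 obtain L where L: "L \<ge> 0" "\<alpha> s \<in> hball L \<theta>" using \<alpha>_hball[OF \<theta>(1,3)] by blast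
 show m: "weighted (\<alpha> s) \<in> mspace E" by (rule limit_close[OF L(2,1)])
 have "mdist E (proj k (\<alpha> s)) (weighted (\<alpha> s)) \<le> cE (real CARD('d)) * (L * real CARD('d)) * (1 / 2 ^ k) powr (\<theta> - \<omega>)" for k
  using limit_close(2)[OF L(2,1)] by (simp add: mdist_commute)
 thus "(\<lambda>k. mdist E (proj k (\<alpha> s)) (weighted (\<alpha> s))) \<longlonglongrightarrow> 0"
  by (intro tendsto_sandwich[OF _ _ tendsto_const rate_tendsto[of "cE (real CARD('d)) * (L * real CARD('d))"]]) auto
qed

lemma ex_edge_event:
 assumes "\<epsilon> > 0" "n \<ge> 1"
 shows "\<exists>A\<in>sets M. prob A \<ge> 1 - \<epsilon> \<and> (\<forall>s\<in>A. weighted (\<alpha>n n s) \<in> mspace E)"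
proof -
 obtain L where "L \<ge> 1" "\<exists>A\<in>sets M. prob A \<ge> 1 - \<epsilon> \<and> (\<forall>s\<in>A. regular s \<and> modulus n L \<theta> s \<and> edge_bound (\<alpha>n n s) L \<theta>)"
  using weighted_modulus[OF \<theta>(1,3) assms(1)] assms(2) by blast
 thus ?thesis using weighted_mspace[of _ L] by fastforce
qed

text \<open>For fixed n the process is bounded on events of probability at least 1 - 1/(m + 1),
  whose union over m has probability 1. For n = 0 the process is 0.\<close>

lemma AE_weighted: "AE s in M. weighted (\<alpha>n n s) \<in> mspace E"
proof (cases "n = 0")
 case True
 hence "\<alpha>n n s = (\<lambda>_. 0)" for s by (simp add: alpha_n_def fun_eq_iff)
 moreover have "edge_bound (\<lambda>_ :: real ^ 'd. 0) 0 \<theta>" by (simp add: edge_bound_def)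
 ultimately show ?thesis using weighted_mspace[of "\<lambda>_. 0" 0] by simp
next
 case False
 have "\<exists>A\<in>sets M. prob A \<ge> 1 - 1 / real (Suc m) \<and> (\<forall>s\<in>A. weighted (\<alpha>n n s) \<in> mspace E)" for m
  using False by (intro ex_edge_event) auto
 then obtain A where A: "\<And>m. A m \<in> sets M" "\<And>m. prob (A m) \<ge> 1 - 1 / real (Suc m)" "\<And>m s. s \<in> A m ==> weighted (\<alpha>n n s) \<in> mspace E"
  by metis
 have U: "(\<Union>m. A m) \<in> sets M" using A(1) by auto
 have "1 \<le> prob (\<Union>m. A m)"
 proof (rule field_le_epsilon)
  fix e :: real assume "e > 0"
  then obtain m where m: "1 / real (Suc m) < e" using nat_approx_posE by blast
  have "prob (A m) \<le> prob (\<Union>m. A m)" using U by (intro finite_measure_mono) auto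
  thus "1 \<le> prob (\<Union>m. A m) + e" using A(2)[of m] m by linarith
 qed
 hence "prob (\<Union>m. A m) = 1" using prob_le_1[of "\<Union>m. A m"] by linarith
 hence "AE s in M. s \<in> (\<Union>m. A m)" using prob_eq_1[OF U] by simp
 thus ?thesis by eventually_elim (use A(3) in blast)
qed

lemma grid_convergence:
 assumes f: "\<And>x y. x \<in> mspace E ==> y \<in> mspace E ==> \<bar>f x - f y\<bar> \<le> L * mdist E x y" "\<And>x. \<bar>f x\<bar> \<le> B" "L \<ge> 0"
 shows "(\<lambda>s. f (proj k (\<alpha>n n s))) \<in> borel_measurable M" "(\<lambda>s. f (proj k (\<alpha> s))) \<in> borel_measurable N"
  "(\<lambda>n. expectation (\<lambda>s. f (proj k (\<alpha>n n s)))) \<longlonglongrightarrow> N.expectation (\<lambda>s. f (proj k (\<alpha> s)))"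
proof -
 have fm: "f \<in> borel_measurable (metric_borel E)" by (intro continuous_map_metric_borel lipschitz_continuous_map[where L=L] f(1))
 show "(\<lambda>s. f (proj k (\<alpha>n n s))) \<in> borel_measurable M" by (rule measurable_compose[OF proj_meas[OF alpha_meas] fm])
 show "(\<lambda>s. f (proj k (\<alpha> s))) \<in> borel_measurable N" by (rule measurable_compose[OF proj_meas[OF \<alpha>_meas] fm])
 let ?c = "(1 + real CARD('d)) / (1 / 2 ^ k) powr \<omega>"
 show "(\<lambda>n. expectation (\<lambda>s. f (proj k (\<alpha>n n s)))) \<longlonglongrightarrow> N.expectation (\<lambda>s. f (proj k (\<alpha> s)))"
 proof (rule fidi_lipschitz[where T="grid k" and F="\<lambda>x. f (proj k x)" and B=B and L="L * ?c" and c=T0, OF prob_space_axioms N.prob_space_axioms finite_grid alpha_meas \<alpha>_meas _ alpha_square_le])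
  show "integrable M (\<lambda>s. (\<alpha>n n s t)\<^sup>2)" for n t using alpha_int(2)[of n t t] by (simp add: power2_eq_square)
  fix t :: "real ^ 'd" assume "t \<in> grid k"
  hence "t \<in> unit_cube" using grid_subset_cube by blast
  thus "integrable N (\<lambda>s. (\<alpha> s t)\<^sup>2)" "N.expectation (\<lambda>s. (\<alpha> s t)\<^sup>2) \<le> T0"
   using gaussian_comb(3,4)[of "{t}" "\<lambda>_. 1"] Gamma_C_diag_le[of t] by simp_all
 next
  show "(\<lambda>n. expectation (\<lambda>s. iexp (\<Sum>t\<in>grid k. b t * \<alpha>n n s t))) \<longlonglongrightarrow> N.expectation (\<lambda>s. iexp (\<Sum>t\<in>grid k. b t * \<alpha> s t))" for b
   unfolding \<alpha>_char[OF finite_grid grid_subset_cube] by (rule comb_clt) simp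
  show "\<bar>f (proj k x) - f (proj k y)\<bar> \<le> L * ?c * \<delta>" if "\<And>t. t \<in> grid k ==> \<bar>x t - y t\<bar> \<le> \<delta>" "0 \<le> \<delta>" for x y \<delta>
  proof -
   have "\<bar>f (proj k x) - f (proj k y)\<bar> \<le> L * mdist E (proj k x) (proj k y)" by (intro f proj_mspace)
   also have "... \<le> L * (?c * \<delta>)" by (intro mult_left_mono proj_mdist that f)
   finally show ?thesis by (simp only: mult.assoc)
  qed
 qed (use f in simp_all)
qed

theorem weak_convergence:
 "weakly_converges_HJ E M (\<lambda>n s. \<lambda>u\<in>unit_cube. C_bar M X n s u / g_tilde \<omega> u) N
  (\<lambda>s. \<lambda>u\<in>unit_cube. copula_transform Cop (\<alpha> s) u / g_tilde \<omega> u)"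
proof -
 have "weakly_converges_HJ E M (\<lambda>n s. weighted (\<alpha>n n s)) N (\<lambda>s. weighted (\<alpha> s))"
 proof (rule weakly_converges_HJ_criterion[OF prob_space_axioms N.prob_space_axioms AE_weighted weighted_limit_borel])
  fix \<epsilon> :: real assume \<epsilon>: "\<epsilon> > 0"
  obtain L where L: "L \<ge> 1" and ev: "\<And>n. n \<ge> 1 ==> \<exists>A\<in>sets M. prob A \<ge> 1 - \<epsilon> \<and> (\<forall>s\<in>A. regular s \<and> modulus n L \<theta> s \<and> edge_bound (\<alpha>n n s) L \<theta>)"
   using weighted_modulus[OF \<theta>(1,3) \<epsilon>] by blast
  obtain L' where L': "L' \<ge> 0" and A': "{s \<in> space N. \<alpha> s \<in> hball L' \<theta>} \<in> sets N" "N.prob {s \<in> space N. \<alpha> s \<in> hball L' \<theta>} \<ge> 1 - \<epsilon>"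
   using ex_hball_prob[OF \<theta>(1,3) \<epsilon>] by blast
  \<comment> \<open>One level k makes the projection error smaller than \<epsilon> both for the
    limit and, uniformly in n \<ge> 2^k, for the weighted processes.\<close>
  have "\<forall>\<^sub>F k in sequentially. cE (real CARD('d)) * L * (1 / 2 ^ k) powr (\<theta> - \<omega>) < \<epsilon> \<and> cE (real CARD('d)) * (L' * real CARD('d)) * (1 / 2 ^ k) powr (\<theta> - \<omega>) < \<epsilon>"
   by (intro eventually_conj order_tendstoD(2)[OF rate_tendsto \<epsilon>])
  then obtain k where k: "cE (real CARD('d)) * L * (1 / 2 ^ k) powr (\<theta> - \<omega>) < \<epsilon>" "cE (real CARD('d)) * (L' * real CARD('d)) * (1 / 2 ^ k) powr (\<theta> - \<omega>) < \<epsilon>"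
   unfolding eventually_sequentially by blast
  show "\<exists>Z Z'. (\<forall>n s. Z n s \<in> mspace E) \<and> (\<forall>s. Z' s \<in> mspace E) \<and>
   (\<forall>f L B. (\<forall>x\<in>mspace E. \<forall>y\<in>mspace E. \<bar>f x - f y\<bar> \<le> L * mdist E x y) --> (\<forall>x. \<bar>f x\<bar> \<le> B) --> L \<ge> 0 -->
     (\<forall>n. (\<lambda>s. f (Z n s)) \<in> borel_measurable M) \<and> (\<lambda>s. f (Z' s)) \<in> borel_measurable N \<and>
     (\<lambda>n. expectation (\<lambda>s. f (Z n s))) \<longlonglongrightarrow> N.expectation (\<lambda>s. f (Z' s))) \<and>
   (\<forall>\<^sub>F n in sequentially. \<exists>A\<in>sets M. prob A \<ge> 1 - \<epsilon> \<and> (\<forall>s\<in>A. weighted (\<alpha>n n s) \<in> mspace E \<and> mdist E (weighted (\<alpha>n n s)) (Z n s) \<le> \<epsilon>)) \<and>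
   (\<exists>A\<in>sets N. N.prob A \<ge> 1 - \<epsilon> \<and> (\<forall>s\<in>A. mdist E (weighted (\<alpha> s)) (Z' s) \<le> \<epsilon>))"
  proof (rule exI[of _ "\<lambda>n s. proj k (\<alpha>n n s)"], rule exI[of _ "\<lambda>s. proj k (\<alpha> s)"], intro conjI allI impI)
   show "\<forall>\<^sub>F n in sequentially. \<exists>A\<in>sets M. prob A \<ge> 1 - \<epsilon> \<and> (\<forall>s\<in>A. weighted (\<alpha>n n s) \<in> mspace E \<and> mdist E (weighted (\<alpha>n n s)) (proj k (\<alpha>n n s)) \<le> \<epsilon>)"
    using eventually_ge_at_top[of "2 ^ k"]
   proof eventually_elim
    case (elim n)
    have n: "n \<ge> 1" using elim by (metis le_trans one_le_numeral one_le_power)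
    have rn: "1 / real n \<le> 1 / 2 ^ k"
    proof -
     have "real (2 ^ k) \<le> real n" using elim by (rule of_nat_mono)
     thus ?thesis by (intro divide_left_mono) (use n in auto)
    qed
    obtain A where A: "A \<in> sets M" "prob A \<ge> 1 - \<epsilon>" and As: "\<And>s. s \<in> A ==> modulus n L \<theta> s \<and> edge_bound (\<alpha>n n s) L \<theta>"
     using ev[OF n] by blast
    have "weighted (\<alpha>n n s) \<in> mspace E \<and> mdist E (weighted (\<alpha>n n s)) (proj k (\<alpha>n n s)) \<le> \<epsilon>" if s: "s \<in> A" for s
    proof
     have edge: "edge_bound (\<alpha>n n s) L \<theta>" and mod: "modulus n L \<theta> s" using As[OF s] by blast+
     have L0: "0 \<le> L" using L by simp
     show "weighted (\<alpha>n n s) \<in> mspace E" by (rule weighted_mspace[OF edge L0])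
     have "\<bar>\<alpha>n n s u - \<alpha>n n s (fl k u)\<bar> \<le> L * (real CARD('d) * (1 / 2 ^ k)) powr \<theta>" if u: "u \<in> unit_cube" for u
     proof -
      have "\<bar>\<alpha>n n s u - \<alpha>n n s (fl k u)\<bar> \<le> L * max (norm (u - fl k u)) (1 / real n) powr \<theta>"
       using mod u fl_cube[OF u] unfolding modulus_def by blast
      also have "... \<le> L * (real CARD('d) * (1 / 2 ^ k)) powr \<theta>"
      proof (intro mult_left_mono powr_mono2 max.boundedI fl_norm)
       have "1 * (1 / 2 ^ k) \<le> real CARD('d) * (1 / 2 ^ k)" using d1 by (intro mult_right_mono) auto
       thus "1 / real n \<le> real CARD('d) * (1 / 2 ^ k)" using rn by linarith
       show "0 \<le> max (norm (u - fl k u)) (1 / real n)" by (rule max.coboundedI1) simp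
      qed (use L0 \<theta> in auto)
      finally show ?thesis .
     qed
     from proj_close[OF edge L0 this] k(1) show "mdist E (weighted (\<alpha>n n s)) (proj k (\<alpha>n n s)) \<le> \<epsilon>" by linarith
    qed
    thus ?case using A by blast
   qed
   show "\<exists>A\<in>sets N. N.prob A \<ge> 1 - \<epsilon> \<and> (\<forall>s\<in>A. mdist E (weighted (\<alpha> s)) (proj k (\<alpha> s)) \<le> \<epsilon>)"
   proof (rule bexI[OF _ A'(1)], intro conjI A'(2) ballI)
    fix s assume "s \<in> {s \<in> space N. \<alpha> s \<in> hball L' \<theta>}"
    thus "mdist E (weighted (\<alpha> s)) (proj k (\<alpha> s)) \<le> \<epsilon>" using limit_close(2)[of s L' k] L' k(2) by fastforce
   qed
  next
   fix f L B n
   assume f: "\<forall>x\<in>mspace E. \<forall>y\<in>mspace E. \<bar>f x - f y\<bar> \<le> L * mdist E x y" "\<forall>x. \<bar>f x\<bar> \<le> B" "L \<ge> (0 :: real)"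
   have fl: "\<bar>f x - f y\<bar> \<le> L * mdist E x y" if "x \<in> mspace E" "y \<in> mspace E" for x y using f(1) that by blast
   have fb: "\<bar>f x\<bar> \<le> B" for x using f(2) by blast
   note gc = grid_convergence[where f=f, OF fl fb f(3)]
   show "(\<lambda>s. f (proj k (\<alpha>n n s))) \<in> borel_measurable M" by (rule gc)
   show "(\<lambda>s. f (proj k (\<alpha> s))) \<in> borel_measurable N" by (rule gc)
   show "(\<lambda>n. expectation (\<lambda>s. f (proj k (\<alpha>n n s)))) \<longlonglongrightarrow> N.expectation (\<lambda>s. f (proj k (\<alpha> s)))" by (rule gc)
  qed (rule proj_mspace)+
 qed
 thus ?thesis by (simp only: weighted_def[abs_def] C_bar_def)
qed

end

theorem theorem2p2:
  fixes M :: "'a measure" and X :: "int \<Rightarrow> 'a \<Rightarrow> real ^ 'd" and a K :: real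
  assumes "CARD('d) \<ge> 2"
    and "prob_space M"
    and "\<And>i. X i \<in> borel_measurable M"
    and "strictly_stationary M X"
    and "alpha_mixing M X"
    and "0 < a" and "a < 1"
    and "alpha_coeff M X \<in> O(\<lambda>k. a ^ k)"
    and "\<And>j. continuous_on UNIV (marginal_cdf M X j)"
    and "\<And>j u. u \<in> V j \<Longrightarrow> partial_exists (copula M X) j u"
    and "\<And>j. continuous_on (V j) (C_dot (copula M X) j)"
    and "\<And>j\<^sub>1 j\<^sub>2 u. u \<in> V j\<^sub>1 \<inter> V j\<^sub>2 \<Longrightarrow> partial_exists (C_dot (copula M X) j\<^sub>2) j\<^sub>1 u"
    and "\<And>j\<^sub>1 j\<^sub>2. continuous_on (V j\<^sub>1 \<inter> V j\<^sub>2) (C_ddot (copula M X) j\<^sub>1 j\<^sub>2)"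
    and "K > 0"
    and "\<And>j\<^sub>1 j\<^sub>2 u. u \<in> V j\<^sub>1 \<inter> V j\<^sub>2 \<Longrightarrow>
           \<bar>C_ddot (copula M X) j\<^sub>1 j\<^sub>2 u\<bar>
             \<le> K * min (1 / (u $ j\<^sub>1 * (1 - u $ j\<^sub>1))) (1 / (u $ j\<^sub>2 * (1 - u $ j\<^sub>2)))"
  shows
    "(\<forall>c \<omega>. 0 < c \<and> c < 1 \<and> 0 < \<omega> \<and> \<omega> < 1/2 \<longrightarrow>
        small_o_P_1 M (\<lambda>n s. SUP u\<in>{vec (c / real n)..vec (1 - c / real n)}.
          ereal \<bar>emp_copula_process M X n s u / g \<omega> u - C_bar M X n s u / g \<omega> u\<bar>)) \<and>
     (\<exists>(N :: (real ^ 'd \<Rightarrow> real) measure) \<alpha>\<^sub>C.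
        prob_space N \<and>
        tight_random_element N (linf unit_cube) \<alpha>\<^sub>C \<and>
        centered_gaussian_process N unit_cube \<alpha>\<^sub>C \<and>
        (\<forall>u\<in>unit_cube. \<forall>v\<in>unit_cube.
          ((\<lambda>i. covariance M (\<lambda>s. of_bool (U M X 0 s \<le> u)) (\<lambda>s. of_bool (U M X i s \<le> v)))
            has_sum covariance N (\<lambda>s. \<alpha>\<^sub>C s u) (\<lambda>s. \<alpha>\<^sub>C s v)) UNIV) \<and>
        (\<forall>\<omega>. 0 < \<omega> \<and> \<omega> < 1/2 \<longrightarrow>
          weakly_converges_HJ (linf unit_cube)
            M (\<lambda>n s. \<lambda>u\<in>unit_cube. C_bar M X n s u / g_tilde \<omega> u)
            N (\<lambda>s. \<lambda>u\<in>unit_cube. copula_transform (copula M X) (\<alpha>\<^sub>C s) u / g_tilde \<omega> u)))"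
proof -
 interpret prob_space M by (rule assms)
 interpret geometric_mixing M X a by unfold_locales (fact assms)+
 interpret mixing_copula M X a K
  by unfold_locales (fact assms | rule Cop_mono Cop_lipschitz Cop_only_coord Cop_0; assumption)+
 obtain N :: "(real ^ 'd => real) measure" and \<alpha> where "limit_process M X a N \<alpha>"
 proof -
  from ex_limit_measure obtain N :: "(real ^ 'd => real) measure" and \<alpha> where N: "prob_space N"
   and *: "\<forall>u. (\<lambda>\<omega>. \<alpha> \<omega> u) \<in> borel_measurable N" "\<forall>\<omega>. \<alpha> \<omega> \<in> extensional unit_cube"
    "\<forall>\<omega> \<theta>. 0 < \<theta> --> \<theta> < 1/2 --> (\<exists>L\<ge>0. \<forall>u\<in>unit_cube. \<forall>v\<in>unit_cube. \<bar>\<alpha> \<omega> u - \<alpha> \<omega> v\<bar> \<le> L * norm (u - v) powr \<theta>)"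
    "\<forall>\<omega> u j. u \<in> unit_cube --> u $ j = 0 --> \<alpha> \<omega> u = 0" "\<forall>\<omega>. \<alpha> \<omega> 1 = 0"
    "\<forall>I b. finite I --> I \<subseteq> unit_cube -->
     integral\<^sup>L N (\<lambda>\<omega>. iexp (\<Sum>u\<in>I. b u * \<alpha> \<omega> u)) = of_real (exp (- (\<Sum>u\<in>I. \<Sum>v\<in>I. b u * b v * Gamma_C u v) / 2))"
   by (elim exE conjE)
  interpret N: prob_space N by (rule N)
  have "limit_process M X a N \<alpha>" by unfold_locales (use * in blast)+
  thus thesis by (rule that)
 qed
 then interpret limit_process M X a N \<alpha> .
 \<comment> \<open>The limit process is fixed before \<omega>, so the same N and \<alpha> serve all
   weights.\<close>
 have wl: "weak_limit M X a N \<alpha> K \<omega>" if "0 < \<omega>" "\<omega> < 1/2" for \<omega>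
  by unfold_locales (use that in auto)
 show ?thesis
 proof (intro conjI allI impI exI[of _ N] exI[of _ \<alpha>] ballI; (elim conjE)?)
  show "prob_space N" by (rule N.prob_space_axioms)
  show "tight_random_element N (linf unit_cube) \<alpha>" by (rule tight)
  show "centered_gaussian_process N unit_cube \<alpha>" by (rule gaussian_process)
 qed (rule emp_copula_small_o limit_covariance weak_limit.weak_convergence[OF wl]; assumption)+
qed

end
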